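(* Let $(M,\mathfrak g)$ be an $(n+1)$-dimensional Riemannian (resp. Lorentzian) manifold and let $\gamma:[0,T]\to M$ be a (non-constant) closed geodesic (resp. a timelike closed geodesic), with Morse index $\mathrm n_-(\gamma)$. If either (OR) $\gamma$ is oriented and $\mathrm n_-(\gamma)+n$ is odd, or (NOR) $\gamma$ is non-oriented and $\mathrm n_-(\gamma)+n$ is even, then $\gamma$ is linearly unstable.
   Context: **Setting.** $\nabla$ is the Levi-Civita connection, $\mathcal R(X,Y)=[\nabla_X,\nabla_Y]-\nabla_{[X,Y]}$. Lorentzian means that $\mathfrak g$ has exactly one negative direction. A closed geodesic is a smooth $\gamma:[0,T]\to M$ with $\frac{D}{dt}\dot\gamma=0$, $\gamma(0)=\gamma(T)$, $\dot\gamma(0)=\dot\gamma(T)$; timelike means $\mathfrak g(\dot\gamma,\dot\gamma)<0$. In both cases $\mathfrak g$ is positive definite on the $\mathfrak g$-orthogonal complement of $\dot\gamma$. Let $e_1,\dots,e_n$ be a parallel $\mathfrak g$-orthonormal frame of this complement along $\gamma$, let $A=[a_{ij}]\in \mathrm O(n)$ be defined by $e_j(T)=\sum_ia_{ij}e_i(0)$ (so $\xi=\sum u_ie_i$ satisfies $\xi(0)=\xi(T)$ iff $u(0)=Au(T)$), and let $\widehat R_{ij}(t)=\mathfrak g(\mathcal R(\dot\gamma,e_i)\dot\gamma,e_j)$, a symmetric matrix. **Orientation.** $\gamma$ is oriented if $\det A=1$, non-oriented if $\det A=-1$. **Morse index.** $\mathrm n_-(\gamma)$ is the maximal dimension of a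 subspace of $E=\{u\in W^{1,2}([0,T],\mathbf R^n):u(0)=Au(T)\}$ on which the index form $I(u,v)=\int_0^T\big(\langle\dot u,\dot v\rangle+\langle\widehat R(t)u,v\rangle\big)dt$ is negative definite; it is finite. **Linear stability.** Let $N=\{v\in T_{\gamma(0)}M:\mathfrak g(v,\dot\gamma(0))=0\}$ and let the linearized Poincaré map $\mathfrak P:N\oplus N\to N\oplus N$ be $\mathfrak P(v,v')=(\xi(T),\frac{D}{dt}\xi(T))$, where $\xi$ is the solution of the Jacobi equation $-\frac{D^2}{dt^2}\xi+\mathcal R(\dot\gamma,\xi)\dot\gamma=0$ with $\xi(0)=v$, $\frac{D}{dt}\xi(0)=v'$. $\gamma$ is linearly stable if $\mathfrak P$ is semisimple (diagonalizable over $\mathbf C$) with spectrum contained in the unit circle; otherwise it is linearly unstable. *)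

theory Defs
  imports
    "HOL-Analysis.Analysis"
    "HOL-Library.Function_Algebras"
    "Jordan_Normal_Form.Char_Poly"
begin

no_notation vec_index (infixl "$" 100)

text \<open>
  Function spaces carry the pointwise vector space structure. It is used for tangent vectors
  (functions of the chart) and for vector functions of time, so that the library notions
  \<^const>\<open>subspace\<close>, \<^const>\<open>span\<close>, \<^const>\<open>independent\<close> and \<^const>\<open>dim\<close> apply to them.
\<close>

instantiation "fun" :: (type, real_vector) real_vector
begin

definition scaleR_fun :: "real \<Rightarrow> ('a \<Rightarrow> 'b) \<Rightarrow> 'a \<Rightarrow> 'b" where
  "scaleR_fun r f = (\<lambda>x. r *\<^sub>R f x)"

instance
  by standard (simp_all add: scaleR_fun_def plus_fun_def fun_eq_iff algebra_simps)

end


section \<open>Smooth maps\<close>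

text \<open>
  The derivative is taken within \<open>S\<close>. It is only used for open \<open>S\<close> and for relatively open subsets
  of a nondegenerate interval \<open>[0,T]\<close>, where it is unique; in the second case smoothness is
  one-sided at the end points.
\<close>

fun times_differentiable_on ::
  "nat \<Rightarrow> 'a::real_normed_vector set \<Rightarrow> ('a \<Rightarrow> 'b::real_normed_vector) \<Rightarrow> bool" where
  "times_differentiable_on 0 S f \<longleftrightarrow> continuous_on S f"
| "times_differentiable_on (Suc k) S f \<longleftrightarrow>
     (\<forall>x\<in>S. f differentiable (at x within S)) \<and>
     (\<forall>v. times_differentiable_on k S (\<lambda>x. frechet_derivative f (at x within S) v))"

definition smooth_on :: "'a::real_normed_vector set \<Rightarrow> ('a \<Rightarrow> 'b::real_normed_vector) \<Rightarrow> bool" where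
  "smooth_on S f \<longleftrightarrow> (\<forall>k. times_differentiable_on k S f)"


section \<open>Smooth manifolds\<close>

text \<open>
  A chart is a pair of its domain and its coordinate map; the manifold is the union of the domains
  of the charts of an atlas. Its dimension is the cardinality of the index type \<open>'m\<close>.
\<close>

type_synonym ('a, 'm) chart = "'a set \<times> ('a \<Rightarrow> real ^ 'm)"

abbreviation cdom :: "('a, 'm) chart \<Rightarrow> 'a set" where
  "cdom c \<equiv> fst c"

abbreviation coord :: "('a, 'm) chart \<Rightarrow> 'a \<Rightarrow> real ^ 'm" where
  "coord c \<equiv> snd c"

definition transition :: "('a, 'm) chart \<Rightarrow> ('a, 'm) chart \<Rightarrow> real ^ 'm \<Rightarrow> real ^ 'm" where
  "transition c d = coord d \<circ> inv_into (cdom c) (coord c)"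

definition is_chart :: "('a::topological_space, 'm::finite) chart \<Rightarrow> bool" where
  "is_chart c \<longleftrightarrow> open (cdom c) \<and> open (coord c ` cdom c) \<and>
     homeomorphism (cdom c) (coord c ` cdom c) (coord c) (inv_into (cdom c) (coord c))"

definition smooth_atlas ::
  "('a::{t2_space, second_countable_topology}, 'm::finite) chart set \<Rightarrow> bool" where
  "smooth_atlas \<A> \<longleftrightarrow> (\<forall>c\<in>\<A>. is_chart c) \<and>
     (\<forall>c\<in>\<A>. \<forall>d\<in>\<A>. smooth_on (coord c ` (cdom c \<inter> cdom d)) (transition c d))"

definition manifold :: "('a, 'm) chart set \<Rightarrow> 'a set" where
  "manifold \<A> = (\<Union>c\<in>\<A>. cdom c)"

definition transition_deriv ::
  "('a, 'm::finite) chart \<Rightarrow> ('a, 'm) chart \<Rightarrow> 'a \<Rightarrow> real ^ 'm \<Rightarrow> real ^ 'm" where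
  "transition_deriv c d p = frechet_derivative (transition c d) (at (coord c p))"

text \<open>
  A tangent vector at \<open>p\<close> is the family of its coordinate vectors in the charts around \<open>p\<close>,
  which transform by the derivatives of the transition maps. The components in the remaining
  charts are normalised to zero, so that the tangent space is a vector space of the dimension
  of the manifold.
\<close>

type_synonym ('a, 'm) tvec = "('a, 'm) chart \<Rightarrow> real ^ 'm"

definition tangent_space ::
  "('a, 'm::finite) chart set \<Rightarrow> 'a \<Rightarrow> ('a, 'm) tvec set" where
  "tangent_space \<A> p = {v.
     (\<forall>c\<in>\<A>. \<forall>d\<in>\<A>. p \<in> cdom c \<longrightarrow> p \<in> cdom d \<longrightarrow> v d = transition_deriv c d p (v c)) \<and>
     (\<forall>c. \<not> (c \<in> \<A> \<and> p \<in> cdom c) \<longrightarrow> v c = 0)}"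


section \<open>Metrics\<close>

text \<open>
  A metric is given by its matrix of components \<open>g c x\<close> at the point with coordinates \<open>x\<close> in each
  chart \<open>c\<close>, and these transform as the components of a covariant 2-tensor.
\<close>

type_synonym ('a, 'm) metric = "('a, 'm) chart \<Rightarrow> real ^ 'm \<Rightarrow> real ^ 'm ^ 'm"

definition metric_tensor ::
  "('a::{t2_space, second_countable_topology}, 'm::finite) chart set \<Rightarrow> ('a, 'm) metric \<Rightarrow> bool" where
  "metric_tensor \<A> g \<longleftrightarrow>
     (\<forall>c\<in>\<A>. smooth_on (coord c ` cdom c) (g c)) \<and>
     (\<forall>c\<in>\<A>. \<forall>p\<in>cdom c.
        Finite_Cartesian_Product.transpose (g c (coord c p)) = g c (coord c p) \<and> invertible (g c (coord c p))) \<and>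
     (\<forall>c\<in>\<A>. \<forall>d\<in>\<A>. \<forall>p\<in>cdom c \<inter> cdom d. \<forall>v w.
        inner v (g c (coord c p) *v w) =
        inner (transition_deriv c d p v) (g d (coord d p) *v transition_deriv c d p w))"

definition riemannian_manifold ::
  "('a::{t2_space, second_countable_topology}, 'm::finite) chart set \<Rightarrow> ('a, 'm) metric \<Rightarrow> bool" where
  "riemannian_manifold \<A> g \<longleftrightarrow> smooth_atlas \<A> \<and> metric_tensor \<A> g \<and>
     (\<forall>c\<in>\<A>. \<forall>x\<in>coord c ` cdom c. \<forall>v. v \<noteq> 0 \<longrightarrow> inner v (g c x *v v) > 0)"

definition negative_definite_on :: "real ^ 'm ^ 'm \<Rightarrow> (real ^ 'm::finite) set \<Rightarrow> bool" where
  "negative_definite_on G S \<longleftrightarrow> (\<forall>v\<in>S. v \<noteq> 0 \<longrightarrow> inner v (G *v v) < 0)"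

text \<open>Exactly one negative direction: the maximal negative definite subspaces are lines.\<close>

definition lorentzian_manifold ::
  "('a::{t2_space, second_countable_topology}, 'm::finite) chart set \<Rightarrow> ('a, 'm) metric \<Rightarrow> bool" where
  "lorentzian_manifold \<A> g \<longleftrightarrow> smooth_atlas \<A> \<and> metric_tensor \<A> g \<and>
     (\<forall>c\<in>\<A>. \<forall>x\<in>coord c ` cdom c.
        (\<exists>S. subspace S \<and> dim S = 1 \<and> negative_definite_on (g c x) S) \<and>
        (\<forall>S. subspace S \<and> negative_definite_on (g c x) S \<longrightarrow> dim S \<le> 1))"

text \<open>The choice of the chart in the next definition is immaterial for tangent vectors at \<open>p\<close>.\<close>

definition metric_at ::
  "('a, 'm::finite) chart set \<Rightarrow> ('a, 'm) metric \<Rightarrow> 'a \<Rightarrow> ('a, 'm) tvec \<Rightarrow> ('a, 'm) tvec \<Rightarrow> real" where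
  "metric_at \<A> g p v w =
     (let c = (SOME c. c \<in> \<A> \<and> p \<in> cdom c) in inner (v c) (g c (coord c p) *v w c))"


section \<open>Levi-Civita connection and curvature in a chart\<close>

definition partial_metric ::
  "(real ^ 'm \<Rightarrow> real ^ 'm ^ 'm) \<Rightarrow> real ^ 'm::finite \<Rightarrow> 'm \<Rightarrow> 'm \<Rightarrow> 'm \<Rightarrow> real" where
  "partial_metric G x k i j = frechet_derivative G (at x) (axis k 1) $ i $ j"

definition christoffel ::
  "(real ^ 'm \<Rightarrow> real ^ 'm ^ 'm) \<Rightarrow> real ^ 'm::finite \<Rightarrow> 'm \<Rightarrow> 'm \<Rightarrow> 'm \<Rightarrow> real" where
  "christoffel G x k i j = 1 / 2 * (\<Sum>l\<in>UNIV. matrix_inv (G x) $ k $ l *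
     (partial_metric G x i j l + partial_metric G x j i l - partial_metric G x l i j))"

definition christoffel_form ::
  "(real ^ 'm \<Rightarrow> real ^ 'm ^ 'm) \<Rightarrow> real ^ 'm::finite \<Rightarrow> real ^ 'm \<Rightarrow> real ^ 'm \<Rightarrow> real ^ 'm" where
  "christoffel_form G x v w =
     (\<chi> k. \<Sum>i\<in>UNIV. \<Sum>j\<in>UNIV. christoffel G x k i j * v $ i * w $ j)"

definition nabla ::
  "(real ^ 'm \<Rightarrow> real ^ 'm ^ 'm) \<Rightarrow> (real ^ 'm \<Rightarrow> real ^ 'm) \<Rightarrow> (real ^ 'm \<Rightarrow> real ^ 'm) \<Rightarrow>
     real ^ 'm::finite \<Rightarrow> real ^ 'm" where
  "nabla G X Y = (\<lambda>x. frechet_derivative Y (at x) (X x) + christoffel_form G x (X x) (Y x))"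

definition lie_bracket ::
  "(real ^ 'm \<Rightarrow> real ^ 'm) \<Rightarrow> (real ^ 'm \<Rightarrow> real ^ 'm) \<Rightarrow> real ^ 'm::finite \<Rightarrow> real ^ 'm" where
  "lie_bracket X Y =
     (\<lambda>x. frechet_derivative Y (at x) (X x) - frechet_derivative X (at x) (Y x))"

definition curvature_op ::
  "(real ^ 'm \<Rightarrow> real ^ 'm ^ 'm) \<Rightarrow> (real ^ 'm \<Rightarrow> real ^ 'm) \<Rightarrow> (real ^ 'm \<Rightarrow> real ^ 'm) \<Rightarrow>
     (real ^ 'm \<Rightarrow> real ^ 'm) \<Rightarrow> real ^ 'm::finite \<Rightarrow> real ^ 'm" where
  "curvature_op G X Y Z = (\<lambda>x. nabla G X (nabla G Y Z) x - nabla G Y (nabla G X Z) x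
     - nabla G (lie_bracket X Y) Z x)"

text \<open>
  The curvature is tensorial, so its value on vectors at a point is computed with the vector fields
  that are constant in the chart.
\<close>

definition curvature_at ::
  "('a, 'm::finite) chart set \<Rightarrow> ('a, 'm) metric \<Rightarrow> 'a \<Rightarrow>
     ('a, 'm) tvec \<Rightarrow> ('a, 'm) tvec \<Rightarrow> ('a, 'm) tvec \<Rightarrow> ('a, 'm) tvec" where
  "curvature_at \<A> g p u v w = (\<lambda>c. if c \<in> \<A> \<and> p \<in> cdom c
     then curvature_op (g c) (\<lambda>_. u c) (\<lambda>_. v c) (\<lambda>_. w c) (coord c p) else 0)"

text \<open>
  The connection with the above Christoffel symbols is the Levi-Civita connection: it is torsion-free
  and metric.
\<close>

lemma frechet_derivative_matrix_nth:
  fixes G :: "real ^ 'm::finite \<Rightarrow> real ^ 'm ^ 'm"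
  assumes "G differentiable (at x)"
  shows "((\<lambda>y. G y $ i $ j) has_derivative (\<lambda>v. frechet_derivative G (at x) v $ i $ j)) (at x)"
proof -
  have "(G has_derivative frechet_derivative G (at x)) (at x)"
    using assms by (simp add: frechet_derivative_works)
  then show ?thesis
    by (intro derivative_intros bounded_linear.has_derivative[OF bounded_linear_vec_nth])
qed

lemma partial_metric_sym:
  fixes G :: "real ^ 'm::finite \<Rightarrow> real ^ 'm ^ 'm"
  assumes "open U" "x \<in> U" "G differentiable (at x)"
    and sym: "\<And>y. y \<in> U \<Longrightarrow> Finite_Cartesian_Product.transpose (G y) = G y"
  shows "partial_metric G x k i j = partial_metric G x k j i"
proof -
  have eq: "G y $ i $ j = G y $ j $ i" if "y \<in> U" for y
  proof -
    have "G y $ i $ j = Finite_Cartesian_Product.transpose (G y) $ i $ j"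
      using sym[OF that] by simp
    then show ?thesis
      by (simp add: Finite_Cartesian_Product.transpose_def)
  qed
  have "((\<lambda>y. G y $ i $ j) has_derivative (\<lambda>v. frechet_derivative G (at x) v $ j $ i)) (at x)"
    by (rule has_derivative_transform_within_open
        [OF frechet_derivative_matrix_nth[OF assms(3), of j i] assms(1,2)]) (simp add: eq)
  then have "(\<lambda>v. frechet_derivative G (at x) v $ i $ j) =
      (\<lambda>v. frechet_derivative G (at x) v $ j $ i)"
    by (rule has_derivative_unique[OF frechet_derivative_matrix_nth[OF assms(3)]])
  from fun_cong[OF this, of "axis k 1"] show ?thesis
    by (simp add: partial_metric_def)
qed

lemma christoffel_torsion_free:
  assumes "open U" "x \<in> U" "G differentiable (at x)"
    and "\<And>y. y \<in> U \<Longrightarrow> Finite_Cartesian_Product.transpose (G y) = G y"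
  shows "christoffel G x k i j = christoffel G x k j i"
  unfolding christoffel_def
  using partial_metric_sym[OF assms, of _ i j] by (simp add: algebra_simps)

lemma christoffel_lower:
  assumes "invertible (G x)"
  shows "(\<Sum>l\<in>UNIV. G x $ m $ l * christoffel G x l i j) =
    1 / 2 * (partial_metric G x i j m + partial_metric G x j i m - partial_metric G x m i j)"
proof -
  define h where "h = (\<chi> l. 1 / 2 *
    (partial_metric G x i j l + partial_metric G x j i l - partial_metric G x l i j))"
  have "(\<chi> l. christoffel G x l i j) = matrix_inv (G x) *v h"
    by (simp add: vec_eq_iff christoffel_def matrix_vector_mult_def h_def sum_distrib_left
        mult.left_commute)
  moreover have "G x ** matrix_inv (G x) = Finite_Cartesian_Product.mat 1"
    using assms unfolding invertible_def matrix_inv_def by (rule someI2_ex) simp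
  ultimately have "G x *v (\<chi> l. christoffel G x l i j) = h"
    by (simp add: matrix_vector_mul_assoc)
  then have "(G x *v (\<chi> l. christoffel G x l i j)) $ m = h $ m"
    by simp
  then show ?thesis
    by (simp add: matrix_vector_mult_def h_def)
qed

lemma christoffel_metric:
  assumes "open U" "x \<in> U" "G differentiable (at x)" "invertible (G x)"
    and sym: "\<And>y. y \<in> U \<Longrightarrow> Finite_Cartesian_Product.transpose (G y) = G y"
  shows "partial_metric G x k i j =
    (\<Sum>l\<in>UNIV. G x $ j $ l * christoffel G x l k i) + (\<Sum>l\<in>UNIV. G x $ i $ l * christoffel G x l k j)"
proof -
  note s = partial_metric_sym[OF assms(1-3) sym]
  show ?thesis
    unfolding christoffel_lower[of G, OF assms(4)]
    using s[of k i j] s[of i k j] s[of j k i] s[of i j k] s[of j i k] by (simp add: field_simps)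
qed


section \<open>Calculus along a curve\<close>

text \<open>
  All fields along a curve \<open>\<gamma>\<close> are considered on the interval \<open>[0,T]\<close>, and derivatives at the end
  points are one-sided.
\<close>

definition smooth_curve ::
  "('a::{t2_space, second_countable_topology}, 'm::finite) chart set \<Rightarrow> real \<Rightarrow> (real \<Rightarrow> 'a) \<Rightarrow> bool" where
  "smooth_curve \<A> T \<gamma> \<longleftrightarrow> continuous_on {0..T} \<gamma> \<and> \<gamma> ` {0..T} \<subseteq> manifold \<A> \<and>
     (\<forall>c\<in>\<A>. smooth_on {t\<in>{0..T}. \<gamma> t \<in> cdom c} (coord c \<circ> \<gamma>))"

definition velocity ::
  "('a, 'm::finite) chart set \<Rightarrow> real \<Rightarrow> (real \<Rightarrow> 'a) \<Rightarrow> real \<Rightarrow> ('a, 'm) tvec" where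
  "velocity \<A> T \<gamma> t = (\<lambda>c. if c \<in> \<A> \<and> \<gamma> t \<in> cdom c
     then vector_derivative (coord c \<circ> \<gamma>) (at t within {0..T}) else 0)"

definition smooth_field_along ::
  "('a, 'm::finite) chart set \<Rightarrow> real \<Rightarrow> (real \<Rightarrow> 'a) \<Rightarrow> (real \<Rightarrow> ('a, 'm) tvec) \<Rightarrow> bool" where
  "smooth_field_along \<A> T \<gamma> \<xi> \<longleftrightarrow> (\<forall>t\<in>{0..T}. \<xi> t \<in> tangent_space \<A> (\<gamma> t)) \<and>
     (\<forall>c\<in>\<A>. smooth_on {t\<in>{0..T}. \<gamma> t \<in> cdom c} (\<lambda>t. \<xi> t c))"

definition cov_deriv ::
  "('a, 'm::finite) chart set \<Rightarrow> ('a, 'm) metric \<Rightarrow> real \<Rightarrow> (real \<Rightarrow> 'a) \<Rightarrow>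
     (real \<Rightarrow> ('a, 'm) tvec) \<Rightarrow> real \<Rightarrow> ('a, 'm) tvec" where
  "cov_deriv \<A> g T \<gamma> \<xi> t = (\<lambda>c. if c \<in> \<A> \<and> \<gamma> t \<in> cdom c
     then vector_derivative (\<lambda>s. \<xi> s c) (at t within {0..T}) +
       christoffel_form (g c) (coord c (\<gamma> t)) (velocity \<A> T \<gamma> t c) (\<xi> t c)
     else 0)"

definition closed_geodesic ::
  "('a::{t2_space, second_countable_topology}, 'm::finite) chart set \<Rightarrow> ('a, 'm) metric \<Rightarrow>
     real \<Rightarrow> (real \<Rightarrow> 'a) \<Rightarrow> bool" where
  "closed_geodesic \<A> g T \<gamma> \<longleftrightarrow> 0 < T \<and> smooth_curve \<A> T \<gamma> \<and>
     (\<forall>t\<in>{0..T}. cov_deriv \<A> g T \<gamma> (velocity \<A> T \<gamma>) t = 0) \<and>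
     \<gamma> 0 = \<gamma> T \<and> velocity \<A> T \<gamma> 0 = velocity \<A> T \<gamma> T"

definition constant_curve :: "real \<Rightarrow> (real \<Rightarrow> 'a) \<Rightarrow> bool" where
  "constant_curve T \<gamma> \<longleftrightarrow> (\<exists>p. \<forall>t\<in>{0..T}. \<gamma> t = p)"

definition timelike_curve ::
  "('a, 'm::finite) chart set \<Rightarrow> ('a, 'm) metric \<Rightarrow> real \<Rightarrow> (real \<Rightarrow> 'a) \<Rightarrow> bool" where
  "timelike_curve \<A> g T \<gamma> \<longleftrightarrow>
     (\<forall>t\<in>{0..T}. metric_at \<A> g (\<gamma> t) (velocity \<A> T \<gamma> t) (velocity \<A> T \<gamma> t) < 0)"


section \<open>Parallel frames and the Morse index\<close>

text \<open>
  Frames and vectors in \<open>\<real>\<^sup>n\<close> are indexed by the natural numbers below \<open>n\<close>; this allows \<open>n = 0\<close>.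
  The vector fields \<open>e i\<close>, \<open>i < n\<close>, span the orthogonal complement of the velocity when the manifold
  has dimension \<open>n + 1\<close>.
\<close>

definition parallel_orthonormal_frame ::
  "('a, 'm::finite) chart set \<Rightarrow> ('a, 'm) metric \<Rightarrow> real \<Rightarrow> (real \<Rightarrow> 'a) \<Rightarrow> nat \<Rightarrow>
     (nat \<Rightarrow> real \<Rightarrow> ('a, 'm) tvec) \<Rightarrow> bool" where
  "parallel_orthonormal_frame \<A> g T \<gamma> n e \<longleftrightarrow>
     (\<forall>i<n. smooth_field_along \<A> T \<gamma> (e i) \<and>
        (\<forall>t\<in>{0..T}. cov_deriv \<A> g T \<gamma> (e i) t = 0) \<and>
        (\<forall>t\<in>{0..T}. metric_at \<A> g (\<gamma> t) (e i t) (velocity \<A> T \<gamma> t) = 0) \<and>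
        (\<forall>t\<in>{0..T}. \<forall>j<n. metric_at \<A> g (\<gamma> t) (e i t) (e j t) = (if i = j then 1 else 0)))"

definition holonomy_matrix ::
  "real \<Rightarrow> nat \<Rightarrow> (nat \<Rightarrow> real \<Rightarrow> ('a, 'm::finite) tvec) \<Rightarrow> real mat \<Rightarrow> bool" where
  "holonomy_matrix T n e A \<longleftrightarrow> A \<in> carrier_mat n n \<and>
     (\<forall>j<n. e j T = (\<Sum>i<n. A $$ (i, j) *\<^sub>R e i 0))"

definition curvature_matrix ::
  "('a, 'm::finite) chart set \<Rightarrow> ('a, 'm) metric \<Rightarrow> real \<Rightarrow> (real \<Rightarrow> 'a) \<Rightarrow>
     (nat \<Rightarrow> real \<Rightarrow> ('a, 'm) tvec) \<Rightarrow> real \<Rightarrow> nat \<Rightarrow> nat \<Rightarrow> real" where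
  "curvature_matrix \<A> g T \<gamma> e t i j = metric_at \<A> g (\<gamma> t)
     (curvature_at \<A> g (\<gamma> t) (velocity \<A> T \<gamma> t) (e i t) (velocity \<A> T \<gamma> t)) (e j t)"

text \<open>
  Elements of \<open>W\<^sup>1\<^sup>,\<^sup>2([0,T])\<close> are represented by their absolutely continuous representative, the
  primitive of a square integrable function.
\<close>

definition is_weak_deriv :: "real \<Rightarrow> (real \<Rightarrow> real) \<Rightarrow> (real \<Rightarrow> real) \<Rightarrow> bool" where
  "is_weak_deriv T f w \<longleftrightarrow>
     w \<in> borel_measurable (lebesgue_on {0..T}) \<and>
     integrable (lebesgue_on {0..T}) (\<lambda>t. (w t)\<^sup>2) \<and>
     (\<forall>t\<in>{0..T}. f t = f 0 + integral\<^sup>L (lebesgue_on {0..t}) w)"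

definition weak_deriv :: "real \<Rightarrow> (real \<Rightarrow> real) \<Rightarrow> real \<Rightarrow> real" where
  "weak_deriv T f = (SOME w. is_weak_deriv T f w)"

text \<open>
  Functions on \<open>[0,T]\<close> with values in \<open>\<real>\<^sup>n\<close> are extended by zero, outside the interval as well as in
  the components from \<open>n\<close> on, so that equality of functions is equality on \<open>[0,T]\<close>.
\<close>

definition sobolev_twisted :: "real \<Rightarrow> nat \<Rightarrow> real mat \<Rightarrow> (real \<Rightarrow> nat \<Rightarrow> real) set" where
  "sobolev_twisted T n A = {u.
     (\<forall>i<n. \<exists>w. is_weak_deriv T (\<lambda>t. u t i) w) \<and>
     (\<forall>t i. t \<notin> {0..T} \<or> n \<le> i \<longrightarrow> u t i = 0) \<and>
     (\<forall>i<n. u 0 i = (\<Sum>j<n. A $$ (i, j) * u T j))}"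

definition index_form ::
  "real \<Rightarrow> nat \<Rightarrow> (real \<Rightarrow> nat \<Rightarrow> nat \<Rightarrow> real) \<Rightarrow>
     (real \<Rightarrow> nat \<Rightarrow> real) \<Rightarrow> (real \<Rightarrow> nat \<Rightarrow> real) \<Rightarrow> real" where
  "index_form T n R u v = integral\<^sup>L (lebesgue_on {0..T}) (\<lambda>t.
     (\<Sum>i<n. weak_deriv T (\<lambda>s. u s i) t * weak_deriv T (\<lambda>s. v s i) t) +
     (\<Sum>i<n. (\<Sum>j<n. R t i j * u t j) * v t i))"

definition morse_index ::
  "('a, 'm::finite) chart set \<Rightarrow> ('a, 'm) metric \<Rightarrow> real \<Rightarrow> (real \<Rightarrow> 'a) \<Rightarrow> nat \<Rightarrow>
     (nat \<Rightarrow> real \<Rightarrow> ('a, 'm) tvec) \<Rightarrow> real mat \<Rightarrow> nat" where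
  "morse_index \<A> g T \<gamma> n e A = (GREATEST k. \<exists>V. subspace V \<and> V \<subseteq> sobolev_twisted T n A \<and> dim V = k \<and>
     (\<forall>u\<in>V. u \<noteq> 0 \<longrightarrow> index_form T n (curvature_matrix \<A> g T \<gamma> e) u u < 0))"


section \<open>Linear stability\<close>

definition normal_space ::
  "('a, 'm::finite) chart set \<Rightarrow> ('a, 'm) metric \<Rightarrow> real \<Rightarrow> (real \<Rightarrow> 'a) \<Rightarrow> ('a, 'm) tvec set" where
  "normal_space \<A> g T \<gamma> =
     {v \<in> tangent_space \<A> (\<gamma> 0). metric_at \<A> g (\<gamma> 0) v (velocity \<A> T \<gamma> 0) = 0}"

definition jacobi_field ::
  "('a, 'm::finite) chart set \<Rightarrow> ('a, 'm) metric \<Rightarrow> real \<Rightarrow> (real \<Rightarrow> 'a) \<Rightarrow>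
     (real \<Rightarrow> ('a, 'm) tvec) \<Rightarrow> bool" where
  "jacobi_field \<A> g T \<gamma> \<xi> \<longleftrightarrow> smooth_field_along \<A> T \<gamma> \<xi> \<and>
     (\<forall>t\<in>{0..T}. - cov_deriv \<A> g T \<gamma> (cov_deriv \<A> g T \<gamma> \<xi>) t +
        curvature_at \<A> g (\<gamma> t) (velocity \<A> T \<gamma> t) (\<xi> t) (velocity \<A> T \<gamma> t) = 0)"

text \<open>The Jacobi field with given initial data is unique on \<open>[0,T]\<close>, but not as a function on \<open>\<real>\<close>.\<close>

definition poincare_map ::
  "('a, 'm::finite) chart set \<Rightarrow> ('a, 'm) metric \<Rightarrow> real \<Rightarrow> (real \<Rightarrow> 'a) \<Rightarrow>
     ('a, 'm) tvec \<times> ('a, 'm) tvec \<Rightarrow> ('a, 'm) tvec \<times> ('a, 'm) tvec" where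
  "poincare_map \<A> g T \<gamma> = (\<lambda>(v, v').
     let \<xi> = (SOME \<xi>. jacobi_field \<A> g T \<gamma> \<xi> \<and> \<xi> 0 = v \<and> cov_deriv \<A> g T \<gamma> \<xi> 0 = v')
     in (\<xi> T, cov_deriv \<A> g T \<gamma> \<xi> T))"

definition matrix_of_map ::
  "'v::real_vector set \<Rightarrow> ('v \<Rightarrow> 'v) \<Rightarrow> real mat \<Rightarrow> bool" where
  "matrix_of_map W L P \<longleftrightarrow> (\<exists>k b. P \<in> carrier_mat k k \<and>
     inj_on b {..<k} \<and> independent (b ` {..<k}) \<and> span (b ` {..<k}) = W \<and>
     (\<forall>j<k. L (b j) = (\<Sum>i<k. P $$ (i, j) *\<^sub>R b i)))"

text \<open>
  Semisimplicity over \<open>\<complex>\<close> and the spectrum are read off from the matrix of the map in a basis; both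
  are invariant under a change of the basis.
\<close>

definition linearly_stable ::
  "('a, 'm::finite) chart set \<Rightarrow> ('a, 'm) metric \<Rightarrow> real \<Rightarrow> (real \<Rightarrow> 'a) \<Rightarrow> bool" where
  "linearly_stable \<A> g T \<gamma> \<longleftrightarrow> (\<exists>P.
     matrix_of_map (normal_space \<A> g T \<gamma> \<times> normal_space \<A> g T \<gamma>) (poincare_map \<A> g T \<gamma>) P \<and>
     (\<exists>D. diagonal_mat D \<and> similar_mat (map_mat complex_of_real P) D) \<and>
     (\<forall>z. eigenvalue (map_mat complex_of_real P) z \<longrightarrow> norm z = 1))"

definition linearly_unstable ::
  "('a, 'm::finite) chart set \<Rightarrow> ('a, 'm) metric \<Rightarrow> real \<Rightarrow> (real \<Rightarrow> 'a) \<Rightarrow> bool" where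
  "linearly_unstable \<A> g T \<gamma> \<longleftrightarrow> \<not> linearly_stable \<A> g T \<gamma>"

end

theory Submission
  imports Defs
begin

text \<open>
  In the parallel frame the Jacobi equation becomes \<open>u'' = R u\<close> with a symmetric matrix \<open>R\<close>, and the
  Poincare map sends the initial data of a solution to the data at \<open>T\<close> multiplied by \<open>A\<close>. Divide \<open>[0,T]\<close>
  into an odd number of short intervals. On a short interval solutions minimise the index form for
  given end values, so the Morse index is the number of negative directions of the index form on the
  solutions broken at the nodes. This is the form with the matrix \<open>M 1\<close>, where
  \<open>M y = D + y B + B\<^sup>T / y\<close> is singular exactly if \<open>y\<close> or \<open>1 / y\<close> is an eigenvalue of the Poincare map.
  If the geodesic is linearly stable, there are no eigenvalues \<open>y > 1\<close> and no Jordan blocks at \<open>1\<close>, so the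
  sign of \<open>det (M y)\<close> is constant for \<open>y > 1\<close>. At infinity it is the sign of \<open>det B\<close>, which is
  \<open>(-1)\<^sup>n det A\<close>. Near \<open>1\<close> it is \<open>(-1)\<close> to the power of the Morse index, because without Jordan blocks the
  kernel of \<open>M 1\<close> contributes the determinant of a nonsingular skew matrix, which is positive. Hence
  stability forces \<open>(-1)\<close> to the power of the Morse index plus \<open>n\<close> to be \<open>det A\<close>.
\<close>

section \<open>Inertia and determinants\<close>

text \<open>The twist is spread evenly over the links: the node values \<open>y ^ k * q\<close> turn
  a null vector of \<open>M y\<close> into an unbroken solution whose data at T, brought back by A,
  are \<open>y ^ N\<close> times the data at 0. A twist at the closing link alone would have a
  degenerate leading matrix in y; spread evenly, the leading matrix is the invertible B. The
  obstacle lies at y = 1, where periodic Jacobi fields may make \<open>M 1\<close> singular, so that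
  its determinant carries no information. Dividing the rows of the kernel directions by y - 1 gives
  a limit that is nonsingular exactly because Jordan chains are absent. Shortness means
  \<open>4 * n\<^sup>2 * C * h\<^sup>2 \<le> 1\<close>, with C a bound for the curvature entries and
  h the length. This one bound makes the two-point problem uniquely solvable, makes solutions
  minimisers, and makes the map from end value to initial velocity positive, so that B can be
  deformed to a block shift. With an odd number of segments the determinant of that shift is
  immediate. In both signatures only a symmetric matrix function on [0,T] and an orthogonal matrix
  remain to be studied.\<close>

definition fdet :: "nat \<Rightarrow> (nat \<Rightarrow> nat \<Rightarrow> real) \<Rightarrow> real" where
  "fdet m M = Determinant.det (Matrix.mat m m (\<lambda>(i, j). M i j))"

lemma fdet_cong: "(\<And>i j. i < m \<Longrightarrow> j < m \<Longrightarrow> M i j = M' i j) \<Longrightarrow> fdet m M = fdet m M'"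
  unfolding fdet_def by (rule arg_cong[where f = Determinant.det]) (auto intro!: eq_matI)

text \<open>Matrices and vectors are functions on all naturals that are read below m only, which
  avoids carrier conditions. The kernel criterion is the form in which nonsingularity is proved
  below, because a null vector can be turned into a solution of the differential equation.\<close>

lemma fdet_nonzero_iff:
  "fdet m M \<noteq> 0 \<longleftrightarrow> (\<forall>q. (\<forall>i<m. (\<Sum>j<m. M i j * q j) = 0) \<longrightarrow> (\<forall>i<m. q i = 0))"
proof -
  let ?M = "Matrix.mat m m (\<lambda>(i, j). M i j)"
  have M: "?M \<in> carrier_mat m m" by simp
  have *: "?M *\<^sub>v Matrix.vec m q = 0\<^sub>v m \<longleftrightarrow> (\<forall>i<m. (\<Sum>j<m. M i j * q j) = 0)" for q
    by (auto simp: vec_eq_iff scalar_prod_def atLeast0LessThan)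
  show ?thesis
    unfolding fdet_def det_0_iff_vec_prod_zero_field[OF M]
  proof safe
    fix q i assume h: "\<nexists>v. v \<in> carrier_vec m \<and> v \<noteq> 0\<^sub>v m \<and> ?M *\<^sub>v v = 0\<^sub>v m"
      and "\<forall>i<m. (\<Sum>j<m. M i j * q j) = 0" "i < m"
    then have "Matrix.vec m q = 0\<^sub>v m" using *[of q] by (metis vec_carrier)
    with \<open>i < m\<close> show "q i = 0" by (metis index_vec index_zero_vec(1))
  next
    fix v :: "real vec"
    assume h: "\<forall>q. (\<forall>i<m. (\<Sum>j<m. M i j * q j) = 0) \<longrightarrow> (\<forall>i<m. q i = 0)"
      and v: "v \<in> carrier_vec m" "v \<noteq> 0\<^sub>v m" "?M *\<^sub>v v = 0\<^sub>v m"
    have e: "v = Matrix.vec m (vec_index v)" using v(1) by auto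
    then have "\<forall>i<m. vec_index v i = 0" using h *[of "vec_index v"] v(3) by auto
    then have "v = 0\<^sub>v m" using v(1) by (auto simp: vec_eq_iff)
    with v(2) show False by simp
  qed
qed

lemma fdet_kernel:
  assumes "fdet m M \<noteq> 0" "\<forall>i<m. (\<Sum>j<m. M i j * q j) = 0"
  shows "\<forall>i<m. q i = 0"
  using assms(1)[unfolded fdet_nonzero_iff, rule_format, of q] assms(2) by simp

lemma fdet_mult: "fdet m M * fdet m N = fdet m (\<lambda>i j. \<Sum>k<m. M i k * N k j)"
proof -
  have "Matrix.mat m m (\<lambda>(i, j). \<Sum>k<m. M i k * N k j)
      = Matrix.mat m m (\<lambda>(i, j). M i j) * Matrix.mat m m (\<lambda>(i, j). N i j)"
    by (auto intro!: eq_matI simp: scalar_prod_def atLeast0LessThan)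
  then show ?thesis unfolding fdet_def by (simp add: det_mult[of _ m])
qed

lemma fdet_transpose: "fdet m (\<lambda>i j. M j i) = fdet m M"
proof -
  have "Matrix.mat m m (\<lambda>(i, j). M j i) = transpose_mat (Matrix.mat m m (\<lambda>(i, j). M i j))"
    by (auto intro!: eq_matI)
  then show ?thesis unfolding fdet_def by (simp add: det_transpose[of _ m])
qed

lemma fdet_leibniz: "fdet m M = (\<Sum>p | p permutes {0..<m}. signof p * (\<Prod>i = 0..<m. M i (p i)))"
  unfolding fdet_def
  by (subst det_def'[of _ m]) (auto intro!: sum.cong prod.cong simp: permutes_in_image)

lemma continuous_on_fdet:
  assumes "\<And>i j. i < m \<Longrightarrow> j < m \<Longrightarrow> continuous_on S (\<lambda>s. M s i j)"
  shows "continuous_on S (\<lambda>s. fdet m (M s))"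
  unfolding fdet_leibniz
  by (intro continuous_intros assms) (auto dest: permutes_in_image[THEN iffD2])

text \<open>A determinant is a polynomial in the entries, so on a connected parameter set it cannot
  change its sign without vanishing. All comparisons of signs along deformations go through
  this.\<close>

lemma sgn_fdet_const:
  fixes M :: "real \<Rightarrow> nat \<Rightarrow> nat \<Rightarrow> real"
  assumes "\<And>i j. i < m \<Longrightarrow> j < m \<Longrightarrow> continuous_on S (\<lambda>s. M s i j)"
    and "connected S" "\<And>s. s \<in> S \<Longrightarrow> fdet m (M s) \<noteq> 0" and "a \<in> S" "b \<in> S"
  shows "sgn (fdet m (M a)) = sgn (fdet m (M b))"
proof -
  let ?f = "\<lambda>s. fdet m (M s)"
  have c: "connected (?f ` S)"
    by (rule connected_continuous_image[OF continuous_on_fdet assms(2)]) (rule assms(1))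
  have "0 \<notin> ?f ` S" using assms(3) by force
  then have *: "\<not> (x < 0 \<and> 0 < y)" if "x \<in> ?f ` S" "y \<in> ?f ` S" for x y
    using connectedD_interval[OF c that, of 0] by auto
  have "?f a \<noteq> 0" "?f b \<noteq> 0" using assms by auto
  moreover have "\<not> (?f a < 0 \<and> 0 < ?f b)" "\<not> (?f b < 0 \<and> 0 < ?f a)"
    using *[of "?f a" "?f b"] *[of "?f b" "?f a"] assms(4,5) by blast+
  ultimately show ?thesis by (auto simp: sgn_if)
qed

lemma fdet_diag: "fdet m (\<lambda>i j. if i = j then d i else 0) = (\<Prod>i<m. d i)"
proof -
  have "fdet m (\<lambda>i j. if i = j then d i else 0)
     = prod_list (diag_mat (Matrix.mat m m (\<lambda>(i, j). if i = j then d i else 0)))"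
    unfolding fdet_def by (rule det_upper_triangular[of _ m]) auto
  also have "\<dots> = (\<Prod>i\<leftarrow>[0..<m]. d i)"
    unfolding diag_mat_def by (rule arg_cong[where f = prod_list]) auto
  also have "\<dots> = (\<Prod>i<m. d i)"
    by (simp add: prod.list_conv_set_nth atLeast0LessThan)
  finally show ?thesis .
qed

lemma fdet_scale_rows: "fdet m (\<lambda>i j. c i * M i j) = (\<Prod>i<m. c i) * fdet m M"
proof -
  have "(\<Prod>i<m. c i) * fdet m M = fdet m (\<lambda>i j. \<Sum>k<m. (if i = k then c i else 0) * M k j)"
    by (simp only: fdet_mult flip: fdet_diag)
  also have "\<dots> = fdet m (\<lambda>i j. c i * M i j)"
    by (rule fdet_cong) (simp add: if_distrib[of "\<lambda>x. x * _"] cong: if_cong)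
  finally show ?thesis ..
qed

lemma fdet_inverse:
  assumes "fdet m M \<noteq> 0"
  shows "\<exists>N. (\<forall>i<m. \<forall>j<m. (\<Sum>k<m. M i k * N k j) = (if i = j then 1 else 0)) \<and>
    (\<forall>i<m. \<forall>j<m. (\<Sum>k<m. N i k * M k j) = (if i = j then 1 else 0))"
proof -
  let ?M = "Matrix.mat m m (\<lambda>(i, j). M i j)"
  have "?M \<in> Units (ring_mat TYPE(real) m ())"
    using assms unfolding fdet_def by (intro det_non_zero_imp_unit) auto
  then obtain N where N: "N \<in> carrier_mat m m" "N * ?M = 1\<^sub>m m" "?M * N = 1\<^sub>m m"
    by (auto simp: Units_def ring_mat_def)
  have "(\<Sum>k<m. M i k * N $$ (k, j)) = (if i = j then 1 else 0)" if "i < m" "j < m" for i j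
  proof -
    have "(?M * N) $$ (i, j) = (\<Sum>k<m. M i k * N $$ (k, j))"
      using that N(1) by (auto simp: scalar_prod_def atLeast0LessThan)
    then show ?thesis using that by (simp add: N(3))
  qed
  moreover have "(\<Sum>k<m. N $$ (i, k) * M k j) = (if i = j then 1 else 0)" if "i < m" "j < m" for i j
  proof -
    have "(N * ?M) $$ (i, j) = (\<Sum>k<m. N $$ (i, k) * M k j)"
      using that N(1) by (auto simp: scalar_prod_def atLeast0LessThan)
    then show ?thesis using that by (simp add: N(2))
  qed
  ultimately show ?thesis by (intro exI[of _ "\<lambda>i j. N $$ (i, j)"]) simp
qed

section \<open>Diagonalising a symmetric form by congruence\<close>

lemma orthogonal_basis_exists:
  fixes f :: "'v::real_vector \<Rightarrow> 'v \<Rightarrow> real"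
  assumes f: "bilinear f" "\<And>x y. f x y = f y x"
    and B: "finite B" "independent B"
  shows "\<exists>B'. finite B' \<and> independent B' \<and> card B' = card B \<and> span B' = span B \<and>
    (\<forall>x\<in>B'. \<forall>y\<in>B'. x \<noteq> y \<longrightarrow> f x y = 0)"
  using B
proof (induction "card B" arbitrary: B rule: less_induct)
  case less
  note add = bilinear_ladd[OF f(1)] bilinear_radd[OF f(1)] and mul = bilinear_lmul[OF f(1)] bilinear_rmul[OF f(1)]
    and sub = bilinear_lsub[OF f(1)] bilinear_rsub[OF f(1)]
  show ?case
  proof (cases "\<exists>v\<in>span B. f v v \<noteq> 0")
    case False
    \<comment> \<open>Polarisation: a form that vanishes on the diagonal vanishes identically, so
      the given basis is already orthogonal.\<close>
    have "f x y = 0" if "x \<in> B" "y \<in> B" for x y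
    proof -
      have "f (x + y) (x + y) = 0" "f x x = 0" "f y y = 0"
        using False that by (auto intro: span_add span_base)
      then show ?thesis by (simp add: add f(2)[of y x])
    qed
    then show ?thesis using less.prems by blast
  next
    case True
    \<comment> \<open>A vector that is not isotropic is split off. Its orthogonal complement S in
      the span meets its line only in zero, even when the form is degenerate, and so has one
      dimension less.\<close>
    then obtain v where v: "v \<in> span B" "f v v \<noteq> 0" by blast
    define S where "S = {w \<in> span B. f v w = 0}"
    have S: "subspace S" unfolding S_def
      by (auto simp: subspace_def add mul bilinear_rzero[OF f(1)] intro: span_add span_scale span_zero)
    obtain B1 where B1: "B1 \<subseteq> S" "independent B1" "S \<subseteq> span B1"
      by (metis basis_exists)
    have fin: "finite B1"
      by (rule independent_span_bound[OF less.prems(1) B1(2), THEN conjunct1]) (use B1(1) S_def in auto)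
    have sp: "span B1 = S" using B1 S by (simp add: span_subspace)
    have nv: "v \<notin> span B1" using v(2) by (auto simp: sp S_def)
    have ind: "independent (insert v B1)" using nv B1(2) by (simp add: independent_insert)
    have eq: "span (insert v B1) = span B"
    proof
      show "span (insert v B1) \<subseteq> span B"
        using v(1) B1(1) S_def by (intro span_minimal) auto
      show "span B \<subseteq> span (insert v B1)"
      proof
        fix w assume w: "w \<in> span B"
        let ?a = "f v w / f v v"
        have "w - ?a *\<^sub>R v \<in> S"
          using w v by (auto simp: S_def sub mul intro: span_diff span_scale)
        then have "w - ?a *\<^sub>R v \<in> span B1" by (simp add: sp)
        then show "w \<in> span (insert v B1)" unfolding span_insert by blast
      qed
    qed
    have card: "card (insert v B1) = card B"
      by (metis dim_eq_card_independent dim_span eq ind less.prems(2))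
    have vB: "v \<notin> B1" using nv span_base by blast
    then have "card B1 < card B" using fin card by simp
    from less.hyps[OF this fin B1(2)] obtain B' where B'_all: "finite B' \<and> independent B' \<and>
      card B' = card B1 \<and> span B' = span B1 \<and> (\<forall>x\<in>B'. \<forall>y\<in>B'. x \<noteq> y \<longrightarrow> f x y = 0)" ..
    then have B': "finite B'" "independent B'" "card B' = card B1" "span B' = span B1"
      "\<forall>x\<in>B'. \<forall>y\<in>B'. x \<noteq> y \<longrightarrow> f x y = 0" by simp_all
    have o: "f v x = 0" "f x v = 0" if "x \<in> B'" for x
    proof -
      have "x \<in> S" using span_base[OF that] B'(4) sp by simp
      then show "f v x = 0" by (simp add: S_def)
      then show "f x v = 0" using f(2)[of x v] by simp
    qed
    show ?thesis
    proof (intro exI[of _ "insert v B'"] conjI)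
      have nv': "v \<notin> span B'" using nv B'(4) by simp
      then have "v \<notin> B'" using span_base by blast
      then show "card (insert v B') = card B" using card vB fin B'(1,3) by simp
      show "independent (insert v B')" using nv' B'(2) by (simp add: independent_insert)
      show "span (insert v B') = span B" using eq B'(4) by (simp add: span_insert)
      show "\<forall>x\<in>insert v B'. \<forall>y\<in>insert v B'. x \<noteq> y \<longrightarrow> f x y = 0"
        using B'(5) o by blast
      show "finite (insert v B')" using B'(1) by simp
    qed
  qed
qed

definition unit_fun :: "nat \<Rightarrow> nat \<Rightarrow> real" where
  "unit_fun i = (\<lambda>j. if j = i then 1 else 0)"

lemma sum_fun_apply: "(\<Sum>i\<in>I. f i) x = (\<Sum>i\<in>I. f i x)"
  by (induction I rule: infinite_finite_induct) auto

text \<open>Only the first m coordinates survive. Hence a vector is replaced by its zero extension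
  before a bilinear form on functions is evaluated on it.\<close>

lemma sum_unit_fun: "(\<Sum>i<m. q i *\<^sub>R unit_fun i) = (\<lambda>j. if j < m then q j else 0)"
  by (auto simp: fun_eq_iff sum_fun_apply scaleR_fun_def unit_fun_def if_distrib cong: if_cong)

lemma inj_unit_fun: "inj unit_fun"
  by (rule injI) (metis unit_fun_def zero_neq_one)

lemma independent_unit_fun: "independent (unit_fun ` {..<m})"
proof (rule independent_if_scalars_zero)
  fix f x assume s: "(\<Sum>x\<in>unit_fun ` {..<m}. f x *\<^sub>R x) = 0" and x: "x \<in> unit_fun ` {..<m}"
  then obtain i where i: "i < m" "x = unit_fun i" by auto
  have "(\<Sum>i<m. f (unit_fun i) *\<^sub>R unit_fun i) = 0"
    using s by (subst (asm) sum.reindex) (auto simp: inj_on_def inj_eq[OF inj_unit_fun])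
  then have "(\<Sum>i<m. f (unit_fun i) *\<^sub>R unit_fun i) i = 0" by simp
  then show "f x = 0" using i by (simp add: sum_unit_fun)
qed simp

text \<open>The columns of Q are an orthogonal basis, for the form with matrix H, of the span of the
  first m unit vectors.\<close>

lemma congruence_diagonal:
  assumes sym: "\<And>i j. i < m \<Longrightarrow> j < m \<Longrightarrow> H i j = H j i"
  shows "\<exists>Q. fdet m Q \<noteq> 0 \<and>
    (\<forall>i<m. \<forall>j<m. i \<noteq> j \<longrightarrow> (\<Sum>k<m. \<Sum>l<m. Q k i * H k l * Q l j) = 0)"
proof -
  define f where "f x y = (\<Sum>k<m. \<Sum>l<m. x k * H k l * y l)" for x y
  have bil: "bilinear f" unfolding bilinear_def f_def
    by (auto intro!: linearI simp: scaleR_fun_def algebra_simps sum.distrib sum_distrib_left)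
  have fsym: "f x y = f y x" for x y
    unfolding f_def by (subst sum.swap) (auto intro!: sum.cong simp: sym)
  obtain B where B: "finite B" "independent B" "card B = card (unit_fun ` {..<m})"
    "span B = span (unit_fun ` {..<m})" "\<forall>x\<in>B. \<forall>y\<in>B. x \<noteq> y \<longrightarrow> f x y = 0"
    using orthogonal_basis_exists[OF bil fsym _ independent_unit_fun[of m]] by auto
  have "card B = m" using B(3) by (simp add: card_image inj_on_subset[OF inj_unit_fun])
  then obtain b where b: "bij_betw b {..<m} B"
    using B(1) by (metis card_lessThan finite_lessThan finite_same_card_bij)
  \<comment> \<open>Combinations of the basis have no coordinates from m on. So if the first m
    vanish, the combination is zero as a function, and independence applies.\<close>
  have supp: "x j = 0" if "x \<in> span B" "j \<ge> m" for x j
    using that(1) unfolding B(4)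
    by (induction rule: span_induct_alt) (use that(2) in \<open>auto simp: unit_fun_def scaleR_fun_def\<close>)
  have "fdet m (\<lambda>k i. b i k) \<noteq> 0"
    unfolding fdet_nonzero_iff
  proof safe
    fix q i assume q: "\<forall>k<m. (\<Sum>i<m. b i k * q i) = 0" and i: "i < m"
    have "(\<Sum>i<m. q i *\<^sub>R b i) j = 0" for j
    proof (cases "j < m")
      case True then show ?thesis using q by (simp add: sum_fun_apply scaleR_fun_def mult.commute)
    next
      case False
      have "(\<Sum>i<m. q i *\<^sub>R b i) \<in> span B"
        using b by (intro span_sum span_scale span_base) (auto simp: bij_betw_def)
      then show ?thesis using supp False by simp
    qed
    then have "(\<Sum>i<m. q i *\<^sub>R b i) = 0" by (auto simp: fun_eq_iff)
    define u where "u x = q (inv_into {..<m} b x)" for x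
    have u: "u (b i) = q i" if "i < m" for i
      using b that by (simp add: u_def bij_betw_def inv_into_f_f)
    have "(\<Sum>x\<in>B. u x *\<^sub>R x) = (\<Sum>i<m. u (b i) *\<^sub>R b i)"
      by (rule sum.reindex_bij_betw[OF b, symmetric])
    also have "\<dots> = 0" using \<open>(\<Sum>i<m. q i *\<^sub>R b i) = 0\<close> by (simp add: u)
    finally have "u (b i) = 0"
      using independentD[OF B(2,1) subset_refl] b i by (meson bij_betwE lessThan_iff)
    then show "q i = 0" using u i by simp
  qed
  moreover have "(\<Sum>k<m. \<Sum>l<m. b i k * H k l * b j l) = 0" if "i < m" "j < m" "i \<noteq> j" for i j
  proof -
    have "b i \<noteq> b j" "b i \<in> B" "b j \<in> B" using b that by (auto simp: bij_betw_def inj_on_def)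
    then show ?thesis using B(5) by (simp add: f_def)
  qed
  ultimately show ?thesis by (intro exI[of _ "\<lambda>k i. b i k"]) simp
qed

text \<open>Zero entries count as 1 because the kernel directions will have been deformed to an
  identity block.\<close>

lemma sgn_prod_card_neg:
  fixes d :: "nat \<Rightarrow> real"
  assumes "finite I"
  shows "sgn (\<Prod>i\<in>I. if d i = 0 then 1 else d i) = (-1) ^ card {i \<in> I. d i < 0}"
  using assms
proof (induction I rule: finite_induct)
  case (insert x F)
  have "{i \<in> insert x F. d i < 0} = (if d x < 0 then insert x {i \<in> F. d i < 0} else {i \<in> F. d i < 0})"
    by auto
  then show ?case using insert by (auto simp: sgn_mult card_insert_if)
qed simp

text \<open>Exchanging the two summation indices changes the sign. This is what keeps a skew block
  nonsingular once a positive multiple of the identity is added.\<close>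

lemma skew_form_zero:
  fixes S :: "nat \<Rightarrow> nat \<Rightarrow> real"
  shows "(\<Sum>i<m. q i * (\<Sum>j<m. (S i j - S j i) * q j)) = 0"
proof -
  have "(\<Sum>i<m. q i * (\<Sum>j<m. S i j * q j)) = (\<Sum>i<m. q i * (\<Sum>j<m. S j i * q j))"
    unfolding sum_distrib_left by (subst sum.swap) (simp add: mult_ac)
  then show ?thesis by (simp add: left_diff_distrib sum_subtractf right_diff_distrib)
qed

text \<open>The factor is a square, so a nonsingular congruence leaves the sign of the determinant
  alone.\<close>

lemma fdet_congruence:
  "fdet m (\<lambda>i j. \<Sum>k<m. \<Sum>l<m. Q k i * X k l * Q l j) = (fdet m Q)\<^sup>2 * fdet m X"
proof -
  have "(fdet m Q)\<^sup>2 * fdet m X = fdet m (\<lambda>i j. Q j i) * fdet m X * fdet m Q"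
    by (simp add: fdet_transpose[of m Q] power2_eq_square)
  also have "\<dots> = fdet m (\<lambda>i j. \<Sum>k<m. \<Sum>l<m. Q k i * X k l * Q l j)"
    unfolding fdet_mult sum_distrib_right by (rule fdet_cong) (rule sum.swap)
  finally show ?thesis ..
qed

text \<open>
  As \<open>y \<rightarrow> \<infinity>\<close> the matrix \<open>M y\<close> is dominated by \<open>y B\<close>. As \<open>y \<rightarrow> 1\<close>, in coordinates that diagonalise
  \<open>M 1\<close>, the rows of the kernel directions divided by \<open>y - 1\<close> tend to the rows of the
  skew matrix \<open>B - B\<^sup>T\<close>, which can be deformed to the identity through nonsingular matrices.
\<close>

lemma inertia_sign:
  fixes D B :: "nat \<Rightarrow> nat \<Rightarrow> real"
  assumes M_def: "M = (\<lambda>y i j. D i j + y * B i j + B j i / y)"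
    and Dsym: "\<And>i j. i < m \<Longrightarrow> j < m \<Longrightarrow> D i j = D j i"
    and ker: "\<And>y. 1 < y \<Longrightarrow> fdet m (M y) \<noteq> 0"
    and B0: "fdet m B \<noteq> 0"
    and jordan: "\<And>q r. \<forall>i<m. (\<Sum>j<m. M 1 i j * q j) = 0 \<Longrightarrow>
      \<forall>i<m. (\<Sum>j<m. M 1 i j * r j) + (\<Sum>j<m. (B i j - B j i) * q j) = 0 \<Longrightarrow> \<forall>i<m. q i = 0"
  obtains Q d where "fdet m Q \<noteq> 0"
    and "\<And>i j. i < m \<Longrightarrow> j < m \<Longrightarrow>
      (\<Sum>k<m. \<Sum>l<m. Q k i * M 1 k l * Q l j) = (if i = j then d i else 0)"
    and "(-1) ^ card {i \<in> {..<m}. d i < 0} = sgn (fdet m B)"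
proof -
  have Hsym: "M 1 i j = M 1 j i" if "i < m" "j < m" for i j
    using Dsym[OF that] by (simp add: M_def)
  obtain Q where Q: "fdet m Q \<noteq> 0 \<and>
      (\<forall>i<m. \<forall>j<m. i \<noteq> j \<longrightarrow> (\<Sum>k<m. \<Sum>l<m. Q k i * M 1 k l * Q l j) = 0)"
    using congruence_diagonal[of m "M 1", OF Hsym] ..
  note Q = Q[THEN conjunct1] Q[THEN conjunct2, rule_format]
  define tr where "tr X i j = (\<Sum>k<m. \<Sum>l<m. Q k i * X k l * Q l j)" for X :: "nat \<Rightarrow> nat \<Rightarrow> real" and i j
  define d where "d i = tr (M 1) i i" for i
  define B' where "B' = tr B"
  have H': "tr (M 1) i j = (if i = j then d i else 0)" if "i < m" "j < m" for i j
    using Q(2)[OF that] by (auto simp: tr_def d_def)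
  have trT: "tr (\<lambda>i j. B j i) i j = B' j i" for i j
    unfolding tr_def B'_def by (subst sum.swap) (simp add: mult_ac)
  have tr_lin: "tr (\<lambda>i j. X i j + a * Y i j) i j = tr X i j + a * tr Y i j" for X Y a i j
    unfolding tr_def by (simp add: distrib_left distrib_right sum.distrib sum_distrib_left mult_ac)
  have det_tr: "fdet m (tr X) = (fdet m Q)\<^sup>2 * fdet m X" for X
    unfolding tr_def using fdet_congruence by blast
  have tr_apply: "(\<Sum>j<m. tr X i j * q j) = (\<Sum>k<m. Q k i * (\<Sum>l<m. X k l * (\<Sum>j<m. Q l j * q j)))"
    for X q i
    unfolding tr_def sum_distrib_left sum_distrib_right
    by (subst sum.swap, rule sum.cong[OF refl], subst sum.swap) (simp add: mult_ac)
  \<comment> \<open>For s > 0 this is the transformed \<open>M (1 + s)\<close> with each row of a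
    kernel direction divided by s; the identity 1 / (1 + s) - 1 = - s / (1 + s) makes the quotient
    explicit. In this form it extends continuously to s = 0, where it is still nonsingular.\<close>
  define N where "N s i j = (if d i = 0 then B' i j - B' j i / (1 + s)
      else tr (M 1) i j + s * B' i j - s / (1 + s) * B' j i)" for s i j
  have trM: "fdet m (tr (M (1 + s))) = (\<Prod>i<m. if d i = 0 then s else 1) * fdet m (N s)" if "0 < s" for s
  proof -
    have "M (1 + s) i j = M 1 i j + s * B i j + (- (s / (1 + s))) * B j i" for i j
      using that by (simp add: M_def field_simps)
    then have "M (1 + s) = (\<lambda>i j. (M 1 i j + s * B i j) + (- (s / (1 + s))) * B j i)"
      by (intro ext)
    then have "tr (M (1 + s)) i j = tr (M 1) i j + s * B' i j - s / (1 + s) * tr (\<lambda>i j. B j i) i j" for i j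
      by (simp only: tr_lin B'_def)
    then have "tr (M (1 + s)) i j = (if d i = 0 then s else 1) * N s i j" if "i < m" "j < m" for i j
      using H'[OF that] \<open>0 < s\<close> by (auto simp: N_def trT field_simps)
    then have "fdet m (tr (M (1 + s))) = fdet m (\<lambda>i j. (if d i = 0 then s else 1) * N s i j)"
      by (intro fdet_cong) auto
    then show ?thesis by (simp only: fdet_scale_rows)
  qed
  have N0: "fdet m (N 0) \<noteq> 0"
    unfolding fdet_nonzero_iff
  proof (rule allI, rule impI)
    fix q assume q: "\<forall>i<m. (\<Sum>j<m. N 0 i j * q j) = 0"
    have q1: "d i * q i = 0" if "i < m" for i
    proof (cases "d i = 0")
      case False
      have "(\<Sum>j<m. N 0 i j * q j) = (\<Sum>j<m. (if i = j then d i else 0) * q j)"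
        by (rule sum.cong) (use False that in \<open>auto simp: N_def H'\<close>)
      also have "\<dots> = d i * q i" using that by (simp add: if_distrib[of "\<lambda>x. x * _"] cong: if_cong)
      finally show ?thesis using q that by simp
    qed simp
    have q2: "(\<Sum>j<m. (B' i j - B' j i) * q j) = 0" if "i < m" "d i = 0" for i
    proof -
      have "(\<Sum>j<m. N 0 i j * q j) = (\<Sum>j<m. (B' i j - B' j i) * q j)"
        by (rule sum.cong) (simp_all add: N_def that(2))
      then show ?thesis using q that(1) by simp
    qed
    \<comment> \<open>In the rows with \<open>d i\<close> nonzero, r is chosen so that its image
      under the diagonalised \<open>M 1\<close> cancels the skew part of q; in the kernel rows that
      part vanishes by \<open>q2\<close>. Transported by Q, the pair satisfies the equations in
      \<open>jordan\<close>.\<close>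
    define r where "r i = (if d i = 0 then 0 else - (\<Sum>j<m. (B' i j - B' j i) * q j) / d i)" for i
    let ?Q = "\<lambda>q l. \<Sum>j<m. Q l j * q j"
    have dg: "(\<Sum>j<m. tr (M 1) i j * p j) = d i * p i" if "i < m" for i p
    proof -
      have "(\<Sum>j<m. tr (M 1) i j * p j) = (\<Sum>j<m. (if i = j then d i else 0) * p j)"
        by (rule sum.cong) (use that in \<open>simp_all add: H'\<close>)
      then show ?thesis using that by (simp add: if_distrib[of "\<lambda>x. x * _"] cong: if_cong)
    qed
    have Qinj: "\<forall>k<m. v k = 0" if "\<And>i. i < m \<Longrightarrow> (\<Sum>k<m. Q k i * v k) = 0" for v
      by (rule fdet_kernel[of m "\<lambda>i k. Q k i"]) (use that Q(1) in \<open>simp_all add: fdet_transpose[of m Q]\<close>)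
    have 1: "\<forall>i<m. (\<Sum>j<m. M 1 i j * ?Q q j) = 0"
      by (rule Qinj) (use q1 dg tr_apply[of "M 1", symmetric] in simp)
    have 2: "\<forall>i<m. (\<Sum>j<m. M 1 i j * ?Q r j) + (\<Sum>j<m. (B i j - B j i) * ?Q q j) = 0"
    proof (rule Qinj)
      fix i assume i: "i < m"
      have "tr (\<lambda>i j. B i j - B j i) i j = B' i j - B' j i" for i j
      proof -
        have "tr (\<lambda>i j. B i j - B j i) i j = tr B i j - tr (\<lambda>i j. B j i) i j"
          using tr_lin[of B "-1" "\<lambda>i j. B j i" i j] by simp
        then show ?thesis by (simp only: trT) (simp only: B'_def)
      qed
      then have "(\<Sum>k<m. Q k i * (\<Sum>j<m. (B k j - B j k) * ?Q q j)) = (\<Sum>j<m. (B' i j - B' j i) * q j)"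
        using tr_apply[of "\<lambda>i j. B i j - B j i" i q, symmetric] by simp
      moreover have "(\<Sum>k<m. Q k i * (\<Sum>j<m. M 1 k j * ?Q r j)) = d i * r i"
        using tr_apply[of "M 1" i r, symmetric] dg[OF i] by simp
      moreover have "d i * r i + (\<Sum>j<m. (B' i j - B' j i) * q j) = 0"
        using q2[OF i] by (cases "d i = 0") (simp_all add: r_def)
      ultimately show "(\<Sum>k<m. Q k i * ((\<Sum>j<m. M 1 k j * ?Q r j) + (\<Sum>j<m. (B k j - B j k) * ?Q q j))) = 0"
        by (simp add: distrib_left sum.distrib)
    qed
    have "\<forall>i<m. ?Q q i = 0" by (rule jordan[OF 1 2])
    then show "\<forall>i<m. q i = 0" using fdet_kernel[OF Q(1)] by blast
  qed
  have Npos: "fdet m (N s) \<noteq> 0" if "0 < s" for s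
  proof -
    have "fdet m (tr (M (1 + s))) \<noteq> 0" unfolding det_tr using ker[of "1 + s"] that Q(1) by simp
    then show ?thesis unfolding trM[OF that] by simp
  qed
  have s1: "sgn (fdet m (N 1)) = sgn (fdet m (N 0))"
  proof (rule sgn_fdet_const[where S = "{0..1}" and M = N])
    show "continuous_on {0..1} (\<lambda>s. N s i j)" for i j
      unfolding N_def by (cases "d i = 0") (auto intro!: continuous_intros)
    show "fdet m (N s) \<noteq> 0" if "s \<in> {0..1}" for s
      using that N0 Npos[of s] by (cases "s = 0") auto
  qed auto
  have s2: "sgn (fdet m (N 1)) = sgn (fdet m (M 2))"
  proof -
    have "fdet m (tr (M 2)) = fdet m (N 1)" using trM[of 1] by (simp add: if_distrib cong: if_cong)
    then have "fdet m (N 1) = (fdet m Q)\<^sup>2 * fdet m (M 2)" by (simp only: det_tr)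
    then show ?thesis using Q(1) by (simp add: sgn_mult) (auto simp: sgn_if)
  qed
  \<comment> \<open>\<open>t * M (1 / t)\<close> is polynomial in t and equals B at t = 0, so
    infinity becomes the end point of a compact path.\<close>
  define L where "L t i j = t * D i j + B i j + t\<^sup>2 * B j i" for t i j
  have Lt: "fdet m (L t) = t ^ m * fdet m (M (1 / t))" if "0 < t" for t
  proof -
    have "L t i j = t * M (1 / t) i j" for i j
      using that by (simp add: L_def M_def field_simps power2_eq_square)
    then have "L t = (\<lambda>i j. t * M (1 / t) i j)" by (intro ext)
    then show ?thesis using fdet_scale_rows[of m "\<lambda>_. t" "M (1 / t)"] by simp
  qed
  have L0: "L 0 = B" by (auto simp: L_def fun_eq_iff)
  have s3: "sgn (fdet m (L (1/2))) = sgn (fdet m (L 0))"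
  proof (rule sgn_fdet_const[where S = "{0..1/2}" and M = L])
    show "continuous_on {0..1/2} (\<lambda>s. L s i j)" for i j
      unfolding L_def by (intro continuous_intros)
    show "fdet m (L t) \<noteq> 0" if "t \<in> {0..1/2}" for t
      using that B0 L0 Lt[of t] ker[of "1 / t"] by (cases "t = 0") auto
  qed auto
  \<comment> \<open>In the kernel rows the path leads from the skew block to the identity; the other
    rows stay diagonal. Pairing a null vector with its own rows kills the skew part and leaves
    \<tau> times its squared norm.\<close>
  define C where "C \<tau> i j = (if d i = 0 then \<tau> * (if i = j then 1 else 0) + (1 - \<tau>) * (B' i j - B' j i)
      else (if i = j then d i else 0))" for \<tau> i j
  have C0: "fdet m (C 0) = fdet m (N 0)" by (rule fdet_cong) (auto simp: C_def N_def H')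
  have s4: "sgn (fdet m (C 0)) = sgn (fdet m (C 1))"
  proof (rule sgn_fdet_const[where S = "{0..1}" and M = C])
    show "continuous_on {0..1} (\<lambda>s. C s i j)" for i j
      unfolding C_def by (cases "d i = 0") (auto intro!: continuous_intros)
    show "fdet m (C t) \<noteq> 0" if "t \<in> {0..1}" for t
    proof (cases "t = 0")
      case False
      then have t: "0 < t" using that by simp
      show ?thesis unfolding fdet_nonzero_iff
      proof (rule allI, rule impI)
        fix q assume q: "\<forall>i<m. (\<Sum>j<m. C t i j * q j) = 0"
        have dq: "(\<Sum>j<m. (if i = j then a else 0) * q j) = a * q i" if "i < m" for i a
          using that by (simp add: if_distrib[of "\<lambda>x. x * _"] cong: if_cong)
        have row: "q i * (t * q i + (1 - t) * (\<Sum>j<m. (B' i j - B' j i) * q j)) = 0" if "i < m" for i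
        proof (cases "d i = 0")
          case True
          have "(\<Sum>j<m. C t i j * q j) = t * (\<Sum>j<m. (if i = j then 1 else 0) * q j)
              + (1 - t) * (\<Sum>j<m. (B' i j - B' j i) * q j)"
            unfolding sum_distrib_left sum.distrib[symmetric]
            by (rule sum.cong) (simp_all add: C_def True algebra_simps)
          then show ?thesis using q that dq[of i 1] by simp
        next
          case False
          then have "(\<Sum>j<m. C t i j * q j) = (\<Sum>j<m. (if i = j then d i else 0) * q j)"
            by (intro sum.cong) (simp_all add: C_def)
          then have "d i * q i = 0" using q that dq[of i "d i"] by simp
          then show ?thesis using False by simp
        qed
        have "(\<Sum>i<m. q i * (t * q i + (1 - t) * (\<Sum>j<m. (B' i j - B' j i) * q j)))
            = t * (\<Sum>i<m. (q i)\<^sup>2) + (1 - t) * (\<Sum>i<m. q i * (\<Sum>j<m. (B' i j - B' j i) * q j))"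
          (is "?l = ?r")
        proof -
          have "?l = (\<Sum>i<m. t * (q i)\<^sup>2 + (1 - t) * (q i * (\<Sum>j<m. (B' i j - B' j i) * q j)))"
            by (rule sum.cong) (simp_all add: power2_eq_square distrib_left mult.left_commute)
          also have "\<dots> = ?r" by (simp only: sum.distrib sum_distrib_left[symmetric])
          finally show ?thesis .
        qed
        then have "(\<Sum>i<m. (q i)\<^sup>2) = 0" using row t by (simp add: skew_form_zero)
        then show "\<forall>i<m. q i = 0" by (simp add: sum_nonneg_eq_0_iff)
      qed
    qed (use C0 N0 in simp)
  qed auto
  have "fdet m (C 1) = fdet m (\<lambda>i j. if i = j then (if d i = 0 then 1 else d i) else 0)"
    by (rule fdet_cong) (simp add: C_def)
  then have s5: "sgn (fdet m (C 1)) = (-1) ^ card {i \<in> {..<m}. d i < 0}"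
    by (simp only: fdet_diag sgn_prod_card_neg[OF finite_lessThan])
  have "sgn (fdet m (M 2)) = sgn (fdet m (L (1/2)))" using Lt[of "1/2"] by (simp add: sgn_mult)
  then have "(-1) ^ card {i \<in> {..<m}. d i < 0} = sgn (fdet m B)"
    using s1 s2 s3 s4 s5 C0 L0 by simp
  then show thesis using that[of Q d] Q(1) H' by (simp add: tr_def)
qed

text \<open>On a subspace where I is negative, the coordinates \<open>\<phi> i\<close> with
  \<open>d i < 0\<close> determine the vector: if they all vanish, \<open>lower\<close> bounds I
  from below by a nonnegative sum. Hence the dimension is at most the number of negative entries,
  and the span of the corresponding \<open>b i\<close> attains it.\<close>

lemma morse_index_eq_card_neg:
  fixes I :: "'v::real_vector \<Rightarrow> real" and \<phi> :: "nat \<Rightarrow> 'v \<Rightarrow> real"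
  assumes lin: "\<And>i. i < m \<Longrightarrow> linear (\<phi> i)"
    and lower: "\<And>u. u \<in> E \<Longrightarrow> (\<Sum>i<m. d i * (\<phi> i u)\<^sup>2) \<le> I u"
    and bE: "\<And>c. (\<Sum>i<m. c i *\<^sub>R b i) \<in> E"
    and Ib: "\<And>c. I (\<Sum>i<m. c i *\<^sub>R b i) = (\<Sum>i<m. d i * (c i)\<^sup>2)"
    and \<phi>b: "\<And>i j. i < m \<Longrightarrow> j < m \<Longrightarrow> \<phi> i (b j) = (if i = j then 1 else 0)"
  shows "(GREATEST k. \<exists>V. subspace V \<and> V \<subseteq> E \<and> dim V = k \<and> (\<forall>u\<in>V. u \<noteq> 0 \<longrightarrow> I u < 0))
    = card {i \<in> {..<m}. d i < 0}"
proof (rule Greatest_equality)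
  let ?J = "{i \<in> {..<m}. d i < 0}"
  have \<phi>sum: "\<phi> i (\<Sum>j\<in>J. c j *\<^sub>R b j) = (if i \<in> J then c i else 0)"
    if "i < m" "J \<subseteq> {..<m}" for i J c
  proof -
    have "finite J" using that(2) finite_subset by blast
    have "\<phi> i (\<Sum>j\<in>J. c j *\<^sub>R b j) = (\<Sum>j\<in>J. c j *\<^sub>R \<phi> i (b j))"
      by (simp add: linear_sum[OF lin[OF that(1)]] linear_scale[OF lin[OF that(1)]])
    also have "\<dots> = (\<Sum>j\<in>J. if i = j then c j else 0)"
      using that by (intro sum.cong) (auto simp: \<phi>b)
    finally show ?thesis using \<open>finite J\<close> by simp
  qed
  have inj: "inj_on b ?J"
  proof (rule inj_onI, rule ccontr)
    fix i j assume "i \<in> ?J" "j \<in> ?J" "b i = b j" "i \<noteq> j"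
    then show False using \<phi>b[of i i] \<phi>b[of i j] by auto
  qed
  have ind: "independent (b ` ?J)"
  proof (rule independent_if_scalars_zero)
    fix f x assume s: "(\<Sum>x\<in>b ` ?J. f x *\<^sub>R x) = 0" and "x \<in> b ` ?J"
    then obtain i where i: "i \<in> ?J" "x = b i" by blast
    have s': "(\<Sum>j\<in>?J. f (b j) *\<^sub>R b j) = 0" using s by (simp only: sum.reindex[OF inj] o_def)
    have "f (b i) = \<phi> i (\<Sum>j\<in>?J. f (b j) *\<^sub>R b j)" using i by (subst \<phi>sum) auto
    also have "\<dots> = 0" unfolding s' using i lin[of i] by (simp add: linear_0)
    finally show "f x = 0" using i by simp
  qed simp
  have neg: "u \<in> E \<and> (u \<noteq> 0 \<longrightarrow> I u < 0)" if "u \<in> span (b ` ?J)" for u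
  proof -
    obtain f where "u = (\<Sum>x\<in>b ` ?J. f x *\<^sub>R x)"
      using \<open>u \<in> span (b ` ?J)\<close> by (subst (asm) span_finite) auto
    then have u: "u = (\<Sum>j\<in>?J. f (b j) *\<^sub>R b j)" by (simp only: sum.reindex[OF inj] o_def)
    define c where "c j = (if j \<in> ?J then f (b j) else 0)" for j
    have u': "u = (\<Sum>i<m. c i *\<^sub>R b i)"
      unfolding u by (rule sum.mono_neutral_cong_left) (auto simp: c_def)
    have "I u < 0" if "u \<noteq> 0"
    proof -
      obtain i where i: "i < m" "c i \<noteq> 0"
      proof (rule ccontr)
        assume "\<not> thesis"
        then have "c i = 0" if "i < m" for i using \<open>\<And>i. i < m \<Longrightarrow> c i \<noteq> 0 \<Longrightarrow> thesis\<close> that by blast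
        then show False using \<open>u \<noteq> 0\<close> u' by simp
      qed
      have "(\<Sum>i<m. d i * (c i)\<^sup>2) < (\<Sum>i<m. 0)"
      proof (rule sum_strict_mono_ex1)
        show "\<forall>i\<in>{..<m}. d i * (c i)\<^sup>2 \<le> 0" by (auto simp: c_def mult_nonpos_nonneg)
        show "\<exists>i\<in>{..<m}. d i * (c i)\<^sup>2 < 0"
          using i by (intro bexI[of _ i]) (auto simp: c_def mult_neg_pos split: if_splits)
      qed simp
      then show ?thesis by (simp add: u' Ib)
    qed
    then show ?thesis using bE[of c] u' by simp
  qed
  have dim: "dim (span (b ` ?J)) = card ?J"
    by (simp only: dim_span_eq_card_independent[OF ind] card_image[OF inj])
  show "\<exists>V. subspace V \<and> V \<subseteq> E \<and> dim V = card ?J \<and> (\<forall>u\<in>V. u \<noteq> 0 \<longrightarrow> I u < 0)"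
    by (rule exI[of _ "span (b ` ?J)"], intro conjI ballI dim subspace_span) (use neg in blast)+
  fix k assume "\<exists>V. subspace V \<and> V \<subseteq> E \<and> dim V = k \<and> (\<forall>u\<in>V. u \<noteq> 0 \<longrightarrow> I u < 0)"
  then obtain V where V: "subspace V" "V \<subseteq> E" "dim V = k" "\<forall>u\<in>V. u \<noteq> 0 \<longrightarrow> I u < 0" by blast
  \<comment> \<open>The coordinates outside the negative directions are set to zero, so that the
    image lies in a span of as many unit vectors as there are negative entries.\<close>
  define f where "f u = (\<lambda>i. if i \<in> ?J then \<phi> i u else 0)" for u
  have linf: "linear f"
    by (rule linearI)
      (auto simp: f_def fun_eq_iff scaleR_fun_def linear_add[OF lin] linear_scale[OF lin])
  obtain Bs where Bs: "Bs \<subseteq> V" "independent Bs" "V \<subseteq> span Bs" "card Bs = dim V"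
    using basis_exists[of V] by metis
  have span: "span Bs = V" using Bs V(1) by (simp add: span_subspace)
  have "inj_on f V"
  proof (subst linear_inj_on_iff_eq_0[OF linf V(1)], intro ballI impI, rule ccontr)
    fix u assume u: "u \<in> V" "f u = 0" "u \<noteq> 0"
    have "0 \<le> d i * (\<phi> i u)\<^sup>2" if "i < m" for i
      using that fun_cong[OF u(2), of i] by (cases "d i < 0") (auto simp: f_def)
    then have "0 \<le> (\<Sum>i<m. d i * (\<phi> i u)\<^sup>2)" by (intro sum_nonneg) auto
    then have "0 \<le> I u" using lower[of u] u(1) V(2) by force
    then show False using V(4) u by force
  qed
  then have 1: "independent (f ` Bs)" and 2: "card (f ` Bs) = card Bs"
    using linear_independent_injective_image[OF linf Bs(2)] span Bs(1)
    by (auto intro: card_image inj_on_subset)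
  have 3: "f ` Bs \<subseteq> span (unit_fun ` ?J)"
  proof safe
    fix x
    have "f x = (\<Sum>i\<in>?J. \<phi> i x *\<^sub>R unit_fun i)"
      by (auto simp: f_def fun_eq_iff sum_fun_apply scaleR_fun_def unit_fun_def if_distrib cong: if_cong)
    also have "\<dots> \<in> span (unit_fun ` ?J)" by (intro span_sum span_scale span_base) auto
    finally show "f x \<in> span (unit_fun ` ?J)" .
  qed
  have "card (f ` Bs) \<le> card (unit_fun ` ?J)" using independent_span_bound[OF _ 1 3] by auto
  also have "\<dots> \<le> card ?J" by (rule card_image_le) simp
  finally show "k \<le> card ?J" using 2 Bs(4) V(3) by simp
qed

section \<open>Mean value estimates with one-sided derivatives at the end points\<close>

lemma deriv_within_mvt:
  fixes f :: "real \<Rightarrow> real"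
  assumes "a \<le> b" and "\<And>x. x \<in> {a..b} \<Longrightarrow> (f has_real_derivative f' x) (at x within {a..b})"
  obtains x where "x \<in> {a..b}" "f b - f a = (b - a) * f' x"
proof (cases "a = b")
  case False
  then have "a < b" using assms(1) by simp
  then obtain x where "x \<in> {a<..<b}" "f b - f a = f' x * (b - a)"
    using mvt_simple[of a b f "\<lambda>x h. f' x * h"] assms(2)
    by (auto simp: has_field_derivative_def)
  then show thesis by (intro that[of x]) auto
qed (use that in force)

lemma deriv_within_nonneg_mono:
  fixes f :: "real \<Rightarrow> real"
  assumes "a \<le> b" and "\<And>x. x \<in> {a..b} \<Longrightarrow> (f has_real_derivative f' x) (at x within {a..b})"
    and "\<And>x. x \<in> {a..b} \<Longrightarrow> 0 \<le> f' x"
  shows "f a \<le> f b"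
proof -
  obtain x where "x \<in> {a..b}" "f b - f a = (b - a) * f' x"
    using deriv_within_mvt[OF assms(1,2)] by blast
  then show ?thesis using assms(1,3) by (metis diff_ge_0_iff_ge mult_nonneg_nonneg)
qed

lemma deriv_within_bound:
  fixes f :: "real \<Rightarrow> real"
  assumes "a \<le> b" and "\<And>x. x \<in> {a..b} \<Longrightarrow> (f has_real_derivative f' x) (at x within {a..b})"
    and "\<And>x. x \<in> {a..b} \<Longrightarrow> \<bar>f' x\<bar> \<le> C"
  shows "\<bar>f b - f a\<bar> \<le> (b - a) * C"
proof -
  obtain x where "x \<in> {a..b}" "f b - f a = (b - a) * f' x"
    using deriv_within_mvt[OF assms(1,2)] by blast
  then show ?thesis using assms(1,3) by (simp add: abs_mult mult_left_mono)
qed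

section \<open>Linear differential equations\<close>

text \<open>Picard iteration written as a series. \<open>X k\<close> is the k-th increment, bounded
  by M (K t)^k / k!, so the series and its termwise derivative converge on the whole interval at
  once.\<close>

lemma linear_ode_exists:
  fixes L :: "real \<Rightarrow> nat \<Rightarrow> nat \<Rightarrow> real"
  assumes T: "0 \<le> T" and cont: "\<And>i j. i < d \<Longrightarrow> j < d \<Longrightarrow> continuous_on {0..T} (\<lambda>t. L t i j)"
  shows "\<exists>x. \<forall>i<d. x 0 i = x0 i \<and> (\<forall>t\<in>{0..T}.
    ((\<lambda>s. x s i) has_real_derivative (\<Sum>j<d. L t i j * x t j)) (at t within {0..T}))"
proof -
  define X where "X = rec_nat (\<lambda>t. x0) (\<lambda>k Y t i. integral {0..t} (\<lambda>s. \<Sum>j<d. L s i j * Y s j))"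
  have X0: "X 0 t i = x0 i" and XS: "X (Suc k) t i = integral {0..t} (\<lambda>s. \<Sum>j<d. L s i j * X k s j)"
    for k t i by (simp_all add: X_def)
  have deriv: "((\<lambda>t. X (Suc k) t i) has_real_derivative (\<Sum>j<d. L t i j * X k t j)) (at t within {0..T})"
    if "\<And>i. i < d \<Longrightarrow> continuous_on {0..T} (\<lambda>t. X k t i)" "i < d" "t \<in> {0..T}" for k i t
    unfolding XS by (rule integral_has_real_derivative) (use that cont in \<open>auto intro!: continuous_intros\<close>)
  have Xcont: "continuous_on {0..T} (\<lambda>t. X k t i)" if "i < d" for k i
    using that
  proof (induction k arbitrary: i)
    case (Suc k)
    show ?case by (rule DERIV_continuous_on) (rule deriv[OF Suc.IH Suc.prems])
  qed (simp add: X0)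
  note deriv = deriv[OF Xcont]
  have "\<exists>C. \<forall>t\<in>{0..T}. \<forall>i<d. \<forall>j<d. \<bar>L t i j\<bar> \<le> C"
  proof -
    have "\<exists>C. \<forall>t\<in>{0..T}. \<bar>L t i j\<bar> \<le> C" if "i < d" "j < d" for i j
      using compact_continuous_image[OF cont[OF that] compact_Icc] by (force dest!: compact_imp_bounded simp: bounded_iff)
    then obtain c where c: "\<And>i j t. i < d \<Longrightarrow> j < d \<Longrightarrow> t \<in> {0..T} \<Longrightarrow> \<bar>L t i j\<bar> \<le> c i j" by metis
    have "\<bar>L t i j\<bar> \<le> (\<Sum>i<d. \<Sum>j<d. \<bar>c i j\<bar>)" if "i < d" "j < d" "t \<in> {0..T}" for i j t
    proof -
      have "\<bar>L t i j\<bar> \<le> \<bar>c i j\<bar>" using c[OF that] by simp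
      also have "\<dots> \<le> (\<Sum>j<d. \<bar>c i j\<bar>)" using that by (intro member_le_sum) auto
      also have "\<dots> \<le> (\<Sum>i<d. \<Sum>j<d. \<bar>c i j\<bar>)"
        using that by (intro member_le_sum[of i _ "\<lambda>i. \<Sum>j<d. \<bar>c i j\<bar>"] sum_nonneg) auto
      finally show ?thesis .
    qed
    then show ?thesis by blast
  qed
  then obtain C where C: "\<And>t i j. t \<in> {0..T} \<Longrightarrow> i < d \<Longrightarrow> j < d \<Longrightarrow> \<bar>L t i j\<bar> \<le> C" by blast
  \<comment> \<open>A bound for the row sums of |L|, hence for the action of L in the maximum
    norm.\<close>
  define K where "K = d * \<bar>C\<bar>"
  define M where "M = (\<Sum>i<d. \<bar>x0 i\<bar>)"
  have K: "0 \<le> K" and M: "0 \<le> M" by (auto simp: K_def M_def sum_nonneg)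
  have sumb: "\<bar>\<Sum>j<d. L t i j * y j\<bar> \<le> K * B"
    if "t \<in> {0..T}" "i < d" "\<And>j. j < d \<Longrightarrow> \<bar>y j\<bar> \<le> B" for t i B and y :: "nat \<Rightarrow> real"
  proof -
    have "\<bar>\<Sum>j<d. L t i j * y j\<bar> \<le> (\<Sum>j<d. \<bar>C\<bar> * B)"
    proof (rule order_trans[OF sum_abs sum_mono])
      fix j assume "j \<in> {..<d}"
      then have "\<bar>L t i j\<bar> \<le> \<bar>C\<bar>" "\<bar>y j\<bar> \<le> B" using C[OF that(1,2), of j] that(3) by auto
      then show "\<bar>L t i j * y j\<bar> \<le> \<bar>C\<bar> * B" by (simp add: abs_mult mult_mono)
    qed
    then show ?thesis by (simp add: K_def)
  qed
  have bound: "\<bar>X k t i\<bar> \<le> M * (K * t) ^ k / fact k" if "i < d" "t \<in> {0..T}" for k t i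
    using that
  proof (induction k arbitrary: i t)
    case 0
    have "\<bar>x0 i\<bar> \<le> M" unfolding M_def using 0 by (intro member_le_sum) auto
    then show ?case by (simp add: X0)
  next
    case (Suc k)
    let ?g = "\<lambda>s. M * (K * s) ^ Suc k / fact (Suc k)" and ?g' = "\<lambda>s. K * (M * (K * s) ^ k / fact k)"
    have g: "(?g has_real_derivative ?g' s) (at s within {0..t})" for s
      by (rule derivative_eq_intros refl | simp)+
    have X: "((\<lambda>t. X (Suc k) t i) has_real_derivative (\<Sum>j<d. L s i j * X k s j)) (at s within {0..t})"
      if "s \<in> {0..t}" for s
      using deriv[of i s k] that Suc.prems by (auto intro: has_field_derivative_subset)
    have b: "\<bar>\<Sum>j<d. L s i j * X k s j\<bar> \<le> ?g' s" if "s \<in> {0..t}" for s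
      using that Suc.prems by (intro sumb Suc.IH) auto
    \<comment> \<open>The bound on the derivative is integrated by monotonicity: g - X and g + X are
      both nondecreasing and both vanish at 0.\<close>
    have "?g 0 - X (Suc k) 0 i \<le> ?g t - X (Suc k) t i"
    proof (rule deriv_within_nonneg_mono[where f = "\<lambda>s. ?g s - X (Suc k) s i"])
      fix s assume s: "s \<in> {0..t}"
      show "((\<lambda>s. ?g s - X (Suc k) s i) has_real_derivative ?g' s - (\<Sum>j<d. L s i j * X k s j)) (at s within {0..t})"
        by (rule DERIV_diff[OF g X[OF s]])
      show "0 \<le> ?g' s - (\<Sum>j<d. L s i j * X k s j)" using b[OF s] by linarith
    qed (use Suc.prems in simp)
    moreover have "?g 0 + X (Suc k) 0 i \<le> ?g t + X (Suc k) t i"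
    proof (rule deriv_within_nonneg_mono[where f = "\<lambda>s. ?g s + X (Suc k) s i"])
      fix s assume s: "s \<in> {0..t}"
      show "((\<lambda>s. ?g s + X (Suc k) s i) has_real_derivative ?g' s + (\<Sum>j<d. L s i j * X k s j)) (at s within {0..t})"
        by (rule DERIV_add[OF g X[OF s]])
      show "0 \<le> ?g' s + (\<Sum>j<d. L s i j * X k s j)" using b[OF s] by linarith
    qed (use Suc.prems in simp)
    moreover have "?g 0 = 0" "X (Suc k) 0 i = 0" by (simp_all add: XS)
    ultimately show ?case by linarith
  qed
  have bound': "\<bar>X k t i\<bar> \<le> M * ((K * T) ^ k / fact k)" if "i < d" "t \<in> {0..T}" for k t i
  proof -
    have "M * (K * t) ^ k / fact k \<le> M * ((K * T) ^ k / fact k)"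
      using that K M by (auto intro!: divide_right_mono mult_left_mono power_mono)
    then show ?thesis using bound[OF that, of k] by linarith
  qed
  have se: "summable (\<lambda>k. (K * T) ^ k / fact k)"
    using summable_exp[of "K * T"] by (simp add: field_simps)
  have sX: "summable (\<lambda>k. X k t i)" if "i < d" "t \<in> {0..T}" for t i
    by (rule summable_comparison_test'[OF summable_mult[OF se, of M]]) (use bound'[OF that] in auto)
  define x where "x t i = (\<Sum>k. X k t i)" for t i
  \<comment> \<open>The derivative of the k-th increment. The zeroth increment is constant and every
    later one differentiates to L applied to its predecessor, so after a shift of the index the
    derivatives sum to L x.\<close>
  define f' where "f' k i t = (case k of 0 \<Rightarrow> 0 | Suc k \<Rightarrow> (\<Sum>j<d. L t i j * X k t j))" for k i t
  have x_init: "x 0 i = x0 i" for i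
  proof -
    have "X k 0 i = (if k = 0 then x0 i else 0)" for k by (cases k) (simp_all add: X0 XS)
    then show ?thesis using suminf_finite[of "{0}" "\<lambda>k. X k 0 i"] by (simp add: x_def)
  qed
  have f'sums: "(\<lambda>k. f' k i t) sums (\<Sum>j<d. L t i j * x t j)" if t: "t \<in> {0..T}" and i: "i < d" for t i
  proof -
    have "(\<lambda>k. \<Sum>j<d. L t i j * X k t j) sums (\<Sum>j<d. L t i j * x t j)"
      unfolding x_def using t by (intro sums_sum sums_mult summable_sums sX) auto
    then have "(\<lambda>k. f' (Suc k) i t) sums (\<Sum>j<d. L t i j * x t j)" by (simp add: f'_def)
    then show ?thesis by (subst (asm) sums_Suc_iff) (simp add: f'_def)
  qed
  define Bd where "Bd k = (case k of 0 \<Rightarrow> 0 | Suc k \<Rightarrow> K * (M * ((K * T) ^ k / fact k)))" for k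
  have f'bound: "norm (f' k i t) \<le> Bd k" if "t \<in> {0..T}" "i < d" for k t i
  proof (cases k)
    case (Suc j)
    have "\<bar>\<Sum>l<d. L t i l * X j t l\<bar> \<le> K * (M * ((K * T) ^ j / fact j))"
      by (rule sumb[OF that bound'[OF _ that(1)]])
    then show ?thesis by (simp add: f'_def Suc Bd_def)
  qed (simp add: f'_def Bd_def)
  have "summable (\<lambda>k. Bd (Suc k))" unfolding Bd_def nat.case by (intro summable_mult se)
  then have sB: "summable Bd" by (subst (asm) summable_Suc_iff)
  have x_deriv: "((\<lambda>s. x s i) has_real_derivative (\<Sum>j<d. L t i j * x t j)) (at t within {0..T})"
    if i: "i < d" and t: "t \<in> {0..T}" for i t
  proof -
    have A: "uniform_limit {0..T} (\<lambda>n t. \<Sum>k<n. f' k i t) (\<lambda>t. \<Sum>k. f' k i t) sequentially"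
      by (rule Weierstrass_m_test[OF f'bound[OF _ i] sB])
    have B: "(\<Sum>k. f' k i t) = (\<Sum>j<d. L t i j * x t j)" if "t \<in> {0..T}" for t
      using f'sums[OF that i] by (simp add: sums_iff)
    have lim: "uniform_limit {0..T} (\<lambda>n t. \<Sum>k<n. f' k i t) (\<lambda>t. \<Sum>j<d. L t i j * x t j) sequentially"
      by (rule iffD1[OF uniform_limit_cong' A]) (use B in auto)
    have fd: "((\<lambda>t. X k t i) has_real_derivative f' k i t) (at t within {0..T})" if "t \<in> {0..T}" for k t
      using deriv[OF _ i that] i by (cases k) (simp_all add: f'_def X0)
    have 0: "0 \<in> {0..T}" using T by simp
    have "\<exists>y. \<forall>t\<in>{0..T}. (\<lambda>k. X k t i) sums y t \<and>
        (y has_real_derivative (\<Sum>j<d. L t i j * x t j)) (at t within {0..T})"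
      by (rule has_field_derivative_series[OF _ fd lim 0 sX[OF i 0]]) simp_all
    then obtain y where y: "\<forall>t\<in>{0..T}. (\<lambda>k. X k t i) sums y t \<and>
        (y has_real_derivative (\<Sum>j<d. L t i j * x t j)) (at t within {0..T})" ..
    then have xy: "x t i = y t" if "t \<in> {0..T}" for t using that by (auto simp: x_def sums_iff)
    show ?thesis
      by (rule has_field_derivative_transform_within[where d = 1 and f = y]) (use y t xy in auto)
  qed
  show ?thesis using x_init x_deriv by blast
qed

text \<open>Gronwall for the squared norm \<phi>: its product with exp (- K t) does not increase,
  which covers the times after s, and its product with exp (K t) does not decrease, which covers the
  times before s. The zero may sit at any time, since solutions will be compared at interior
  nodes.\<close>

lemma linear_ode_unique:
  fixes L :: "real \<Rightarrow> nat \<Rightarrow> nat \<Rightarrow> real"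
  assumes cont: "\<And>i j. i < d \<Longrightarrow> j < d \<Longrightarrow> continuous_on {0..T} (\<lambda>t. L t i j)"
    and x: "\<And>i t. i < d \<Longrightarrow> t \<in> {0..T} \<Longrightarrow>
      ((\<lambda>s. x s i) has_real_derivative (\<Sum>j<d. L t i j * x t j)) (at t within {0..T})"
    and s: "s \<in> {0..T}" "\<And>i. i < d \<Longrightarrow> x s i = 0" and t: "t \<in> {0..T}" and i: "i < d"
  shows "x t i = 0"
proof -
  have "\<exists>C. \<forall>t\<in>{0..T}. \<forall>i<d. \<forall>j<d. \<bar>L t i j\<bar> \<le> C"
  proof -
    have "\<exists>C. \<forall>t\<in>{0..T}. \<bar>L t i j\<bar> \<le> C" if "i < d" "j < d" for i j
      using compact_continuous_image[OF cont[OF that] compact_Icc] by (force dest!: compact_imp_bounded simp: bounded_iff)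
    then obtain c where c: "\<And>i j t. i < d \<Longrightarrow> j < d \<Longrightarrow> t \<in> {0..T} \<Longrightarrow> \<bar>L t i j\<bar> \<le> c i j" by metis
    have "\<bar>L t i j\<bar> \<le> (\<Sum>i<d. \<Sum>j<d. \<bar>c i j\<bar>)" if "i < d" "j < d" "t \<in> {0..T}" for i j t
    proof -
      have "\<bar>L t i j\<bar> \<le> \<bar>c i j\<bar>" using c[OF that] by simp
      also have "\<dots> \<le> (\<Sum>j<d. \<bar>c i j\<bar>)" using that by (intro member_le_sum) auto
      also have "\<dots> \<le> (\<Sum>i<d. \<Sum>j<d. \<bar>c i j\<bar>)"
        using that by (intro member_le_sum[of i _ "\<lambda>i. \<Sum>j<d. \<bar>c i j\<bar>"] sum_nonneg) auto
      finally show ?thesis .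
    qed
    then show ?thesis by blast
  qed
  then obtain C where C: "\<And>t i j. t \<in> {0..T} \<Longrightarrow> i < d \<Longrightarrow> j < d \<Longrightarrow> \<bar>L t i j\<bar> \<le> C" by blast
  have C0: "0 \<le> C" using C[OF t i i] by linarith
  define \<phi> where "\<phi> t = (\<Sum>i<d. (x t i)\<^sup>2)" for t
  define \<phi>' where "\<phi>' t = (\<Sum>i<d. 2 * x t i * (\<Sum>j<d. L t i j * x t j))" for t
  \<comment> \<open>From 2 |x i| |x j| being at most the sum of the two squares, summed over both
    indices.\<close>
  define K where "K = 2 * C * d"
  have \<phi>d: "(\<phi> has_real_derivative \<phi>' t) (at t within {0..T})" if "t \<in> {0..T}" for t
    unfolding \<phi>_def[abs_def] \<phi>'_def
    by (rule DERIV_sum) (auto intro!: derivative_eq_intros x that)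
  have \<phi>'b: "\<bar>\<phi>' t\<bar> \<le> K * \<phi> t" if t: "t \<in> {0..T}" for t
  proof -
    have "\<bar>\<phi>' t\<bar> = \<bar>\<Sum>i<d. \<Sum>j<d. 2 * x t i * (L t i j * x t j)\<bar>"
      by (simp add: \<phi>'_def sum_distrib_left)
    also have "\<dots> \<le> (\<Sum>i<d. \<Sum>j<d. C * ((x t i)\<^sup>2 + (x t j)\<^sup>2))"
    proof (rule order_trans[OF sum_abs sum_mono], rule order_trans[OF sum_abs sum_mono])
      fix i j assume ij: "i \<in> {..<d}" "j \<in> {..<d}"
      have "2 * (\<bar>x t i\<bar> * \<bar>x t j\<bar>) \<le> (x t i)\<^sup>2 + (x t j)\<^sup>2"
        using sum_squares_bound[of "\<bar>x t i\<bar>" "\<bar>x t j\<bar>"] by simp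
      then have "\<bar>L t i j\<bar> * (2 * (\<bar>x t i\<bar> * \<bar>x t j\<bar>)) \<le> C * ((x t i)\<^sup>2 + (x t j)\<^sup>2)"
        using C[OF t] ij C0 by (intro mult_mono) auto
      then show "\<bar>2 * x t i * (L t i j * x t j)\<bar> \<le> C * ((x t i)\<^sup>2 + (x t j)\<^sup>2)"
        by (simp add: abs_mult mult_ac)
    qed
    also have "\<dots> = K * \<phi> t"
      by (simp add: K_def \<phi>_def distrib_left sum.distrib sum_distrib_left[symmetric])
    finally show ?thesis .
  qed
  have e: "((\<lambda>t. \<phi> t * exp (c * t)) has_real_derivative (\<phi>' t + c * \<phi> t) * exp (c * t)) (at t within S)"
    if "t \<in> {0..T}" "S \<subseteq> {0..T}" for t c S
    using has_field_derivative_subset[OF \<phi>d[OF that(1)] that(2)]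
    by (auto intro!: derivative_eq_intros simp: algebra_simps)
  have "\<phi> s = 0" using s by (simp add: \<phi>_def)
  have "\<phi> t \<le> 0"
  proof (cases "s \<le> t")
    case True
    have "- (\<phi> s * exp (- K * s)) \<le> - (\<phi> t * exp (- K * t))"
    proof (rule deriv_within_nonneg_mono[OF True, where f' = "\<lambda>r. - ((\<phi>' r + - K * \<phi> r) * exp (- K * r))"])
      fix r assume "r \<in> {s..t}"
      then have r: "r \<in> {0..T}" "{s..t} \<subseteq> {0..T}" using s t by auto
      show "((\<lambda>r. - (\<phi> r * exp (- K * r))) has_real_derivative - ((\<phi>' r + - K * \<phi> r) * exp (- K * r))) (at r within {s..t})"
        by (rule DERIV_minus[OF e[OF r]])
      have "\<phi>' r + - K * \<phi> r \<le> 0" using \<phi>'b[OF r(1)] by linarith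
      then show "0 \<le> - ((\<phi>' r + - K * \<phi> r) * exp (- K * r))" by (simp add: mult_nonpos_nonneg)
    qed
    then have "\<phi> t * exp (- K * t) \<le> 0" using \<open>\<phi> s = 0\<close> by simp
    then show ?thesis by (simp add: mult_le_0_iff)
  next
    case False
    then have "t \<le> s" by simp
    have "\<phi> t * exp (K * t) \<le> \<phi> s * exp (K * s)"
    proof (rule deriv_within_nonneg_mono[OF \<open>t \<le> s\<close>, where f' = "\<lambda>r. (\<phi>' r + K * \<phi> r) * exp (K * r)"])
      fix r assume "r \<in> {t..s}"
      then have r: "r \<in> {0..T}" "{t..s} \<subseteq> {0..T}" using s t by auto
      show "((\<lambda>r. \<phi> r * exp (K * r)) has_real_derivative (\<phi>' r + K * \<phi> r) * exp (K * r)) (at r within {t..s})"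
        by (rule e[OF r])
      have "0 \<le> \<phi>' r + K * \<phi> r" using \<phi>'b[OF r(1)] by linarith
      then show "0 \<le> (\<phi>' r + K * \<phi> r) * exp (K * r)" by simp
    qed
    then have "\<phi> t * exp (K * t) \<le> 0" using \<open>\<phi> s = 0\<close> by simp
    then show ?thesis by (simp add: mult_le_0_iff)
  qed
  moreover have "(x t i)\<^sup>2 \<le> \<phi> t" unfolding \<phi>_def using i by (intro member_le_sum) auto
  ultimately show ?thesis by (metis order_trans power2_less_eq_zero_iff)
qed

section \<open>The Jacobi equation as a first-order system\<close>

definition jacobi_sol ::
  "real \<Rightarrow> nat \<Rightarrow> (real \<Rightarrow> nat \<Rightarrow> nat \<Rightarrow> real) \<Rightarrow> (real \<Rightarrow> nat \<Rightarrow> real) \<Rightarrow> (real \<Rightarrow> nat \<Rightarrow> real) \<Rightarrow> bool" where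
  "jacobi_sol T n R u v \<longleftrightarrow> (\<forall>i<n. \<forall>t\<in>{0..T}.
     ((\<lambda>s. u s i) has_real_derivative v t i) (at t within {0..T}) \<and>
     ((\<lambda>s. v s i) has_real_derivative (\<Sum>j<n. R t i j * u t j)) (at t within {0..T}))"

lemma sum_lessThan_add: "(\<Sum>j<n + k. f j) = (\<Sum>j<n. f j) + (\<Sum>j<k. f (n + j))" for f :: "nat \<Rightarrow> real"
  by (induction k) (simp_all add: add.assoc)

text \<open>The block matrix with rows (0, 1) and (R, 0): positions sit below n, velocities from n
  on.\<close>

definition first_order :: "nat \<Rightarrow> (real \<Rightarrow> nat \<Rightarrow> nat \<Rightarrow> real) \<Rightarrow> real \<Rightarrow> nat \<Rightarrow> nat \<Rightarrow> real" where
  "first_order n R t i j = (if i < n then (if j = n + i then 1 else 0) else (if j < n then R t (i - n) j else 0))"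

lemma first_order_apply:
  "i < n \<Longrightarrow> (\<Sum>j<n + n. first_order n R t i j * x j) = x (n + i)"
  "(\<Sum>j<n + n. first_order n R t (n + i) j * x j) = (\<Sum>j<n. R t i j * x j)"
  unfolding sum_lessThan_add
  by (simp_all add: first_order_def if_distrib[of "\<lambda>a. a * _"] cong: if_cong)

context
  fixes T :: real and n :: nat and R :: "real \<Rightarrow> nat \<Rightarrow> nat \<Rightarrow> real"
  assumes T: "0 \<le> T" and Rcont: "\<And>i j. i < n \<Longrightarrow> j < n \<Longrightarrow> continuous_on {0..T} (\<lambda>t. R t i j)"
begin

lemma first_order_cont:
  "i < n + n \<Longrightarrow> j < n + n \<Longrightarrow> continuous_on {0..T} (\<lambda>t. first_order n R t i j)"
  unfolding first_order_def using Rcont[of "i - n" j] by (cases "i < n"; cases "j < n") auto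

lemma jacobi_sol_exists:
  obtains u v where "jacobi_sol T n R u v" "\<And>i. i < n \<Longrightarrow> u 0 i = a i" "\<And>i. i < n \<Longrightarrow> v 0 i = b i"
proof -
  have "\<exists>x. \<forall>i<n + n. x 0 i = (if i < n then a i else b (i - n)) \<and> (\<forall>t\<in>{0..T}.
      ((\<lambda>s. x s i) has_real_derivative (\<Sum>j<n + n. first_order n R t i j * x t j)) (at t within {0..T}))"
    by (rule linear_ode_exists[OF T first_order_cont])
  then obtain x where x: "\<forall>i<n + n. x 0 i = (if i < n then a i else b (i - n)) \<and> (\<forall>t\<in>{0..T}.
      ((\<lambda>s. x s i) has_real_derivative (\<Sum>j<n + n. first_order n R t i j * x t j)) (at t within {0..T}))"
    ..
  show thesis
  proof (rule that[of x "\<lambda>t i. x t (n + i)"])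
    show "jacobi_sol T n R x (\<lambda>t i. x t (n + i))"
      unfolding jacobi_sol_def
    proof (intro allI ballI impI conjI)
      fix i t assume i: "i < n" and t: "t \<in> {0..T}"
      show "((\<lambda>s. x s i) has_real_derivative x t (n + i)) (at t within {0..T})"
        using x[rule_format, of i] i t by (simp add: first_order_apply)
      show "((\<lambda>s. x s (n + i)) has_real_derivative (\<Sum>j<n. R t i j * x t j)) (at t within {0..T})"
        using x[rule_format, of "n + i"] i t by (simp add: first_order_apply)
    qed
  qed (use x in auto)
qed

lemma jacobi_sol_unique:
  assumes "jacobi_sol T n R u v" "s \<in> {0..T}" "\<And>i. i < n \<Longrightarrow> u s i = 0" "\<And>i. i < n \<Longrightarrow> v s i = 0"
    and "t \<in> {0..T}" "i < n"
  shows "u t i = 0" "v t i = 0"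
proof -
  define x where "x t i = (if i < n then u t i else v t (i - n))" for t i
  have xa: "x t i = u t i" "x t (n + i) = v t i" if "i < n" for t i using that by (simp_all add: x_def)
  have *: "x t i = 0" if "i < n + n" for i
  proof (rule linear_ode_unique[OF first_order_cont, where x = x and d = "n + n" and s = s])
    fix i t assume i: "i < n + n" and t: "t \<in> {0..T}"
    show "((\<lambda>s. x s i) has_real_derivative (\<Sum>j<n + n. first_order n R t i j * x t j)) (at t within {0..T})"
    proof (cases "i < n")
      case True
      then show ?thesis using assms(1) t by (simp add: first_order_apply xa jacobi_sol_def)
    next
      case False
      then obtain k where k: "i = n + k" "k < n" using i by (metis add_less_cancel_left le_Suc_ex not_less)
      have "(\<Sum>j<n + n. first_order n R t i j * x t j) = (\<Sum>j<n. R t k j * u t j)"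
        unfolding k(1) first_order_apply by (simp add: xa)
      then show ?thesis using assms(1) t k(2) by (simp add: k(1) xa jacobi_sol_def)
    qed
  qed (use assms that in \<open>auto simp: x_def\<close>)
  show "u t i = 0" "v t i = 0" using *[of i] *[of "n + i"] assms(6) by (simp_all add: xa)
qed

end

lemma jacobi_sol_sum:
  assumes "\<And>k. k \<in> K \<Longrightarrow> jacobi_sol T n R (u k) (v k)"
  shows "jacobi_sol T n R (\<lambda>t i. \<Sum>k\<in>K. c k * u k t i) (\<lambda>t i. \<Sum>k\<in>K. c k * v k t i)"
  unfolding jacobi_sol_def
proof (intro allI ballI impI conjI)
  fix i t assume i: "i < n" and t: "t \<in> {0..T}"
  note d = assms[unfolded jacobi_sol_def, rule_format, OF _ i t]
  show "((\<lambda>s. \<Sum>k\<in>K. c k * u k s i) has_real_derivative (\<Sum>k\<in>K. c k * v k t i)) (at t within {0..T})"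
    by (intro DERIV_sum DERIV_cmult) (use d in blast)
  have "((\<lambda>s. \<Sum>k\<in>K. c k * v k s i) has_real_derivative (\<Sum>k\<in>K. c k * (\<Sum>j<n. R t i j * u k t j))) (at t within {0..T})"
    by (intro DERIV_sum DERIV_cmult) (use d in blast)
  moreover have "(\<Sum>k\<in>K. c k * (\<Sum>j<n. R t i j * u k t j)) = (\<Sum>j<n. R t i j * (\<Sum>k\<in>K. c k * u k t j))"
    unfolding sum_distrib_left by (subst sum.swap) (simp add: mult_ac)
  ultimately show "((\<lambda>s. \<Sum>k\<in>K. c k * v k s i) has_real_derivative (\<Sum>j<n. R t i j * (\<Sum>k\<in>K. c k * u k t j))) (at t within {0..T})"
    by simp
qed

lemma jacobi_sol_lincomb:
  assumes "jacobi_sol T n R u v" "jacobi_sol T n R u' v'"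
  shows "jacobi_sol T n R (\<lambda>t i. a * u t i + b * u' t i) (\<lambda>t i. a * v t i + b * v' t i)"
  using jacobi_sol_sum[where K = "{True, False}" and u = "\<lambda>k. if k then u else u'" and T = T and n = n and R = R
      and v = "\<lambda>k. if k then v else v'" and c = "\<lambda>k. if k then a else b"] assms by simp

text \<open>With zero start value, \<open>u r\<close> is close to (r - s) times \<open>v s\<close>,
  so the pairing is close to (r - s) times the squared length of \<open>v s\<close>. This excludes
  conjugate points on short intervals, and it later makes the map from end value to initial velocity
  positive.\<close>

lemma jacobi_sol_short_positive:
  assumes sol: "jacobi_sol T n R u v" and sr: "0 \<le> s" "s < r" "r \<le> T"
    and C: "\<And>t i j. t \<in> {0..T} \<Longrightarrow> i < n \<Longrightarrow> j < n \<Longrightarrow> \<bar>R t i j\<bar> \<le> C" "0 \<le> C"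
    and small: "4 * (real n)\<^sup>2 * C * (r - s)\<^sup>2 \<le> 1"
    and u0: "\<And>i. i < n \<Longrightarrow> u s i = 0" and i0: "i0 < n" "v s i0 \<noteq> 0"
  shows "0 < (\<Sum>i<n. v s i * u r i)"
proof -
  define h where "h = r - s"
  have h: "0 < h" using sr by (simp add: h_def)
  have sub: "{s..t} \<subseteq> {0..T}" if "t \<le> r" for t using sr that by auto
  have du: "((\<lambda>s. u s i) has_real_derivative v x i) (at x within {s..t})"
    and dv: "((\<lambda>s. v s i) has_real_derivative (\<Sum>j<n. R x i j * u x j)) (at x within {s..t})"
    if "x \<in> {s..t}" "t \<le> r" "i < n" for x t i
    using sol that sub[OF that(2)] unfolding jacobi_sol_def by (blast intro: has_field_derivative_subset)+
  define F where "F t = (\<Sum>j<n. \<bar>v t j\<bar>)" for t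
  have "continuous_on {s..r} F"
    unfolding F_def by (intro continuous_intros DERIV_continuous_on) (rule dv, auto)
  then obtain ts where ts: "ts \<in> {s..r}" "\<And>t. t \<in> {s..r} \<Longrightarrow> F t \<le> F ts"
    using continuous_attains_sup[of "{s..r}" F] sr by auto
  \<comment> \<open>The maximal speed in the sum norm. It bounds u by h M, and then, through the
    equation, the drift of each component of v by n C h^2 M.\<close>
  define M where "M = F ts"
  have vM: "\<bar>v t j\<bar> \<le> M" if "t \<in> {s..r}" "j < n" for t j
  proof -
    have "\<bar>v t j\<bar> \<le> F t" unfolding F_def using that(2) by (intro member_le_sum) auto
    then show ?thesis using ts(2)[OF that(1)] by (simp add: M_def)
  qed
  have M0: "0 \<le> M" unfolding M_def F_def by (simp add: sum_nonneg)
  have ub: "\<bar>u t j\<bar> \<le> h * M" if "t \<in> {s..r}" "j < n" for t j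
  proof -
    have "\<bar>u t j - u s j\<bar> \<le> (t - s) * M"
      by (rule deriv_within_bound[where f' = "\<lambda>x. v x j"]) (use that in \<open>auto intro!: du vM\<close>)
    also have "\<dots> \<le> h * M" using that M0 by (intro mult_right_mono) (auto simp: h_def)
    finally show ?thesis using u0[OF that(2)] by simp
  qed
  have vd: "\<bar>v t i - v s i\<bar> \<le> n * C * h\<^sup>2 * M" if "t \<in> {s..r}" "i < n" for t i
  proof -
    have "\<bar>v t i - v s i\<bar> \<le> (t - s) * (n * (C * (h * M)))"
    proof (rule deriv_within_bound[where f' = "\<lambda>x. \<Sum>j<n. R x i j * u x j"])
      fix x assume x: "x \<in> {s..t}"
      have "\<bar>\<Sum>j<n. R x i j * u x j\<bar> \<le> (\<Sum>j<n. C * (h * M))"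
      proof (rule order_trans[OF sum_abs sum_mono])
        fix j assume "j \<in> {..<n}"
        then show "\<bar>R x i j * u x j\<bar> \<le> C * (h * M)"
          unfolding abs_mult using x that sr by (intro mult_mono C ub) auto
      qed
      then show "\<bar>\<Sum>j<n. R x i j * u x j\<bar> \<le> n * (C * (h * M))" by simp
    qed (use that in \<open>auto intro!: dv\<close>)
    also have "\<dots> \<le> h * (n * (C * (h * M)))"
      using that M0 C(2) h by (intro mult_right_mono) (auto simp: h_def)
    finally show ?thesis by (simp add: power2_eq_square mult_ac)
  qed
  define \<pi> where "\<pi> = (\<Sum>i<n. \<bar>v s i\<bar>)"
  have "M \<le> (\<Sum>i<n. \<bar>v s i\<bar> + n * C * h\<^sup>2 * M)"
    unfolding M_def F_def by (rule sum_mono) (use vd[OF ts(1)] in \<open>fastforce simp: M_def F_def\<close>)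
  then have "M \<le> \<pi> + (n\<^sup>2 * C * h\<^sup>2) * M"
    by (simp add: sum.distrib \<pi>_def power2_eq_square mult_ac)
  moreover have "(n\<^sup>2 * C * h\<^sup>2) * M \<le> 1/4 * M"
    using small M0 by (intro mult_right_mono) (simp_all add: h_def)
  \<comment> \<open>Summed over the components, the drift is at most a quarter of M, so M is
    controlled by the initial speed alone.\<close>
  ultimately have M\<pi>: "M \<le> 4/3 * \<pi>" by linarith
  have yd: "\<bar>u r i - h * v s i\<bar> \<le> h * (n * C * h\<^sup>2 * M)" if "i < n" for i
  proof -
    have "\<bar>(u r i - r * v s i) - (u s i - s * v s i)\<bar> \<le> (r - s) * (n * C * h\<^sup>2 * M)"
      by (rule deriv_within_bound[where f' = "\<lambda>x. v x i - v s i" and f = "\<lambda>x. u x i - x * v s i"])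
        (use that sr in \<open>auto intro!: derivative_eq_intros du vd\<close>)
    then show ?thesis using u0[OF that] by (simp add: h_def algebra_simps)
  qed
  define S where "S = (\<Sum>i<n. (v s i)\<^sup>2)"
  have "0 < S" unfolding S_def
    by (rule sum_pos2[of _ i0]) (use i0 in auto)
  have "h * (v s i)\<^sup>2 - \<bar>v s i\<bar> * (h * (n * C * h\<^sup>2 * M)) \<le> v s i * u r i" if "i < n" for i
  proof -
    have "\<bar>v s i * (u r i - h * v s i)\<bar> \<le> \<bar>v s i\<bar> * (h * (n * C * h\<^sup>2 * M))"
      unfolding abs_mult by (intro mult_left_mono yd that) simp
    then show ?thesis by (simp add: abs_le_iff power2_eq_square algebra_simps)
  qed
  then have "(\<Sum>i<n. h * (v s i)\<^sup>2 - \<bar>v s i\<bar> * (h * (n * C * h\<^sup>2 * M))) \<le> (\<Sum>i<n. v s i * u r i)"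
    by (intro sum_mono) auto
  then have "h * S - \<pi> * (h * (n * C * h\<^sup>2 * M)) \<le> (\<Sum>i<n. v s i * u r i)"
    by (simp only: sum_subtractf S_def \<pi>_def sum_distrib_left sum_distrib_right)
  \<comment> \<open>Cauchy-Schwarz replaces the square of \<pi> by n S. Together with the factor 4/3
    this produces the 4 n^2 of the smallness condition and leaves an error of at most a third of the
    main term h S.\<close>
  moreover have "\<pi> * (h * (n * C * h\<^sup>2 * M)) \<le> h * (S / 3)"
  proof -
    have p0: "0 \<le> \<pi>" by (simp add: \<pi>_def sum_nonneg)
    have "\<pi>\<^sup>2 \<le> n * S"
      using sum_squared_le_sum_of_squares[of "\<lambda>i. \<bar>v s i\<bar>" "{..<n}"] by (simp add: \<pi>_def S_def mult.commute)
    have "\<pi> * (h * (n * C * h\<^sup>2 * M)) \<le> \<pi> * (h * (n * C * h\<^sup>2 * (4/3 * \<pi>)))"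
      using p0 h C(2) M\<pi> by (intro mult_left_mono) auto
    also have "\<dots> = h * (n * C * h\<^sup>2 * (4/3)) * \<pi>\<^sup>2" by (simp add: power2_eq_square)
    also have "\<dots> \<le> h * (n * C * h\<^sup>2 * (4/3)) * (n * S)"
      using \<open>\<pi>\<^sup>2 \<le> n * S\<close> h C(2) by (intro mult_left_mono) auto
    also have "\<dots> = h * (S / 3) * (4 * n\<^sup>2 * C * h\<^sup>2)" by (simp add: power2_eq_square)
    also have "\<dots> \<le> h * (S / 3) * 1"
      using small \<open>0 < S\<close> h by (intro mult_left_mono) (simp_all add: h_def)
    finally show ?thesis by simp
  qed
  moreover have "0 < h * S - h * (S / 3)" using h \<open>0 < S\<close> by (simp add: algebra_simps)
  ultimately show ?thesis by linarith
qed

section \<open>Broken solutions\<close>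

locale jacobi_problem =
  fixes T :: real and n :: nat and R :: "real \<Rightarrow> nat \<Rightarrow> nat \<Rightarrow> real" and C :: real
  assumes T: "0 < T"
    and Rcont: "\<And>i j. i < n \<Longrightarrow> j < n \<Longrightarrow> continuous_on {0..T} (\<lambda>t. R t i j)"
    and Rsym: "\<And>t i j. t \<in> {0..T} \<Longrightarrow> i < n \<Longrightarrow> j < n \<Longrightarrow> R t i j = R t j i"
    and Rbound: "\<And>t i j. t \<in> {0..T} \<Longrightarrow> i < n \<Longrightarrow> j < n \<Longrightarrow> \<bar>R t i j\<bar> \<le> C"
    and C0: "0 \<le> C"
begin

abbreviation sol where "sol \<equiv> jacobi_sol T n R"

abbreviation short where "short s r \<equiv> 0 \<le> s \<and> s < r \<and> r \<le> T \<and> 4 * (real n)\<^sup>2 * C * (r - s)\<^sup>2 \<le> 1"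

lemma sol_lincomb: "sol u v \<Longrightarrow> sol u' v' \<Longrightarrow> sol (\<lambda>t i. a * u t i + b * u' t i) (\<lambda>t i. a * v t i + b * v' t i)"
  by (rule jacobi_sol_lincomb)

lemma sol_deriv:
  assumes "sol u v" "t \<in> {0..T}" "i < n"
  shows "((\<lambda>s. u s i) has_real_derivative v t i) (at t within {0..T})"
    "((\<lambda>s. v s i) has_real_derivative (\<Sum>j<n. R t i j * u t j)) (at t within {0..T})"
  using assms unfolding jacobi_sol_def by blast+

lemma sol_unique:
  assumes "sol u v" "sol u' v'" "s \<in> {0..T}" "\<And>i. i < n \<Longrightarrow> u s i = u' s i" "\<And>i. i < n \<Longrightarrow> v s i = v' s i"
    and "t \<in> {0..T}" "i < n"
  shows "u t i = u' t i" "v t i = v' t i"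
proof -
  have "sol (\<lambda>t i. 1 * u t i + (-1) * u' t i) (\<lambda>t i. 1 * v t i + (-1) * v' t i)"
    using assms(1,2) by (rule sol_lincomb)
  from jacobi_sol_unique[OF less_imp_le[OF T] Rcont this assms(3) _ _ assms(6,7)] assms(4,5)
  show "u t i = u' t i" "v t i = v' t i" by simp_all
qed

text \<open>The difference of the two solutions vanishes at both ends. A nonzero initial velocity
  would have a positive pairing with its end value, which is zero.\<close>

lemma dirichlet_unique:
  assumes "sol u v" "sol u' v'" "short s r" "\<And>i. i < n \<Longrightarrow> u s i = u' s i" "\<And>i. i < n \<Longrightarrow> u r i = u' r i"
    and "t \<in> {0..T}" "i < n"
  shows "u t i = u' t i" "v t i = v' t i"
proof -
  let ?u = "\<lambda>t i. 1 * u t i + (-1) * u' t i" and ?v = "\<lambda>t i. 1 * v t i + (-1) * v' t i"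
  have sol: "sol ?u ?v" using assms(1,2) by (rule sol_lincomb)
  have "?v s i = 0" if "i < n" for i
  proof (rule ccontr)
    assume "?v s i \<noteq> 0"
    then have "0 < (\<Sum>i<n. ?v s i * ?u r i)"
      using assms(3-5) that by (intro jacobi_sol_short_positive[OF sol _ _ _ Rbound C0, of s r i]) auto
    then show False using assms(5) by simp
  qed
  then have "v s i = v' s i" if "i < n" for i using that by simp
  then show "u t i = u' t i" "v t i = v' t i"
    using sol_unique[OF assms(1,2) _ assms(4) _ assms(6,7)] assms(3) by auto
qed

text \<open>Existence follows from uniqueness by counting dimensions: the map from 2n initial values
  to 2n boundary values is a square matrix without kernel.\<close>

lemma dirichlet_exists:
  assumes sr: "short s r"
  shows "\<exists>u v. sol u v \<and> (\<forall>i<n. u s i = a i) \<and> (\<forall>i<n. u r i = b i)"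
proof -
  have "\<exists>u v. sol u v \<and> (\<forall>i<n. u 0 i = (if l = i then 1 else 0)) \<and> (\<forall>i<n. v 0 i = (if l = n + i then 1 else 0))" for l
    by (rule jacobi_sol_exists[OF less_imp_le[OF T] Rcont, where a = "\<lambda>i. if l = i then 1 else 0"
          and b = "\<lambda>i. if l = n + i then 1 else 0"]) blast+
  then obtain Fu Fv where F: "\<And>l. sol (Fu l) (Fv l)"
    "\<And>l i. i < n \<Longrightarrow> Fu l 0 i = (if l = i then 1 else 0)" "\<And>l i. i < n \<Longrightarrow> Fv l 0 i = (if l = n + i then 1 else 0)"
    by metis
  \<comment> \<open>The rows below n evaluate the fundamental solutions at s, the remaining ones at
    r.\<close>
  define M where "M i j = (if i < n then Fu j s i else Fu j r (i - n))" for i j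
  define u where "u c t i = (\<Sum>j<n + n. c j * Fu j t i)" for c t i
  define v where "v c t i = (\<Sum>j<n + n. c j * Fv j t i)" for c t i
  have uv: "sol (u c) (v c)" for c unfolding u_def[abs_def] v_def[abs_def] by (rule jacobi_sol_sum[OF F(1)])
  have Mu: "(\<Sum>j<n + n. M i j * c j) = u c s i" "(\<Sum>j<n + n. M (n + i) j * c j) = u c r i" if "i < n" for i c
    using that by (simp_all add: M_def u_def mult.commute)
  have "fdet (n + n) M \<noteq> 0"
    unfolding fdet_nonzero_iff
  proof (intro allI impI)
    fix c i assume c: "\<forall>i<n + n. (\<Sum>j<n + n. M i j * c j) = 0" and i: "i < n + n"
    have 0: "sol (\<lambda>t i. 0) (\<lambda>t i. 0)" by (simp add: jacobi_sol_def)
    have z: "u c s i = 0" "u c r i = 0" if "i < n" for i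
      using c[rule_format, of i] c[rule_format, of "n + i"] that by (simp_all only: Mu)
    have z0: "u c 0 i = 0" "v c 0 i = 0" if "i < n" for i
      using dirichlet_unique[OF uv 0 sr, of c 0 i] z that T by auto
    have e: "u c 0 i = c i" "v c 0 i = c (n + i)" if "i < n" for i
      using that by (simp_all add: u_def v_def F(2,3) if_distrib[of "\<lambda>x. _ * x"] cong: if_cong)
    show "c i = 0"
    proof (cases "i < n")
      case False
      then obtain k where "i = n + k" "k < n" using i by (metis add_less_cancel_left le_Suc_ex not_less)
      then show ?thesis using z0 e by metis
    qed (use z0 e in metis)
  qed
  from fdet_inverse[OF this] obtain N where
    N': "(\<forall>i<n + n. \<forall>j<n + n. (\<Sum>k<n + n. M i k * N k j) = (if i = j then 1 else 0)) \<and>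
      (\<forall>i<n + n. \<forall>j<n + n. (\<Sum>k<n + n. N i k * M k j) = (if i = j then 1 else 0))" ..
  note N = N'[THEN conjunct1, rule_format]
  define y where "y i = (if i < n then a i else b (i - n))" for i
  define c where "c k = (\<Sum>j<n + n. N k j * y j)" for k
  have Mc: "(\<Sum>k<n + n. M i k * c k) = y i" if "i < n + n" for i
  proof -
    have "(\<Sum>k<n + n. M i k * c k) = (\<Sum>j<n + n. (\<Sum>k<n + n. M i k * N k j) * y j)"
      unfolding c_def sum_distrib_left sum_distrib_right by (subst sum.swap) (simp add: mult_ac)
    also have "\<dots> = (\<Sum>j<n + n. (if i = j then 1 else 0) * y j)"
      by (rule sum.cong) (use N that in auto)
    finally show ?thesis using that by (simp add: if_distrib[of "\<lambda>x. x * _"] cong: if_cong)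
  qed
  have "u c s i = a i" "u c r i = b i" if "i < n" for i
    using Mc[of i] Mc[of "n + i"] that by (simp_all only: Mu) (simp_all add: y_def)
  then show ?thesis using uv by blast
qed

text \<open>Symmetry of R makes the symplectic pairing of two solutions constant in time. From this
  come the symmetry of the diagonal part of the broken form and the transposition that relates its
  off-diagonal parts.\<close>

lemma wronskian:
  assumes "sol u v" "sol u' v'" "s \<in> {0..T}" "t \<in> {0..T}"
  shows "(\<Sum>i<n. v s i * u' s i - u s i * v' s i) = (\<Sum>i<n. v t i * u' t i - u t i * v' t i)"
proof -
  let ?w = "\<lambda>t. \<Sum>i<n. v t i * u' t i - u t i * v' t i"
  have "(?w has_real_derivative 0) (at t within {0..T})" if t: "t \<in> {0..T}" for t
  proof -
    have "((\<lambda>t. v t i * u' t i - u t i * v' t i) has_real_derivative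
       (\<Sum>j<n. R t i j * u t j) * u' t i - u t i * (\<Sum>j<n. R t i j * u' t j)) (at t within {0..T})" if "i < n" for i
      using DERIV_diff[OF DERIV_mult[OF sol_deriv(2)[OF assms(1) t that] sol_deriv(1)[OF assms(2) t that]]
          DERIV_mult[OF sol_deriv(1)[OF assms(1) t that] sol_deriv(2)[OF assms(2) t that]]]
      by (simp add: algebra_simps)
    then have "(?w has_real_derivative
       (\<Sum>i<n. (\<Sum>j<n. R t i j * u t j) * u' t i - u t i * (\<Sum>j<n. R t i j * u' t j))) (at t within {0..T})"
      by (intro DERIV_sum) auto
    moreover have "(\<Sum>i<n. (\<Sum>j<n. R t i j * u t j) * u' t i - u t i * (\<Sum>j<n. R t i j * u' t j)) = 0"
    proof -
      have "(\<Sum>i<n. (\<Sum>j<n. R t i j * u t j) * u' t i) = (\<Sum>j<n. \<Sum>i<n. R t i j * u t j * u' t i)"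
        unfolding sum_distrib_right by (rule sum.swap)
      also have "\<dots> = (\<Sum>j<n. u t j * (\<Sum>i<n. R t j i * u' t i))"
        unfolding sum_distrib_left by (intro sum.cong refl) (simp add: Rsym[OF t] mult_ac)
      finally show ?thesis by (simp add: sum_subtractf)
    qed
    ultimately show ?thesis by simp
  qed
  then obtain c where "\<And>t. t \<in> {0..T} \<Longrightarrow> ?w t = c"
    using has_field_derivative_zero_constant[of "{0..T}" ?w] by auto
  then show ?thesis using assms(3,4) by simp
qed

end

locale broken_problem = jacobi_problem +
  fixes N :: nat and A :: "nat \<Rightarrow> nat \<Rightarrow> real"
  assumes N: "odd N" and small: "4 * (real n)\<^sup>2 * C * (T / N)\<^sup>2 \<le> 1"
    and AtA: "\<And>i j. i < n \<Longrightarrow> j < n \<Longrightarrow> (\<Sum>k<n. A k i * A k j) = (if i = j then 1 else 0)"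
    and AAt: "\<And>i j. i < n \<Longrightarrow> j < n \<Longrightarrow> (\<Sum>k<n. A i k * A j k) = (if i = j then 1 else 0)"
begin

lemma N0: "0 < N" using N by (cases N) auto

definition node :: "nat \<Rightarrow> real" where "node k = k * (T / N)"

lemma node_0: "node 0 = 0" and node_N: "node N = T" using N0 by (simp_all add: node_def)

lemma node_less: "node k < node (Suc k)" using T N0 by (simp add: node_def divide_strict_right_mono)

lemma node_in: "k \<le> N \<Longrightarrow> node k \<in> {0..T}"
  using T N0 by (simp add: node_def field_simps)

lemma node_short: "k < N \<Longrightarrow> short (node k) (node (Suc k))"
  using node_in[of k] node_in[of "Suc k"] node_less[of k] small by (simp add: node_def algebra_simps diff_divide_distrib[symmetric])

text \<open>Each piece is a solution on all of [0,T] that is merely prescribed at two adjacent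
  nodes. Thus neighbouring pieces can be compared as functions, by uniqueness for the initial value
  problem at their common node.\<close>

definition seg :: "nat \<Rightarrow> (nat \<Rightarrow> real) \<Rightarrow> (nat \<Rightarrow> real) \<Rightarrow> (real \<Rightarrow> nat \<Rightarrow> real) \<times> (real \<Rightarrow> nat \<Rightarrow> real)" where
  "seg k x y = (SOME w. sol (fst w) (snd w) \<and> (\<forall>i<n. fst w (node k) i = x i) \<and> (\<forall>i<n. fst w (node (Suc k)) i = y i))"

definition U where "U k x y = fst (seg k x y)"
definition V where "V k x y = snd (seg k x y)"

lemma seg:
  assumes "k < N"
  shows "sol (U k x y) (V k x y)" "i < n \<Longrightarrow> U k x y (node k) i = x i" "i < n \<Longrightarrow> U k x y (node (Suc k)) i = y i"
proof -
  obtain u v where "sol u v \<and> (\<forall>i<n. u (node k) i = x i) \<and> (\<forall>i<n. u (node (Suc k)) i = y i)"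
    using dirichlet_exists[OF node_short[OF assms]] by blast
  then have "sol (fst (u, v)) (snd (u, v)) \<and> (\<forall>i<n. fst (u, v) (node k) i = x i) \<and> (\<forall>i<n. fst (u, v) (node (Suc k)) i = y i)"
    by simp
  from someI[where P = "\<lambda>w. sol (fst w) (snd w) \<and> (\<forall>i<n. fst w (node k) i = x i) \<and> (\<forall>i<n. fst w (node (Suc k)) i = y i)", OF this]
  have "sol (U k x y) (V k x y) \<and> (\<forall>i<n. U k x y (node k) i = x i) \<and> (\<forall>i<n. U k x y (node (Suc k)) i = y i)"
    unfolding U_def V_def seg_def .
  then show "sol (U k x y) (V k x y)" "i < n \<Longrightarrow> U k x y (node k) i = x i" "i < n \<Longrightarrow> U k x y (node (Suc k)) i = y i"
    by simp_all
qed

lemma seg_eq: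
  assumes "k < N" "sol u v" "\<And>i. i < n \<Longrightarrow> u (node k) i = x i" "\<And>i. i < n \<Longrightarrow> u (node (Suc k)) i = y i"
    and "t \<in> {0..T}" "i < n"
  shows "U k x y t i = u t i" "V k x y t i = v t i"
  using dirichlet_unique[OF seg(1)[OF assms(1)] assms(2) node_short[OF assms(1)] _ _ assms(5,6), of x y] seg(2,3)[OF assms(1)] assms(3,4)
  by auto

lemma seg_lincomb:
  assumes "k < N" "t \<in> {0..T}" "i < n"
    and "\<And>i. i < n \<Longrightarrow> z i = a * x i + b * x' i" "\<And>i. i < n \<Longrightarrow> w i = a * y i + b * y' i"
  shows "U k z w t i = a * U k x y t i + b * U k x' y' t i" "V k z w t i = a * V k x y t i + b * V k x' y' t i"
  using seg_eq[OF assms(1) sol_lincomb[OF seg(1)[OF assms(1)] seg(1)[OF assms(1)]] _ _ assms(2,3), of a x y b x' y' z w]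
    seg(2,3)[OF assms(1)] assms(4,5) by auto

text \<open>A vector q lists the values at the nodes 0, ..., N - 1 one after the other.\<close>

definition blk :: "nat \<Rightarrow> (nat \<Rightarrow> real) \<Rightarrow> nat \<Rightarrow> real" where "blk k q i = q (k * n + i)"

text \<open>The boundary condition \<open>u 0 = A u T\<close> makes \<open>A\<^sup>T q\<^sub>0\<close> the value at the last node.\<close>

definition nxt :: "nat \<Rightarrow> (nat \<Rightarrow> real) \<Rightarrow> nat \<Rightarrow> real" where
  "nxt k q i = (if Suc k < N then blk (Suc k) q i else (\<Sum>l<n. A l i * q l))"

lemma blk_lincomb: "blk k (\<lambda>i. a * q i + b * r i) i = a * blk k q i + b * blk k r i"
  and nxt_lincomb: "nxt k (\<lambda>i. a * q i + b * r i) i = a * nxt k q i + b * nxt k r i"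
  by (simp_all add: blk_def nxt_def sum.distrib sum_distrib_left algebra_simps)

text \<open>The boundary terms left by integrating by parts over all segments: \<open>f k\<close>
  and \<open>g k\<close> stand for the velocities at the end and at the start of segment k, and q
  for a variation of the node values.\<close>

definition jump :: "(nat \<Rightarrow> nat \<Rightarrow> real) \<Rightarrow> (nat \<Rightarrow> nat \<Rightarrow> real) \<Rightarrow> (nat \<Rightarrow> real) \<Rightarrow> real" where
  "jump f g q = (\<Sum>k<N. \<Sum>i<n. f k i * nxt k q i - g k i * blk k q i)"

lemma index_eq_iff: "i < n \<Longrightarrow> i' < n \<Longrightarrow> k * n + i = k' * n + i' \<longleftrightarrow> k = k' \<and> i = i'"
  by (metis add_right_cancel div_mult_self3 div_less add.right_neutral not_less_zero add.commute add_left_cancel)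

text \<open>Testing with a unit vector isolates the jump of the velocity at one node. The node 0
  occurs twice, as start of the first segment and, through A transposed, as end of the last one;
  this yields the boundary condition for the velocity.\<close>

lemma jump_zero:
  assumes "\<forall>l<N * n. jump f g (unit_fun l) = 0" "i < n"
  shows "Suc k < N \<Longrightarrow> f k i = g (Suc k) i" and "(\<Sum>l<n. A i l * f (N - 1) l) = g 0 i"
proof -
  have b: "blk k (unit_fun (j * n + i)) i' = (if k = j \<and> i' = i then 1 else 0)" if "i' < n" for k j i'
    using index_eq_iff[OF that assms(2)] by (simp add: blk_def unit_fun_def)
  have sd: "(\<Sum>i'<n. g k i' * blk k (unit_fun (j * n + i)) i') = (if k = j then g k i else 0)" for k j
  proof -
    have "(\<Sum>i'<n. g k i' * blk k (unit_fun (j * n + i)) i') = (\<Sum>i'<n. if i' = i then (if k = j then g k i else 0) else 0)"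
      by (rule sum.cong) (auto simp: b)
    then show ?thesis using assms(2) by simp
  qed
  have Sd: "(\<Sum>k<N. \<Sum>i'<n. g k i' * blk k (unit_fun (j * n + i)) i') = g j i" if "j < N" for j
    using that by (simp add: sd)
  have lt: "j * n + i < N * n" if "j < N" for j
    using that assms(2) by (metis add.commute add_less_cancel_left less_le_trans mult_Suc mult_le_mono1 Suc_leI)
  note j = assms(1)[rule_format, OF lt, unfolded jump_def sum_subtractf Sd]
  show "f k i = g (Suc k) i" if k: "Suc k < N"
  proof -
    have "(\<Sum>i'<n. f k' i' * nxt k' (unit_fun (Suc k * n + i)) i') = (if k' = k then f k i else 0)" if k': "k' < N" for k'
    proof -
      have "nxt k' (unit_fun (Suc k * n + i)) i' = (if k' = k \<and> i' = i then 1 else 0)" if "i' < n" for i'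
      proof (cases "Suc k' < N")
        case True
        then show ?thesis using b[OF that, of "Suc k'" "Suc k"] by (simp add: nxt_def)
      next
        case False
        moreover have "unit_fun (Suc k * n + i) l = 0" if "l < n" for l using that by (simp add: unit_fun_def)
        ultimately show ?thesis using k by (auto simp: nxt_def)
      qed
      then have "(\<Sum>i'<n. f k' i' * nxt k' (unit_fun (Suc k * n + i)) i') = (\<Sum>i'<n. if i' = i then (if k' = k then f k i else 0) else 0)"
        by (intro sum.cong) auto
      then show ?thesis using assms(2) by simp
    qed
    then have "(\<Sum>k'<N. \<Sum>i'<n. f k' i' * nxt k' (unit_fun (Suc k * n + i)) i') = (\<Sum>k'<N. if k' = k then f k i else 0)"
      by (intro sum.cong) auto
    then show ?thesis using j[OF k] k Sd[OF k] by simp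
  qed
  have "(\<Sum>i'<n. f k' i' * nxt k' (unit_fun i) i') = (if k' = N - 1 then (\<Sum>l<n. A i l * f (N - 1) l) else 0)" if k': "k' < N" for k'
  proof (cases "Suc k' < N")
    case True
    then show ?thesis using b[of _ "Suc k'" 0] by (auto simp: nxt_def)
  next
    case False
    then have "k' = N - 1" using k' by simp
    moreover have "nxt k' (unit_fun i) i' = A i i'" for i'
      using False assms(2) by (simp add: nxt_def unit_fun_def if_distrib[of "\<lambda>x. _ * x"] cong: if_cong)
    ultimately show ?thesis by (simp add: mult.commute)
  qed
  then have "(\<Sum>k'<N. \<Sum>i'<n. f k' i' * nxt k' (unit_fun i) i') = (\<Sum>k'<N. if k' = N - 1 then (\<Sum>l<n. A i l * f (N - 1) l) else 0)"
    by (intro sum.cong) auto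
  then show "(\<Sum>l<n. A i l * f (N - 1) l) = g 0 i" using j[OF N0] N0 Sd[OF N0] by simp
qed

text \<open>Neighbouring pieces share value and velocity at their common node, so they are one and
  the same solution on [0,T]. The first piece therefore passes through all the node values.\<close>

lemma glue:
  assumes match: "\<And>k i. Suc k < N \<Longrightarrow> i < n \<Longrightarrow> V k (x k) (x (Suc k)) (node (Suc k)) i = V (Suc k) (x (Suc k)) (x (Suc (Suc k))) (node (Suc k)) i"
  obtains u v where "sol u v" "\<And>k i. k \<le> N \<Longrightarrow> i < n \<Longrightarrow> u (node k) i = x k i"
    and "\<And>i. i < n \<Longrightarrow> v 0 i = V 0 (x 0) (x 1) 0 i" "\<And>i. i < n \<Longrightarrow> v T i = V (N - 1) (x (N - 1)) (x N) T i"
proof -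
  let ?u = "\<lambda>k. U k (x k) (x (Suc k))" and ?v = "\<lambda>k. V k (x k) (x (Suc k))"
  have eq: "?u k t i = ?u 0 t i \<and> ?v k t i = ?v 0 t i" if "k < N" "t \<in> {0..T}" "i < n" for k t i
    using that
  proof (induction k arbitrary: t i)
    case (Suc k)
    have "?u (Suc k) t i = ?u k t i \<and> ?v (Suc k) t i = ?v k t i"
      using sol_unique[OF seg(1)[OF Suc.prems(1)] seg(1)[OF Suc_lessD[OF Suc.prems(1)]] node_in[of "Suc k"] _ _ Suc.prems(2,3), of "x (Suc k)" "x (Suc (Suc k))" "x k" "x (Suc k)"]
        seg(2)[OF Suc.prems(1)] seg(3)[OF Suc_lessD[OF Suc.prems(1)]] match[OF Suc.prems(1)] Suc.prems(1) by auto
    then show ?case using Suc by simp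
  qed simp
  have N1: "N - 1 < N" "Suc (N - 1) = N" using N0 by simp_all
  show thesis
  proof (rule that[of "?u 0" "?v 0"])
    show "sol (?u 0) (?v 0)" using seg(1) N0 by blast
    show "?u 0 (node k) i = x k i" if k: "k \<le> N" and i: "i < n" for k i
    proof (cases "k = N")
      case True
      then show ?thesis using eq[OF N1(1) node_in[OF k] i] seg(3)[OF N1(1) i, of "x (N - 1)" "x N"] N1(2) by simp
    next
      case False
      then have "k < N" using k by simp
      then show ?thesis using eq[OF _ node_in[OF k] i] seg(2)[OF _ i] by metis
    qed
    show "?v 0 T i = V (N - 1) (x (N - 1)) (x N) T i" if "i < n" for i
      using eq[OF N1(1) _ that, of T] T N1(2) by simp
  qed simp
qed

end

section \<open>Determinants of block matrices and block rotations\<close>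

lemma fdet_block_identity:
  "fdet (n + k) (\<lambda>i j. if i < n then (if j < n then X i j else 0) else (if i = j then 1 else 0)) = fdet n X"
proof -
  let ?X = "Matrix.mat n n (\<lambda>(i, j). X i j)"
  have "Matrix.mat (n + k) (n + k) (\<lambda>(i, j). if i < n then (if j < n then X i j else 0) else (if i = j then 1 else 0))
    = four_block_mat ?X (0\<^sub>m n k) (0\<^sub>m k n) (1\<^sub>m k)"
    by (rule eq_matI) auto
  then show ?thesis
    unfolding fdet_def by (simp add: det_four_block_mat_lower_left_zero[of _ n _ k])
qed

text \<open>The N-th power of the rotation is the identity, so its determinant is a real root of 1
  of odd order.\<close>

lemma fdet_block_rotation:
  assumes "odd N"
  shows "fdet (N * n) (\<lambda>i l. if l = (i + n) mod (N * n) then 1 else 0) = 1"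
proof (cases "n = 0")
  case True
  then show ?thesis using fdet_diag[of 0 "\<lambda>_. 1"] by (simp add: fdet_def)
next
  case False
  define m where "m = N * n"
  have m: "0 < m" using False assms by (auto simp: m_def intro: Nat.gr0I)
  define r where "r k i l = (if l = (i + k * n) mod m then 1 else (0::real))" for k i l
  have step: "fdet m (r (Suc k)) = fdet m (r k) * fdet m (r 1)" for k
    unfolding fdet_mult
  proof (rule fdet_cong)
    fix i j assume "i < m" "j < m"
    have "(\<Sum>l<m. r k i l * r 1 l j) = (\<Sum>l<m. if l = (i + k * n) mod m then r 1 ((i + k * n) mod m) j else 0)"
      by (rule sum.cong) (auto simp: r_def)
    also have "\<dots> = r 1 ((i + k * n) mod m) j" using m by simp
    also have "\<dots> = r (Suc k) i j"
    proof -
      have "i + Suc k * n = i + k * n + n" by simp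
      then show ?thesis by (simp only: r_def mult_1 mod_add_left_eq)
    qed
    finally show "r (Suc k) i j = (\<Sum>l<m. r k i l * r 1 l j)" ..
  qed
  have id: "fdet m (\<lambda>i l. if i = l then 1 else 0) = 1" using fdet_diag[of m "\<lambda>_. 1"] by simp
  have "fdet m (r 0) = fdet m (\<lambda>i l. if i = l then 1 else 0)" by (rule fdet_cong) (auto simp: r_def)
  then have "fdet m (r 0) = 1" by (simp only: id)
  then have pow: "fdet m (r k) = fdet m (r 1) ^ k" for k
  proof (induction k)
    case (Suc k)
    then show ?case using step[of k] by (simp only: power_Suc mult.commute)
  qed simp
  have "fdet m (r N) = fdet m (\<lambda>i l. if i = l then 1 else 0)"
    by (rule fdet_cong) (auto simp: r_def m_def[symmetric])
  then have "fdet m (r N) = 1" by (simp only: id)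
  then have e: "fdet m (r 1) ^ N = 1" using pow[of N] by simp
  have "fdet m (r 1) = 1"
  proof -
    have "0 < N" using assms by (rule odd_pos)
    then have "root N (fdet m (r 1) ^ N) = fdet m (r 1)" using odd_real_root_power_cancel[OF assms] by blast
    then show ?thesis using \<open>0 < N\<close> unfolding e by simp
  qed
  moreover have "fdet m (\<lambda>i l. if l = (i + n) mod m then 1 else 0) = fdet m (r 1)"
    by (rule fdet_cong) (simp only: r_def mult_1)
  ultimately show ?thesis unfolding m_def[symmetric] by (rule trans[rotated])
qed

section \<open>The broken form and its twist\<close>

context broken_problem
begin

definition m where "m = N * n"

abbreviation (input) "z \<equiv> (\<lambda>_::nat. 0::real)"

text \<open>The coupling of adjacent nodes: the initial velocity of the piece that starts at zero,
  tested with the variation at the start. \<open>Df\<close> collects the terms in which the value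
  and the variation belong to the same node of a segment.\<close>

definition Bf where "Bf q' q = jump (\<lambda>k. z) (\<lambda>k. V k z (nxt k q) (node k)) q'"
definition Df where
  "Df q' q = jump (\<lambda>k. V k z (nxt k q) (node (Suc k))) (\<lambda>k. V k (blk k q) z (node k)) q'"

lemma jump_lincomb: "jump f g (\<lambda>i. a * q i + b * r i) = a * jump f g q + b * jump f g r"
  unfolding jump_def nxt_lincomb blk_lincomb
  by (simp add: algebra_simps sum.distrib sum_subtractf sum_distrib_left)

lemma jump_lincomb_fg:
  assumes "\<And>k i. k < N \<Longrightarrow> i < n \<Longrightarrow> F k i = a * f k i + b * f' k i"
    and "\<And>k i. k < N \<Longrightarrow> i < n \<Longrightarrow> G k i = a * g k i + b * g' k i"
  shows "jump F G q = a * jump f g q + b * jump f' g' q"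
proof -
  have "jump F G q = (\<Sum>k<N. \<Sum>i<n. (a * f k i + b * f' k i) * nxt k q i - (a * g k i + b * g' k i) * blk k q i)"
    unfolding jump_def by (intro sum.cong refl) (simp add: assms)
  also have "\<dots> = a * jump f g q + b * jump f' g' q"
    unfolding jump_def sum_distrib_left sum.distrib[symmetric] by (intro sum.cong refl) (simp add: algebra_simps)
  finally show ?thesis .
qed

lemma node_in': "k < N \<Longrightarrow> node k \<in> {0..T}" "k < N \<Longrightarrow> node (Suc k) \<in> {0..T}"
  using node_in by simp_all

lemma Bf_lincomb: "Bf q' (\<lambda>i. a * q i + b * r i) = a * Bf q' q + b * Bf q' r"
  unfolding Bf_def
  by (rule jump_lincomb_fg) (auto intro!: seg_lincomb node_in' simp: nxt_lincomb)

lemma Df_lincomb: "Df q' (\<lambda>i. a * q i + b * r i) = a * Df q' q + b * Df q' r"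
  unfolding Df_def
  by (rule jump_lincomb_fg) (auto intro!: seg_lincomb node_in' simp: nxt_lincomb blk_lincomb)

lemma bilinear_if_lincomb:
  fixes F :: "(nat \<Rightarrow> real) \<Rightarrow> (nat \<Rightarrow> real) \<Rightarrow> real"
  assumes "\<And>q a b r s. F q (\<lambda>i. a * r i + b * s i) = a * F q r + b * F q s"
    and "\<And>q a b r s. F (\<lambda>i. a * r i + b * s i) q = a * F r q + b * F s q"
  shows "bilinear F"
  unfolding bilinear_def
proof (intro conjI allI linearI)
  fix q r s :: "nat \<Rightarrow> real" and c :: real
  have 1: "r + s = (\<lambda>i. 1 * r i + 1 * s i)" and 2: "c *\<^sub>R r = (\<lambda>i. c * r i + 0 * r i)"
    by (simp_all add: fun_eq_iff scaleR_fun_def)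
  show "F q (r + s) = F q r + F q s" "F (r + s) q = F r q + F s q"
    unfolding 1 assms by simp_all
  show "F q (c *\<^sub>R r) = c *\<^sub>R F q r" "F (c *\<^sub>R r) q = c *\<^sub>R F r q"
    unfolding 2 assms by simp_all
qed

lemma bilinear_Bf: "bilinear Bf" and bilinear_Df: "bilinear Df"
  by (rule bilinear_if_lincomb, rule Bf_lincomb Df_lincomb,
      simp only: Bf_def Df_def jump_lincomb)+

text \<open>On each segment, the Wronskian of a piece vanishing at the end with one vanishing at the
  start exchanges the two couplings.\<close>

lemma Bf_transpose:
  "Bf q q' = jump (\<lambda>k. V k (blk k q) z (node (Suc k))) (\<lambda>k. z) q'"
proof -
  have "(\<Sum>i<n. V k (blk k q) z (node (Suc k)) i * nxt k q' i) = - (\<Sum>i<n. V k z (nxt k q') (node k) i * blk k q i)"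
    if k: "k < N" for k
    using wronskian[OF seg(1)[OF k] seg(1)[OF k] node_in'(1)[OF k] node_in'(2)[OF k], of "blk k q" z z "nxt k q'"]
    by (simp add: seg(2,3)[OF k] sum_negf mult.commute)
  then show ?thesis unfolding Bf_def jump_def by (simp add: sum_subtractf sum_negf)
qed

text \<open>Two pieces that vanish at the same end have zero Wronskian, so the velocity at the other
  end depends symmetrically on the value there.\<close>

lemma Df_sym: "Df q' q = Df q q'"
proof -
  have "(\<Sum>i<n. V k z (nxt k q) (node (Suc k)) i * nxt k q' i) = (\<Sum>i<n. V k z (nxt k q') (node (Suc k)) i * nxt k q i)"
    if k: "k < N" for k
    using wronskian[OF seg(1)[OF k] seg(1)[OF k] node_in'(1)[OF k] node_in'(2)[OF k], of z "nxt k q" z "nxt k q'"]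
    by (simp add: seg(2,3)[OF k] sum_subtractf mult.commute)
  moreover have "(\<Sum>i<n. V k (blk k q) z (node k) i * blk k q' i) = (\<Sum>i<n. V k (blk k q') z (node k) i * blk k q i)"
    if k: "k < N" for k
    using wronskian[OF seg(1)[OF k] seg(1)[OF k] node_in'(1)[OF k] node_in'(2)[OF k], of "blk k q" z "blk k q'" z]
    by (simp add: seg(2,3)[OF k] sum_subtractf mult.commute)
  ultimately show ?thesis unfolding Df_def jump_def by (simp add: sum_subtractf)
qed

text \<open>The start value is divided by y in the end velocity, and the end value is multiplied by
  y in the start velocity. Up to the factors \<open>y ^ Suc k\<close> and \<open>y ^ k\<close> these
  are the velocities of one piece, with the k-th and (k+1)-st node values scaled by
  \<open>y ^ k\<close> and \<open>y ^ Suc k\<close>. This is why a null vector of \<open>M y\<close>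
  can be glued to a solution.\<close>

lemma twisted_form:
  assumes "y \<noteq> 0"
  shows "Df q' q + y * Bf q' q + Bf q q' / y = jump (\<lambda>k. V k (\<lambda>i. blk k q i / y) (nxt k q) (node (Suc k)))
     (\<lambda>k. V k (blk k q) (\<lambda>i. y * nxt k q i) (node k)) q'"
proof -
  have "jump (\<lambda>k. V k (\<lambda>i. blk k q i / y) (nxt k q) (node (Suc k))) (\<lambda>k. V k (blk k q) (\<lambda>i. y * nxt k q i) (node k)) q'
      = 1 * jump (\<lambda>k i. V k z (nxt k q) (node (Suc k)) i + 1 / y * V k (blk k q) z (node (Suc k)) i) (\<lambda>k. V k (blk k q) z (node k)) q'
        + y * Bf q' q"
    unfolding Bf_def
  proof (rule jump_lincomb_fg)
    fix k i assume k: "k < N" and i: "i < n"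
    have "V k (\<lambda>i. blk k q i / y) (nxt k q) (node (Suc k)) i = 1 * V k z (nxt k q) (node (Suc k)) i + 1 / y * V k (blk k q) z (node (Suc k)) i"
      by (rule seg_lincomb[OF k node_in'(2)[OF k] i]) (simp_all add: assms)
    then show "V k (\<lambda>i. blk k q i / y) (nxt k q) (node (Suc k)) i
        = 1 * (V k z (nxt k q) (node (Suc k)) i + 1 / y * V k (blk k q) z (node (Suc k)) i) + y * z i" by simp
    show "V k (blk k q) (\<lambda>i. y * nxt k q i) (node k) i = 1 * V k (blk k q) z (node k) i + y * V k z (nxt k q) (node k) i"
      by (rule seg_lincomb[OF k node_in'(1)[OF k] i]) simp_all
  qed
  also have "jump (\<lambda>k i. V k z (nxt k q) (node (Suc k)) i + 1 / y * V k (blk k q) z (node (Suc k)) i) (\<lambda>k. V k (blk k q) z (node k)) q'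
      = 1 * Df q' q + 1 / y * Bf q q'"
    unfolding Bf_transpose Df_def by (rule jump_lincomb_fg) simp_all
  finally show ?thesis by simp
qed

lemma form_sum_right:
  assumes "bilinear F"
  shows "(\<Sum>j<m. F q' (unit_fun j) * q j) = F q' (\<lambda>j. if j < m then q j else 0)"
proof -
  have lin: "linear (F q')" using assms by (simp add: bilinear_def)
  have "F q' (\<Sum>j<m. q j *\<^sub>R unit_fun j) = (\<Sum>j<m. F q' (unit_fun j) * q j)"
    by (simp add: linear_sum[OF lin] linear_scale[OF lin] mult.commute)
  then show ?thesis by (simp add: sum_unit_fun)
qed

lemma form_sum_left:
  assumes "bilinear F"
  shows "(\<Sum>i<m. F (unit_fun i) q * q' i) = F (\<lambda>j. if j < m then q' j else 0) q"
proof -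
  have lin: "linear (\<lambda>x. F x q)" using assms by (simp add: bilinear_def)
  have "F (\<Sum>j<m. q' j *\<^sub>R unit_fun j) q = (\<Sum>j<m. F (unit_fun j) q * q' j)"
    by (simp add: linear_sum[OF lin] linear_scale[OF lin] mult.commute)
  then show ?thesis by (simp add: sum_unit_fun)
qed

definition Bm where "Bm i j = Bf (unit_fun i) (unit_fun j)"
definition Dm where "Dm i j = Df (unit_fun i) (unit_fun j)"
definition M where "M y i j = Dm i j + y * Bm i j + Bm j i / y"

lemma M_row:
  "(\<Sum>j<m. M y i j * q j) = Df (unit_fun i) q' + y * Bf (unit_fun i) q' + Bf q' (unit_fun i) / y"
  if "q' = (\<lambda>j. if j < m then q j else 0)" for q'
proof -
  have "(\<Sum>j<m. M y i j * q j) = (\<Sum>j<m. Df (unit_fun i) (unit_fun j) * q j)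
      + y * (\<Sum>j<m. Bf (unit_fun i) (unit_fun j) * q j) + (\<Sum>j<m. Bf (unit_fun j) (unit_fun i) * q j) / y"
    unfolding sum_distrib_left sum_divide_distrib sum.distrib[symmetric]
    by (intro sum.cong refl) (simp add: M_def Dm_def Bm_def algebra_simps)
  then show ?thesis by (simp only: form_sum_right[OF bilinear_Df] form_sum_right[OF bilinear_Bf] form_sum_left[OF bilinear_Bf] that)
qed

text \<open>The values at all N + 1 nodes; the last one is imposed by the boundary condition, as in
  \<open>nxt\<close>.\<close>

definition seq :: "(nat \<Rightarrow> real) \<Rightarrow> nat \<Rightarrow> nat \<Rightarrow> real" where
  "seq q k i = (if k < N then blk k q i else (\<Sum>l<n. A l i * q l))"

lemma seq_simps: "k < N \<Longrightarrow> seq q k i = blk k q i" "k < N \<Longrightarrow> seq q (Suc k) i = nxt k q i"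
  by (auto simp: seq_def nxt_def)

lemma A_seq_N: "i < n \<Longrightarrow> (\<Sum>l<n. A i l * seq q N l) = seq q 0 i"
proof -
  assume i: "i < n"
  have "(\<Sum>l<n. A i l * seq q N l) = (\<Sum>j<n. (\<Sum>l<n. A i l * A j l) * q j)"
    unfolding sum_distrib_right by (subst sum.swap) (simp add: seq_def sum_distrib_left mult_ac)
  also have "\<dots> = (\<Sum>j<n. (if i = j then 1 else 0) * q j)" by (rule sum.cong) (use AAt i in auto)
  finally show ?thesis using i N0 by (simp add: seq_def blk_def if_distrib[of "\<lambda>x. x * _"] cong: if_cong)
qed

lemma seq_zero:
  assumes "\<And>k i. k < N \<Longrightarrow> i < n \<Longrightarrow> seq q k i = 0" "l < m"
  shows "q l = 0"
proof -
  have "0 < n" using assms(2) unfolding m_def by (cases "n = 0") simp_all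
  then have "l div n < N" "l mod n < n" using assms(2) by (simp_all add: m_def less_mult_imp_div_less)
  then show ?thesis using assms(1)[of "l div n" "l mod n"] by (simp add: seq_def blk_def)
qed

lemma last_node: "N - 1 < N" "Suc (N - 1) = N" "node (Suc (N - 1)) = T"
  using N0 node_N by simp_all

text \<open>The rows of the equation for a null vector say that the pieces through the values
  \<open>y ^ k * seq q k i\<close> have matching velocities. They glue to a solution whose data at
  T, brought back by A, are \<open>y ^ N\<close> times its data at 0, and \<open>y ^ N\<close>
  exceeds 1.\<close>

lemma M_nonsingular:
  assumes y: "1 < y"
    and hyperbolic: "\<And>u v x. sol u v \<Longrightarrow> 1 < x \<Longrightarrow> \<forall>i<n. (\<Sum>j<n. A i j * u T j) = x * u 0 i \<Longrightarrow>
      \<forall>i<n. (\<Sum>j<n. A i j * v T j) = x * v 0 i \<Longrightarrow> \<forall>t\<in>{0..T}. \<forall>i<n. u t i = 0"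
  shows "fdet m (M y) \<noteq> 0"
  unfolding fdet_nonzero_iff
proof (intro allI impI)
  fix q0 l assume q0: "\<forall>i<m. (\<Sum>j<m. M y i j * q0 j) = 0" and l: "l < m"
  define q where "q = (\<lambda>j. if j < m then q0 j else 0)"
  define f where "f k = V k (\<lambda>i. blk k q i / y) (nxt k q) (node (Suc k))" for k
  define g where "g k = V k (blk k q) (\<lambda>i. y * nxt k q i) (node k)" for k
  have "jump f g (unit_fun i) = 0" if "i < m" for i
    using q0[rule_format, OF that] M_row[OF q_def] twisted_form[of y "unit_fun i" q] y by (simp add: f_def[abs_def] g_def[abs_def])
  then have "\<forall>i<N * n. jump f g (unit_fun i) = 0" by (simp add: m_def)
  note J = jump_zero[OF this]
  define x where "x k i = y ^ k * seq q k i" for k i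
  have Vf: "V k (x k) (x (Suc k)) (node (Suc k)) i = y ^ Suc k * f k i" if "k < N" "i < n" for k i
  proof -
    have "V k (x k) (x (Suc k)) (node (Suc k)) i = y ^ Suc k * f k i + 0 * V k z z (node (Suc k)) i"
      unfolding f_def by (rule seg_lincomb[OF that(1) node_in'(2)[OF that(1)] that(2)]) (use y that in \<open>simp_all add: x_def seq_simps\<close>)
    then show ?thesis by simp
  qed
  have Vg: "V k (x k) (x (Suc k)) (node k) i = y ^ k * g k i" if "k < N" "i < n" for k i
  proof -
    have "V k (x k) (x (Suc k)) (node k) i = y ^ k * g k i + 0 * V k z z (node k) i"
      unfolding g_def by (rule seg_lincomb[OF that(1) node_in'(1)[OF that(1)] that(2)]) (use y that in \<open>simp_all add: x_def seq_simps\<close>)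
    then show ?thesis by simp
  qed
  have match: "V k (x k) (x (Suc k)) (node (Suc k)) i = V (Suc k) (x (Suc k)) (x (Suc (Suc k))) (node (Suc k)) i"
    if "Suc k < N" "i < n" for k i
    using J(1)[OF that(2,1)] Vf[of k i] Vg[of "Suc k" i] that by simp
  obtain u v where uv: "sol u v" "\<And>k i. k \<le> N \<Longrightarrow> i < n \<Longrightarrow> u (node k) i = x k i"
    "\<And>i. i < n \<Longrightarrow> v 0 i = V 0 (x 0) (x 1) 0 i" "\<And>i. i < n \<Longrightarrow> v T i = V (N - 1) (x (N - 1)) (x N) T i"
    using glue[of x, OF match] by blast
  have v0: "v 0 i = g 0 i" if "i < n" for i using uv(3)[OF that] Vg[OF N0 that] node_0 by simp
  have vT: "v T i = y ^ N * f (N - 1) i" if "i < n" for i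
    using uv(4)[OF that] Vf[OF last_node(1) that] last_node by simp
  have "\<forall>t\<in>{0..T}. \<forall>i<n. u t i = 0"
  proof (rule hyperbolic[OF uv(1), of "y ^ N"])
    show "1 < y ^ N" using y N0 by simp
    show "\<forall>i<n. (\<Sum>j<n. A i j * u T j) = y ^ N * u 0 i"
    proof (intro allI impI)
      fix i assume i: "i < n"
      have "(\<Sum>j<n. A i j * u T j) = (\<Sum>j<n. y ^ N * (A i j * seq q N j))"
        by (rule sum.cong) (use uv(2)[of N] node_N in \<open>simp_all add: x_def\<close>)
      also have "\<dots> = y ^ N * seq q 0 i" unfolding sum_distrib_left[symmetric] A_seq_N[OF i] ..
      also have "seq q 0 i = u 0 i" using uv(2)[of 0] node_0 i by (simp add: x_def)
      finally show "(\<Sum>j<n. A i j * u T j) = y ^ N * u 0 i" .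
    qed
    show "\<forall>i<n. (\<Sum>j<n. A i j * v T j) = y ^ N * v 0 i"
    proof (intro allI impI)
      fix i assume i: "i < n"
      have "(\<Sum>j<n. A i j * v T j) = (\<Sum>j<n. y ^ N * (A i j * f (N - 1) j))"
        by (rule sum.cong) (simp_all add: vT)
      then show "(\<Sum>j<n. A i j * v T j) = y ^ N * v 0 i"
        unfolding sum_distrib_left[symmetric] J(2)[OF i] v0[OF i] .
    qed
  qed
  then have xz: "x k i = 0" if "k < N" "i < n" for k i
    using uv(2)[of k i] that node_in[of k] by simp
  have "q l = 0" by (rule seq_zero[OF _ l]) (use y xz in \<open>simp add: x_def\<close>)
  then show "q0 l = 0" using l by (simp add: q_def)
qed

text \<open>The construction for \<open>M y\<close>, differentiated at y = 1. There B minus its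
  transpose is the derivative of \<open>M y\<close>, and r plays the part of the derivative of the
  null vector q. Differentiating \<open>y ^ N\<close> gives the constant N of the chain.\<close>

lemma M_no_jordan_chain:
  assumes chain: "\<And>u v u' v' c. sol u v \<Longrightarrow> sol u' v' \<Longrightarrow> c \<noteq> 0 \<Longrightarrow>
      \<forall>i<n. (\<Sum>j<n. A i j * u T j) = u 0 i \<Longrightarrow> \<forall>i<n. (\<Sum>j<n. A i j * v T j) = v 0 i \<Longrightarrow>
      \<forall>i<n. (\<Sum>j<n. A i j * u' T j) = u' 0 i + c * u 0 i \<Longrightarrow> \<forall>i<n. (\<Sum>j<n. A i j * v' T j) = v' 0 i + c * v 0 i \<Longrightarrow>
      \<forall>t\<in>{0..T}. \<forall>i<n. u t i = 0"
    and q0: "\<forall>i<m. (\<Sum>j<m. M 1 i j * q0 j) = 0"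
    and r0: "\<forall>i<m. (\<Sum>j<m. M 1 i j * r0 j) + (\<Sum>j<m. (Bm i j - Bm j i) * q0 j) = 0"
  shows "\<forall>l<m. q0 l = 0"
proof (intro allI impI)
  fix l assume l: "l < m"
  define q where "q = (\<lambda>j. if j < m then q0 j else 0)"
  define r where "r = (\<lambda>j. if j < m then r0 j else 0)"
  define f where "f p k = V k (blk k p) (nxt k p) (node (Suc k))" for p k
  define g where "g p k = V k (blk k p) (nxt k p) (node k)" for p k
  have M1: "Df (unit_fun i) p + Bf (unit_fun i) p + Bf p (unit_fun i) = jump (f p) (g p) (unit_fun i)" for p i
    using twisted_form[of 1 "unit_fun i" p] by (simp add: f_def[abs_def] g_def[abs_def])
  have "jump (f q) (g q) (unit_fun i) = 0" if "i < m" for i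
    using q0[rule_format, OF that] M_row[OF q_def, of 1 i] M1[of i q] by simp
  then have "\<forall>i<N * n. jump (f q) (g q) (unit_fun i) = 0" by (simp add: m_def)
  note J = jump_zero[OF this]
  \<comment> \<open>F and G are the derivatives at y = 1 of the twisted end and start velocities.
    The minus sign in F comes from differentiating the start value divided by y.\<close>
  define F where "F k i = f r k i - V k (blk k q) z (node (Suc k)) i" for k i
  define G where "G k i = g r k i + V k z (nxt k q) (node k) i" for k i
  have "jump F G (unit_fun i) = 0" if i: "i < m" for i
  proof -
    have "(\<Sum>j<m. (Bm i j - Bm j i) * q0 j) = Bf (unit_fun i) q - Bf q (unit_fun i)"
      unfolding q_def form_sum_right[OF bilinear_Bf, symmetric] form_sum_left[OF bilinear_Bf, symmetric]
      by (simp add: Bm_def left_diff_distrib sum_subtractf)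
    then have "jump (f r) (g r) (unit_fun i) + (Bf (unit_fun i) q - Bf q (unit_fun i)) = 0"
      using r0[rule_format, OF i] M_row[OF r_def, of 1 i] M1[of i r] by simp
    moreover have "jump F G (unit_fun i) = 1 * jump (f r) (g r) (unit_fun i)
        + (-1) * jump (\<lambda>k. V k (blk k q) z (node (Suc k))) (\<lambda>k i. - V k z (nxt k q) (node k) i) (unit_fun i)"
      by (rule jump_lincomb_fg) (simp_all add: F_def G_def)
    moreover have "jump (\<lambda>k. V k (blk k q) z (node (Suc k))) (\<lambda>k i. - V k z (nxt k q) (node k) i) (unit_fun i)
        = 1 * Bf q (unit_fun i) + (-1) * Bf (unit_fun i) q"
      unfolding Bf_transpose[of q] unfolding Bf_def by (rule jump_lincomb_fg) simp_all
    ultimately show ?thesis by simp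
  qed
  then have "\<forall>i<N * n. jump F G (unit_fun i) = 0" by (simp add: m_def)
  note J' = jump_zero[OF this]
  define x where "x k i = seq q k i" for k i
  \<comment> \<open>The derivative at y = 1 of \<open>y ^ k\<close> times the k-th node value, when
    q moves in the direction r.\<close>
  define w where "w k i = seq r k i + real k * seq q k i" for k i
  have Vf: "V k (x k) (x (Suc k)) (node (Suc k)) i = f q k i" and Vg: "V k (x k) (x (Suc k)) (node k) i = g q k i"
    if k: "k < N" and i: "i < n" for k i
  proof -
    note s = seg_lincomb(2)[OF k node_in'(2)[OF k] i, of "x k" 1 "blk k q" 0 z "x (Suc k)" "nxt k q" z]
    note s' = seg_lincomb(2)[OF k node_in'(1)[OF k] i, of "x k" 1 "blk k q" 0 z "x (Suc k)" "nxt k q" z]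
    show "V k (x k) (x (Suc k)) (node (Suc k)) i = f q k i" "V k (x k) (x (Suc k)) (node k) i = g q k i"
      using s s' k by (simp_all add: x_def seq_simps f_def g_def)
  qed
  have Wf: "V k (w k) (w (Suc k)) (node (Suc k)) i = F k i + real (Suc k) * f q k i" if k: "k < N" and i: "i < n" for k i
  proof -
    note t = node_in'(2)[OF k]
    have "V k (\<lambda>i. 1 * blk k r i + (-1) * blk k q i) (\<lambda>i. 1 * nxt k r i + (-1) * z i) (node (Suc k)) i = 1 * f r k i + (-1) * V k (blk k q) z (node (Suc k)) i"
      unfolding f_def by (rule seg_lincomb[OF k t i refl refl])
    then have F: "F k i = V k (\<lambda>i. 1 * blk k r i + (-1) * blk k q i) (\<lambda>i. 1 * nxt k r i + (-1) * z i) (node (Suc k)) i"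
      by (simp add: F_def)
    have "V k (w k) (w (Suc k)) (node (Suc k)) i = 1 * F k i + real (Suc k) * f q k i"
      unfolding F f_def by (rule seg_lincomb[OF k t i]) (use k in \<open>simp_all add: w_def seq_simps algebra_simps\<close>)
    then show ?thesis by simp
  qed
  have Wg: "V k (w k) (w (Suc k)) (node k) i = G k i + real k * g q k i" if k: "k < N" and i: "i < n" for k i
  proof -
    note t = node_in'(1)[OF k]
    have "V k (\<lambda>i. 1 * blk k r i + 1 * z i) (\<lambda>i. 1 * nxt k r i + 1 * nxt k q i) (node k) i = 1 * g r k i + 1 * V k z (nxt k q) (node k) i"
      unfolding g_def by (rule seg_lincomb[OF k t i refl refl])
    then have G: "G k i = V k (\<lambda>i. 1 * blk k r i + 1 * z i) (\<lambda>i. 1 * nxt k r i + 1 * nxt k q i) (node k) i"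
      by (simp add: G_def)
    have "V k (w k) (w (Suc k)) (node k) i = 1 * G k i + real k * g q k i"
      unfolding G g_def by (rule seg_lincomb[OF k t i]) (use k in \<open>simp_all add: w_def seq_simps algebra_simps\<close>)
    then show ?thesis by simp
  qed
  have match: "V k (x k) (x (Suc k)) (node (Suc k)) i = V (Suc k) (x (Suc k)) (x (Suc (Suc k))) (node (Suc k)) i"
    if "Suc k < N" "i < n" for k i
    using J(1)[OF that(2,1)] Vf[of k i] Vg[of "Suc k" i] that by simp
  have match': "V k (w k) (w (Suc k)) (node (Suc k)) i = V (Suc k) (w (Suc k)) (w (Suc (Suc k))) (node (Suc k)) i"
    if "Suc k < N" "i < n" for k i
    using J(1)[OF that(2,1)] J'(1)[OF that(2,1)] Wf[of k i] Wg[of "Suc k" i] that by simp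
  obtain u v where uv: "sol u v" "\<And>k i. k \<le> N \<Longrightarrow> i < n \<Longrightarrow> u (node k) i = x k i"
    "\<And>i. i < n \<Longrightarrow> v 0 i = V 0 (x 0) (x 1) 0 i" "\<And>i. i < n \<Longrightarrow> v T i = V (N - 1) (x (N - 1)) (x N) T i"
    using glue[of x, OF match] by blast
  obtain u' v' where uv': "sol u' v'" "\<And>k i. k \<le> N \<Longrightarrow> i < n \<Longrightarrow> u' (node k) i = w k i"
    "\<And>i. i < n \<Longrightarrow> v' 0 i = V 0 (w 0) (w 1) 0 i" "\<And>i. i < n \<Longrightarrow> v' T i = V (N - 1) (w (N - 1)) (w N) T i"
    using glue[of w, OF match'] by blast
  have v0: "v 0 i = g q 0 i" "v' 0 i = G 0 i" if "i < n" for i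
    using uv(3)[OF that] uv'(3)[OF that] Vg[OF N0 that] Wg[OF N0 that] node_0 by simp_all
  have vT: "v T i = f q (N - 1) i" "v' T i = F (N - 1) i + N * f q (N - 1) i" if "i < n" for i
    using uv(4)[OF that] uv'(4)[OF that] Vf[OF last_node(1) that] Wf[OF last_node(1) that] last_node by simp_all
  have u0: "u 0 i = seq q 0 i" "u' 0 i = seq r 0 i" if "i < n" for i
    using uv(2)[of 0 i] uv'(2)[of 0 i] that node_0 by (simp_all add: x_def w_def)
  have uT: "u T i = seq q N i" "u' T i = seq r N i + N * seq q N i" if "i < n" for i
    using uv(2)[of N i] uv'(2)[of N i] that node_N by (simp_all add: x_def w_def)
  have "\<forall>t\<in>{0..T}. \<forall>i<n. u t i = 0"
  proof (rule chain[OF uv(1) uv'(1), of "real N"], goal_cases)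
    case 1 show ?case using N0 by simp
  next
    case 2 show ?case using A_seq_N by (simp add: u0 uT)
  next
    case 3 show ?case using J(2) by (simp add: v0 vT)
  next
    case 4 show ?case using A_seq_N by (simp add: u0 uT distrib_left sum.distrib mult.left_commute flip: sum_distrib_left)
  next
    case 5 show ?case using J(2) J'(2) by (simp add: v0 vT distrib_left sum.distrib mult.left_commute flip: sum_distrib_left)
  qed
  then have xz: "x k i = 0" if "k < N" "i < n" for k i
    using uv(2)[of k i] that node_in[of k] by simp
  have "q l = 0" by (rule seq_zero[OF _ l]) (use xz in \<open>simp add: x_def\<close>)
  then show "q0 l = 0" using l by (simp add: q_def)
qed

end

section \<open>The sign of the determinant of the coupling matrix\<close>

context broken_problem
begin

text \<open>A nonzero end value forces a nonzero initial velocity, to which the estimate on short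
  intervals applies.\<close>

lemma seg_positive:
  assumes k: "k < N" and y: "i0 < n" "y i0 \<noteq> 0"
  shows "0 < (\<Sum>i<n. V k z y (node k) i * y i)"
proof -
  note s = seg[OF k, where x = z and y = y]
  have "\<exists>i<n. V k z y (node k) i \<noteq> 0"
  proof (rule ccontr)
    assume "\<not> ?thesis"
    then have v: "V k z y (node k) i = 0" if "i < n" for i using that by blast
    have "U k z y (node (Suc k)) i0 = 0"
      by (rule jacobi_sol_unique(1)[OF less_imp_le[OF T] Rcont s(1) node_in'(1)[OF k] s(2) v node_in'(2)[OF k] y(1)])
    then show False using s(3)[OF y(1)] y(2) by simp
  qed
  then obtain i where "i < n" "V k z y (node k) i \<noteq> 0" by blast
  then have "0 < (\<Sum>i<n. V k z y (node k) i * U k z y (node (Suc k)) i)"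
    using node_short[OF k] by (intro jacobi_sol_short_positive[OF s(1) _ _ _ Rbound C0 _ s(2)]) auto
  then show ?thesis using s(3) by simp
qed

text \<open>The coupling with the identity in place of the map from end value to initial velocity.
  Both maps have a positive pairing with every nonzero argument, so all their convex combinations
  are injective.\<close>

definition Zf where "Zf q' q = jump (\<lambda>k. z) (\<lambda>k. nxt k q) q'"

lemma bilinear_Zf: "bilinear Zf"
proof (rule bilinear_if_lincomb)
  fix q r s :: "nat \<Rightarrow> real" and a b :: real
  show "Zf q (\<lambda>i. a * r i + b * s i) = a * Zf q r + b * Zf q s"
    unfolding Zf_def by (rule jump_lincomb_fg) (simp_all add: nxt_lincomb)
  show "Zf (\<lambda>i. a * r i + b * s i) q = a * Zf r q + b * Zf s q"
    unfolding Zf_def by (rule jump_lincomb)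
qed

lemma Zf_unit:
  assumes i: "i < m"
  shows "Zf (unit_fun i) q = - nxt (i div n) q (i mod n)"
proof -
  have n: "0 < n" using i unfolding m_def by (cases "n = 0") simp_all
  have k: "i div n < N" using i by (simp add: m_def less_mult_imp_div_less)
  have b: "blk k (unit_fun i) i' = (if k = i div n \<and> i' = i mod n then 1 else 0)" if "i' < n" for k i'
    using index_eq_iff[OF that mod_less_divisor[OF n], of k "i div n" i] by (simp add: blk_def unit_fun_def)
  have "Zf (unit_fun i) q = - (\<Sum>k<N. \<Sum>i'<n. nxt k q i' * blk k (unit_fun i) i')"
    by (simp add: Zf_def jump_def sum_negf)
  also have "(\<Sum>k<N. \<Sum>i'<n. nxt k q i' * blk k (unit_fun i) i')
      = (\<Sum>k<N. \<Sum>i'<n. if i' = i mod n then (if k = i div n then nxt k q i' else 0) else 0)"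
    by (intro sum.cong refl) (auto simp: b)
  also have "\<dots> = nxt (i div n) q (i mod n)" using n k by simp
  finally show ?thesis .
qed

text \<open>\<open>Bm\<close> is deformed to minus the twisted block shift, whose determinant is known because \<open>N\<close> is odd.\<close>

lemma sgn_det_Bm: "sgn (fdet m Bm) = (-1) ^ n * sgn (fdet n A)"
proof -
  define c where "c \<tau> i j = (1 - \<tau>) * Bm i j + \<tau> * Zf (unit_fun i) (unit_fun j)" for \<tau> i j
  have "sgn (fdet m (c 0)) = sgn (fdet m (c 1))"
  proof (rule sgn_fdet_const[where S = "{0..1}" and M = c])
    show "continuous_on {0..1} (\<lambda>s. c s i j)" for i j unfolding c_def by (intro continuous_intros)
    fix \<tau> :: real assume \<tau>: "\<tau> \<in> {0..1}"
    show "fdet m (c \<tau>) \<noteq> 0"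
      unfolding fdet_nonzero_iff
    proof (intro allI impI)
      fix q0 l assume q0: "\<forall>i<m. (\<Sum>j<m. c \<tau> i j * q0 j) = 0" and l: "l < m"
      define q where "q = (\<lambda>j. if j < m then q0 j else 0)"
      define g where "g k i = (1 - \<tau>) * V k z (nxt k q) (node k) i + \<tau> * nxt k q i" for k i
      have "jump (\<lambda>k. z) g (unit_fun i) = 0" if "i < m" for i
      proof -
        have "jump (\<lambda>k. z) g (unit_fun i) = (1 - \<tau>) * Bf (unit_fun i) q + \<tau> * Zf (unit_fun i) q"
          unfolding Bf_def Zf_def by (rule jump_lincomb_fg) (simp_all add: g_def)
        also have "\<dots> = (\<Sum>j<m. c \<tau> i j * q0 j)"
          unfolding q_def form_sum_right[OF bilinear_Bf, symmetric] form_sum_right[OF bilinear_Zf, symmetric]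
            sum_distrib_left sum.distrib[symmetric]
          by (intro sum.cong refl) (simp add: c_def Bm_def algebra_simps)
        finally show ?thesis using q0 that by simp
      qed
      then have "\<forall>i<N * n. jump (\<lambda>k. z) g (unit_fun i) = 0" by (simp add: m_def)
      note J = jump_zero[OF this]
      \<comment> \<open>With zero end velocities the matching conditions annihilate the start
        velocities at all nodes; for node 0 this is the condition involving A.\<close>
      have g0: "g k i = 0" if "k < N" "i < n" for k i
      proof (cases k)
        case 0 then show ?thesis using J(2)[OF that(2)] by simp
      next
        case (Suc k') then show ?thesis using J(1)[OF that(2), of k'] that(1) by simp
      qed
      \<comment> \<open>The combination is paired with the node value itself. Both contributions are
        positive for a nonzero value, and the weights are nonnegative with sum 1.\<close>
      have nz: "nxt k q i = 0" if k: "k < N" and i: "i < n" for k i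
      proof (rule ccontr)
        assume ne: "nxt k q i \<noteq> 0"
        have "0 < (\<Sum>i<n. V k z (nxt k q) (node k) i * nxt k q i)" (is "0 < ?p") by (rule seg_positive[where y = "nxt k q", OF k i ne])
        moreover have "0 < (\<Sum>i<n. (nxt k q i)\<^sup>2)" (is "0 < ?s") by (rule sum_pos2[of _ i]) (use i ne in auto)
        moreover have "(1 - \<tau>) * ?p + \<tau> * ?s = (\<Sum>i<n. g k i * nxt k q i)"
          unfolding sum_distrib_left sum.distrib[symmetric]
          by (intro sum.cong refl) (simp add: g_def power2_eq_square algebra_simps)
        moreover have "\<dots> = 0" using g0[OF k] by simp
        moreover have "0 < (1 - \<tau>) * ?p + \<tau> * ?s"
        proof (cases "\<tau> = 0")
          case False
          then have "0 < \<tau> * ?s" "0 \<le> (1 - \<tau>) * ?p" using \<tau> calculation by auto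
          then show ?thesis by linarith
        qed (use calculation in simp)
        ultimately show False by linarith
      qed
      have s: "seq q (Suc k) i = 0" if "k < N" "i < n" for k i
        using nz[OF that] seq_simps(2)[OF that(1)] by simp
      \<comment> \<open>The values at the nodes 1, ..., N vanish; the value at node 0 is recovered
        from node N through A.\<close>
      have "seq q N i = 0" if "i < n" for i using s[OF last_node(1) that] last_node(2) by simp
      then have "seq q 0 i = 0" if "i < n" for i using A_seq_N[OF that, of q] by simp
      then have "seq q k i = 0" if "k < N" "i < n" for k i using s[of "k - 1" i] that by (cases k) simp_all
      then have "q l = 0" using seq_zero[OF _ l, of q] by blast
      then show "q0 l = 0" using l by (simp add: q_def)
    qed
  qed auto
  moreover have "c 0 = Bm" by (simp add: c_def fun_eq_iff)
  moreover have "fdet m (c 1) = (-1) ^ n * fdet n A"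
  proof -
    \<comment> \<open>Up to sign, the end point of the deformation is the rotation by one block
      times a block diagonal matrix. Its first block is A transposed, for the passage from the last
      segment back to node 0, and the others are identities.\<close>
    define rot where "rot i l = (if l = (i + n) mod (N * n) then 1 else (0::real))" for i l
    define W where "W i j = (if i < n then (if j < n then A j i else 0) else (if i = j then 1 else (0::real)))" for i j
    have "c 1 i j = (-1) * (\<Sum>l<m. rot i l * W l j)" if i: "i < m" and j: "j < m" for i j
    proof -
      have m0: "0 < m" using i by simp
      have n: "0 < n" using i unfolding m_def by (cases "n = 0") simp_all
      have k: "i div n < N" using i by (simp add: m_def less_mult_imp_div_less)
      have "(\<Sum>l<m. rot i l * W l j) = (\<Sum>l<m. if l = (i + n) mod m then W ((i + n) mod m) j else 0)"
        by (rule sum.cong) (auto simp: rot_def m_def)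
      also have "\<dots> = W ((i + n) mod m) j" using m0 by simp
      also have "\<dots> = nxt (i div n) (unit_fun j) (i mod n)"
      proof (cases "Suc (i div n) < N")
        case True
        have e: "Suc (i div n) * n + i mod n = i + n" by (metis add.commute add.left_commute div_mult_mod_eq mult_Suc)
        have "Suc (i div n) * n + i mod n < Suc (Suc (i div n)) * n"
          unfolding mult_Suc using mod_less_divisor[OF n, of i] by linarith
        also have "\<dots> \<le> N * n" using True by (intro mult_le_mono1) simp
        finally have "i + n < m" by (simp add: e m_def)
        moreover have "nxt (i div n) (unit_fun j) (i mod n) = unit_fun j (i + n)"
          using True e by (simp add: nxt_def blk_def)
        ultimately show ?thesis by (simp add: W_def unit_fun_def)
      next
        case False
        then have "Suc (i div n) = N" using k by simp
        then have "i + n = m + i mod n" unfolding m_def by (metis add.commute add.left_commute div_mult_mod_eq mult_Suc)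
        moreover have "i mod n < m" using mod_less_eq_dividend[of i n] i by linarith
        ultimately have "(i + n) mod m = i mod n" by simp
        moreover have "nxt (i div n) (unit_fun j) (i mod n) = (\<Sum>l<n. if l = j then A l (i mod n) else 0)"
        proof -
          have "nxt (i div n) (unit_fun j) (i mod n) = (\<Sum>l<n. A l (i mod n) * unit_fun j l)"
            using False by (simp add: nxt_def)
          also have "\<dots> = (\<Sum>l<n. if l = j then A l (i mod n) else 0)"
            by (rule sum.cong) (auto simp: unit_fun_def)
          finally show ?thesis .
        qed
        ultimately show ?thesis using mod_less_divisor[OF n, of i] by (simp add: W_def)
      qed
      finally show ?thesis using Zf_unit[OF i] by (simp add: c_def)
    qed
    then have "fdet m (c 1) = fdet m (\<lambda>i j. (-1) * (\<Sum>l<m. rot i l * W l j))" by (intro fdet_cong)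
    also have "\<dots> = (-1) ^ m * (fdet m rot * fdet m W)"
      unfolding fdet_scale_rows[of m "\<lambda>_. -1"] fdet_mult by simp
    also have "fdet m rot = 1" unfolding rot_def m_def by (rule fdet_block_rotation[OF N])
    also have "fdet m W = fdet n A"
    proof -
      have "m = n + (N - 1) * n" using N0 unfolding m_def by (cases N) simp_all
      then show ?thesis unfolding W_def using fdet_block_identity[of n "(N - 1) * n" "\<lambda>i j. A j i"] fdet_transpose[of n A] by simp
    qed
    also have "(-1) ^ m = ((-1) ^ n :: real)" unfolding m_def power_mult using N by simp
    finally show ?thesis by simp
  qed
  moreover have "sgn ((-1) ^ n :: real) = (-1) ^ n" by (cases "even n") simp_all
  ultimately show ?thesis by (simp add: sgn_mult)
qed

end

section \<open>The index form\<close>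

text \<open>The integrals over the pieces of a division vanish, so the bound of Henstock's lemma is
  a bound for the Riemann sums of |f| themselves.\<close>

lemma has_integral_abs_zero:
  fixes f :: "real \<Rightarrow> real"
  assumes f: "f integrable_on {a..b}"
    and zero: "\<And>c d. c \<le> d \<Longrightarrow> {c..d} \<subseteq> {a..b} \<Longrightarrow> integral {c..d} f = 0"
  shows "((\<lambda>x. \<bar>f x\<bar>) has_integral 0) {a..b}"
proof -
  have "((\<lambda>x. \<bar>f x\<bar>) has_integral 0) (cbox a b)"
    unfolding has_integral
  proof (intro allI impI)
    fix e :: real assume "0 < e"
    from f have f': "f integrable_on cbox a b" by simp
    obtain \<gamma> where \<gamma>: "gauge \<gamma>" "\<And>p. p tagged_partial_division_of cbox a b \<Longrightarrow> \<gamma> fine p \<Longrightarrow>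
        (\<Sum>(x,k)\<in>p. norm (measure lborel k *\<^sub>R f x - integral k f)) < e"
      using Henstock_lemma[OF f' \<open>0 < e\<close>] by blast
    show "\<exists>\<gamma>. gauge \<gamma> \<and> (\<forall>D. D tagged_division_of cbox a b \<and> \<gamma> fine D \<longrightarrow>
        norm ((\<Sum>(x,K)\<in>D. measure lborel K *\<^sub>R \<bar>f x\<bar>) - 0) < e)"
    proof (intro exI[of _ \<gamma>] conjI allI impI \<gamma>(1))
      fix D assume D: "D tagged_division_of cbox a b \<and> \<gamma> fine D"
      have "(\<Sum>(x,K)\<in>D. measure lborel K *\<^sub>R \<bar>f x\<bar>) = (\<Sum>(x,K)\<in>D. norm (measure lborel K *\<^sub>R f x - integral K f))"
      proof (intro sum.cong refl, clarify)
        fix x K assume xK: "(x, K) \<in> D"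
        then obtain c d where "K = cbox c d" "K \<subseteq> cbox a b" "x \<in> K"
          using D tagged_division_ofD(2-4) by metis
        then have "integral K f = 0" using zero[of c d] by auto
        then show "measure lborel K *\<^sub>R \<bar>f x\<bar> = norm (measure lborel K *\<^sub>R f x - integral K f)" by (simp add: abs_mult)
      qed
      also have "\<dots> < e" using \<gamma>(2)[of D] D tagged_division_of_def by blast
      finally have "(\<Sum>(x,K)\<in>D. measure lborel K *\<^sub>R \<bar>f x\<bar>) < e" .
      moreover have "0 \<le> (\<Sum>(x,K)\<in>D. measure lborel K *\<^sub>R \<bar>f x\<bar>)" by (intro sum_nonneg) auto
      ultimately show "norm ((\<Sum>(x,K)\<in>D. measure lborel K *\<^sub>R \<bar>f x\<bar>) - 0) < e" by simp
    qed
  qed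
  then show ?thesis by simp
qed

text \<open>Square integrability on a bounded interval gives integrability, since |w| is at most 1 +
  w^2. The Lebesgue integrals become gauge integrals, in which the calculus below is carried
  out.\<close>

lemma weak_deriv_facts:
  assumes T: "0 \<le> T" and w: "is_weak_deriv T f w"
  shows "w absolutely_integrable_on {0..T}" "(\<lambda>t. (w t)\<^sup>2) absolutely_integrable_on {0..T}"
    "\<And>a b. a \<in> {0..T} \<Longrightarrow> b \<in> {0..T} \<Longrightarrow> a \<le> b \<Longrightarrow> (w has_integral (f b - f a)) {a..b}"
    "continuous_on {0..T} f"
proof -
  have w1: "w \<in> borel_measurable (lebesgue_on {0..T})" and w2: "integrable (lebesgue_on {0..T}) (\<lambda>t. (w t)\<^sup>2)"
    and w3: "\<And>t. t \<in> {0..T} \<Longrightarrow> f t = f 0 + integral\<^sup>L (lebesgue_on {0..t}) w"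
    using w unfolding is_weak_deriv_def by blast+
  have one: "integrable (lebesgue_on {0..T}) (\<lambda>t. 1 :: real)"
    by (simp add: integrable_restrict_space[symmetric] integrable_on_const absolutely_integrable_imp_integrable
        absolutely_integrable_continuous_real)
  have i1: "integrable (lebesgue_on {0..T}) w"
  proof (rule Bochner_Integration.integrable_bound[OF Bochner_Integration.integrable_add[OF one w2] w1])
    have "\<bar>w t\<bar> \<le> 1 + (w t)\<^sup>2" for t
    proof -
      have "2 * \<bar>w t\<bar> \<le> 1 + (w t)\<^sup>2" using sum_squares_bound[of 1 "\<bar>w t\<bar>"] by simp
      then show ?thesis by linarith
    qed
    then show "AE x in lebesgue_on {0..T}. norm (w x) \<le> norm (1 + (w x)\<^sup>2)" by simp
  qed
  have ai: "g absolutely_integrable_on {0..T}" if "integrable (lebesgue_on {0..T}) g" for g :: "real \<Rightarrow> real"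
    using that by (simp add: integrable_restrict_space set_integrable_def)
  show a1: "w absolutely_integrable_on {0..T}" and "(\<lambda>t. (w t)\<^sup>2) absolutely_integrable_on {0..T}"
    using ai i1 w2 by blast+
  have wi: "w integrable_on {c..d}" if "{c..d} \<subseteq> {0..T}" for c d
    by (rule integrable_on_subinterval[OF set_lebesgue_integral_eq_integral(1)[OF a1] that])
  have ft: "f t = f 0 + integral {0..t} w" if t: "t \<in> {0..T}" for t
  proof -
    have "w absolutely_integrable_on {0..t}"
      by (rule absolutely_integrable_on_subinterval[OF a1]) (use t in auto)
    then have "integrable (lebesgue_on {0..t}) w" by (simp add: integrable_restrict_space set_integrable_def)
    then show ?thesis using w3[OF t] by (simp add: lebesgue_integral_eq_integral)
  qed
  show "(w has_integral (f b - f a)) {a..b}" if "a \<in> {0..T}" "b \<in> {0..T}" "a \<le> b" for a b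
  proof -
    have "integral {0..a} w + integral {a..b} w = integral {0..b} w"
      by (rule Henstock_Kurzweil_Integration.integral_combine) (use that wi in auto)
    then have "integral {a..b} w = f b - f a" using ft[OF that(1)] ft[OF that(2)] by linarith
    then show ?thesis using integrable_integral[OF wi[of a b]] that by simp
  qed
  have "continuous_on {0..T} (\<lambda>t. f 0 + integral {0..t} w)"
    by (intro continuous_intros indefinite_integral_continuous_1 wi) simp
  then show "continuous_on {0..T} f"
    by (rule continuous_on_eq) (rule ft[symmetric])
qed

text \<open>Two weak derivatives have the same integral over every subinterval. The index form is
  written with a chosen one, and this shows that the choice matters only on a null set.\<close>

lemma weak_deriv_AE_unique:
  assumes T: "0 \<le> T" and w: "is_weak_deriv T f w" and w': "is_weak_deriv T f w'"
  shows "AE t in lebesgue_on {0..T}. w t = w' t"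
proof -
  let ?d = "\<lambda>t. w t - w' t"
  note F = weak_deriv_facts[OF T w] and F' = weak_deriv_facts[OF T w']
  have ad: "?d absolutely_integrable_on {0..T}" using F(1) F'(1) by (rule set_integral_diff)
  have "((\<lambda>t. \<bar>?d t\<bar>) has_integral 0) {0..T}"
  proof (rule has_integral_abs_zero)
    show "?d integrable_on {0..T}" using ad by (rule set_lebesgue_integral_eq_integral(1))
    fix c d :: real assume "c \<le> d" "{c..d} \<subseteq> {0..T}"
    then have "c \<in> {0..T}" "d \<in> {0..T}" by auto
    then have "(?d has_integral (f d - f c) - (f d - f c)) {c..d}"
      using \<open>c \<le> d\<close> by (intro has_integral_diff F(3) F'(3))
    then show "integral {c..d} ?d = 0" by (simp add: integral_unique)
  qed
  then have "integral {0..T} (\<lambda>t. \<bar>?d t\<bar>) = 0" by (rule integral_unique)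
  moreover have int: "integrable (lebesgue_on {0..T}) (\<lambda>t. \<bar>?d t\<bar>)"
    using ad by (simp add: integrable_restrict_space set_integrable_def integrable_abs_iff)
  ultimately have "integral\<^sup>L (lebesgue_on {0..T}) (\<lambda>t. \<bar>?d t\<bar>) = 0"
    by (simp add: lebesgue_integral_eq_integral)
  then have "AE t in lebesgue_on {0..T}. \<bar>?d t\<bar> = 0"
    using integral_nonneg_eq_0_iff_AE[OF int] by simp
  then show ?thesis by eventually_elim simp
qed

text \<open>Since f is only absolutely continuous, a product rule at every point is not at hand.
  Instead the defect G of the formula has increments bounded by a multiple of (d - c) (W d - W c),
  where W is the continuous primitive of |w|. So G has derivative zero at every point, not merely
  almost everywhere.\<close>

lemma integration_by_parts_weak:
  fixes f w \<phi> \<phi>' :: "real \<Rightarrow> real"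
  assumes ab: "a \<le> b" and w: "w absolutely_integrable_on {a..b}"
    and f: "\<And>c d. a \<le> c \<Longrightarrow> c \<le> d \<Longrightarrow> d \<le> b \<Longrightarrow> (w has_integral (f d - f c)) {c..d}"
    and \<phi>: "\<And>t. t \<in> {a..b} \<Longrightarrow> (\<phi> has_real_derivative \<phi>' t) (at t within {a..b})"
    and \<phi>': "continuous_on {a..b} \<phi>'"
  shows "((\<lambda>t. w t * \<phi> t + f t * \<phi>' t) has_integral (f b * \<phi> b - f a * \<phi> a)) {a..b}"
proof -
  have c\<phi>: "continuous_on {a..b} \<phi>" by (rule DERIV_continuous_on[OF \<phi>])
  have wi: "w integrable_on {c..d}" if "a \<le> c" "d \<le> b" for c d
  proof (cases "c \<le> d")
    case True then show ?thesis using f[of c d] that by blast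
  qed (simp add: integrable_on_empty)
  have "continuous_on {a..b} (\<lambda>t. f a + integral {a..t} w)"
    by (intro continuous_intros indefinite_integral_continuous_1 wi) auto
  then have cf: "continuous_on {a..b} f"
    by (rule continuous_on_eq) (use integral_unique[OF f[OF order_refl]] in auto)
  define W where "W t = integral {a..t} (\<lambda>s. \<bar>w s\<bar>)" for t
  have aw: "(\<lambda>s. \<bar>w s\<bar>) integrable_on {c..d}" if "a \<le> c" "d \<le> b" for c d
  proof -
    have "w absolutely_integrable_on {c..d}" by (rule absolutely_integrable_on_subinterval[OF w]) (use that in auto)
    then show ?thesis by (auto simp: absolutely_integrable_on_def)
  qed
  have cW: "continuous_on {a..b} W"
    unfolding W_def by (intro indefinite_integral_continuous_1 aw) auto
  have Wd: "integral {c..d} (\<lambda>s. \<bar>w s\<bar>) = W d - W c" if "a \<le> c" "c \<le> d" "d \<le> b" for c d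
    using Henstock_Kurzweil_Integration.integral_combine[of a c d "\<lambda>s. \<bar>w s\<bar>"] that aw by (simp add: W_def)
  have fd: "\<bar>f d - f c\<bar> \<le> W d - W c" if "a \<le> c" "c \<le> d" "d \<le> b" for c d
    using integral_norm_bound_integral[OF wi aw, of c d] that integral_unique[OF f[OF that]] Wd[OF that] by simp
  obtain L where L: "\<And>t. t \<in> {a..b} \<Longrightarrow> \<bar>\<phi>' t\<bar> \<le> L"
    using compact_continuous_image[OF \<phi>' compact_Icc] by (force dest!: compact_imp_bounded simp: bounded_iff)
  have L0: "0 \<le> L" using L[of a] ab by (meson abs_ge_zero atLeastAtMost_iff order_refl order_trans)
  have \<phi>d: "\<bar>\<phi> d - \<phi> c\<bar> \<le> (d - c) * L" if "a \<le> c" "c \<le> d" "d \<le> b" for c d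
    by (rule deriv_within_bound[OF that(2), where f' = \<phi>'])
      (use that in \<open>auto intro!: L has_field_derivative_subset[OF \<phi>]\<close>)
  have wphi: "(\<lambda>s. w s * \<phi> s) absolutely_integrable_on {a..b}"
  proof -
    have "(\<lambda>s. \<phi> s * w s) absolutely_integrable_on {a..b}"
      by (rule absolutely_integrable_bounded_measurable_product_real)
        (use c\<phi> w in \<open>auto intro!: continuous_imp_measurable_on_sets_lebesgue compact_imp_bounded compact_continuous_image\<close>)
    then show ?thesis by (simp add: mult.commute)
  qed
  let ?g = "\<lambda>t. w t * \<phi> t + f t * \<phi>' t"
  have fi: "(\<lambda>t. f t * \<phi>' t) integrable_on {a..b}"
    by (intro integrable_continuous_real continuous_intros cf \<phi>')
  have gi: "?g integrable_on {a..b}"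
    using set_lebesgue_integral_eq_integral(1)[OF wphi] fi by (rule integrable_add)
  have gi': "?g integrable_on {c..d}" if "a \<le> c" "d \<le> b" for c d
    by (rule integrable_on_subinterval[OF gi]) (use that in auto)
  define G where "G t = integral {a..t} ?g - f t * \<phi> t" for t
  have Gb: "\<bar>G d - G c\<bar> \<le> 2 * L * (d - c) * (W d - W c)" if cd: "a \<le> c" "c \<le> d" "d \<le> b" for c d
  proof -
    \<comment> \<open>Freezing \<phi> at the right end and f at the left end makes the subtracted
      terms add up to the increment of f \<phi>. In both summands that remain, a factor has been
      replaced by its small deviation, which makes the integral of second order.\<close>
    let ?h = "\<lambda>r. w r * (\<phi> r - \<phi> d) + (f r - f c) * \<phi>' r"
    have 1: "(?g has_integral integral {c..d} ?g) {c..d}" using gi'[of c d] cd by (simp add: has_integral_integral)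
    have 2: "(w has_integral (f d - f c)) {c..d}" by (rule f[OF cd])
    have 3: "(\<phi>' has_integral (\<phi> d - \<phi> c)) {c..d}"
      by (rule fundamental_theorem_of_calculus[OF cd(2)])
        (use cd in \<open>auto simp: has_real_derivative_iff_has_vector_derivative[symmetric] intro!: has_field_derivative_subset[OF \<phi>]\<close>)
    have 4: "((\<lambda>r. ?g r - \<phi> d * w r - f c * \<phi>' r) has_integral
        integral {c..d} ?g - \<phi> d * (f d - f c) - f c * (\<phi> d - \<phi> c)) {c..d}"
      by (intro has_integral_diff has_integral_mult_right 1 2 3)
    have 5: "(\<lambda>r. ?g r - \<phi> d * w r - f c * \<phi>' r) = ?h" by (simp add: fun_eq_iff algebra_simps)
    have "integral {a..c} ?g + integral {c..d} ?g = integral {a..d} ?g"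
      by (rule Henstock_Kurzweil_Integration.integral_combine[OF cd(1,2) gi']) (use cd in auto)
    then have 6: "integral {c..d} ?g - \<phi> d * (f d - f c) - f c * (\<phi> d - \<phi> c) = G d - G c"
      unfolding G_def by (simp only: algebra_simps)
    have h: "(?h has_integral (G d - G c)) {c..d}"
      using 4 unfolding 5 6 .
    have k: "((\<lambda>r. (d - c) * L * \<bar>w r\<bar> + (W d - W c) * L) has_integral
        (d - c) * L * (W d - W c) + (d - c) *\<^sub>R ((W d - W c) * L)) {c..d}"
    proof (intro has_integral_add)
      have "((\<lambda>r. \<bar>w r\<bar>) has_integral W d - W c) {c..d}"
        using integrable_integral[OF aw[of c d]] cd unfolding Wd[OF cd] by simp
      then show "((\<lambda>r. (d - c) * L * \<bar>w r\<bar>) has_integral (d - c) * L * (W d - W c)) {c..d}"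
        by (rule has_integral_mult_right)
      show "((\<lambda>r. (W d - W c) * L) has_integral (d - c) *\<^sub>R ((W d - W c) * L)) {c..d}"
        using has_integral_const_real[of "(W d - W c) * L" c d] cd(2) by simp
    qed
    have hk: "norm (?h r) \<le> (d - c) * L * \<bar>w r\<bar> + (W d - W c) * L" if r: "r \<in> {c..d}" for r
    proof -
      have "\<bar>\<phi> r - \<phi> d\<bar> \<le> (d - c) * L"
      proof -
        have "\<bar>\<phi> d - \<phi> r\<bar> \<le> (d - r) * L" using \<phi>d[of r d] r cd by auto
        also have "\<dots> \<le> (d - c) * L" using r L0 by (intro mult_right_mono) auto
        finally show ?thesis by (simp add: abs_minus_commute)
      qed
      then have A: "\<bar>w r * (\<phi> r - \<phi> d)\<bar> \<le> \<bar>w r\<bar> * ((d - c) * L)" by (simp add: abs_mult mult_left_mono)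
      have "\<bar>f r - f c\<bar> \<le> W d - W c"
      proof -
        have "\<bar>f r - f c\<bar> \<le> W r - W c" using fd[of c r] r cd by auto
        moreover have "0 \<le> W d - W r" using fd[of r d] r cd abs_ge_zero[of "f d - f r"] by (meson atLeastAtMost_iff order_trans)
        ultimately show ?thesis by linarith
      qed
      then have B: "\<bar>(f r - f c) * \<phi>' r\<bar> \<le> (W d - W c) * L"
        unfolding abs_mult using L[of r] r cd by (intro mult_mono) auto
      have "\<bar>?h r\<bar> \<le> \<bar>w r * (\<phi> r - \<phi> d)\<bar> + \<bar>(f r - f c) * \<phi>' r\<bar>" by (rule abs_triangle_ineq)
      then show ?thesis using A B by (simp add: mult_ac)
    qed
    have "norm (integral {c..d} ?h) \<le> integral {c..d} (\<lambda>r. (d - c) * L * \<bar>w r\<bar> + (W d - W c) * L)"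
      by (rule integral_norm_bound_integral[OF has_integral_integrable[OF h] has_integral_integrable[OF k] hk])
    then show ?thesis unfolding integral_unique[OF h] integral_unique[OF k] by (simp add: algebra_simps)
  qed
  have "(G has_real_derivative 0) (at t within {a..b})" if t: "t \<in> {a..b}" for t
    unfolding has_field_derivative_iff
  proof (rule Lim_null_comparison)
    have "((\<lambda>s. 2 * L * \<bar>W s - W t\<bar>) \<longlongrightarrow> 2 * L * \<bar>W t - W t\<bar>) (at t within {a..b})"
      using cW t by (intro tendsto_intros) (auto simp: continuous_on_def)
    then show "((\<lambda>s. 2 * L * \<bar>W s - W t\<bar>) \<longlongrightarrow> 0) (at t within {a..b})" by simp
    show "\<forall>\<^sub>F s in at t within {a..b}. norm ((G s - G t) / (s - t)) \<le> 2 * L * \<bar>W s - W t\<bar>"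
      unfolding eventually_at
    proof (intro exI[of _ 1] conjI ballI impI)
      fix s assume s: "s \<in> {a..b}" "s \<noteq> t \<and> dist s t < 1"
      have "\<bar>G s - G t\<bar> \<le> \<bar>s - t\<bar> * (2 * L * \<bar>W s - W t\<bar>)"
      proof (cases "s \<le> t")
        case True
        then have st: "a \<le> s" "s \<le> t" "t \<le> b" using s t by auto
        have "2 * L * (t - s) * (W t - W s) \<le> 2 * L * (t - s) * \<bar>W s - W t\<bar>"
          using L0 True by (intro mult_left_mono) auto
        moreover have "\<bar>s - t\<bar> * (2 * L * \<bar>W s - W t\<bar>) = 2 * L * (t - s) * \<bar>W s - W t\<bar>"
          using True by simp
        ultimately show ?thesis using Gb[OF st] abs_minus_commute[of "G s" "G t"] by linarith
      next
        case False
        then have st: "a \<le> t" "t \<le> s" "s \<le> b" using s t by auto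
        have "2 * L * (s - t) * (W s - W t) \<le> 2 * L * (s - t) * \<bar>W s - W t\<bar>"
          using L0 False by (intro mult_left_mono) auto
        moreover have "\<bar>s - t\<bar> * (2 * L * \<bar>W s - W t\<bar>) = 2 * L * (s - t) * \<bar>W s - W t\<bar>"
          using False by simp
        ultimately show ?thesis using Gb[OF st] by linarith
      qed
      then show "norm ((G s - G t) / (s - t)) \<le> 2 * L * \<bar>W s - W t\<bar>"
        using s by (simp add: abs_divide divide_le_eq mult.commute)
    qed simp
  qed
  then have "G b = G a"
    using has_field_derivative_zero_constant[of "{a..b}" G] ab by fastforce
  then have "integral {a..b} ?g = f b * \<phi> b - f a * \<phi> a" by (simp add: G_def)
  then show ?thesis using gi by (metis has_integral_integral)
qed

section \<open>Solutions minimise the index form on short intervals\<close>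

context jacobi_problem
begin

abbreviation potential :: "(real \<Rightarrow> nat \<Rightarrow> real) \<Rightarrow> real \<Rightarrow> real" where
  "potential u t \<equiv> (\<Sum>i<n. (\<Sum>j<n. R t i j * u t j) * u t i)"

lemma potential_bound:
  assumes "t \<in> {0..T}"
  shows "\<bar>potential u t\<bar> \<le> n * C * (\<Sum>i<n. (u t i)\<^sup>2)"
proof -
  have "\<bar>potential u t\<bar> = \<bar>\<Sum>i<n. \<Sum>j<n. R t i j * u t j * u t i\<bar>" by (simp add: sum_distrib_right)
  also have "\<dots> \<le> (\<Sum>i<n. \<Sum>j<n. C * (((u t i)\<^sup>2 + (u t j)\<^sup>2) / 2))"
  proof (rule order_trans[OF sum_abs sum_mono], rule order_trans[OF sum_abs sum_mono])
    fix i j assume ij: "i \<in> {..<n}" "j \<in> {..<n}"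
    have "\<bar>u t j\<bar> * \<bar>u t i\<bar> \<le> ((u t i)\<^sup>2 + (u t j)\<^sup>2) / 2"
      using sum_squares_bound[of "\<bar>u t i\<bar>" "\<bar>u t j\<bar>"] by (simp add: mult_ac)
    then have "\<bar>R t i j\<bar> * (\<bar>u t j\<bar> * \<bar>u t i\<bar>) \<le> C * (((u t i)\<^sup>2 + (u t j)\<^sup>2) / 2)"
      using Rbound[OF assms] ij C0 by (intro mult_mono) auto
    then show "\<bar>R t i j * u t j * u t i\<bar> \<le> C * (((u t i)\<^sup>2 + (u t j)\<^sup>2) / 2)" by (simp add: abs_mult mult.assoc)
  qed
  also have "\<dots> = n * C * (\<Sum>i<n. (u t i)\<^sup>2)"
    by (simp add: sum_distrib_left[symmetric] sum_divide_distrib[symmetric] sum.distrib)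
  finally show ?thesis .
qed

lemma potential_continuous:
  assumes "\<And>i. i < n \<Longrightarrow> continuous_on S (\<lambda>t. u t i)" "S \<subseteq> {0..T}"
  shows "continuous_on S (potential u)"
  by (intro continuous_intros assms(1) continuous_on_subset[OF Rcont assms(2)]) auto

text \<open>For z = u - \<beta>, which vanishes at both ends, the index form of u is the form of z
  plus a boundary term, because \<beta> solves the equation. The form of z is nonnegative by a
  Poincare inequality on the short interval.\<close>

lemma segment_minimal:
  assumes sol: "sol \<beta> \<beta>'" and ab: "0 \<le> a" "a < b" "b \<le> T" and small: "n * C * (b - a)\<^sup>2 \<le> 1"
    and w: "\<And>i. i < n \<Longrightarrow> w i absolutely_integrable_on {a..b}" "\<And>i. i < n \<Longrightarrow> (\<lambda>t. (w i t)\<^sup>2) integrable_on {a..b}"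
    and u: "\<And>i c d. i < n \<Longrightarrow> a \<le> c \<Longrightarrow> c \<le> d \<Longrightarrow> d \<le> b \<Longrightarrow> (w i has_integral (u d i - u c i)) {c..d}"
    and ends: "\<And>i. i < n \<Longrightarrow> u a i = \<beta> a i" "\<And>i. i < n \<Longrightarrow> u b i = \<beta> b i"
    and cu: "\<And>i. i < n \<Longrightarrow> continuous_on {a..b} (\<lambda>t. u t i)"
  shows "(\<Sum>i<n. u b i * \<beta>' b i - u a i * \<beta>' a i) \<le> integral {a..b} (\<lambda>t. (\<Sum>i<n. (w i t)\<^sup>2) + potential u t)"
proof -
  have sub: "{a..b} \<subseteq> {0..T}" using ab by auto
  note d = sol_deriv[OF sol]
  have d': "((\<lambda>s. \<beta> s i) has_real_derivative \<beta>' t i) (at t within {a..b})"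
    "((\<lambda>s. \<beta>' s i) has_real_derivative (\<Sum>j<n. R t i j * \<beta> t j)) (at t within {a..b})" if "i < n" "t \<in> {a..b}" for i t
    using d[of t i] that sub by (auto intro: has_field_derivative_subset)
  have c\<beta>: "continuous_on {a..b} (\<lambda>t. \<beta> t i)" "continuous_on {a..b} (\<lambda>t. \<beta>' t i)" if "i < n" for i
    by (rule DERIV_continuous_on, rule d', use that in auto)+
  have cR\<beta>: "continuous_on {a..b} (\<lambda>t. \<Sum>j<n. R t i j * \<beta> t j)" if "i < n" for i
    by (intro continuous_intros continuous_on_subset[OF Rcont sub] c\<beta> that) auto
  let ?z = "\<lambda>t i. u t i - \<beta> t i" and ?\<zeta> = "\<lambda>i t. w i t - \<beta>' t i"
  have \<beta>int: "((\<lambda>t. \<beta>' t i) has_integral (\<beta> q i - \<beta> p i)) {p..q}" if "i < n" "a \<le> p" "p \<le> q" "q \<le> b" for i p q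
    by (rule fundamental_theorem_of_calculus[OF that(3)])
      (use that in \<open>auto simp: has_real_derivative_iff_has_vector_derivative[symmetric] intro!: has_field_derivative_subset[OF d'(1)]\<close>)
  have w\<beta>: "(\<lambda>t. w i t * \<beta>' t i) integrable_on {a..b}" if i: "i < n" for i
  proof -
    have "(\<lambda>t. \<beta>' t i * w i t) absolutely_integrable_on {a..b}"
      by (rule absolutely_integrable_bounded_measurable_product_real)
        (use c\<beta>[OF i] w(1)[OF i] in \<open>auto intro!: continuous_imp_measurable_on_sets_lebesgue compact_imp_bounded compact_continuous_image\<close>)
    then show ?thesis using set_lebesgue_integral_eq_integral(1) by (simp add: mult.commute)
  qed
  have \<beta>2: "(\<lambda>t. (\<beta>' t i)\<^sup>2) integrable_on {a..b}" if "i < n" for i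
    by (intro integrable_continuous_real continuous_intros c\<beta> that)
  have \<zeta>2: "(\<lambda>t. (?\<zeta> i t)\<^sup>2) integrable_on {a..b}" if i: "i < n" for i
  proof -
    have "(\<lambda>t. 2 * (w i t * \<beta>' t i)) integrable_on {a..b}"
      using integrable_on_cmult_left[OF w\<beta>[OF i], of 2] by simp
    then have "(\<lambda>t. (w i t)\<^sup>2 - 2 * (w i t * \<beta>' t i) + (\<beta>' t i)\<^sup>2) integrable_on {a..b}"
      by (intro integrable_add integrable_diff w(2) \<beta>2 i)
    moreover have "(\<lambda>t. (?\<zeta> i t)\<^sup>2) = (\<lambda>t. (w i t)\<^sup>2 - 2 * (w i t * \<beta>' t i) + (\<beta>' t i)\<^sup>2)"
      by (simp add: fun_eq_iff power2_diff)
    ultimately show ?thesis by simp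
  qed
  define En where "En i = integral {a..b} (\<lambda>t. (?\<zeta> i t)\<^sup>2)" for i
  have \<zeta>int: "(?\<zeta> i has_integral ?z t i) {a..t}" if "i < n" "t \<in> {a..b}" for i t
    using has_integral_diff[OF u[OF that(1), of a t] \<beta>int[OF that(1), of a t]] that ends(1)[OF that(1)] by simp
  have poincare: "(?z t i)\<^sup>2 \<le> (b - a) * En i" if i: "i < n" and t: "t \<in> {a..b}" for i t
  proof (cases "t = a")
    case True
    have "0 \<le> En i" unfolding En_def by (rule integral_nonneg[OF \<zeta>2[OF i]]) simp
    then show ?thesis using True ends(1)[OF i] ab by simp
  next
    case False
    then have ta: "0 < t - a" using t by simp
    \<comment> \<open>The mean slope. Expanding the nonnegative integral of (\<zeta> - c)^2 gives
      the Cauchy-Schwarz bound of the squared increment by (t - a) times the energy.\<close>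
    define c where "c = ?z t i / (t - a)"
    have i2: "(\<lambda>s. (?\<zeta> i s)\<^sup>2) integrable_on {a..t}" by (rule integrable_on_subinterval[OF \<zeta>2[OF i]]) (use t in auto)
    have A: "((\<lambda>s. (?\<zeta> i s)\<^sup>2 - 2 * c * ?\<zeta> i s + c\<^sup>2) has_integral
        integral {a..t} (\<lambda>s. (?\<zeta> i s)\<^sup>2) - 2 * c * ?z t i + (t - a) *\<^sub>R c\<^sup>2) {a..t}"
    proof (intro has_integral_add has_integral_diff)
      show "((\<lambda>s. 2 * c * ?\<zeta> i s) has_integral 2 * c * ?z t i) {a..t}"
        by (rule has_integral_mult_right[OF \<zeta>int[OF i t]])
      show "((\<lambda>s. c\<^sup>2) has_integral (t - a) *\<^sub>R c\<^sup>2) {a..t}"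
        using has_integral_const_real[of "c\<^sup>2" a t] ta by simp
    qed (rule integrable_integral[OF i2])
    have B: "(\<lambda>s. (?\<zeta> i s)\<^sup>2 - 2 * c * ?\<zeta> i s + c\<^sup>2) = (\<lambda>s. (?\<zeta> i s - c)\<^sup>2)"
      by (rule ext) (simp add: power2_eq_square algebra_simps)
    have "0 \<le> integral {a..t} (\<lambda>s. (?\<zeta> i s)\<^sup>2) - 2 * c * ?z t i + (t - a) *\<^sub>R c\<^sup>2"
      by (rule has_integral_nonneg[OF A[unfolded B]]) simp
    moreover have "(t - a) *\<^sub>R c\<^sup>2 = c * ?z t i" using ta by (simp add: c_def power2_eq_square)
    moreover have "integral {a..t} (\<lambda>s. (?\<zeta> i s)\<^sup>2) \<le> En i"
      unfolding En_def by (rule integral_subset_le[OF _ i2 \<zeta>2[OF i]]) (use t in auto)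
    ultimately have "c * ?z t i \<le> En i" by linarith
    then have "(t - a) * (c * ?z t i) \<le> (t - a) * En i" using ta by (intro mult_left_mono) auto
    moreover have "(t - a) * (c * ?z t i) = (?z t i)\<^sup>2" using ta by (simp add: c_def power2_eq_square)
    moreover have "(t - a) * En i \<le> (b - a) * En i"
      using t unfolding En_def by (intro mult_right_mono integral_nonneg \<zeta>2 i) auto
    ultimately show ?thesis by linarith
  qed
  have potz: "potential ?z integrable_on {a..b}"
    by (rule integrable_continuous_real, rule potential_continuous[OF _ sub]) (intro continuous_intros cu c\<beta>)
  have resid: "0 \<le> integral {a..b} (\<lambda>t. (\<Sum>i<n. (?\<zeta> i t)\<^sup>2) + potential ?z t)"
  proof -
    \<comment> \<open>A pointwise bound for the potential of z. Its integral over the segment is n C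
      (b - a)^2 times the total energy, hence at most that energy.\<close>
    let ?k = "n * C * (\<Sum>i<n. (b - a) * En i)"
    have s\<zeta>: "((\<lambda>t. \<Sum>i<n. (?\<zeta> i t)\<^sup>2) has_integral (\<Sum>i<n. En i)) {a..b}"
      unfolding En_def by (intro has_integral_sum integrable_integral \<zeta>2) auto
    have k: "((\<lambda>t. ?k) has_integral (b - a) *\<^sub>R ?k) {a..b}"
      using has_integral_const_real[of ?k a b] ab by simp
    have "(\<Sum>i<n. En i) - (b - a) *\<^sub>R ?k \<le> integral {a..b} (\<lambda>t. (\<Sum>i<n. (?\<zeta> i t)\<^sup>2) + potential ?z t)"
    proof (rule has_integral_le[OF has_integral_diff[OF s\<zeta> k]])
      show "((\<lambda>t. (\<Sum>i<n. (?\<zeta> i t)\<^sup>2) + potential ?z t) has_integral integral {a..b} (\<lambda>t. (\<Sum>i<n. (?\<zeta> i t)\<^sup>2) + potential ?z t)) {a..b}"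
        by (intro integrable_integral integrable_add potz has_integral_integrable[OF s\<zeta>])
      fix t assume t: "t \<in> {a..b}"
      have "\<bar>potential ?z t\<bar> \<le> n * C * (\<Sum>i<n. (?z t i)\<^sup>2)" by (rule potential_bound) (use t sub in auto)
      also have "\<dots> \<le> ?k" using C0 by (intro mult_left_mono sum_mono poincare t) auto
      finally show "(\<Sum>i<n. (?\<zeta> i t)\<^sup>2) - ?k \<le> (\<Sum>i<n. (?\<zeta> i t)\<^sup>2) + potential ?z t" by linarith
    qed
    moreover have "(b - a) *\<^sub>R ?k \<le> (\<Sum>i<n. En i)"
    proof -
      have "(b - a) *\<^sub>R ?k = (n * C * (b - a)\<^sup>2) * (\<Sum>i<n. En i)"
        unfolding sum_distrib_left[symmetric] by (simp add: power2_eq_square)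
      also have "\<dots> \<le> 1 * (\<Sum>i<n. En i)"
        using small by (intro mult_right_mono sum_nonneg) (auto simp: En_def intro!: integral_nonneg \<zeta>2)
      finally show ?thesis by simp
    qed
    ultimately show ?thesis by linarith
  qed
  define X where "X = (\<Sum>i<n. u b i * \<beta>' b i - u a i * \<beta>' a i)"
  have cross: "((\<lambda>t. \<Sum>i<n. w i t * \<beta>' t i + u t i * (\<Sum>j<n. R t i j * \<beta> t j)) has_integral X) {a..b}"
    unfolding X_def
    by (intro has_integral_sum integration_by_parts_weak less_imp_le[OF ab(2)] w(1) u d'(2) cR\<beta>) auto
  have self: "((\<lambda>t. \<Sum>i<n. \<beta>' t i * \<beta>' t i + \<beta> t i * (\<Sum>j<n. R t i j * \<beta> t j)) has_integral X) {a..b}"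
    unfolding X_def
  proof (intro has_integral_sum)
    fix i assume "i \<in> {..<n}"
    then have i: "i < n" by simp
    have "((\<lambda>t. \<beta>' t i * \<beta>' t i + \<beta> t i * (\<Sum>j<n. R t i j * \<beta> t j)) has_integral \<beta> b i * \<beta>' b i - \<beta> a i * \<beta>' a i) {a..b}"
      by (rule integration_by_parts_weak[OF less_imp_le[OF ab(2)] absolutely_integrable_continuous_real[OF c\<beta>(2)[OF i]] \<beta>int[OF i] d'(2)[OF i] cR\<beta>[OF i]])
    then show "((\<lambda>t. \<beta>' t i * \<beta>' t i + \<beta> t i * (\<Sum>j<n. R t i j * \<beta> t j)) has_integral u b i * \<beta>' b i - u a i * \<beta>' a i) {a..b}"
      using ends i by simp
  qed simp
  have resi: "(\<lambda>t. (\<Sum>i<n. (?\<zeta> i t)\<^sup>2) + potential ?z t) integrable_on {a..b}"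
    by (intro integrable_add potz integrable_sum \<zeta>2) auto
  \<comment> \<open>The polarised identity I(u) = I(z) + 2 I(u, \<beta>) - I(\<beta>). The mixed and
    the pure term both equal the boundary term X.\<close>
  have "((\<lambda>t. ((\<Sum>i<n. (?\<zeta> i t)\<^sup>2) + potential ?z t) + 2 * (\<Sum>i<n. w i t * \<beta>' t i + u t i * (\<Sum>j<n. R t i j * \<beta> t j))
      - (\<Sum>i<n. \<beta>' t i * \<beta>' t i + \<beta> t i * (\<Sum>j<n. R t i j * \<beta> t j))) has_integral
      (integral {a..b} (\<lambda>t. (\<Sum>i<n. (?\<zeta> i t)\<^sup>2) + potential ?z t) + 2 * X - X)) {a..b}"
    by (intro has_integral_add has_integral_diff has_integral_mult_right integrable_integral[OF resi] cross self)
  moreover have "((\<Sum>i<n. (?\<zeta> i t)\<^sup>2) + potential ?z t) + 2 * (\<Sum>i<n. w i t * \<beta>' t i + u t i * (\<Sum>j<n. R t i j * \<beta> t j))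
      - (\<Sum>i<n. \<beta>' t i * \<beta>' t i + \<beta> t i * (\<Sum>j<n. R t i j * \<beta> t j)) = (\<Sum>i<n. (w i t)\<^sup>2) + potential u t"
    if t: "t \<in> {a..b}" for t
  proof -
    let ?P = "\<lambda>x y. \<Sum>i<n. \<Sum>j<n. R t i j * x j * y i"
    have Psym: "?P x y = ?P y x" for x y :: "nat \<Rightarrow> real"
    proof -
      have "?P x y = (\<Sum>j<n. \<Sum>i<n. R t i j * x j * y i)" by (rule sum.swap)
      also have "\<dots> = ?P y x" by (intro sum.cong refl) (use t sub Rsym in \<open>auto simp: mult_ac\<close>)
      finally show ?thesis .
    qed
    have 1: "potential u t = ?P (u t) (u t)" by (simp add: sum_distrib_right)
    have 2: "(\<Sum>i<n. x i * (\<Sum>j<n. R t i j * y j)) = ?P y x" for x y :: "nat \<Rightarrow> real" by (simp add: sum_distrib_left mult_ac)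
    have 3: "potential ?z t = ?P (u t) (u t) - ?P (\<beta> t) (u t) - ?P (u t) (\<beta> t) + ?P (\<beta> t) (\<beta> t)"
      unfolding sum_distrib_right sum_subtractf[symmetric] sum.distrib[symmetric]
      by (intro sum.cong refl) (simp add: algebra_simps)
    have 4: "(\<Sum>i<n. (?\<zeta> i t)\<^sup>2) = (\<Sum>i<n. (w i t)\<^sup>2) - 2 * (\<Sum>i<n. w i t * \<beta>' t i) + (\<Sum>i<n. \<beta>' t i * \<beta>' t i)"
      by (simp add: power2_eq_square algebra_simps sum.distrib sum_subtractf sum_distrib_left)
    have arith: "(W - 2 * X + B) + (p - q - r + s) + 2 * (X + q) - (B + s) = W + p" if "r = q"
      for W X B p q r s :: real using that by simp
    show ?thesis
      unfolding sum.distrib 1 2 3 4 by (rule arith[OF Psym])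
  qed
  ultimately have "((\<lambda>t. (\<Sum>i<n. (w i t)\<^sup>2) + potential u t) has_integral
      (integral {a..b} (\<lambda>t. (\<Sum>i<n. (?\<zeta> i t)\<^sup>2) + potential ?z t) + 2 * X - X)) {a..b}"
    by (rule has_integral_eq[rotated])
  then have "integral {a..b} (\<lambda>t. (\<Sum>i<n. (w i t)\<^sup>2) + potential u t)
      = integral {a..b} (\<lambda>t. (\<Sum>i<n. (?\<zeta> i t)\<^sup>2) + potential ?z t) + 2 * X - X"
    by (rule integral_unique)
  then show ?thesis using resid by (simp add: X_def)
qed

text \<open>This frees the index form from the chosen weak derivative, so that the explicit
  derivative of a broken solution may be inserted.\<close>

lemma index_form_eq:
  assumes w: "\<And>i. i < n \<Longrightarrow> is_weak_deriv T (\<lambda>t. u t i) (w i)"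
  shows "index_form T n R u u = integral {0..T} (\<lambda>t. (\<Sum>i<n. (w i t)\<^sup>2) + potential u t)"
    and "(\<lambda>t. (\<Sum>i<n. (w i t)\<^sup>2) + potential u t) integrable_on {0..T}"
proof -
  have T0: "0 \<le> T" using T by simp
  let ?F = "\<lambda>w t. (\<Sum>i<n. (w i t)\<^sup>2) + potential u t"
  define w' where "w' i = weak_deriv T (\<lambda>t. u t i)" for i
  have w': "is_weak_deriv T (\<lambda>t. u t i) (w' i)" if "i < n" for i
    unfolding w'_def weak_deriv_def by (rule someI[where P = "is_weak_deriv T (\<lambda>t. u t i)", OF w[OF that]])
  have "continuous_on {0..T} (potential u)"
    by (rule potential_continuous) (use weak_deriv_facts(4)[OF T0 w] in auto)
  then have pc: "potential u \<in> borel_measurable (lebesgue_on {0..T})" and pa: "potential u absolutely_integrable_on {0..T}"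
    by (auto intro: continuous_imp_measurable_on_sets_lebesgue absolutely_integrable_continuous_real)
  have meas: "?F v \<in> borel_measurable (lebesgue_on {0..T})" if "\<And>i. i < n \<Longrightarrow> is_weak_deriv T (\<lambda>t. u t i) (v i)" for v
    by (intro borel_measurable_add borel_measurable_sum borel_measurable_power pc) (use that in \<open>auto simp: is_weak_deriv_def\<close>)
  have "\<forall>i\<in>{..<n}. AE t in lebesgue_on {0..T}. w' i t = w i t"
    using weak_deriv_AE_unique[OF T0 w' w] by auto
  then have "AE t in lebesgue_on {0..T}. \<forall>i\<in>{..<n}. w' i t = w i t" by (simp add: AE_ball_countable)
  then have "AE t in lebesgue_on {0..T}. ?F w' t = ?F w t" by eventually_elim simp
  then have "integral\<^sup>L (lebesgue_on {0..T}) (?F w') = integral\<^sup>L (lebesgue_on {0..T}) (?F w)"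
    by (intro integral_cong_AE meas w w')
  moreover have "index_form T n R u u = integral\<^sup>L (lebesgue_on {0..T}) (?F w')"
    by (simp add: index_form_def w'_def power2_eq_square)
  moreover have abs: "?F w absolutely_integrable_on {0..T}"
    by (intro set_integral_add pa absolutely_integrable_sum weak_deriv_facts(2)[OF T0 w]) auto
  then have "integrable (lebesgue_on {0..T}) (?F w)" by (simp add: integrable_restrict_space set_integrable_def)
  ultimately show "index_form T n R u u = integral {0..T} (?F w)" by (simp add: lebesgue_integral_eq_integral)
  show "?F w integrable_on {0..T}" using abs by (rule set_lebesgue_integral_eq_integral(1))
qed

end

section \<open>Broken solutions as test functions\<close>

context broken_problem
begin

text \<open>The cut-off at N - 1 puts the end point T into the last segment.\<close>

definition piece :: "real \<Rightarrow> nat" where "piece t = min (nat \<lfloor>t / (T / N)\<rfloor>) (N - 1)"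

definition broken :: "(nat \<Rightarrow> real) \<Rightarrow> real \<Rightarrow> nat \<Rightarrow> real" where
  "broken q t i = (if t \<in> {0..T} \<and> i < n then U (piece t) (blk (piece t) q) (nxt (piece t) q) t i else 0)"

text \<open>Half-open segments make the summands disjoint. At T all of them vanish, which no
  integral notices.\<close>

definition broken_deriv :: "(nat \<Rightarrow> real) \<Rightarrow> nat \<Rightarrow> real \<Rightarrow> real" where
  "broken_deriv q i t = (\<Sum>k<N. indicator {node k..<node (Suc k)} t * V k (blk k q) (nxt k q) t i)"

lemma piece_less: "piece t < N" using N0 by (simp add: piece_def)

lemma TN: "0 < T / N" using T N0 by simp

lemma node_mono: "j \<le> k \<Longrightarrow> node j \<le> node k"
  unfolding node_def by (rule mult_right_mono) (use TN in auto)

lemma node_le_iff: "node k \<le> t \<longleftrightarrow> real k \<le> t / (T / N)"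
  unfolding node_def by (rule pos_le_divide_eq[OF TN, symmetric])

lemma less_node_iff: "t < node k \<longleftrightarrow> t / (T / N) < real k"
  using node_le_iff[of k t] by linarith

lemma piece_eq:
  assumes "k < N" "node k \<le> t" "t < node (Suc k)"
  shows "piece t = k"
proof -
  have "real k \<le> t / (T / N)" "t / (T / N) < real k + 1"
    using assms(2,3) unfolding node_le_iff less_node_iff by simp_all
  then have "\<lfloor>t / (T / N)\<rfloor> = int k" by (intro floor_unique) auto
  then show ?thesis using assms(1) by (simp add: piece_def)
qed

lemma piece_in:
  assumes "t \<in> {0..T}"
  shows "t \<in> {node (piece t)..node (Suc (piece t))}"
proof (cases "t = T")
  case True
  have "t / (T / N) = real N" using True T N0 by simp
  then have "piece t = N - 1" by (simp add: piece_def)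
  then show ?thesis using True last_node node_less[of "N - 1"] by simp
next
  case False
  define k where "k = nat \<lfloor>t / (T / N)\<rfloor>"
  have t0: "0 \<le> t / (T / N)" using assms TN by simp
  have "real k \<le> t / (T / N)" "t / (T / N) < real k + 1"
    using t0 unfolding k_def by (simp_all add: of_nat_nat)
  then have k: "node k \<le> t" "t < node (Suc k)"
    unfolding node_le_iff less_node_iff by simp_all
  have "k < N"
  proof (rule ccontr)
    assume "\<not> k < N"
    then have "node N \<le> node k" by (intro node_mono) simp
    then show False using k(1) node_N assms False by simp
  qed
  then show ?thesis using piece_eq[OF _ k] k by simp
qed

text \<open>At an inner node \<open>piece\<close> selects the later segment, but both adjacent
  pieces take the same value there, so closed segments are allowed.\<close>

lemma broken_seg:
  assumes k: "k < N" and t: "t \<in> {node k..node (Suc k)}" and i: "i < n"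
  shows "broken q t i = U k (blk k q) (nxt k q) t i"
proof -
  have tT: "t \<in> {0..T}" using t node_in'[OF k] by auto
  show ?thesis
  proof (cases "t < node (Suc k)")
    case True
    then show ?thesis using piece_eq[OF k _ True] t tT i by (simp add: broken_def)
  next
    case False
    then have te: "t = node (Suc k)" using t by simp
    show ?thesis
    proof (cases "Suc k < N")
      case True
      have "piece t = Suc k" using piece_eq[OF True] te node_less by simp
      then show ?thesis using tT i te True seg(2)[OF True i] seg(3)[OF k i] by (simp add: broken_def nxt_def)
    next
      case False
      then have N: "Suc k = N" using k by simp
      have "t / (T / N) = real N" using te T N0 by (simp add: N node_N)
      then have "piece t = k" using N by (simp add: piece_def)
      then show ?thesis using tT i by (simp add: broken_def)
    qed
  qed
qed

lemma broken_node: "k < N \<Longrightarrow> i < n \<Longrightarrow> broken q (node k) i = blk k q i"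
  "k < N \<Longrightarrow> i < n \<Longrightarrow> broken q (node (Suc k)) i = nxt k q i"
  using broken_seg[of k "node k"] broken_seg[of k "node (Suc k)"] seg(2,3)[of k i] node_less[of k] by auto

lemma broken_lincomb: "broken (\<lambda>l. a * q l + b * r l) t i = a * broken q t i + b * broken r t i"
proof (cases "t \<in> {0..T} \<and> i < n")
  case True
  have "U (piece t) (blk (piece t) (\<lambda>l. a * q l + b * r l)) (nxt (piece t) (\<lambda>l. a * q l + b * r l)) t i
    = a * U (piece t) (blk (piece t) q) (nxt (piece t) q) t i + b * U (piece t) (blk (piece t) r) (nxt (piece t) r) t i"
    using True by (intro seg_lincomb piece_less blk_lincomb nxt_lincomb) auto
  then show ?thesis using True by (simp add: broken_def)
qed (auto simp: broken_def)

lemma linear_broken: "linear broken"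
proof (rule linearI)
  fix q r :: "nat \<Rightarrow> real" and c :: real
  have 1: "q + r = (\<lambda>i. 1 * q i + 1 * r i)" and 2: "c *\<^sub>R q = (\<lambda>i. c * q i + 0 * q i)"
    by (simp_all add: fun_eq_iff scaleR_fun_def)
  show "broken (q + r) = broken q + broken r" "broken (c *\<^sub>R q) = c *\<^sub>R broken q"
    unfolding 1 2 fun_eq_iff broken_lincomb by (simp_all add: scaleR_fun_def)
qed

lemma broken_deriv_seg:
  assumes k: "k < N" and t: "t \<in> {node k..<node (Suc k)}"
  shows "broken_deriv q i t = V k (blk k q) (nxt k q) t i"
proof -
  have "indicator {node j..<node (Suc j)} t = (if j = k then 1 else 0 :: real)" for j
  proof -
    have "node (Suc j) \<le> node k" if "j < k" using that by (intro node_mono) simp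
    moreover have "node (Suc k) \<le> node j" if "k < j" using that by (intro node_mono) simp
    ultimately show ?thesis using t by (cases j k rule: linorder_cases) (auto simp: indicator_def)
  qed
  then show ?thesis using k by (simp add: broken_deriv_def if_distrib[of "\<lambda>x. x * _"] cong: if_cong)
qed

lemma V_cont: "k < N \<Longrightarrow> i < n \<Longrightarrow> continuous_on {0..T} (\<lambda>t. V k x y t i)"
  by (rule DERIV_continuous_on[OF sol_deriv(2)[OF seg(1)]])

lemma broken_deriv_int:
  assumes k: "k < N" and i: "i < n" and t: "t \<in> {node k..node (Suc k)}"
  shows "(broken_deriv q i has_integral (broken q t i - broken q (node k) i)) {node k..t}"
proof -
  have sub: "{node k..t} \<subseteq> {0..T}" using t node_in'[OF k] by auto
  have "((\<lambda>s. V k (blk k q) (nxt k q) s i) has_integral (U k (blk k q) (nxt k q) t i - U k (blk k q) (nxt k q) (node k) i)) {node k..t}"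
  proof (rule fundamental_theorem_of_calculus)
    show "node k \<le> t" using t by simp
    fix s assume "s \<in> {node k..t}"
    then show "((\<lambda>s. U k (blk k q) (nxt k q) s i) has_vector_derivative V k (blk k q) (nxt k q) s i) (at s within {node k..t})"
      unfolding has_real_derivative_iff_has_vector_derivative[symmetric]
      using has_field_derivative_subset[OF sol_deriv(1)[OF seg(1)[OF k] _ i] sub] sub by blast
  qed
  then have "(broken_deriv q i has_integral (U k (blk k q) (nxt k q) t i - U k (blk k q) (nxt k q) (node k) i)) {node k..t}"
    by (rule has_integral_spike_finite[where S = "{node (Suc k)}", rotated 2])
      (use t broken_deriv_seg[OF k] in auto)
  then show ?thesis using broken_seg[OF k _ i] t node_less[of k] by simp
qed

text \<open>The pieces agree at the nodes, so the integrals over the segments telescope to the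
  increment of the broken solution. Boundedness on [0,T] gives square integrability.\<close>

lemma broken_weak_deriv:
  assumes i: "i < n"
  shows "is_weak_deriv T (\<lambda>t. broken q t i) (broken_deriv q i)"
proof -
  have meas: "broken_deriv q i \<in> borel_measurable (lebesgue_on {0..T})"
  proof -
    have "(\<lambda>t. indicator {node k..<node (Suc k)} t * V k (blk k q) (nxt k q) t i) \<in> borel_measurable (lebesgue_on {0..T})"
      if "k < N" for k
    proof (rule borel_measurable_times)
      show "(indicator {node k..<node (Suc k)} :: real \<Rightarrow> real) \<in> borel_measurable (lebesgue_on {0..T})"
        by (rule measurable_restrict_space1) (simp add: borel_measurable_indicator)
      show "(\<lambda>t. V k (blk k q) (nxt k q) t i) \<in> borel_measurable (lebesgue_on {0..T})"
        using V_cont[OF that i] by (rule continuous_imp_measurable_on_sets_lebesgue) simp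
    qed
    then show ?thesis unfolding broken_deriv_def[abs_def] by (intro borel_measurable_sum) auto
  qed
  have "\<exists>c. \<forall>t\<in>{0..T}. \<bar>V k (blk k q) (nxt k q) t i\<bar> \<le> c" if "k < N" for k
    using compact_continuous_image[OF V_cont[OF that i] compact_Icc] by (force dest!: compact_imp_bounded simp: bounded_iff)
  then obtain c where c: "\<And>k t. k < N \<Longrightarrow> t \<in> {0..T} \<Longrightarrow> \<bar>V k (blk k q) (nxt k q) t i\<bar> \<le> c k" by metis
  define K where "K = (\<Sum>k<N. \<bar>c k\<bar>)"
  have bound: "\<bar>broken_deriv q i t\<bar> \<le> K" if "t \<in> {0..T}" for t
    unfolding broken_deriv_def K_def
    by (rule order_trans[OF sum_abs sum_mono]) (use c[OF _ that] in \<open>force simp: indicator_def\<close>)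
  have int_of_bound: "integrable (lebesgue_on {0..t}) f"
    if "f \<in> borel_measurable (lebesgue_on {0..T})" "t \<in> {0..T}" "\<And>s. s \<in> {0..T} \<Longrightarrow> \<bar>f s\<bar> \<le> B" for f :: "real \<Rightarrow> real" and t B
  proof -
    have "integrable (lebesgue_on {0..T}) f"
    proof (rule Bochner_Integration.integrable_bound[OF _ that(1)])
      show "integrable (lebesgue_on {0..T}) (\<lambda>_. B)"
        by (simp add: absolutely_integrable_imp_integrable absolutely_integrable_continuous_real)
      show "AE s in lebesgue_on {0..T}. norm (f s) \<le> norm B" using that(3) by (intro AE_I2) force
    qed
    then have "f absolutely_integrable_on {0..T}" by (simp add: integrable_restrict_space set_integrable_def)
    then have "f absolutely_integrable_on {0..t}"
      by (rule absolutely_integrable_on_subinterval) (use that(2) in auto)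
    then show ?thesis by (simp add: integrable_restrict_space set_integrable_def)
  qed
  have nodes: "(broken_deriv q i has_integral (broken q (node k) i - broken q 0 i)) {0..node k}" if "k \<le> N" for k
    using that
  proof (induction k)
    case (Suc k)
    then have k: "k < N" by simp
    have "(broken_deriv q i has_integral ((broken q (node k) i - broken q 0 i) + (broken q (node (Suc k)) i - broken q (node k) i))) {0..node (Suc k)}"
      by (rule has_integral_combine[OF _ _ Suc.IH broken_deriv_int[OF k i]])
        (use k node_in[of k] node_less[of k] in auto)
    then show ?case by simp
  next
    case 0
    show ?case using has_integral_refl(2)[of "broken_deriv q i" 0] by (simp add: node_0)
  qed
  have int: "(broken_deriv q i has_integral (broken q t i - broken q 0 i)) {0..t}" if t: "t \<in> {0..T}" for t
  proof -
    let ?k = "piece t"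
    have "(broken_deriv q i has_integral ((broken q (node ?k) i - broken q 0 i) + (broken q t i - broken q (node ?k) i))) {0..t}"
      by (rule has_integral_combine[OF _ _ nodes broken_deriv_int[OF piece_less i piece_in[OF t]]])
        (use piece_less[of t] piece_in[OF t] node_in[of ?k] in auto)
    then show ?thesis by simp
  qed
  show ?thesis
    unfolding is_weak_deriv_def
  proof (intro conjI ballI meas)
    have "(\<lambda>t. (broken_deriv q i t)\<^sup>2) \<in> borel_measurable (lebesgue_on {0..T})" using meas by (rule borel_measurable_power)
    then show "integrable (lebesgue_on {0..T}) (\<lambda>t. (broken_deriv q i t)\<^sup>2)"
    proof (rule int_of_bound)
      show "\<bar>(broken_deriv q i s)\<^sup>2\<bar> \<le> K\<^sup>2" if "s \<in> {0..T}" for s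
        using power_mono[OF bound[OF that], of 2] by simp
    qed (use T in simp)
    fix t assume t: "t \<in> {0..T}"
    show "broken q t i = broken q 0 i + integral\<^sup>L (lebesgue_on {0..t}) (broken_deriv q i)"
      using integral_unique[OF int[OF t]] int_of_bound[OF meas t bound] by (simp add: lebesgue_integral_eq_integral)
  qed
qed

definition E :: "(real \<Rightarrow> nat \<Rightarrow> real) set" where
  "E = {u. (\<forall>i<n. \<exists>w. is_weak_deriv T (\<lambda>t. u t i) w) \<and> (\<forall>t i. t \<notin> {0..T} \<or> n \<le> i \<longrightarrow> u t i = 0) \<and>
     (\<forall>i<n. u 0 i = (\<Sum>j<n. A i j * u T j))}"

lemma broken_in_E: "broken q \<in> E"
proof -
  have "broken q 0 i = (\<Sum>j<n. A i j * broken q T j)" if i: "i < n" for i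
  proof -
    have "broken q T j = seq q N j" if "j < n" for j
      using broken_node(2)[OF last_node(1) that, of q] seq_simps(2)[OF last_node(1), of q j] last_node by simp
    then have "(\<Sum>j<n. A i j * broken q T j) = (\<Sum>j<n. A i j * seq q N j)" by (intro sum.cong) auto
    then show ?thesis using broken_node(1)[OF N0 i, of q] A_seq_N[OF i, of q] seq_simps(1)[OF N0, of q i] node_0 by simp
  qed
  then show ?thesis unfolding E_def using broken_weak_deriv by (auto simp: broken_def)
qed

text \<open>The quadratic form of \<open>M 1\<close> on node values, as \<open>twisted_form\<close>
  shows for y = 1.\<close>

definition H where "H q = jump (\<lambda>k. V k (blk k q) (nxt k q) (node (Suc k))) (\<lambda>k. V k (blk k q) (nxt k q) (node k)) q"

lemma integral_nodes:
  fixes F :: "real \<Rightarrow> real"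
  assumes "F integrable_on {0..T}" "k \<le> N"
  shows "integral {0..node k} F = (\<Sum>j<k. integral {node j..node (Suc j)} F)"
  using assms(2)
proof (induction k)
  case (Suc k)
  have "integral {0..node k} F + integral {node k..node (Suc k)} F = integral {0..node (Suc k)} F"
    by (rule Henstock_Kurzweil_Integration.integral_combine, use Suc.prems node_in[of k] node_less[of k] in simp_all)
      (use Suc.prems node_in[of "Suc k"] in \<open>auto intro: integrable_on_subinterval[OF assms(1)]\<close>)
  then show ?case using Suc by simp
qed (simp add: node_0)

text \<open>On each segment the integrand is the derivative of the product of a solution with its
  velocity, so only terms at the nodes remain.\<close>

lemma index_form_broken: "index_form T n R (broken q) (broken q) = H q"
proof -
  let ?F = "\<lambda>t. (\<Sum>i<n. (broken_deriv q i t)\<^sup>2) + potential (broken q) t"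
  have "integral {node k..node (Suc k)} ?F
      = (\<Sum>i<n. V k (blk k q) (nxt k q) (node (Suc k)) i * nxt k q i - V k (blk k q) (nxt k q) (node k) i * blk k q i)"
    if k: "k < N" for k
  proof -
    let ?u = "U k (blk k q) (nxt k q)" and ?v = "V k (blk k q) (nxt k q)"
    have sub: "{node k..node (Suc k)} \<subseteq> {0..T}" using node_in'[OF k] by auto
    note d = sol_deriv[OF seg(1)[OF k, of "blk k q" "nxt k q"]]
    have "((\<lambda>t. \<Sum>i<n. (\<Sum>j<n. R t i j * ?u t j) * ?u t i + ?v t i * ?v t i) has_integral
        (\<Sum>i<n. ?v (node (Suc k)) i * ?u (node (Suc k)) i - ?v (node k) i * ?u (node k) i)) {node k..node (Suc k)}"
    proof (intro has_integral_sum fundamental_theorem_of_calculus)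
      fix i t assume i: "i \<in> {..<n}" and t: "t \<in> {node k..node (Suc k)}"
      have "((\<lambda>t. ?v t i * ?u t i) has_real_derivative (\<Sum>j<n. R t i j * ?u t j) * ?u t i + ?v t i * ?v t i) (at t within {0..T})"
        using DERIV_mult[OF d(2)[of t i] d(1)[of t i]] i t sub by (auto simp: mult.commute add.commute)
      then show "((\<lambda>t. ?v t i * ?u t i) has_vector_derivative (\<Sum>j<n. R t i j * ?u t j) * ?u t i + ?v t i * ?v t i) (at t within {node k..node (Suc k)})"
        unfolding has_real_derivative_iff_has_vector_derivative[symmetric] using sub by (rule has_field_derivative_subset)
    qed (use node_less[of k] in auto)
    then have "(?F has_integral (\<Sum>i<n. ?v (node (Suc k)) i * ?u (node (Suc k)) i - ?v (node k) i * ?u (node k) i)) {node k..node (Suc k)}"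
    proof (rule has_integral_spike_finite[where S = "{node (Suc k)}", rotated 2])
      fix t assume t: "t \<in> {node k..node (Suc k)} - {node (Suc k)}"
      have "broken q t i = ?u t i" if "i < n" for i using broken_seg[OF k _ that] t by simp
      moreover have "broken_deriv q i t = ?v t i" for i using broken_deriv_seg[OF k] t by simp
      ultimately show "?F t = (\<Sum>i<n. (\<Sum>j<n. R t i j * ?u t j) * ?u t i + ?v t i * ?v t i)"
        by (simp add: sum.distrib power2_eq_square)
    qed simp
    then show ?thesis using seg(2,3)[OF k] by (simp add: integral_unique)
  qed
  then have "(\<Sum>k<N. integral {node k..node (Suc k)} ?F) = H q" unfolding H_def jump_def by (intro sum.cong) auto
  moreover have idx: "index_form T n R (broken q) (broken q) = integral {0..T} ?F" "?F integrable_on {0..T}"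
    by (rule index_form_eq, erule broken_weak_deriv)+
  ultimately show ?thesis using integral_nodes[OF idx(2) order_refl] idx(1) by (simp add: node_N)
qed

text \<open>These functionals read off the node values and recover q from
  \<open>broken q\<close>.\<close>

definition nd :: "nat \<Rightarrow> (real \<Rightarrow> nat \<Rightarrow> real) \<Rightarrow> real" where "nd l u = u (node (l div n)) (l mod n)"

lemma nd_index: "i < n \<Longrightarrow> nd (k * n + i) u = u (node k) i"
  by (simp add: nd_def)

text \<open>Replacing u by the broken solution with the same node values does not increase the
  contribution of any segment.\<close>

lemma index_form_lower:
  assumes u: "u \<in> E"
  shows "H (\<lambda>l. nd l u) \<le> index_form T n R u u"
proof -
  obtain w where w: "\<And>i. i < n \<Longrightarrow> is_weak_deriv T (\<lambda>t. u t i) (w i)"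
    using u unfolding E_def by (auto simp: Ball_def) metis
  have per: "\<And>i. i < n \<Longrightarrow> u 0 i = (\<Sum>j<n. A i j * u T j)" using u unfolding E_def by blast
  let ?q = "\<lambda>l. nd l u"
  have blk: "blk k ?q i = u (node k) i" if "i < n" for k i using that by (simp add: blk_def nd_index)
  have nxt: "nxt k ?q i = u (node (Suc k)) i" if k: "k < N" and i: "i < n" for k i
  proof (cases "Suc k < N")
    case False
    then have T': "node (Suc k) = T" using k last_node by (metis Suc_lessI)
    \<comment> \<open>The condition u 0 = A u T together with \<open>AtA\<close> gives back the
      value at T.\<close>
    have "(\<Sum>l<n. A l i * ?q l) = (\<Sum>l<n. A l i * (\<Sum>j<n. A l j * u T j))"
      by (rule sum.cong) (use per nd_index[of _ 0] node_0 in auto)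
    also have "\<dots> = (\<Sum>j<n. (\<Sum>l<n. A l i * A l j) * u T j)"
      unfolding sum_distrib_left sum_distrib_right by (subst sum.swap) (simp add: mult_ac)
    also have "\<dots> = (\<Sum>j<n. if i = j then u T j else 0)"
      by (rule sum.cong) (use AtA i in auto)
    finally show ?thesis using False i T' by (simp add: nxt_def)
  qed (simp add: nxt_def blk i)
  let ?F = "\<lambda>t. (\<Sum>i<n. (w i t)\<^sup>2) + potential u t"
  have T0: "0 \<le> T" using T by simp
  note wf = weak_deriv_facts[OF T0 w]
  have "(\<Sum>i<n. V k (blk k ?q) (nxt k ?q) (node (Suc k)) i * nxt k ?q i - V k (blk k ?q) (nxt k ?q) (node k) i * blk k ?q i)
      \<le> integral {node k..node (Suc k)} ?F" if k: "k < N" for k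
  proof -
    have sub: "{node k..node (Suc k)} \<subseteq> {0..T}" using node_in'[OF k] by auto
    \<comment> \<open>Minimality asks for n C h^2 at most 1. For n > 0 this follows from the bound
      with 4 n^2, and for n = 0 the left side is zero.\<close>
    have nC: "real n * C * (node (Suc k) - node k)\<^sup>2 \<le> 1"
    proof (cases "n = 0")
      case False
      then have "real n \<le> 4 * (real n)\<^sup>2" by (simp add: power2_eq_square mult.commute)
      then have "real n * (C * (node (Suc k) - node k)\<^sup>2) \<le> 4 * (real n)\<^sup>2 * (C * (node (Suc k) - node k)\<^sup>2)"
        using C0 by (intro mult_right_mono) auto
      then show ?thesis using node_short[OF k] by (simp add: mult.assoc)
    qed simp
    have "(\<Sum>i<n. u (node (Suc k)) i * V k (blk k ?q) (nxt k ?q) (node (Suc k)) i - u (node k) i * V k (blk k ?q) (nxt k ?q) (node k) i)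
        \<le> integral {node k..node (Suc k)} ?F"
    proof (rule segment_minimal[OF seg(1)[OF k] _ node_less _ nC])
      fix i assume i: "i < n"
      show "w i absolutely_integrable_on {node k..node (Suc k)}" by (rule absolutely_integrable_on_subinterval[OF wf(1)[OF i] sub])
      show "(\<lambda>t. (w i t)\<^sup>2) integrable_on {node k..node (Suc k)}"
        by (rule integrable_on_subinterval[OF set_lebesgue_integral_eq_integral(1)[OF wf(2)[OF i]] sub])
      show "(w i has_integral u d i - u c i) {c..d}" if "node k \<le> c" "c \<le> d" "d \<le> node (Suc k)" for c d
        by (rule wf(3)[OF i]) (use that sub node_in'[OF k] in auto)
      show "u (node k) i = U k (blk k ?q) (nxt k ?q) (node k) i" "u (node (Suc k)) i = U k (blk k ?q) (nxt k ?q) (node (Suc k)) i"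
        using seg(2,3)[OF k i] blk[OF i] nxt[OF k i] by simp_all
      show "continuous_on {node k..node (Suc k)} (\<lambda>t. u t i)" by (rule continuous_on_subset[OF wf(4)[OF i] sub])
    qed (use node_in'[OF k] in auto)
    also have "(\<Sum>i<n. u (node (Suc k)) i * V k (blk k ?q) (nxt k ?q) (node (Suc k)) i - u (node k) i * V k (blk k ?q) (nxt k ?q) (node k) i)
      = (\<Sum>i<n. V k (blk k ?q) (nxt k ?q) (node (Suc k)) i * nxt k ?q i - V k (blk k ?q) (nxt k ?q) (node k) i * blk k ?q i)"
      by (rule sum.cong) (use blk nxt[OF k] in auto)
    finally show ?thesis .
  qed
  then have "H ?q \<le> (\<Sum>k<N. integral {node k..node (Suc k)} ?F)" unfolding H_def jump_def by (intro sum_mono) auto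
  also have "\<dots> = index_form T n R u u"
    using integral_nodes[OF index_form_eq(2)[where w = w, OF w] order_refl] index_form_eq(1)[where w = w, OF w] by (simp add: node_N)
  finally show ?thesis .
qed

text \<open>In coordinates that diagonalise \<open>M 1\<close>, a diagonal form bounds the index
  form from below on E and equals it on broken solutions. The index is therefore the number of
  negative entries, and \<open>inertia_sign\<close> ties the parity of that number to the sign of
  the determinant of \<open>Bm\<close>.\<close>

theorem index_parity:
  assumes hyperbolic: "\<And>u v x. sol u v \<Longrightarrow> 1 < x \<Longrightarrow> \<forall>i<n. (\<Sum>j<n. A i j * u T j) = x * u 0 i \<Longrightarrow>
      \<forall>i<n. (\<Sum>j<n. A i j * v T j) = x * v 0 i \<Longrightarrow> \<forall>t\<in>{0..T}. \<forall>i<n. u t i = 0"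
    and chain: "\<And>u v u' v' c. sol u v \<Longrightarrow> sol u' v' \<Longrightarrow> c \<noteq> 0 \<Longrightarrow>
      \<forall>i<n. (\<Sum>j<n. A i j * u T j) = u 0 i \<Longrightarrow> \<forall>i<n. (\<Sum>j<n. A i j * v T j) = v 0 i \<Longrightarrow>
      \<forall>i<n. (\<Sum>j<n. A i j * u' T j) = u' 0 i + c * u 0 i \<Longrightarrow> \<forall>i<n. (\<Sum>j<n. A i j * v' T j) = v' 0 i + c * v 0 i \<Longrightarrow>
      \<forall>t\<in>{0..T}. \<forall>i<n. u t i = 0"
    and A0: "fdet n A \<noteq> 0"
  shows "(-1) ^ (GREATEST k. \<exists>V. subspace V \<and> V \<subseteq> E \<and> dim V = k \<and>
      (\<forall>u\<in>V. u \<noteq> 0 \<longrightarrow> index_form T n R u u < 0)) = (-1) ^ n * sgn (fdet n A)"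
proof -
  have B0: "fdet m Bm \<noteq> 0" using sgn_det_Bm A0 by (metis mult_eq_0_iff power_eq_0_iff sgn_zero_iff zero_neq_neg_one)
  have Dsym: "Dm i j = Dm j i" for i j unfolding Dm_def by (rule Df_sym)
  have Mdef: "M = (\<lambda>y i j. Dm i j + y * Bm i j + Bm j i / y)" by (simp add: M_def fun_eq_iff)
  obtain Q d where Q: "fdet m Q \<noteq> 0"
    and QMQ: "\<And>i j. i < m \<Longrightarrow> j < m \<Longrightarrow> (\<Sum>k<m. \<Sum>l<m. Q k i * M 1 k l * Q l j) = (if i = j then d i else 0)"
    and sgn: "(-1) ^ card {i \<in> {..<m}. d i < 0} = sgn (fdet m Bm)"
  proof (rule inertia_sign[of M Dm Bm m, OF Mdef])
    show "fdet m (M y) \<noteq> 0" if "1 < y" for y using that hyperbolic by (rule M_nonsingular)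
    show "\<forall>i<m. q i = 0" if "\<forall>i<m. (\<Sum>j<m. M 1 i j * q j) = 0"
      "\<forall>i<m. (\<Sum>j<m. M 1 i j * r j) + (\<Sum>j<m. (Bm i j - Bm j i) * q j) = 0" for q r
      using chain that by (rule M_no_jordan_chain)
  qed (use Dsym B0 in auto)
  from fdet_inverse[OF Q] obtain P where
    P': "(\<forall>i<m. \<forall>j<m. (\<Sum>k<m. Q i k * P k j) = (if i = j then 1 else 0)) \<and>
      (\<forall>i<m. \<forall>j<m. (\<Sum>k<m. P i k * Q k j) = (if i = j then 1 else 0))" ..
  note P = P'[THEN conjunct1, rule_format] P'[THEN conjunct2, rule_format]
  \<comment> \<open>The coordinates of the node values in the basis of the columns of Q, P being its
    inverse.\<close>
  define \<phi> where "\<phi> i u = (\<Sum>l<m. P i l * nd l u)" for i u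
  define col where "col i = (\<lambda>l. if l < m then Q l i else 0)" for i
  have H_diag: "H q = (\<Sum>i<m. d i * (y i)\<^sup>2)" if q: "\<And>l. l < m \<Longrightarrow> q l = (\<Sum>i<m. Q l i * y i)" for q y
  proof -
    define q' where "q' = (\<lambda>l. if l < m then q l else 0)"
    have "H q = H q'"
    proof -
      have b: "blk k q i = blk k q' i" if "k < N" "i < n" for k i
      proof -
        have "k * n + i < Suc k * n" using that(2) by simp
        also have "\<dots> \<le> m" unfolding m_def using that(1) by (intro mult_le_mono1) simp
        finally show ?thesis by (simp add: blk_def q'_def)
      qed
      have nx: "nxt k q i = nxt k q' i" if "k < N" "i < n" for k i
      proof (cases "Suc k < N")
        case False
        have "q l = q' l" if "l < n" for l using b[OF N0 that] by (simp add: blk_def)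
        then show ?thesis using False by (simp add: nxt_def)
      qed (use b that in \<open>simp add: nxt_def\<close>)
      have "V k (blk k q) (nxt k q) t i = V k (blk k q') (nxt k q') t i" if "k < N" "t \<in> {0..T}" "i < n" for k t i
        using seg_eq(2)[OF that(1) seg(1)[OF that(1)] _ _ that(2,3), of "blk k q'" "nxt k q'" "blk k q" "nxt k q"]
          seg(2,3)[OF that(1)] b nx that(1) by simp
      then show ?thesis unfolding H_def jump_def using b nx node_in' by (intro sum.cong) auto
    qed
    also have "H q' = Df q' q' + 1 * Bf q' q' + Bf q' q' / 1" using twisted_form[of 1 q' q'] by (simp add: H_def)
    also have "\<dots> = (\<Sum>i<m. (Df (unit_fun i) q' + 1 * Bf (unit_fun i) q' + Bf q' (unit_fun i) / 1) * q i)"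
    proof -
      have e: "(\<lambda>j. if j < m then q j else 0) = q'" by (simp add: q'_def)
      show ?thesis
        using form_sum_left[OF bilinear_Df, of q' q] form_sum_left[OF bilinear_Bf, of q' q] form_sum_right[OF bilinear_Bf, of q' q]
        unfolding e by (simp add: distrib_right sum.distrib)
    qed
    also have "\<dots> = (\<Sum>i<m. (\<Sum>j<m. M 1 i j * q j) * q i)" using M_row[OF q'_def, of 1] by simp
    also have "\<dots> = (\<Sum>k<m. \<Sum>l<m. q k * M 1 k l * q l)" by (simp add: sum_distrib_left sum_distrib_right mult_ac)
    also have "\<dots> = (\<Sum>k<m. \<Sum>l<m. \<Sum>i<m. \<Sum>j<m. y i * (Q k i * M 1 k l * Q l j) * y j)"
      by (intro sum.cong refl) (simp add: q sum_distrib_left sum_distrib_right mult_ac)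
    also have "\<dots> = (\<Sum>i<m. \<Sum>j<m. \<Sum>k<m. \<Sum>l<m. y i * (Q k i * M 1 k l * Q l j) * y j)"
    proof -
      have "(\<Sum>k<m. \<Sum>l<m. \<Sum>i<m. \<Sum>j<m. f i j k l) = (\<Sum>i<m. \<Sum>j<m. \<Sum>k<m. \<Sum>l<m. f i j k l)" for f :: "nat \<Rightarrow> nat \<Rightarrow> nat \<Rightarrow> nat \<Rightarrow> real"
      proof -
        have "(\<Sum>k<m. \<Sum>l<m. \<Sum>i<m. \<Sum>j<m. f i j k l) = (\<Sum>k<m. \<Sum>i<m. \<Sum>l<m. \<Sum>j<m. f i j k l)"
          by (rule sum.cong[OF refl], rule sum.swap)
        also have "\<dots> = (\<Sum>i<m. \<Sum>k<m. \<Sum>l<m. \<Sum>j<m. f i j k l)" by (rule sum.swap)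
        also have "\<dots> = (\<Sum>i<m. \<Sum>k<m. \<Sum>j<m. \<Sum>l<m. f i j k l)"
          by (rule sum.cong[OF refl], rule sum.cong[OF refl], rule sum.swap)
        also have "\<dots> = (\<Sum>i<m. \<Sum>j<m. \<Sum>k<m. \<Sum>l<m. f i j k l)" by (rule sum.cong[OF refl], rule sum.swap)
        finally show ?thesis .
      qed
      then show ?thesis .
    qed
    also have "\<dots> = (\<Sum>i<m. \<Sum>j<m. y i * (if i = j then d i else 0) * y j)"
    proof (intro sum.cong refl)
      fix i j assume "i \<in> {..<m}" "j \<in> {..<m}"
      then show "(\<Sum>k<m. \<Sum>l<m. y i * (Q k i * M 1 k l * Q l j) * y j) = y i * (if i = j then d i else 0) * y j"
        using QMQ[of i j] by (simp only: sum_distrib_left[symmetric] sum_distrib_right[symmetric]) simp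
    qed
    also have "\<dots> = (\<Sum>i<m. d i * (y i)\<^sup>2)"
      by (intro sum.cong refl) (simp add: power2_eq_square if_distrib[of "\<lambda>x. _ * x * _"] cong: if_cong)
    finally show ?thesis .
  qed
  have nd_broken: "nd l (broken q) = q l" if "l < m" for l q
  proof -
    have n: "0 < n" using that unfolding m_def by (cases "n = 0") simp_all
    have "l div n < N" "l mod n < n" using that n by (simp_all add: m_def less_mult_imp_div_less)
    then show ?thesis using broken_node(1)[of "l div n" "l mod n" q] by (simp add: nd_def blk_def)
  qed
  have comb: "(\<Sum>i<m. c i *\<^sub>R broken (col i)) = broken (\<Sum>i<m. c i *\<^sub>R col i)" for c
    by (simp add: linear_sum[OF linear_broken] linear_scale[OF linear_broken])
  have colsum: "(\<Sum>i<m. c i *\<^sub>R col i) l = (\<Sum>i<m. Q l i * c i)" if "l < m" for c l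
    using that by (simp add: sum_fun_apply scaleR_fun_def col_def mult.commute)
  have "(GREATEST k. \<exists>V. subspace V \<and> V \<subseteq> E \<and> dim V = k \<and> (\<forall>u\<in>V. u \<noteq> 0 \<longrightarrow> index_form T n R u u < 0))
      = card {i \<in> {..<m}. d i < 0}"
  \<comment> \<open>The test functions are the broken solutions through the columns of Q; they are
    dual to the coordinates \<phi>.\<close>
  proof (rule morse_index_eq_card_neg[where \<phi> = \<phi> and b = "\<lambda>i. broken (col i)"])
    show "linear (\<phi> i)" for i
      unfolding \<phi>_def[abs_def] nd_def
      by (rule linearI) (simp_all add: scaleR_fun_def algebra_simps sum.distrib sum_distrib_left)
    show "(\<Sum>i<m. d i * (\<phi> i u)\<^sup>2) \<le> index_form T n R u u" if "u \<in> E" for u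
    proof -
      have "H (\<lambda>l. nd l u) = (\<Sum>i<m. d i * (\<phi> i u)\<^sup>2)"
      proof (rule H_diag)
        fix l assume l: "l < m"
        have "(\<Sum>i<m. Q l i * \<phi> i u) = (\<Sum>j<m. (\<Sum>i<m. Q l i * P i j) * nd j u)"
          unfolding \<phi>_def sum_distrib_left sum_distrib_right by (subst sum.swap) (simp add: mult_ac)
        also have "\<dots> = (\<Sum>j<m. if l = j then nd j u else 0)" by (rule sum.cong) (use P l in auto)
        finally show "nd l u = (\<Sum>i<m. Q l i * \<phi> i u)" using l by simp
      qed
      then show ?thesis using index_form_lower[OF that] by simp
    qed
    show "(\<Sum>i<m. c i *\<^sub>R broken (col i)) \<in> E" for c unfolding comb by (rule broken_in_E)
    show "index_form T n R (\<Sum>i<m. c i *\<^sub>R broken (col i)) (\<Sum>i<m. c i *\<^sub>R broken (col i)) = (\<Sum>i<m. d i * (c i)\<^sup>2)" for c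
      unfolding comb index_form_broken by (rule H_diag) (rule colsum)
    show "\<phi> i (broken (col j)) = (if i = j then 1 else 0)" if "i < m" "j < m" for i j
    proof -
      have "\<phi> i (broken (col j)) = (\<Sum>l<m. P i l * Q l j)"
        unfolding \<phi>_def by (rule sum.cong) (simp_all add: nd_broken col_def)
      then show ?thesis using P(2)[OF that] by simp
    qed
  qed
  then show ?thesis using sgn sgn_det_Bm by simp
qed

end

lemma continuous_matrix_bound:
  fixes R :: "real \<Rightarrow> nat \<Rightarrow> nat \<Rightarrow> real"
  assumes "\<And>i j. i < n \<Longrightarrow> j < n \<Longrightarrow> continuous_on {0..T} (\<lambda>t. R t i j)"
  shows "\<exists>C\<ge>0. \<forall>t\<in>{0..T}. \<forall>i<n. \<forall>j<n. \<bar>R t i j\<bar> \<le> C"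
proof -
  have "\<exists>C. \<forall>t\<in>{0..T}. \<bar>R t i j\<bar> \<le> C" if "i < n" "j < n" for i j
    using compact_continuous_image[OF assms[OF that] compact_Icc] by (force dest!: compact_imp_bounded simp: bounded_iff)
  then obtain c where c: "\<And>i j t. i < n \<Longrightarrow> j < n \<Longrightarrow> t \<in> {0..T} \<Longrightarrow> \<bar>R t i j\<bar> \<le> c i j" by metis
  have "\<bar>R t i j\<bar> \<le> (\<Sum>i<n. \<Sum>j<n. \<bar>c i j\<bar>)" if "i < n" "j < n" "t \<in> {0..T}" for i j t
  proof -
    have "\<bar>R t i j\<bar> \<le> \<bar>c i j\<bar>" using c[OF that] by simp
    also have "\<dots> \<le> (\<Sum>j<n. \<bar>c i j\<bar>)" using that by (intro member_le_sum) auto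
    also have "\<dots> \<le> (\<Sum>i<n. \<Sum>j<n. \<bar>c i j\<bar>)"
      using that by (intro member_le_sum[of i _ "\<lambda>i. \<Sum>j<n. \<bar>c i j\<bar>"] sum_nonneg) auto
    finally show ?thesis .
  qed
  then show ?thesis by (intro exI[of _ "\<Sum>i<n. \<Sum>j<n. \<bar>c i j\<bar>"]) (auto intro!: sum_nonneg)
qed

text \<open>The interface to the geometry. The last two assumptions say that the return map has no
  real eigenvalue above 1 and no Jordan chain at 1, phrased through solutions and the matrix
  A.\<close>

theorem morse_parity:
  fixes R :: "real \<Rightarrow> nat \<Rightarrow> nat \<Rightarrow> real" and A :: "real mat"
  assumes T: "0 < T"
    and Rcont: "\<And>i j. i < n \<Longrightarrow> j < n \<Longrightarrow> continuous_on {0..T} (\<lambda>t. R t i j)"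
    and Rsym: "\<And>t i j. t \<in> {0..T} \<Longrightarrow> i < n \<Longrightarrow> j < n \<Longrightarrow> R t i j = R t j i"
    and A: "A \<in> carrier_mat n n"
    and AtA: "\<And>i j. i < n \<Longrightarrow> j < n \<Longrightarrow> (\<Sum>k<n. A $$ (k, i) * A $$ (k, j)) = (if i = j then 1 else 0)"
    and hyperbolic: "\<And>u v x. jacobi_sol T n R u v \<Longrightarrow> 1 < x \<Longrightarrow> \<forall>i<n. (\<Sum>j<n. A $$ (i, j) * u T j) = x * u 0 i \<Longrightarrow>
      \<forall>i<n. (\<Sum>j<n. A $$ (i, j) * v T j) = x * v 0 i \<Longrightarrow> \<forall>t\<in>{0..T}. \<forall>i<n. u t i = 0"
    and chain: "\<And>u v u' v' c. jacobi_sol T n R u v \<Longrightarrow> jacobi_sol T n R u' v' \<Longrightarrow> c \<noteq> 0 \<Longrightarrow>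
      \<forall>i<n. (\<Sum>j<n. A $$ (i, j) * u T j) = u 0 i \<Longrightarrow> \<forall>i<n. (\<Sum>j<n. A $$ (i, j) * v T j) = v 0 i \<Longrightarrow>
      \<forall>i<n. (\<Sum>j<n. A $$ (i, j) * u' T j) = u' 0 i + c * u 0 i \<Longrightarrow>
      \<forall>i<n. (\<Sum>j<n. A $$ (i, j) * v' T j) = v' 0 i + c * v 0 i \<Longrightarrow>
      \<forall>t\<in>{0..T}. \<forall>i<n. u t i = 0"
  shows "(-1) ^ (GREATEST k. \<exists>V. subspace V \<and> V \<subseteq> sobolev_twisted T n A \<and> dim V = k \<and>
      (\<forall>u\<in>V. u \<noteq> 0 \<longrightarrow> index_form T n R u u < 0)) = (-1) ^ n * sgn (Determinant.det A)"
proof -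
  have "transpose_mat A * A = 1\<^sub>m n"
    using A by (intro eq_matI) (auto simp: scalar_prod_def atLeast0LessThan AtA)
  moreover have A': "transpose_mat A \<in> carrier_mat n n" using A by simp
  ultimately have AAt': "A * transpose_mat A = 1\<^sub>m n"
    using mat_mult_left_right_inverse[OF A' A] by blast
  have AAt: "(\<Sum>k<n. A $$ (i, k) * A $$ (j, k)) = (if i = j then 1 else 0)" if "i < n" "j < n" for i j
  proof -
    have "(A * transpose_mat A) $$ (i, j) = (\<Sum>k<n. A $$ (i, k) * A $$ (j, k))"
      using A that by (auto simp: scalar_prod_def atLeast0LessThan)
    then show ?thesis using that by (simp add: AAt')
  qed
  have "1 = Determinant.det A * Determinant.det (transpose_mat A)"
    using det_mult[OF A A'] by (simp add: AAt')
  then have detA: "Determinant.det A \<noteq> 0" by auto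
  have fA: "fdet n (\<lambda>i j. A $$ (i, j)) = Determinant.det A"
    unfolding fdet_def using A by (intro arg_cong[where f = Determinant.det] eq_matI) auto
  obtain C where C: "C \<ge> 0" "\<forall>t\<in>{0..T}. \<forall>i<n. \<forall>j<n. \<bar>R t i j\<bar> \<le> C"
    using continuous_matrix_bound[of n T R] Rcont by blast
  \<comment> \<open>k exceeds 4 n^2 C T^2, and N = 2 k + 1 is odd with k at most N and N at most
    N^2, so a segment of length T / N is short.\<close>
  obtain k :: nat where k: "4 * (real n)\<^sup>2 * C * T\<^sup>2 < real k" using reals_Archimedean2 by blast
  define N where "N = 2 * k + 1"
  have N: "odd N" "0 < N" by (simp_all add: N_def)
  have small: "4 * (real n)\<^sup>2 * C * (T / N)\<^sup>2 \<le> 1"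
  proof -
    have "real k \<le> real N" by (simp add: N_def)
    also have "\<dots> \<le> (real N)\<^sup>2" using N(2) by (simp add: power2_eq_square)
    finally have "4 * (real n)\<^sup>2 * C * T\<^sup>2 \<le> (real N)\<^sup>2" using k by linarith
    then show ?thesis using N(2) by (simp add: power_divide divide_le_eq)
  qed
  interpret broken_problem T n R C N "\<lambda>i j. A $$ (i, j)"
    by unfold_locales (use T Rcont Rsym C N small AtA AAt in auto)
  have E: "E = sobolev_twisted T n A" unfolding E_def sobolev_twisted_def by simp
  have "fdet n (\<lambda>i j. A $$ (i, j)) \<noteq> 0" using fA detA by simp
  from index_parity[OF hyperbolic chain this] show ?thesis unfolding E fA .
qed

section \<open>Smooth maps\<close>

abbreviation (input) tdo where "tdo \<equiv> times_differentiable_on"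

text \<open>Derivatives within such sets are unique.\<close>

definition full_dirs :: "'a::euclidean_space set \<Rightarrow> bool" where
  "full_dirs S \<longleftrightarrow> (\<forall>x\<in>S. \<forall>i\<in>Basis. \<forall>e>0. \<exists>d. 0 < \<bar>d\<bar> \<and> \<bar>d\<bar> < e \<and> x + d *\<^sub>R i \<in> S)"

lemma full_dirs_open: "open S \<Longrightarrow> full_dirs S" for S :: "'a::euclidean_space set"
  unfolding full_dirs_def
proof (intro ballI allI impI)
  fix x i :: 'a and e :: real assume S: "open S" "x \<in> S" "i \<in> Basis" "0 < e"
  then obtain r where r: "0 < r" "ball x r \<subseteq> S" by (meson open_contains_ball)
  define d where "d = min e r / 2"
  have "0 < d" "d < e" "d < r" using r S by (auto simp: d_def)
  moreover have "x + d *\<^sub>R i \<in> ball x r" using \<open>0 < d\<close> \<open>d < r\<close> S by (simp add: dist_norm)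
  ultimately show "\<exists>d. 0 < \<bar>d\<bar> \<and> \<bar>d\<bar> < e \<and> x + d *\<^sub>R i \<in> S" using r by (intro exI[of _ d]) auto
qed

lemma full_dirs_interval:
  fixes T :: real
  assumes T: "0 < T" and W: "open W"
  shows "full_dirs ({0..T} \<inter> W)"
  unfolding full_dirs_def
proof (intro ballI allI impI)
  fix x i e :: real assume S: "x \<in> {0..T} \<inter> W" "i \<in> Basis" "0 < e"
  then have i: "i = 1" by simp
  obtain r where r: "0 < r" "ball x r \<subseteq> W" using W S by (meson IntD2 open_contains_ball)
  \<comment> \<open>The step goes forward, and backward only from the right end point; half of \<mu>
    keeps all the bounds strict.\<close>
  have "\<exists>d. 0 < \<bar>d\<bar> \<and> \<bar>d\<bar> < e \<and> \<bar>d\<bar> < r \<and> x + d \<in> {0..T}"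
  proof (cases "x < T")
    case True
    define \<mu> where "\<mu> = min (min e r) (T - x)"
    have "0 < \<mu>" "\<mu> \<le> e" "\<mu> \<le> r" "\<mu> \<le> T - x" using True r S by (auto simp: \<mu>_def)
    then show ?thesis using S by (intro exI[of _ "\<mu> / 2"]) auto
  next
    case False
    define \<mu> where "\<mu> = min (min e r) T"
    have "0 < \<mu>" "\<mu> \<le> e" "\<mu> \<le> r" "\<mu> \<le> T" using T r S by (auto simp: \<mu>_def)
    then show ?thesis using S False by (intro exI[of _ "- \<mu> / 2"]) auto
  qed
  then obtain d where d: "0 < \<bar>d\<bar>" "\<bar>d\<bar> < e" "\<bar>d\<bar> < r" "x + d \<in> {0..T}" by blast
  moreover have "x + d \<in> W" using r d(3) by (auto simp: subset_iff dist_real_def)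
  ultimately show "\<exists>d. 0 < \<bar>d\<bar> \<and> \<bar>d\<bar> < e \<and> x + d *\<^sub>R i \<in> {0..T} \<inter> W" by (intro exI[of _ d]) (auto simp: i)
qed

lemma frechet_derivative_eq:
  assumes "full_dirs S" "x \<in> S" "(f has_derivative D) (at x within S)"
  shows "frechet_derivative f (at x within S) = D"
  using frechet_derivative_unique_within[OF frechet_derivative_works[THEN iffD1, OF differentiableI[OF assms(3)]] assms(3)] assms(1,2)
  unfolding full_dirs_def by blast

lemma frechet_derivative_cong:
  fixes f g :: "'a::real_normed_vector \<Rightarrow> 'b::real_normed_vector"
  assumes "x \<in> S" "\<And>x. x \<in> S \<Longrightarrow> f x = g x"
  shows "frechet_derivative f (at x within S) = frechet_derivative g (at x within S)"
proof -
  have t: "(g has_derivative D) (at x within S)"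
    if "(f has_derivative D) (at x within S)" "\<And>x. x \<in> S \<Longrightarrow> f x = g x" for f g :: "'a \<Rightarrow> 'b" and D
    by (rule has_derivative_transform[OF assms(1) _ that(1)]) (simp add: that(2))
  have "(f has_derivative D) (at x within S) \<longleftrightarrow> (g has_derivative D) (at x within S)" for D
    using t[of f D g] t[of g D f] assms(2) by metis
  then show ?thesis unfolding frechet_derivative_def by simp
qed

lemma tdo_cong:
  assumes "\<And>x. x \<in> S \<Longrightarrow> f x = g x" "tdo k S f"
  shows "tdo k S g"
  using assms
proof (induction k arbitrary: f g)
  case 0
  then show ?case by (auto intro: continuous_on_eq)
next
  case (Suc k)
  have "g differentiable (at x within S)" if "x \<in> S" for x
  proof -
    have "f differentiable (at x within S)" using Suc.prems(2) that by simp
    then obtain D where "(f has_derivative D) (at x within S)" unfolding differentiable_def by blast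
    then have "(g has_derivative D) (at x within S)"
      by (rule has_derivative_transform[OF that, rotated]) (simp add: Suc.prems(1))
    then show ?thesis by (rule differentiableI)
  qed
  moreover have "tdo k S (\<lambda>x. frechet_derivative g (at x within S) v)" for v
  proof (rule Suc.IH)
    show "tdo k S (\<lambda>x. frechet_derivative f (at x within S) v)" using Suc.prems(2) by simp
    show "frechet_derivative f (at x within S) v = frechet_derivative g (at x within S) v" if "x \<in> S" for x
      using frechet_derivative_cong[OF that Suc.prems(1)] by simp
  qed
  ultimately show ?case by simp
qed

lemma tdo_continuous: "tdo k S f \<Longrightarrow> continuous_on S f"
  by (cases k) (auto simp: continuous_on_eq_continuous_within intro: differentiable_imp_continuous_within)

lemma tdo_Suc_D: "tdo (Suc k) S f \<Longrightarrow> tdo k S f"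
proof (induction k arbitrary: f)
  case 0
  show ?case using tdo_continuous[OF 0] by simp
next
  case (Suc k)
  show ?case unfolding times_differentiable_on.simps(2)[of k]
  proof (intro conjI allI)
    show "\<forall>x\<in>S. f differentiable at x within S" using Suc.prems by simp
    show "tdo k S (\<lambda>x. frechet_derivative f (at x within S) v)" for v
      by (rule Suc.IH) (use Suc.prems times_differentiable_on.simps(2)[of "Suc k" S f] in blast)
  qed
qed

lemma tdo_has_derivative:
  assumes "tdo (Suc k) S f" "x \<in> S"
  shows "(f has_derivative frechet_derivative f (at x within S)) (at x within S)"
  using assms by (simp add: frechet_derivative_works)

text \<open>Derivatives within S are unique, so inductions on the order of differentiability may use
  an explicitly known derivative in place of \<open>frechet_derivative\<close>.\<close>

lemma tdo_SucI:
  assumes "full_dirs S" "\<And>x. x \<in> S \<Longrightarrow> (f has_derivative D x) (at x within S)"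
    and "\<And>v. tdo k S (\<lambda>x. D x v)"
  shows "tdo (Suc k) S f"
  unfolding times_differentiable_on.simps
proof (intro conjI allI ballI)
  show "f differentiable at x within S" if "x \<in> S" for x using assms(2)[OF that] by (auto simp: differentiable_def)
  show "tdo k S (\<lambda>x. frechet_derivative f (at x within S) v)" for v
    by (rule tdo_cong[OF _ assms(3)[of v]]) (simp add: frechet_derivative_eq[OF assms(1) _ assms(2)])
qed

lemma tdo_const: "full_dirs S \<Longrightarrow> tdo k S (\<lambda>x. c)"
proof (induction k arbitrary: c)
  case (Suc k)
  show ?case by (rule tdo_SucI[OF Suc.prems, where D = "\<lambda>x v. 0"]) (auto intro: Suc)
qed simp

lemma tdo_linear:
  assumes "full_dirs S" "bounded_linear L" "tdo k S f"
  shows "tdo k S (\<lambda>x. L (f x))"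
  using assms(3)
proof (induction k arbitrary: f)
  case 0
  then show ?case using bounded_linear.continuous_on[OF assms(2)] by simp
next
  case (Suc k)
  show ?case
    by (rule tdo_SucI[OF assms(1), where D = "\<lambda>x v. L (frechet_derivative f (at x within S) v)"])
      (use Suc bounded_linear.has_derivative[OF assms(2) tdo_has_derivative[OF Suc.prems]] in auto)
qed

lemma tdo_add:
  assumes "full_dirs S" "tdo k S f" "tdo k S g"
  shows "tdo k S (\<lambda>x. f x + g x)"
  using assms(2,3)
proof (induction k arbitrary: f g)
  case 0
  then show ?case by (simp add: continuous_on_add)
next
  case (Suc k)
  show ?case
    by (rule tdo_SucI[OF assms(1), where D = "\<lambda>x v. frechet_derivative f (at x within S) v + frechet_derivative g (at x within S) v"])
      (use Suc has_derivative_add[OF tdo_has_derivative[OF Suc.prems(1)] tdo_has_derivative[OF Suc.prems(2)]] in auto)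
qed

lemma tdo_sum:
  assumes "full_dirs S" "\<And>i. i \<in> I \<Longrightarrow> tdo k S (f i)"
  shows "tdo k S (\<lambda>x. \<Sum>i\<in>I. f i x)"
  using assms(2) by (induction I rule: infinite_finite_induct) (simp_all add: tdo_const tdo_add assms(1))

lemma tdo_bilinear:
  assumes "full_dirs S" "bounded_bilinear P" "tdo k S f" "tdo k S g"
  shows "tdo k S (\<lambda>x. P (f x) (g x))"
  using assms(3,4)
proof (induction k arbitrary: f g)
  case 0
  then show ?case using bounded_bilinear.continuous_on[OF assms(2)] by simp
next
  case (Suc k)
  let ?D = "\<lambda>x v. P (f x) (frechet_derivative g (at x within S) v) + P (frechet_derivative f (at x within S) v) (g x)"
  show ?case
  proof (rule tdo_SucI[OF assms(1), where D = ?D])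
    show "((\<lambda>x. P (f x) (g x)) has_derivative ?D x) (at x within S)" if "x \<in> S" for x
      by (rule bounded_bilinear.FDERIV[OF assms(2) tdo_has_derivative[OF Suc.prems(1) that] tdo_has_derivative[OF Suc.prems(2) that]])
    show "tdo k S (\<lambda>x. ?D x v)" for v
      by (intro tdo_add assms(1) Suc.IH tdo_Suc_D[OF Suc.prems(1)] tdo_Suc_D[OF Suc.prems(2)]) (use Suc.prems in simp_all)
  qed
qed

lemmas tdo_mult = tdo_bilinear[OF _ bounded_bilinear_mult]
lemmas tdo_scaleR = tdo_bilinear[OF _ bounded_bilinear_scaleR]

lemma at_within_open_Int: "open W \<Longrightarrow> x \<in> W \<Longrightarrow> at x within (S \<inter> W) = at x within S"
  by (rule at_within_nhd[of x W]) auto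

lemma tdo_restrict:
  assumes "open W" "tdo k S f"
  shows "tdo k (S \<inter> W) f"
  using assms(2)
proof (induction k arbitrary: f)
  case 0
  then show ?case by (auto intro: continuous_on_subset)
next
  case (Suc k)
  have "tdo k (S \<inter> W) (\<lambda>x. frechet_derivative f (at x within S) v)" for v
    using Suc by simp
  then have "tdo k (S \<inter> W) (\<lambda>x. frechet_derivative f (at x within (S \<inter> W)) v)" for v
    by (rule tdo_cong[rotated]) (simp add: at_within_open_Int[OF assms(1)])
  then show ?case using Suc.prems by (simp add: at_within_open_Int[OF assms(1)])
qed

text \<open>All higher derivatives at x depend on S near x only. This is how smoothness on the parts
  of the curve lying in single charts gives smoothness on the whole interval.\<close>

lemma tdo_local:
  assumes "\<And>x. x \<in> S \<Longrightarrow> \<exists>W. open W \<and> x \<in> W \<and> tdo k (S \<inter> W) f"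
  shows "tdo k S f"
  using assms
proof (induction k arbitrary: f)
  case 0
  show ?case unfolding times_differentiable_on.simps continuous_on_eq_continuous_within
  proof
    fix x assume "x \<in> S"
    then obtain W where W: "open W" "x \<in> W" "continuous_on (S \<inter> W) f" using 0 by force
    then have "continuous (at x within (S \<inter> W)) f" using \<open>x \<in> S\<close> by (simp add: continuous_on_eq_continuous_within)
    then show "continuous (at x within S) f" by (simp add: at_within_open_Int[OF W(1,2)])
  qed
next
  case (Suc k)
  show ?case unfolding times_differentiable_on.simps
  proof (intro conjI allI ballI)
    fix x assume "x \<in> S"
    then obtain W where W: "open W" "x \<in> W" "tdo (Suc k) (S \<inter> W) f" using Suc.prems by blast
    then have "f differentiable at x within (S \<inter> W)" using \<open>x \<in> S\<close> by simp
    then show "f differentiable at x within S" by (simp only: at_within_open_Int[OF W(1,2)])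
  next
    fix v
    show "tdo k S (\<lambda>x. frechet_derivative f (at x within S) v)"
    proof (rule Suc.IH)
      fix x assume "x \<in> S"
      then obtain W where W: "open W" "x \<in> W" "tdo (Suc k) (S \<inter> W) f" using Suc.prems by blast
      have "tdo k (S \<inter> W) (\<lambda>x. frechet_derivative f (at x within (S \<inter> W)) v)" using W(3) by simp
      then have "tdo k (S \<inter> W) (\<lambda>x. frechet_derivative f (at x within S) v)"
        by (rule tdo_cong[rotated]) (simp add: at_within_open_Int[OF W(1)])
      then show "\<exists>W. open W \<and> x \<in> W \<and> tdo k (S \<inter> W) (\<lambda>x. frechet_derivative f (at x within S) v)"
        using W by blast
    qed
  qed
qed

lemma linear_axis_expansion:
  fixes D :: "real ^ 'm::finite \<Rightarrow> 'b::real_vector"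
  assumes "linear D"
  shows "D v = (\<Sum>i\<in>UNIV. (v $ i) *\<^sub>R D (axis i 1))"
proof -
  have "D v = D (\<Sum>i\<in>UNIV. (v $ i) *\<^sub>R axis i 1)" by (simp add: basis_expansion scalar_mult_eq_scaleR[symmetric])
  then show ?thesis by (simp add: linear_sum[OF assms] linear_scale[OF assms])
qed

text \<open>The derivative of the composition combines partial derivatives of F along the curve, so
  the induction runs over all F at once. The expansion along the axes is there because higher
  differentiability is defined for derivatives in fixed directions.\<close>

lemma tdo_compose_curve:
  fixes F :: "real ^ 'm::finite \<Rightarrow> 'b::real_normed_vector" and x :: "real \<Rightarrow> real ^ 'm"
  assumes S: "full_dirs S" and U: "open U" and xU: "x ` S \<subseteq> U" and x: "tdo k S x" and F: "tdo k U F"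
  shows "tdo k S (\<lambda>t. F (x t))"
  using x F
proof (induction k arbitrary: F)
  case 0
  then show ?case using xU by (auto intro: continuous_on_compose2)
next
  case (Suc k)
  let ?x' = "\<lambda>t. frechet_derivative x (at t within S)" and ?F' = "\<lambda>y. frechet_derivative F (at y within U)"
  show ?case
  proof (rule tdo_SucI[OF S, where D = "\<lambda>t v. \<Sum>i\<in>UNIV. (?x' t v $ i) *\<^sub>R ?F' (x t) (axis i 1)"])
    fix t assume t: "t \<in> S"
    have "(F has_derivative ?F' (x t)) (at (x t) within x ` S)"
      using tdo_has_derivative[OF Suc.prems(2)] xU t by (blast intro: has_derivative_subset)
    from diff_chain_within[OF tdo_has_derivative[OF Suc.prems(1) t] this]
    have d: "((\<lambda>t. F (x t)) has_derivative (\<lambda>v. ?F' (x t) (?x' t v))) (at t within S)" by (simp add: o_def)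
    have "linear (?F' (x t))" using \<open>(F has_derivative _) _\<close> by (rule has_derivative_linear)
    then have "?F' (x t) (?x' t v) = (\<Sum>i\<in>UNIV. (?x' t v $ i) *\<^sub>R ?F' (x t) (axis i 1))" for v
      by (rule linear_axis_expansion)
    with d show "((\<lambda>t. F (x t)) has_derivative (\<lambda>v. \<Sum>i\<in>UNIV. (?x' t v $ i) *\<^sub>R ?F' (x t) (axis i 1))) (at t within S)"
      by simp
  next
    fix v
    show "tdo k S (\<lambda>t. \<Sum>i\<in>UNIV. (?x' t v $ i) *\<^sub>R ?F' (x t) (axis i 1))"
      by (intro tdo_sum tdo_scaleR S tdo_linear[OF S bounded_linear_vec_nth] Suc.IH tdo_Suc_D[OF Suc.prems(1)])
        (use Suc.prems in simp_all)
  qed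
qed

lemma smooth_deriv:
  assumes "smooth_on S f"
  shows "smooth_on S (\<lambda>x. frechet_derivative f (at x within S) v)"
  unfolding smooth_on_def
proof
  fix k
  have "tdo (Suc k) S f" using assms unfolding smooth_on_def by blast
  then show "tdo k S (\<lambda>x. frechet_derivative f (at x within S) v)" by simp
qed

lemma smooth_has_derivative:
  assumes "open U" "smooth_on U f" "x \<in> U"
  shows "(f has_derivative frechet_derivative f (at x)) (at x)"
proof -
  have "tdo (Suc 0) U f" using assms(2) unfolding smooth_on_def by blast
  from tdo_has_derivative[OF this assms(3)] show ?thesis by (simp only: at_within_open[OF assms(3,1)])
qed

lemma smooth_deriv_open:
  assumes "open U" "smooth_on U f"
  shows "smooth_on U (\<lambda>x. frechet_derivative f (at x) v)"
  unfolding smooth_on_def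
proof
  fix k
  have "tdo k U (\<lambda>x. frechet_derivative f (at x within U) v)"
    using smooth_deriv[OF assms(2), of v] unfolding smooth_on_def by blast
  then show "tdo k U (\<lambda>x. frechet_derivative f (at x) v)"
    by (rule tdo_cong[rotated]) (simp only: at_within_open[OF _ assms(1)])
qed

section \<open>Symmetry of second derivatives\<close>

lemma second_difference:
  fixes F :: "'a::real_normed_vector \<Rightarrow> real"
  assumes h: "0 < h"
    and sub: "\<And>a b. 0 \<le> a \<Longrightarrow> a \<le> h \<Longrightarrow> 0 \<le> b \<Longrightarrow> b \<le> h \<Longrightarrow> x + a *\<^sub>R u + b *\<^sub>R v \<in> U"
    and F': "\<And>y. y \<in> U \<Longrightarrow> (F has_derivative F' y) (at y)"
    and F'': "\<And>y. y \<in> U \<Longrightarrow> ((\<lambda>z. F' z u) has_derivative F'' y) (at y)"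
  obtains a b where "0 \<le> a" "a \<le> h" "0 \<le> b" "b \<le> h"
    "F (x + h *\<^sub>R u + h *\<^sub>R v) - F (x + h *\<^sub>R u) - F (x + h *\<^sub>R v) + F x = h\<^sup>2 * F'' (x + a *\<^sub>R u + b *\<^sub>R v) v"
proof -
  \<comment> \<open>The second difference is the increment in s of a first difference. The mean
    value theorem is applied in the direction u and then in the direction v.\<close>
  define \<phi> where "\<phi> s = F (x + s *\<^sub>R u + h *\<^sub>R v) - F (x + s *\<^sub>R u + 0 *\<^sub>R v)" for s
  have l: "((\<lambda>s. x + s *\<^sub>R u + b *\<^sub>R v) has_derivative (\<lambda>r. r *\<^sub>R u)) (at s within S)" for s b S
    by (auto intro!: derivative_eq_intros)
  have dF: "((\<lambda>s. F (x + s *\<^sub>R u + b *\<^sub>R v)) has_derivative (\<lambda>r. r * F' (x + s *\<^sub>R u + b *\<^sub>R v) u)) (at s within {0..h})"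
    if "0 \<le> s" "s \<le> h" "0 \<le> b" "b \<le> h" for s b
  proof -
    have f: "(F has_derivative F' (x + s *\<^sub>R u + b *\<^sub>R v)) (at (x + s *\<^sub>R u + b *\<^sub>R v))" by (rule F'[OF sub[OF that]])
    have "((\<lambda>s. F (x + s *\<^sub>R u + b *\<^sub>R v)) has_derivative (\<lambda>r. F' (x + s *\<^sub>R u + b *\<^sub>R v) (r *\<^sub>R u))) (at s within {0..h})"
      by (rule has_derivative_compose[OF l f])
    then show ?thesis by (simp add: linear_scale[OF has_derivative_linear[OF f]])
  qed
  have "\<exists>a\<in>{0<..<h}. \<phi> h - \<phi> 0 = (h - 0) * F' (x + a *\<^sub>R u + h *\<^sub>R v) u - (h - 0) * F' (x + a *\<^sub>R u + 0 *\<^sub>R v) u"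
    unfolding \<phi>_def
    by (rule mvt_simple[OF h, where f' = "\<lambda>a r. r * F' (x + a *\<^sub>R u + h *\<^sub>R v) u - r * F' (x + a *\<^sub>R u + 0 *\<^sub>R v) u"])
      (use h in \<open>auto intro!: has_derivative_diff dF[simplified] dF[where b = 0, simplified]\<close>)
  then obtain a where a: "0 < a" "a < h" "\<phi> h - \<phi> 0 = h * (F' (x + a *\<^sub>R u + h *\<^sub>R v) u - F' (x + a *\<^sub>R u + 0 *\<^sub>R v) u)"
    by (auto simp: right_diff_distrib)
  have dF': "((\<lambda>b. F' (x + a *\<^sub>R u + b *\<^sub>R v) u) has_derivative (\<lambda>r. r * F'' (x + a *\<^sub>R u + b *\<^sub>R v) v)) (at b within {0..h})"
    if "0 \<le> b" "b \<le> h" for b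
  proof -
    have f: "((\<lambda>z. F' z u) has_derivative F'' (x + a *\<^sub>R u + b *\<^sub>R v)) (at (x + a *\<^sub>R u + b *\<^sub>R v))"
      by (rule F''[OF sub]) (use a that in auto)
    have l': "((\<lambda>b. x + a *\<^sub>R u + b *\<^sub>R v) has_derivative (\<lambda>r. r *\<^sub>R v)) (at b within {0..h})"
      by (auto intro!: derivative_eq_intros)
    have "((\<lambda>b. F' (x + a *\<^sub>R u + b *\<^sub>R v) u) has_derivative (\<lambda>r. F'' (x + a *\<^sub>R u + b *\<^sub>R v) (r *\<^sub>R v))) (at b within {0..h})"
      by (rule has_derivative_compose[OF l' f])
    then show ?thesis by (simp add: linear_scale[OF has_derivative_linear[OF f]])
  qed
  obtain b where b: "b \<in> {0<..<h}" "F' (x + a *\<^sub>R u + h *\<^sub>R v) u - F' (x + a *\<^sub>R u + 0 *\<^sub>R v) u = (h - 0) * F'' (x + a *\<^sub>R u + b *\<^sub>R v) v"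
    using mvt_simple[OF h, where f = "\<lambda>b. F' (x + a *\<^sub>R u + b *\<^sub>R v) u" and f' = "\<lambda>b r. r * F'' (x + a *\<^sub>R u + b *\<^sub>R v) v"] dF'
    by blast
  have "F (x + h *\<^sub>R u + h *\<^sub>R v) - F (x + h *\<^sub>R u) - F (x + h *\<^sub>R v) + F x = \<phi> h - \<phi> 0" by (simp add: \<phi>_def)
  also have "\<dots> = h\<^sup>2 * F'' (x + a *\<^sub>R u + b *\<^sub>R v) v" unfolding a(3) b(2) by (simp add: power2_eq_square)
  finally show thesis using that[of a b] a b by auto
qed

text \<open>The same second difference divided by h^2 is a value of either mixed derivative at some
  nearby point; continuity at x identifies the two in the limit.\<close>

lemma schwarz_real:
  fixes F :: "'a::real_normed_vector \<Rightarrow> real"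
  assumes U: "open U" "x \<in> U" and F: "smooth_on U F"
  shows "frechet_derivative (\<lambda>y. frechet_derivative F (at y) u) (at x) v
       = frechet_derivative (\<lambda>y. frechet_derivative F (at y) v) (at x) u"
proof -
  define F2 where "F2 u v y = frechet_derivative (\<lambda>y. frechet_derivative F (at y) u) (at y) v" for u v y
  have F': "\<And>y. y \<in> U \<Longrightarrow> (F has_derivative frechet_derivative F (at y)) (at y)"
    by (rule smooth_has_derivative[OF U(1) F])
  have F'': "((\<lambda>z. frechet_derivative F (at z) u) has_derivative (\<lambda>v. F2 u v y)) (at y)" if "y \<in> U" for u y
    unfolding F2_def by (rule smooth_has_derivative[OF U(1) smooth_deriv_open[OF U(1) F] that])
  have cont: "continuous (at x) (F2 u v)" for u v
  proof -
    have "smooth_on U (F2 u v)" unfolding F2_def by (intro smooth_deriv_open U F)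
    then have "tdo 0 U (F2 u v)" unfolding smooth_on_def by blast
    then have "continuous_on U (F2 u v)" by simp
    then show ?thesis using U by (simp add: continuous_on_eq_continuous_at)
  qed
  have "F2 u v x = F2 v u x"
  proof (rule ccontr)
    assume ne: "F2 u v x \<noteq> F2 v u x"
    define e where "e = dist (F2 u v x) (F2 v u x) / 2"
    have e: "0 < e" using ne by (simp add: e_def)
    obtain d1 where d1: "0 < d1" "\<And>y. dist y x < d1 \<Longrightarrow> dist (F2 u v y) (F2 u v x) < e"
      using cont[of u v] e unfolding continuous_at_eps_delta by blast
    obtain d2 where d2: "0 < d2" "\<And>y. dist y x < d2 \<Longrightarrow> dist (F2 v u y) (F2 v u x) < e"
      using cont[of v u] e unfolding continuous_at_eps_delta by blast
    obtain r where r: "0 < r" "ball x r \<subseteq> U" using U by (meson open_contains_ball)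
    define \<delta> where "\<delta> = min (min d1 d2) r"
    \<comment> \<open>The summand 1 keeps c positive when both vectors vanish. With this h the whole
      parallelogram stays within \<delta> / 2 of x.\<close>
    define c where "c = norm u + norm v + 1"
    define h where "h = \<delta> / (2 * c)"
    have pos: "0 < c" by (simp add: c_def add_nonneg_pos)
    have \<delta>: "0 < \<delta>" using d1 d2 r by (simp add: \<delta>_def)
    have h: "0 < h" using \<delta> pos by (simp add: h_def)
    have near: "dist (x + a *\<^sub>R u' + b *\<^sub>R v') x < \<delta>"
      if "0 \<le> a" "a \<le> h" "0 \<le> b" "b \<le> h" "u' = u \<and> v' = v \<or> u' = v \<and> v' = u" for a b u' v'
    proof -
      have "norm (a *\<^sub>R u' + b *\<^sub>R v') \<le> a * norm u' + b * norm v'"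
        using norm_triangle_ineq[of "a *\<^sub>R u'" "b *\<^sub>R v'"] that by simp
      also have "\<dots> \<le> h * norm u' + h * norm v'" using that by (intro add_mono mult_right_mono) auto
      also have "\<dots> \<le> h * c" using that(5) h by (auto simp: c_def algebra_simps)
      also have "\<dots> = \<delta> / 2" using pos by (simp add: h_def)
      also have "\<dots> < \<delta>" using \<delta> by simp
      finally show ?thesis by (simp add: dist_norm)
    qed
    have sub: "x + a *\<^sub>R u' + b *\<^sub>R v' \<in> U"
      if "0 \<le> a" "a \<le> h" "0 \<le> b" "b \<le> h" "u' = u \<and> v' = v \<or> u' = v \<and> v' = u" for a b u' v'
      using near[OF that] r by (auto simp: \<delta>_def dist_commute subset_iff)
    obtain a b where ab: "0 \<le> a" "a \<le> h" "0 \<le> b" "b \<le> h"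
      "F (x + h *\<^sub>R u + h *\<^sub>R v) - F (x + h *\<^sub>R u) - F (x + h *\<^sub>R v) + F x = h\<^sup>2 * F2 u v (x + a *\<^sub>R u + b *\<^sub>R v)"
      by (rule second_difference[OF h _ F' F'', of x u v]) (use sub in auto)
    obtain a' b' where ab': "0 \<le> a'" "a' \<le> h" "0 \<le> b'" "b' \<le> h"
      "F (x + h *\<^sub>R v + h *\<^sub>R u) - F (x + h *\<^sub>R v) - F (x + h *\<^sub>R u) + F x = h\<^sup>2 * F2 v u (x + a' *\<^sub>R v + b' *\<^sub>R u)"
      by (rule second_difference[OF h _ F' F'', of x v u]) (use sub in auto)
    have "h\<^sup>2 * F2 u v (x + a *\<^sub>R u + b *\<^sub>R v) = h\<^sup>2 * F2 v u (x + a' *\<^sub>R v + b' *\<^sub>R u)"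
    proof -
      have "x + h *\<^sub>R u + h *\<^sub>R v = x + h *\<^sub>R v + h *\<^sub>R u" by simp
      then have "F (x + h *\<^sub>R u + h *\<^sub>R v) = F (x + h *\<^sub>R v + h *\<^sub>R u)" by (rule arg_cong)
      then show ?thesis using ab(5) ab'(5) by linarith
    qed
    then have eq: "F2 u v (x + a *\<^sub>R u + b *\<^sub>R v) = F2 v u (x + a' *\<^sub>R v + b' *\<^sub>R u)" using h by simp
    have "dist (F2 u v (x + a *\<^sub>R u + b *\<^sub>R v)) (F2 u v x) < e"
      by (rule d1(2)) (use near[OF ab(1-4), of u v] in \<open>simp add: \<delta>_def\<close>)
    moreover have "dist (F2 v u (x + a' *\<^sub>R v + b' *\<^sub>R u)) (F2 v u x) < e"
      by (rule d2(2)) (use near[OF ab'(1-4), of v u] in \<open>simp add: \<delta>_def\<close>)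
    ultimately have "dist (F2 u v x) (F2 v u x) < 2 * e" unfolding eq dist_real_def by linarith
    then show False by (simp add: e_def)
  qed
  then show ?thesis by (simp add: F2_def)
qed

lemma frechet_derivative_cong_open:
  assumes "open U" "x \<in> U" "\<And>y. y \<in> U \<Longrightarrow> f y = g y"
  shows "frechet_derivative f (at x) = frechet_derivative g (at x)"
  using frechet_derivative_cong[OF assms(2,3)] by (simp add: at_within_open[OF assms(2,1)])

lemma smooth_cong: "(\<And>x. x \<in> S \<Longrightarrow> f x = g x) \<Longrightarrow> smooth_on S f \<Longrightarrow> smooth_on S g"
  unfolding smooth_on_def using tdo_cong by blast

lemma smooth_const: "full_dirs S \<Longrightarrow> smooth_on S (\<lambda>x. c)"
  by (simp add: smooth_on_def tdo_const)

lemma smooth_linear: "full_dirs S \<Longrightarrow> bounded_linear L \<Longrightarrow> smooth_on S f \<Longrightarrow> smooth_on S (\<lambda>x. L (f x))"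
  by (simp add: smooth_on_def tdo_linear)

lemma smooth_add: "full_dirs S \<Longrightarrow> smooth_on S f \<Longrightarrow> smooth_on S g \<Longrightarrow> smooth_on S (\<lambda>x. f x + g x)"
  by (simp add: smooth_on_def tdo_add)

lemma smooth_minus: "full_dirs S \<Longrightarrow> smooth_on S f \<Longrightarrow> smooth_on S (\<lambda>x. - f x)"
  by (rule smooth_linear[OF _ bounded_linear_minus[OF bounded_linear_ident]])

lemma smooth_diff: "full_dirs S \<Longrightarrow> smooth_on S f \<Longrightarrow> smooth_on S g \<Longrightarrow> smooth_on S (\<lambda>x. f x - g x)"
  using smooth_add[OF _ _ smooth_minus, of S f g] by simp

lemma smooth_sum: "full_dirs S \<Longrightarrow> (\<And>i. i \<in> I \<Longrightarrow> smooth_on S (f i)) \<Longrightarrow> smooth_on S (\<lambda>x. \<Sum>i\<in>I. f i x)"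
  by (simp add: smooth_on_def tdo_sum)

lemma smooth_mult:
  fixes f g :: "'a::euclidean_space \<Rightarrow> real"
  shows "full_dirs S \<Longrightarrow> smooth_on S f \<Longrightarrow> smooth_on S g \<Longrightarrow> smooth_on S (\<lambda>x. f x * g x)"
  by (simp add: smooth_on_def tdo_mult)

lemma smooth_scaleR: "full_dirs S \<Longrightarrow> smooth_on S f \<Longrightarrow> smooth_on S g \<Longrightarrow> smooth_on S (\<lambda>x. f x *\<^sub>R g x)"
  by (simp add: smooth_on_def tdo_scaleR)

lemma smooth_prod:
  fixes f :: "'i \<Rightarrow> 'a::euclidean_space \<Rightarrow> real"
  shows "full_dirs S \<Longrightarrow> (\<And>i. i \<in> I \<Longrightarrow> smooth_on S (f i)) \<Longrightarrow> smooth_on S (\<lambda>x. \<Prod>i\<in>I. f i x)"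
  by (induction I rule: infinite_finite_induct) (simp_all add: smooth_const smooth_mult)

text \<open>The derivative of 1 / f is - (1 / f) f' (1 / f), so each order for 1 / f gives the next
  one.\<close>

lemma smooth_inverse:
  fixes f :: "'a::euclidean_space \<Rightarrow> real"
  assumes S: "full_dirs S" and f: "smooth_on S f" and nz: "\<And>x. x \<in> S \<Longrightarrow> f x \<noteq> 0"
  shows "smooth_on S (\<lambda>x. inverse (f x))"
  unfolding smooth_on_def
proof
  fix k
  show "tdo k S (\<lambda>x. inverse (f x))"
  proof (induction k)
    case 0
    have "tdo 0 S f" using f unfolding smooth_on_def by blast
    then show ?case using nz by (auto intro: continuous_intros)
  next
    case (Suc k)
    have f': "tdo (Suc k) S f" using f unfolding smooth_on_def by blast
    show ?case
    proof (rule tdo_SucI[OF S, where D = "\<lambda>x v. (- 1) * ((inverse (f x) * frechet_derivative f (at x within S) v) * inverse (f x))"])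
      show "((\<lambda>x. inverse (f x)) has_derivative (\<lambda>v. (- 1) * ((inverse (f x) * frechet_derivative f (at x within S) v) * inverse (f x)))) (at x within S)"
        if "x \<in> S" for x
        using Deriv.has_derivative_inverse[OF nz[OF that] tdo_has_derivative[OF f' that]] by simp
      show "tdo k S (\<lambda>x. (- 1) * ((inverse (f x) * frechet_derivative f (at x within S) v) * inverse (f x)))" for v
        by (intro tdo_mult tdo_const S Suc.IH) (use f' in simp)
    qed
  qed
qed

lemma smooth_vec:
  fixes f :: "'a::euclidean_space \<Rightarrow> real ^ 'm::finite"
  assumes "full_dirs S" "\<And>i. smooth_on S (\<lambda>x. f x $ i)"
  shows "smooth_on S f"
proof -
  have "smooth_on S (\<lambda>x. \<Sum>i\<in>UNIV. (f x $ i) *\<^sub>R (axis i 1 :: real ^ 'm))"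
    by (intro smooth_sum smooth_scaleR smooth_const assms)
  then show ?thesis by (simp add: basis_expansion scalar_mult_eq_scaleR[symmetric])
qed

lemma smooth_vec_nth: "full_dirs S \<Longrightarrow> smooth_on S f \<Longrightarrow> smooth_on S (\<lambda>x. f x $ i)"
  by (rule smooth_linear[OF _ bounded_linear_vec_nth])

lemma smooth_det:
  fixes M :: "'a::euclidean_space \<Rightarrow> real ^ 'm ^ 'm::finite"
  assumes "full_dirs S" "\<And>i j. smooth_on S (\<lambda>x. M x $ i $ j)"
  shows "smooth_on S (\<lambda>x. Determinants.det (M x))"
  unfolding Determinants.det_def by (intro smooth_sum smooth_mult smooth_const smooth_prod assms)

text \<open>Cramer's rule writes an entry of the inverse as a quotient of determinants.\<close>

lemma smooth_matrix_inv:
  fixes M :: "'a::euclidean_space \<Rightarrow> real ^ 'm ^ 'm::finite"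
  assumes S: "full_dirs S" and M: "\<And>i j. smooth_on S (\<lambda>x. M x $ i $ j)" and inv: "\<And>x. x \<in> S \<Longrightarrow> invertible (M x)"
  shows "smooth_on S (\<lambda>x. matrix_inv (M x) $ k $ l)"
proof -
  let ?N = "\<lambda>x. (\<chi> i j. if j = k then axis l 1 $ i else M x $ i $ j) :: real ^ 'm ^ 'm"
  have eq: "Determinants.det (?N x) * inverse (Determinants.det (M x)) = matrix_inv (M x) $ k $ l" if "x \<in> S" for x
  proof -
    have d: "Determinants.det (M x) \<noteq> 0" using inv[OF that] invertible_det_nz by blast
    have "M x ** matrix_inv (M x) = Finite_Cartesian_Product.mat 1"
      using inv[OF that] unfolding invertible_def matrix_inv_def by (rule someI2_ex) simp
    then have "M x *v (matrix_inv (M x) *v axis l 1) = axis l 1"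
      by (simp add: matrix_vector_mul_assoc)
    then have "matrix_inv (M x) *v axis l 1 = (\<chi> k. Determinants.det (\<chi> i j. if j = k then axis l 1 $ i else M x $ i $ j) / Determinants.det (M x))"
      by (simp only: cramer[OF d])
    then have "(matrix_inv (M x) *v axis l 1) $ k = Determinants.det (?N x) / Determinants.det (M x)" by simp
    then show ?thesis by (simp add: matrix_vector_mul_component inner_axis divide_inverse)
  qed
  have "smooth_on S (\<lambda>x. Determinants.det (?N x))"
  proof (rule smooth_det[OF S])
    show "smooth_on S (\<lambda>x. ?N x $ i $ j)" for i j
      by (cases "j = k") (simp_all add: M smooth_const[OF S])
  qed
  moreover have "smooth_on S (\<lambda>x. inverse (Determinants.det (M x)))"
    by (rule smooth_inverse[OF S smooth_det[OF S M]]) (use inv invertible_det_nz in blast)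
  ultimately have "smooth_on S (\<lambda>x. Determinants.det (?N x) * inverse (Determinants.det (M x)))" by (rule smooth_mult[OF S])
  then show ?thesis by (rule smooth_cong[rotated]) (simp only: eq)
qed

lemma schwarz:
  fixes F :: "'a::real_normed_vector \<Rightarrow> 'b::real_inner"
  assumes U: "open U" "x \<in> U" and F: "smooth_on U F" and Fz: "\<And>z. smooth_on U (\<lambda>x. F x \<bullet> z)"
  shows "frechet_derivative (\<lambda>y. frechet_derivative F (at y) u) (at x) v
       = frechet_derivative (\<lambda>y. frechet_derivative F (at y) v) (at x) u"
proof -
  have d1: "frechet_derivative (\<lambda>x. F x \<bullet> z) (at y) u = frechet_derivative F (at y) u \<bullet> z" if "y \<in> U" for y u z
    by (subst frechet_derivative_at[symmetric, OF has_derivative_inner_left[OF smooth_has_derivative[OF U(1) F that]]]) simp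
  have d2: "frechet_derivative (\<lambda>y. frechet_derivative F (at y) u \<bullet> z) (at x) v
      = frechet_derivative (\<lambda>y. frechet_derivative F (at y) u) (at x) v \<bullet> z" for u v z
    by (subst frechet_derivative_at[symmetric, OF has_derivative_inner_left[OF smooth_has_derivative[OF U(1) smooth_deriv_open[OF U(1) F] U(2)]]]) simp
  have "frechet_derivative (\<lambda>y. frechet_derivative F (at y) u) (at x) v \<bullet> z
      = frechet_derivative (\<lambda>y. frechet_derivative F (at y) v) (at x) u \<bullet> z" for z
    using schwarz_real[OF U Fz[of z], of u v]
    by (simp only: d2[symmetric] frechet_derivative_cong_open[OF U d1])
  then show ?thesis by (metis vector_eq_rdot)
qed

section \<open>Tensor fields in a chart\<close>

lemma bilinear_axis_expansion:
  fixes B :: "real ^ 'm::finite \<Rightarrow> real ^ 'm \<Rightarrow> 'b::real_normed_vector"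
  assumes "bounded_bilinear B"
  shows "B a b = (\<Sum>i\<in>UNIV. \<Sum>j\<in>UNIV. (a $ i * b $ j) *\<^sub>R B (axis i 1) (axis j 1))"
proof -
  interpret bounded_bilinear B by fact
  have l: "linear (\<lambda>a. B a b)" "linear (\<lambda>b. B a b)" for a b
    by (auto intro!: linearI simp: add_left add_right scaleR_left scaleR_right)
  show ?thesis
    by (subst linear_axis_expansion[OF l(1)], subst linear_axis_expansion[OF l(2)])
      (simp add: scaleR_sum_right)
qed

text \<open>A common frame for the metric, for the Christoffel form and, by
  \<open>deriv_family\<close>, for their derivatives in a fixed direction.\<close>

locale bilinear_family =
  fixes U :: "(real ^ 'm::finite) set" and F :: "real ^ 'm \<Rightarrow> real ^ 'm \<Rightarrow> real ^ 'm \<Rightarrow> 'b::real_normed_vector"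
  assumes U: "open U" and bil: "\<And>x. x \<in> U \<Longrightarrow> bounded_bilinear (F x)" and F: "\<And>a b. smooth_on U (\<lambda>x. F x a b)"
begin

abbreviation DF where "DF x a b \<equiv> frechet_derivative (\<lambda>x. F x a b) (at x)"

lemma dF: "x \<in> U \<Longrightarrow> ((\<lambda>x. F x a b) has_derivative DF x a b) (at x)"
  by (rule smooth_has_derivative[OF U F])

lemma DF_eqI:
  assumes "x \<in> U" "(f has_derivative D) (at x)" "\<And>y. y \<in> U \<Longrightarrow> f y = F y a b"
  shows "DF x a b = D"
  using frechet_derivative_at[symmetric, OF has_derivative_transform_within_open[OF assms(2) U assms(1)]] assms(3) by metis

lemma bilinear_DF: assumes x: "x \<in> U" shows "bounded_bilinear (\<lambda>a b. DF x a b h)"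
proof -
  note b = bounded_bilinear.add_left[OF bil] bounded_bilinear.add_right[OF bil]
    bounded_bilinear.scaleR_left[OF bil] bounded_bilinear.scaleR_right[OF bil]
  have "bilinear (\<lambda>a b. DF x a b h)"
    unfolding bilinear_def
  proof (intro conjI allI linearI)
    fix a b c r
    show "DF x a (b + c) h = DF x a b h + DF x a c h"
      by (subst DF_eqI[OF x has_derivative_add[OF dF[OF x] dF[OF x]]]) (simp_all add: b)
    show "DF x (b + c) a h = DF x b a h + DF x c a h"
      by (subst DF_eqI[OF x has_derivative_add[OF dF[OF x] dF[OF x]]]) (simp_all add: b)
    show "DF x a (r *\<^sub>R b) h = r *\<^sub>R DF x a b h"
      by (subst DF_eqI[OF x has_derivative_scaleR_right[OF dF[OF x]]]) (simp_all add: b)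
    show "DF x (r *\<^sub>R b) a h = r *\<^sub>R DF x b a h"
      by (subst DF_eqI[OF x has_derivative_scaleR_right[OF dF[OF x]]]) (simp_all add: b)
  qed
  then show ?thesis by (simp add: bilinear_conv_bounded_bilinear)
qed

lemma deriv_family: "bilinear_family U (\<lambda>x a b. DF x a b h)"
  by (rule bilinear_family.intro[OF U bilinear_DF smooth_deriv_open[OF U F]])

text \<open>Expanding both arguments along the axes leaves products of real functions with functions
  of the base point alone.\<close>

lemma product_rule:
  fixes y :: "'z::real_normed_vector \<Rightarrow> real ^ 'm"
  assumes y: "(y has_derivative y') (at z within S)" and a: "(a has_derivative a') (at z within S)"
    and b: "(b has_derivative b') (at z within S)" and yU: "\<And>z. z \<in> S \<Longrightarrow> y z \<in> U" and z: "z \<in> S"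
  shows "((\<lambda>z. F (y z) (a z) (b z)) has_derivative
    (\<lambda>h. DF (y z) (a z) (b z) (y' h) + F (y z) (a' h) (b z) + F (y z) (a z) (b' h))) (at z within S)"
proof -
  let ?f = "\<lambda>i j x. F x (axis i 1) (axis j 1)" and ?D = "\<lambda>i j. DF (y z) (axis i 1) (axis j 1)"
  have f: "((\<lambda>z. ?f i j (y z)) has_derivative (\<lambda>h. ?D i j (y' h))) (at z within S)" for i j
    by (rule has_derivative_compose[OF y dF[OF yU[OF z]]])
  have c: "((\<lambda>z. a z $ i * b z $ j) has_derivative (\<lambda>h. a z $ i * b' h $ j + a' h $ i * b z $ j)) (at z within S)" for i j
    by (intro has_derivative_mult bounded_linear.has_derivative[OF bounded_linear_vec_nth] a b)
  have "((\<lambda>z. \<Sum>i\<in>UNIV. \<Sum>j\<in>UNIV. (a z $ i * b z $ j) *\<^sub>R ?f i j (y z)) has_derivative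
    (\<lambda>h. \<Sum>i\<in>UNIV. \<Sum>j\<in>UNIV. (a z $ i * b z $ j) *\<^sub>R ?D i j (y' h) + (a z $ i * b' h $ j + a' h $ i * b z $ j) *\<^sub>R ?f i j (y z))) (at z within S)"
    by (intro has_derivative_sum has_derivative_scaleR f c)
  then have d: "((\<lambda>z. F (y z) (a z) (b z)) has_derivative
    (\<lambda>h. \<Sum>i\<in>UNIV. \<Sum>j\<in>UNIV. (a z $ i * b z $ j) *\<^sub>R ?D i j (y' h) + (a z $ i * b' h $ j + a' h $ i * b z $ j) *\<^sub>R ?f i j (y z))) (at z within S)"
    by (rule has_derivative_transform[OF z, rotated]) (use bilinear_axis_expansion[OF bil[OF yU]] in simp)
  have e: "(\<Sum>i\<in>UNIV. \<Sum>j\<in>UNIV. (a z $ i * b z $ j) *\<^sub>R ?D i j (y' h) + (a z $ i * b' h $ j + a' h $ i * b z $ j) *\<^sub>R ?f i j (y z))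
     = DF (y z) (a z) (b z) (y' h) + F (y z) (a' h) (b z) + F (y z) (a z) (b' h)" for h
    unfolding bilinear_axis_expansion[OF bilinear_DF[OF yU[OF z]], of "a z" "b z"]
      bilinear_axis_expansion[OF bil[OF yU[OF z]], of "a' h" "b z"] bilinear_axis_expansion[OF bil[OF yU[OF z]], of "a z" "b' h"]
    by (simp add: sum.distrib scaleR_add_left)
  show ?thesis using d unfolding e .
qed

lemma smooth_along:
  fixes y :: "real \<Rightarrow> real ^ 'm"
  assumes S: "full_dirs S" and y: "smooth_on S y" and yU: "y ` S \<subseteq> U" and a: "smooth_on S a" and b: "smooth_on S b"
  shows "smooth_on S (\<lambda>t. F (y t) (a t) (b t))"
proof -
  have f: "smooth_on S (\<lambda>t. F (y t) v w)" for v w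
    using tdo_compose_curve[OF S U yU] y F[of v w] unfolding smooth_on_def by blast
  have "smooth_on S (\<lambda>t. \<Sum>i\<in>UNIV. \<Sum>j\<in>UNIV. (a t $ i * b t $ j) *\<^sub>R F (y t) (axis i 1) (axis j 1))"
    by (intro smooth_sum smooth_scaleR smooth_mult smooth_vec_nth f a b S)
  then show ?thesis
    by (rule smooth_cong[rotated]) (use bilinear_axis_expansion[OF bil] yU in \<open>simp add: image_subset_iff\<close>)
qed

lemma smooth_DF_along:
  fixes y :: "real \<Rightarrow> real ^ 'm"
  assumes S: "full_dirs S" and y: "smooth_on S y" and yU: "y ` S \<subseteq> U" and a: "smooth_on S a" and b: "smooth_on S b" and c: "smooth_on S c"
  shows "smooth_on S (\<lambda>t. DF (y t) (a t) (b t) (c t))"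
proof -
  have "smooth_on S (\<lambda>t. \<Sum>k\<in>UNIV. (c t $ k) *\<^sub>R DF (y t) (a t) (b t) (axis k 1))"
    by (intro smooth_sum smooth_scaleR smooth_vec_nth c S bilinear_family.smooth_along[OF deriv_family S y yU a b])
  then show ?thesis
  proof (rule smooth_cong[rotated])
    fix t assume "t \<in> S"
    then have "linear (DF (y t) (a t) (b t))" using yU dF has_derivative_linear by blast
    then show "(\<Sum>k\<in>UNIV. (c t $ k) *\<^sub>R DF (y t) (a t) (b t) (axis k 1)) = DF (y t) (a t) (b t) (c t)"
      by (rule linear_axis_expansion[symmetric])
  qed
qed

end

section \<open>Connection and curvature of a metric in one chart\<close>

lemma christoffel_form_bilinear: "bounded_bilinear (christoffel_form G x)"
proof -
  have "bilinear (christoffel_form G x)"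
    unfolding bilinear_def
    by (intro conjI allI linearI)
      (simp_all add: christoffel_form_def Finite_Cartesian_Product.vec_eq_iff algebra_simps sum.distrib sum_distrib_left)
  then show ?thesis by (simp add: bilinear_conv_bounded_bilinear)
qed

locale chart_metric =
  fixes U :: "(real ^ 'm::finite) set" and G :: "real ^ 'm \<Rightarrow> real ^ 'm ^ 'm"
  assumes U: "open U" and G: "smooth_on U G"
    and tr: "\<And>x. x \<in> U \<Longrightarrow> Finite_Cartesian_Product.transpose (G x) = G x"
    and inv: "\<And>x. x \<in> U \<Longrightarrow> invertible (G x)"
begin

abbreviation gm where "gm x v w \<equiv> inner v (G x *v w)"

lemma gm_commute: "x \<in> U \<Longrightarrow> gm x v w = gm x w v"
  by (metis dot_lmul_matrix inner_commute transpose_matrix_vector tr)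

lemma gm_nondegenerate:
  assumes x: "x \<in> U" and v: "\<And>w. gm x v w = 0"
  shows "v = 0"
proof -
  have "(G x *v v) \<bullet> w = 0" for w using v[of w] gm_commute[OF x, of v w] by (simp add: inner_commute)
  then have "G x *v v = 0" using inner_eq_zero_iff by blast
  moreover obtain M where "M ** G x = Finite_Cartesian_Product.mat 1" using inv[OF x] unfolding invertible_def by blast
  ultimately show ?thesis by (metis matrix_vector_mul_assoc matrix_vector_mul_lid matrix_vector_mult_0_right)
qed

lemma G_nth: "smooth_on U (\<lambda>x. G x $ i $ j)"
  by (intro smooth_vec_nth full_dirs_open U G)

sublocale gm: bilinear_family U gm
proof (rule bilinear_family.intro)
  show "open U" by (rule U)
  have "bilinear (gm x)" for x
    unfolding bilinear_def
    by (intro conjI allI linearI) (simp_all add: inner_simps matrix_vector_right_distrib matrix_vector_mult_scaleR)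
  then show "bounded_bilinear (gm x)" for x by (simp add: bilinear_conv_bounded_bilinear)
  have "smooth_on U (\<lambda>x. \<Sum>i\<in>UNIV. v $ i * (\<Sum>j\<in>UNIV. G x $ i $ j * w $ j))" for v w
    by (intro smooth_sum smooth_mult smooth_const full_dirs_open U G_nth)
  then show "smooth_on U (\<lambda>x. gm x v w)" for v w
    by (simp add: inner_vec_def matrix_vector_mult_def)
qed

sublocale \<Gamma>: bilinear_family U "christoffel_form G"
proof (rule bilinear_family.intro)
  show "open U" by (rule U)
  show "bounded_bilinear (christoffel_form G x)" for x by (rule christoffel_form_bilinear)
  have p: "smooth_on U (\<lambda>x. partial_metric G x k i j)" for k i j
    unfolding partial_metric_def by (intro smooth_vec_nth full_dirs_open U smooth_deriv_open G)
  have "smooth_on U (\<lambda>x. 1 / 2 * (\<Sum>l\<in>UNIV. matrix_inv (G x) $ k $ l *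
     (partial_metric G x i j l + partial_metric G x j i l - partial_metric G x l i j)))" for k i j
    by (intro smooth_mult smooth_sum smooth_diff smooth_add smooth_const full_dirs_open U p
        smooth_matrix_inv G_nth inv)
  then have "smooth_on U (\<lambda>x. christoffel G x k i j)" for k i j unfolding christoffel_def .
  then have "smooth_on U (\<lambda>x. \<Sum>i\<in>UNIV. \<Sum>j\<in>UNIV. christoffel G x k i j * v $ i * w $ j)" for k v w
    by (intro smooth_mult smooth_sum smooth_const full_dirs_open U)
  then show "smooth_on U (\<lambda>x. christoffel_form G x v w)" for v w
    by (intro smooth_vec full_dirs_open U) (simp add: christoffel_form_def)
qed

lemma G_differentiable: "x \<in> U \<Longrightarrow> G differentiable (at x)"
  using smooth_has_derivative[OF U G] by (auto simp: differentiable_def)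

lemma \<Gamma>_commute: "x \<in> U \<Longrightarrow> christoffel_form G x v w = christoffel_form G x w v"
proof -
  assume x: "x \<in> U"
  have c: "christoffel G x k i j = christoffel G x k j i" for k i j
    by (rule christoffel_torsion_free[OF U x G_differentiable[OF x] tr])
  have "(\<Sum>i\<in>UNIV. \<Sum>j\<in>UNIV. christoffel G x k i j * v $ i * w $ j) = (\<Sum>i\<in>UNIV. \<Sum>j\<in>UNIV. christoffel G x k i j * w $ i * v $ j)" for k
    by (subst sum.swap, intro sum.cong refl) (use c in simp)
  then show ?thesis unfolding christoffel_form_def by simp
qed

text \<open>On axis vectors this is \<open>christoffel_metric\<close>, and both sides are linear in
  each of the three vectors.\<close>

lemma metric_compatible:
  assumes x: "x \<in> U"
  shows "frechet_derivative (\<lambda>y. gm y v w) (at x) u = gm x (christoffel_form G x u v) w + gm x v (christoffel_form G x u w)"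
proof -
  let ?\<Gamma> = "christoffel_form G x"
  have ax: "frechet_derivative (\<lambda>y. gm y (axis i 1) (axis j 1)) (at x) (axis k 1)
    = gm x (?\<Gamma> (axis k 1) (axis i 1)) (axis j 1) + gm x (axis i 1) (?\<Gamma> (axis k 1) (axis j 1))" for i j k
  proof -
    have "inner (axis i 1) (G y *v axis j 1) = G y $ i $ j" for y
      by (simp add: inner_axis' matrix_vector_mul_component)  (simp add: inner_axis)
    then have "frechet_derivative (\<lambda>y. gm y (axis i 1) (axis j 1)) (at x) = (\<lambda>v. frechet_derivative G (at x) v $ i $ j)"
      using frechet_derivative_at[symmetric, OF frechet_derivative_matrix_nth[OF G_differentiable[OF x]]] by simp
    moreover have c: "?\<Gamma> (axis k 1) (axis i 1) $ l = christoffel G x l k i" for k i l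
    proof -
      have "axis k (1::real) $ i = (if i = k then 1 else 0)" for k i :: 'm by (simp add: axis_def)
      then show ?thesis by (simp add: christoffel_form_def mult_delta_right)
    qed
    have "gm x (axis j 1) (?\<Gamma> (axis k 1) (axis i 1)) = (\<Sum>l\<in>UNIV. G x $ j $ l * christoffel G x l k i)" for i j k
      unfolding inner_axis' by (simp add: matrix_vector_mult_def c)
    ultimately show ?thesis
      using christoffel_metric[OF U x G_differentiable[OF x] inv[OF x] tr, of k i j]
      by (simp add: partial_metric_def gm_commute[OF x, of _ "axis j 1"])
  qed
  have l: "linear (\<lambda>u. frechet_derivative (\<lambda>y. gm y v w) (at x) u)" for v w
    by (rule has_derivative_linear[OF gm.dF[OF x]])
  note gb = bounded_bilinear.add_left[OF gm.bil[OF x]] bounded_bilinear.add_right[OF gm.bil[OF x]]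
    bounded_bilinear.scaleR_left[OF gm.bil[OF x]] bounded_bilinear.scaleR_right[OF gm.bil[OF x]]
  note cb = bounded_bilinear.add_left[OF christoffel_form_bilinear] bounded_bilinear.add_right[OF christoffel_form_bilinear]
    bounded_bilinear.scaleR_left[OF christoffel_form_bilinear] bounded_bilinear.scaleR_right[OF christoffel_form_bilinear]
  define C where "C u v w = gm x (?\<Gamma> u v) w + gm x v (?\<Gamma> u w)" for u v w
  have lC: "linear (\<lambda>u. C u v w)" for v w by (rule linearI) (simp_all add: C_def gb cb algebra_simps)
  have bC: "bounded_bilinear (\<lambda>v w. C u v w)" for u
  proof -
    have "bilinear (\<lambda>v w. C u v w)"
      unfolding bilinear_def by (intro conjI allI linearI) (simp_all add: C_def gb cb algebra_simps)
    then show ?thesis by (simp add: bilinear_conv_bounded_bilinear)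
  qed
  have "frechet_derivative (\<lambda>y. gm y (axis i 1) (axis j 1)) (at x) u = C u (axis i 1) (axis j 1)" for i j
    using linear_axis_expansion[OF l[of "axis i 1" "axis j 1"], of u] linear_axis_expansion[OF lC[of "axis i 1" "axis j 1"], of u]
    by (simp add: ax C_def)
  then show ?thesis
    using bilinear_axis_expansion[OF gm.bilinear_DF[OF x], of v w u] bilinear_axis_expansion[OF bC, of u v w]
    by (simp add: C_def)
qed

text \<open>The curvature operator on fields that are constant in the chart. Their Lie bracket
  vanishes, which leaves derivatives and products of the Christoffel form.\<close>

definition curv :: "real ^ 'm \<Rightarrow> real ^ 'm \<Rightarrow> real ^ 'm \<Rightarrow> real ^ 'm \<Rightarrow> real ^ 'm" where
  "curv x u v w = \<Gamma>.DF x v w u + christoffel_form G x u (christoffel_form G x v w)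
     - \<Gamma>.DF x u w v - christoffel_form G x v (christoffel_form G x u w)"

lemma curvature_op_const:
  assumes x: "x \<in> U"
  shows "curvature_op G (\<lambda>_. u) (\<lambda>_. v) (\<lambda>_. w) x = curv x u v w"
proof -
  have z: "christoffel_form G x 0 w = 0" by (rule bounded_bilinear.zero_left[OF christoffel_form_bilinear])
  have n: "nabla G (\<lambda>_. v) (\<lambda>_. w) = (\<lambda>x. christoffel_form G x v w)" for v w
    by (simp add: nabla_def frechet_derivative_const)
  show ?thesis unfolding curvature_op_def n
    by (simp add: nabla_def lie_bracket_def frechet_derivative_const z curv_def)
qed

lemma curv_alt: "curv x v u w = - curv x u v w" by (simp add: curv_def)

lemma curv_bilinear: assumes x: "x \<in> U" shows "bounded_bilinear (\<lambda>v w. curv x u v w)"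
proof -
  define B where "B u v w = \<Gamma>.DF x v w u" for u v w
  have l: "linear (\<Gamma>.DF x v w)" for v w by (rule has_derivative_linear[OF \<Gamma>.dF[OF x]])
  note \<Gamma>' = bounded_bilinear.add_left[OF christoffel_form_bilinear] bounded_bilinear.add_right[OF christoffel_form_bilinear]
    bounded_bilinear.scaleR_left[OF christoffel_form_bilinear] bounded_bilinear.scaleR_right[OF christoffel_form_bilinear]
  note B = bounded_bilinear.add_left[OF \<Gamma>.bilinear_DF[OF x], folded B_def] bounded_bilinear.add_right[OF \<Gamma>.bilinear_DF[OF x], folded B_def]
    bounded_bilinear.scaleR_left[OF \<Gamma>.bilinear_DF[OF x], folded B_def] bounded_bilinear.scaleR_right[OF \<Gamma>.bilinear_DF[OF x], folded B_def]
    linear_add[OF l, folded B_def] linear_scale[OF l, folded B_def]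
  have "bilinear (\<lambda>v w. curv x u v w)"
    unfolding bilinear_def curv_def B_def[symmetric]
    by (intro conjI allI linearI) (simp_all add: \<Gamma>' B algebra_simps)
  then show ?thesis by (simp add: bilinear_conv_bounded_bilinear)
qed

text \<open>Absence of torsion: the Christoffel form and its derivatives are symmetric in the two
  vector arguments, so the cyclic sum cancels in pairs.\<close>

lemma curv_bianchi:
  assumes x: "x \<in> U"
  shows "curv x u v w + curv x v w u + curv x w u v = 0"
proof -
  have "\<Gamma>.DF x v w = \<Gamma>.DF x w v" for v w
    by (rule \<Gamma>.DF_eqI[OF x \<Gamma>.dF[OF x]]) (rule \<Gamma>_commute)
  then have s: "\<Gamma>.DF x v w u = \<Gamma>.DF x w v u" for u v w by simp
  show ?thesis unfolding curv_def
    using s[of u w v] s[of v w u] s[of u v w] \<Gamma>_commute[OF x, of u w] \<Gamma>_commute[OF x, of v w] \<Gamma>_commute[OF x, of u v]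
    by simp
qed

text \<open>Differentiating metric compatibility once more expresses the second derivatives of the
  product of the constant fields w and z. Antisymmetrised, the left side vanishes by symmetry of
  second derivatives and the right side is the sum of the two curvature terms.\<close>

lemma curv_skew:
  assumes x: "x \<in> U"
  shows "gm x (curv x u v w) z = - gm x w (curv x u v z)"
proof -
  let ?\<Gamma> = "christoffel_form G"
  have D: "frechet_derivative (\<lambda>y. gm y (?\<Gamma> y v w) z + gm y w (?\<Gamma> y v z)) (at x) u =
      gm x (?\<Gamma> x u (?\<Gamma> x v w)) z + gm x (?\<Gamma> x v w) (?\<Gamma> x u z) + gm x (\<Gamma>.DF x v w u) z
      + (gm x (?\<Gamma> x u w) (?\<Gamma> x v z) + gm x w (?\<Gamma> x u (?\<Gamma> x v z)) + gm x w (\<Gamma>.DF x v z u))" for u v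
  proof -
    have id: "((\<lambda>y. y) has_derivative (\<lambda>h. h)) (at x within U)" by (rule has_derivative_ident)
    have k: "((\<lambda>y. c) has_derivative (\<lambda>h. 0)) (at x within U)" for c :: "real ^ 'm" by (rule has_derivative_const)
    have \<Gamma>': "((\<lambda>y. ?\<Gamma> y a b) has_derivative \<Gamma>.DF x a b) (at x within U)" for a b
      using \<Gamma>.dF[OF x] has_derivative_at_withinI by blast
    have z0: "gm x 0 b = 0" "gm x a 0 = 0" for a b by (simp_all add: matrix_vector_mult_0_right)
    have "((\<lambda>y. gm y (?\<Gamma> y v w) z + gm y w (?\<Gamma> y v z)) has_derivative
      (\<lambda>u. (gm.DF x (?\<Gamma> x v w) z u + gm x (\<Gamma>.DF x v w u) z + gm x (?\<Gamma> x v w) 0)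
         + (gm.DF x w (?\<Gamma> x v z) u + gm x 0 (?\<Gamma> x v z) + gm x w (\<Gamma>.DF x v z u)))) (at x within U)"
      by (intro has_derivative_add gm.product_rule id k \<Gamma>' x)
    then have "((\<lambda>y. gm y (?\<Gamma> y v w) z + gm y w (?\<Gamma> y v z)) has_derivative
      (\<lambda>u. (gm.DF x (?\<Gamma> x v w) z u + gm x (\<Gamma>.DF x v w u) z + gm x (?\<Gamma> x v w) 0)
         + (gm.DF x w (?\<Gamma> x v z) u + gm x 0 (?\<Gamma> x v z) + gm x w (\<Gamma>.DF x v z u)))) (at x)"
      by (simp only: at_within_open[OF x U])
    from frechet_derivative_at[OF this, symmetric] show ?thesis
      by (simp only: metric_compatible[OF x] z0 add_0_right add_0_left)
  qed
  have "frechet_derivative (\<lambda>y. gm.DF y w z v) (at x) u = frechet_derivative (\<lambda>y. gm y (?\<Gamma> y v w) z + gm y w (?\<Gamma> y v z)) (at x) u" for u v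
    by (rule frechet_derivative_cong_open[OF U x, THEN fun_cong]) (rule metric_compatible)
  moreover have "frechet_derivative (\<lambda>y. gm.DF y w z v) (at x) u = frechet_derivative (\<lambda>y. gm.DF y w z u) (at x) v"
    by (rule schwarz_real[OF U x gm.F])
  ultimately have e: "frechet_derivative (\<lambda>y. gm y (?\<Gamma> y v w) z + gm y w (?\<Gamma> y v z)) (at x) u =
    frechet_derivative (\<lambda>y. gm y (?\<Gamma> y u w) z + gm y w (?\<Gamma> y u z)) (at x) v" by metis
  have "gm x (curv x u v w) z = gm x (\<Gamma>.DF x v w u) z + gm x (?\<Gamma> x u (?\<Gamma> x v w)) z - gm x (\<Gamma>.DF x u w v) z - gm x (?\<Gamma> x v (?\<Gamma> x u w)) z"
    unfolding curv_def by (simp add: inner_simps)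
  moreover have "gm x w (curv x u v z) = gm x w (\<Gamma>.DF x v z u) + gm x w (?\<Gamma> x u (?\<Gamma> x v z)) - gm x w (\<Gamma>.DF x u z v) - gm x w (?\<Gamma> x v (?\<Gamma> x u z))"
    unfolding curv_def by (simp add: inner_simps matrix_vector_mult_diff_distrib matrix_vector_right_distrib)
  ultimately show ?thesis using e unfolding D by linarith
qed

text \<open>The classical derivation of pair symmetry from the Bianchi identity and skewness within
  each pair, in the instance where u occurs twice. It is the reason why the curvature matrix is
  symmetric.\<close>

lemma curv_symmetric:
  assumes x: "x \<in> U"
  shows "gm x (curv x u v u) w = gm x (curv x u w u) v"
proof -
  define R where "R a b c d = gm x (curv x a b c) d" for a b c d
  have 1: "R b a c d = - R a b c d" for a b c d
    unfolding R_def curv_alt[of x a b] by simp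
  have 2: "R a b d c = - R a b c d" for a b c d
    unfolding R_def using curv_skew[OF x, of a b d c] gm_commute[OF x] by metis
  have 3: "R a b c d + R b c a d + R c a b d = 0" for a b c d
  proof -
    have "R a b c d + R b c a d + R c a b d = gm x (curv x a b c + curv x b c a + curv x c a b) d"
      unfolding R_def by (simp only: inner_add_left)
    then show ?thesis unfolding curv_bianchi[OF x] by simp
  qed
  have "R u v u w = R u w u v"
    using 3[of u v u w] 3[of v u w u] 3[of u w v u] 3[of w u v u] 3[of u v w u]
      1[of u v w u] 1[of v u u w] 1[of u v u w] 1[of u w v u] 1[of w u v u] 1[of v w u u] 1[of u u v w] 1[of w v u u]
      1[of u w u v] 2[of u v u w] 2[of u w u v] 2[of v w u u] 2[of u v w u] by linarith
  then show ?thesis unfolding R_def .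
qed

lemma smooth_curv_along:
  fixes y :: "real \<Rightarrow> real ^ 'm"
  assumes S: "full_dirs S" and y: "smooth_on S y" "y ` S \<subseteq> U" and a: "smooth_on S a" and b: "smooth_on S b" and c: "smooth_on S c"
  shows "smooth_on S (\<lambda>t. curv (y t) (a t) (b t) (c t))"
  unfolding curv_def
  by (intro smooth_diff smooth_add S \<Gamma>.smooth_DF_along \<Gamma>.smooth_along y a b c)

end

section \<open>Invariance under isometric changes of chart\<close>

locale chart_change = c: chart_metric Uc Gc + d: chart_metric Ud Gd
  for Uc :: "(real ^ 'm::finite) set" and Gc and Ud :: "(real ^ 'm) set" and Gd +
  fixes V :: "(real ^ 'm) set" and \<phi> :: "real ^ 'm \<Rightarrow> real ^ 'm"
  assumes V: "open V" and VU: "V \<subseteq> Uc" and \<phi>: "smooth_on V \<phi>" and \<phi>V: "\<And>x. x \<in> V \<Longrightarrow> \<phi> x \<in> Ud"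
    and metric: "\<And>x v w. x \<in> V \<Longrightarrow> c.gm x v w = d.gm (\<phi> x) (frechet_derivative \<phi> (at x) v) (frechet_derivative \<phi> (at x) w)"
begin

abbreviation D where "D x \<equiv> frechet_derivative \<phi> (at x)"
abbreviation D2 where "D2 x v w \<equiv> frechet_derivative (\<lambda>y. D y w) (at x) v"
abbreviation \<Gamma>c where "\<Gamma>c \<equiv> christoffel_form Gc"
abbreviation \<Gamma>d where "\<Gamma>d \<equiv> christoffel_form Gd"

lemma \<phi>_deriv: "x \<in> V \<Longrightarrow> (\<phi> has_derivative D x) (at x)"
  by (rule smooth_has_derivative[OF V \<phi>])

lemma D_deriv: "x \<in> V \<Longrightarrow> ((\<lambda>y. D y w) has_derivative (\<lambda>v. D2 x v w)) (at x)"
  by (rule smooth_has_derivative[OF V smooth_deriv_open[OF V \<phi>]])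

lemma D_linear: "x \<in> V \<Longrightarrow> linear (D x)"
  by (rule has_derivative_linear[OF \<phi>_deriv])

lemma D2_commute: "x \<in> V \<Longrightarrow> D2 x v w = D2 x w v"
  by (rule schwarz[OF V _ \<phi>]) (assumption, rule smooth_linear[OF full_dirs_open[OF V] bounded_linear_inner_left \<phi>])

text \<open>The differential preserves the metrics, so a vector that it kills is orthogonal to
  everything and vanishes by nondegeneracy. Equal dimensions do the rest.\<close>

lemma D_surj: assumes x: "x \<in> V" shows "surj (D x)"
proof -
  have "inj (D x)"
    unfolding linear_injective_0[OF D_linear[OF x]]
  proof (intro allI impI)
    fix v assume v: "D x v = 0"
    have "c.gm x v w = 0" for w using metric[OF x, of v w] v by simp
    then show "v = 0" using c.gm_nondegenerate x VU by blast
  qed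
  then show ?thesis by (rule linear_injective_imp_surjective[OF D_linear[OF x]]) simp
qed

text \<open>\<open>D2\<close> is a derivative in its first vector. Linearity in the second one, used
  to undo the expansion along the axes, comes from the symmetry of second derivatives.\<close>

lemma D_product_rule:
  fixes y :: "'z::real_normed_vector \<Rightarrow> real ^ 'm"
  assumes y: "(y has_derivative y') (at z within S)" and a: "(a has_derivative a') (at z within S)"
    and yV: "\<And>z. z \<in> S \<Longrightarrow> y z \<in> V" and z: "z \<in> S"
  shows "((\<lambda>z. D (y z) (a z)) has_derivative (\<lambda>h. D2 (y z) (y' h) (a z) + D (y z) (a' h))) (at z within S)"
proof -
  note yz = yV[OF z]
  have "((\<lambda>z. \<Sum>k\<in>UNIV. (a z $ k) *\<^sub>R D (y z) (axis k 1)) has_derivative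
    (\<lambda>h. \<Sum>k\<in>UNIV. (a z $ k) *\<^sub>R D2 (y z) (y' h) (axis k 1) + (a' h $ k) *\<^sub>R D (y z) (axis k 1))) (at z within S)"
    by (intro has_derivative_sum has_derivative_scaleR has_derivative_compose[OF y D_deriv[OF yz]]
        bounded_linear.has_derivative[OF bounded_linear_vec_nth] a)
  then have d: "((\<lambda>z. D (y z) (a z)) has_derivative
    (\<lambda>h. \<Sum>k\<in>UNIV. (a z $ k) *\<^sub>R D2 (y z) (y' h) (axis k 1) + (a' h $ k) *\<^sub>R D (y z) (axis k 1))) (at z within S)"
    by (rule has_derivative_transform[OF z, rotated]) (rule linear_axis_expansion[OF D_linear[OF yV]])
  have lin: "linear (\<lambda>b. D2 (y z) u b)" for u
  proof -
    have "(\<lambda>b. D2 (y z) u b) = (\<lambda>b. D2 (y z) b u)" by (rule ext) (rule D2_commute[OF yz])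
    then show ?thesis using has_derivative_linear[OF D_deriv[OF yz]] by simp
  qed
  show ?thesis using d
    by (simp only: sum.distrib linear_axis_expansion[OF lin, symmetric] linear_axis_expansion[OF D_linear[OF yz], symmetric])
qed

lemma metric_deriv:
  assumes x: "x \<in> V"
  shows "c.gm.DF x v w u = d.gm.DF (\<phi> x) (D x v) (D x w) (D x u) + d.gm (\<phi> x) (D2 x u v) (D x w) + d.gm (\<phi> x) (D x v) (D2 x u w)"
proof -
  have "((\<lambda>x. d.gm (\<phi> x) (D x v) (D x w)) has_derivative
    (\<lambda>u. d.gm.DF (\<phi> x) (D x v) (D x w) (D x u) + d.gm (\<phi> x) (D2 x u v) (D x w) + d.gm (\<phi> x) (D x v) (D2 x u w))) (at x within V)"
    by (rule d.gm.product_rule[OF has_derivative_at_withinI[OF \<phi>_deriv[OF x]] has_derivative_at_withinI[OF D_deriv[OF x]]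
        has_derivative_at_withinI[OF D_deriv[OF x]] \<phi>V x])
  then have "((\<lambda>x. d.gm (\<phi> x) (D x v) (D x w)) has_derivative
    (\<lambda>u. d.gm.DF (\<phi> x) (D x v) (D x w) (D x u) + d.gm (\<phi> x) (D2 x u v) (D x w) + d.gm (\<phi> x) (D x v) (D2 x u w))) (at x)"
    by (simp only: at_within_open[OF x V])
  note D = frechet_derivative_at[OF this, symmetric]
  have "c.gm.DF x v w = frechet_derivative (\<lambda>x. d.gm (\<phi> x) (D x v) (D x w)) (at x)"
    by (rule frechet_derivative_cong_open[OF V x]) (rule metric)
  then show ?thesis unfolding D by simp
qed

text \<open>The difference of the two sides is symmetric in two and skew in two of its three arguments
  once it is paired with the metric.\<close>

lemma christoffel_change:
  assumes x: "x \<in> V"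
  shows "D x (\<Gamma>c x v w) = \<Gamma>d (\<phi> x) (D x v) (D x w) + D2 x v w"
proof -
  define B where "B v w = D x (\<Gamma>c x v w) - \<Gamma>d (\<phi> x) (D x v) (D x w) - D2 x v w" for v w
  define b where "b u v w = d.gm (\<phi> x) (B u v) (D x w)" for u v w
  have xc: "x \<in> Uc" using x VU by blast
  have xd: "\<phi> x \<in> Ud" by (rule \<phi>V[OF x])
  have sym: "b u v w = b v u w" for u v w
    unfolding b_def B_def using c.\<Gamma>_commute[OF xc] d.\<Gamma>_commute[OF xd] D2_commute[OF x] by metis
  have e: "b u v w = d.gm (\<phi> x) (D x (\<Gamma>c x u v)) (D x w) - d.gm (\<phi> x) (\<Gamma>d (\<phi> x) (D x u) (D x v)) (D x w) - d.gm (\<phi> x) (D2 x u v) (D x w)" for u v w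
    unfolding b_def B_def by (simp add: inner_simps)
  have skew: "b u v w = - b u w v" for u v w
    unfolding e
    using metric_deriv[OF x, of v w u] c.metric_compatible[OF xc, of v w u] d.metric_compatible[OF xd, of "D x v" "D x w" "D x u"]
      metric[OF x, of "\<Gamma>c x u v" w] metric[OF x, of v "\<Gamma>c x u w"]
      d.gm_commute[OF xd, of "D x v" "D x (\<Gamma>c x u w)"] d.gm_commute[OF xd, of "D x v" "\<Gamma>d (\<phi> x) (D x u) (D x w)"]
      d.gm_commute[OF xd, of "D x v" "D2 x u w"]
    by linarith
  \<comment> \<open>Applying skewness and symmetry alternately, three times each, returns to the
    same arguments with the opposite sign.\<close>
  have "b u v w = 0" for u v w
    using skew[of u v w] sym[of u w v] skew[of w u v] sym[of w v u] skew[of v w u] sym[of v u w] by linarith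
  then have "d.gm (\<phi> x) (B v w) z = 0" for z
    using D_surj[OF x] unfolding b_def by (metis surjD)
  then have "B v w = 0" by (rule d.gm_nondegenerate[OF xd])
  then show ?thesis by (simp add: B_def algebra_simps)
qed

text \<open>Differentiating \<open>christoffel_change\<close> once more transforms the derivative of
  the Christoffel form, up to terms symmetric in u and v, among them the third derivative of \<phi>.
  The curvature is what survives antisymmetrising.\<close>

lemma curv_change:
  assumes x: "x \<in> V"
  shows "D x (c.curv x u v w) = d.curv (\<phi> x) (D x u) (D x v) (D x w)"
proof -
  have xc: "x \<in> Uc" using x VU by blast
  have xd: "\<phi> x \<in> Ud" by (rule \<phi>V[OF x])
  define D3 where "D3 u v w = frechet_derivative (\<lambda>y. D2 y v w) (at x) u" for u v w
  have D3: "((\<lambda>y. D2 y v w) has_derivative (\<lambda>u. D3 u v w)) (at x)" for v w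
    unfolding D3_def by (rule smooth_has_derivative[OF V smooth_deriv_open[OF V smooth_deriv_open[OF V \<phi>]] x])
  have D3_sym: "D3 u v w = D3 v u w" for u v w
    unfolding D3_def
    by (rule schwarz[OF V x smooth_deriv_open[OF V \<phi>]])
      (intro smooth_linear[OF full_dirs_open[OF V] bounded_linear_inner_left smooth_deriv_open[OF V \<phi>]])
  define R where "R u v w = d.\<Gamma>.DF (\<phi> x) (D x v) (D x w) (D x u) + \<Gamma>d (\<phi> x) (D2 x u v) (D x w) + \<Gamma>d (\<phi> x) (D x v) (D2 x u w) + D3 u v w" for u v w
  have R: "((\<lambda>y. D y (\<Gamma>c y v w)) has_derivative (\<lambda>u. R u v w)) (at x)" for v w
  proof -
    have "((\<lambda>y. \<Gamma>d (\<phi> y) (D y v) (D y w) + D2 y v w) has_derivative (\<lambda>u. R u v w)) (at x within V)"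
      unfolding R_def
      by (intro has_derivative_add d.\<Gamma>.product_rule has_derivative_at_withinI[OF \<phi>_deriv[OF x]] has_derivative_at_withinI[OF D_deriv[OF x]]
          has_derivative_at_withinI[OF D3] \<phi>V x)
    then have "((\<lambda>y. \<Gamma>d (\<phi> y) (D y v) (D y w) + D2 y v w) has_derivative (\<lambda>u. R u v w)) (at x)"
      by (simp only: at_within_open[OF x V])
    then show ?thesis by (rule has_derivative_transform_within_open[OF _ V x]) (simp add: christoffel_change)
  qed
  have L: "((\<lambda>y. D y (\<Gamma>c y v w)) has_derivative (\<lambda>u. D2 x u (\<Gamma>c x v w) + D x (c.\<Gamma>.DF x v w u))) (at x)" for v w
  proof -
    have "((\<lambda>y. D y (\<Gamma>c y v w)) has_derivative (\<lambda>u. D2 x u (\<Gamma>c x v w) + D x (c.\<Gamma>.DF x v w u))) (at x within V)"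
      by (rule D_product_rule[OF has_derivative_ident has_derivative_at_withinI[OF c.\<Gamma>.dF[OF xc]] _ x])
    then show ?thesis by (simp only: at_within_open[OF x V])
  qed
  have eq: "D2 x u (\<Gamma>c x v w) + D x (c.\<Gamma>.DF x v w u) = R u v w" for u v w
    using has_derivative_unique[OF L R] by (rule fun_cong)
  have D2e: "D2 x u (\<Gamma>c x v w) = D x (\<Gamma>c x u (\<Gamma>c x v w)) - \<Gamma>d (\<phi> x) (D x u) (\<Gamma>d (\<phi> x) (D x v) (D x w)) - \<Gamma>d (\<phi> x) (D x u) (D2 x v w)" for u v w
    using christoffel_change[OF x, of u "\<Gamma>c x v w"] christoffel_change[OF x, of v w]
    by (simp add: bounded_bilinear.add_right[OF christoffel_form_bilinear])
  define E where "E u v w = D x (\<Gamma>c x u (\<Gamma>c x v w)) + D x (c.\<Gamma>.DF x v w u)" for u v w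
  \<comment> \<open>\<open>E\<close> is the curvature before antisymmetrising. The terms are grouped
    so that the last bracket is symmetric in u and v.\<close>
  have E: "E u v w = d.\<Gamma>.DF (\<phi> x) (D x v) (D x w) (D x u) + \<Gamma>d (\<phi> x) (D x u) (\<Gamma>d (\<phi> x) (D x v) (D x w))
      + (\<Gamma>d (\<phi> x) (D2 x u v) (D x w) + (\<Gamma>d (\<phi> x) (D x v) (D2 x u w) + \<Gamma>d (\<phi> x) (D x u) (D2 x v w)) + D3 u v w)" for u v w
    using eq[where u = u and v = v and w = w] unfolding D2e R_def E_def by (simp add: algebra_simps)
  have "D x (c.curv x u v w) = E u v w - E v u w"
    unfolding c.curv_def E_def
    by (simp add: linear_diff[OF D_linear[OF x]] linear_add[OF D_linear[OF x]])
  also have "\<dots> = d.curv (\<phi> x) (D x u) (D x v) (D x w)"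
    unfolding E d.curv_def D3_sym[of u v] D2_commute[OF x, of u v] by simp
  finally show ?thesis .
qed

end

section \<open>Tensors on a manifold with a metric\<close>

lemma scaleR_fun_apply [simp]: "(r *\<^sub>R f) x = r *\<^sub>R f x"
  by (simp add: scaleR_fun_def)

locale metric_manifold =
  fixes \<A> :: "('a::{t2_space, second_countable_topology}, 'm::finite) chart set" and g :: "('a, 'm) metric"
  assumes atlas: "smooth_atlas \<A>" and tensor: "metric_tensor \<A> g"
begin

lemma chart: "c \<in> \<A> \<Longrightarrow> chart_metric (coord c ` cdom c) (g c)"
proof (rule chart_metric.intro)
  assume c: "c \<in> \<A>"
  show "open (coord c ` cdom c)" using atlas c unfolding smooth_atlas_def is_chart_def by blast
  show "smooth_on (coord c ` cdom c) (g c)" using tensor c unfolding metric_tensor_def by blast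
  fix x assume "x \<in> coord c ` cdom c"
  then obtain p where "x = coord c p" "p \<in> cdom c" by blast
  then show "Finite_Cartesian_Product.transpose (g c x) = g c x" "invertible (g c x)"
    using tensor c unfolding metric_tensor_def by simp_all
qed

lemma chart_inv: "c \<in> \<A> \<Longrightarrow> p \<in> cdom c \<Longrightarrow> inv_into (cdom c) (coord c) (coord c p) = p"
  using atlas unfolding smooth_atlas_def is_chart_def homeomorphism_def by blast

lemma transition_coord: "c \<in> \<A> \<Longrightarrow> p \<in> cdom c \<Longrightarrow> transition c d (coord c p) = coord d p"
  by (simp add: transition_def chart_inv)

lemma overlap_open: assumes "c \<in> \<A>" "d \<in> \<A>" shows "open (coord c ` (cdom c \<inter> cdom d))"
proof -
  let ?i = "inv_into (cdom c) (coord c)"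
  have c: "open (coord c ` cdom c)" "continuous_on (coord c ` cdom c) ?i" "open (cdom d)"
    using atlas assms unfolding smooth_atlas_def is_chart_def homeomorphism_def by blast+
  have "coord c ` (cdom c \<inter> cdom d) = coord c ` cdom c \<inter> ?i -` cdom d"
    using chart_inv[OF assms(1)] by force
  then show ?thesis using continuous_open_preimage[OF c(2,1,3)] by simp
qed

text \<open>By the tensor law of the metric the transition maps are isometries, so the invariance
  statements for charts all become instances of \<open>chart_change\<close>.\<close>

lemma change:
  assumes "c \<in> \<A>" "d \<in> \<A>"
  shows "chart_change (coord c ` cdom c) (g c) (coord d ` cdom d) (g d) (coord c ` (cdom c \<inter> cdom d)) (transition c d)"
proof (intro chart_change.intro chart chart_change_axioms.intro assms overlap_open)
  show "coord c ` (cdom c \<inter> cdom d) \<subseteq> coord c ` cdom c" by blast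
  show "smooth_on (coord c ` (cdom c \<inter> cdom d)) (transition c d)"
    using atlas assms unfolding smooth_atlas_def by blast
  fix x assume "x \<in> coord c ` (cdom c \<inter> cdom d)"
  then obtain p where p: "x = coord c p" "p \<in> cdom c" "p \<in> cdom d" by blast
  show "transition c d x \<in> coord d ` cdom d" using p transition_coord[OF assms(1)] by auto
  show "v \<bullet> (g c x *v w) = frechet_derivative (transition c d) (at x) v \<bullet> (g d (transition c d x) *v frechet_derivative (transition c d) (at x) w)" for v w
    using tensor[unfolded metric_tensor_def, THEN conjunct2, THEN conjunct2, rule_format, of c d p v w] assms p
    by (simp add: transition_coord transition_deriv_def)
qed

lemma transition_deriv_linear:
  assumes "c \<in> \<A>" "d \<in> \<A>" "p \<in> cdom c" "p \<in> cdom d"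
  shows "linear (transition_deriv c d p)"
  unfolding transition_deriv_def using chart_change.D_linear[OF change[OF assms(1,2)]] assms by blast

lemma tangent_change:
  "v \<in> tangent_space \<A> p \<Longrightarrow> c \<in> \<A> \<Longrightarrow> d \<in> \<A> \<Longrightarrow> p \<in> cdom c \<Longrightarrow> p \<in> cdom d \<Longrightarrow> v d = transition_deriv c d p (v c)"
  unfolding tangent_space_def by blast

lemma tangent_outside: "v \<in> tangent_space \<A> p \<Longrightarrow> \<not> (c \<in> \<A> \<and> p \<in> cdom c) \<Longrightarrow> v c = 0"
  unfolding tangent_space_def by blast

lemma tangentI:
  assumes "\<And>c d. c \<in> \<A> \<Longrightarrow> d \<in> \<A> \<Longrightarrow> p \<in> cdom c \<Longrightarrow> p \<in> cdom d \<Longrightarrow> v d = transition_deriv c d p (v c)"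
    and "\<And>c. \<not> (c \<in> \<A> \<and> p \<in> cdom c) \<Longrightarrow> v c = 0"
  shows "v \<in> tangent_space \<A> p"
  using assms unfolding tangent_space_def by blast

lemma tangent_add:
  assumes v: "v \<in> tangent_space \<A> p" and w: "w \<in> tangent_space \<A> p"
  shows "v + w \<in> tangent_space \<A> p"
proof (rule tangentI)
  fix c d assume c: "c \<in> \<A>" "d \<in> \<A>" "p \<in> cdom c" "p \<in> cdom d"
  show "(v + w) d = transition_deriv c d p ((v + w) c)"
    by (simp only: plus_fun_apply linear_add[OF transition_deriv_linear[OF c]] tangent_change[OF v c, symmetric] tangent_change[OF w c, symmetric])
next
  fix c assume c: "\<not> (c \<in> \<A> \<and> p \<in> cdom c)"
  show "(v + w) c = 0" by (simp only: plus_fun_apply tangent_outside[OF v c] tangent_outside[OF w c] add_0)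
qed

lemma tangent_scaleR:
  assumes v: "v \<in> tangent_space \<A> p"
  shows "r *\<^sub>R v \<in> tangent_space \<A> p"
proof (rule tangentI)
  fix c d assume c: "c \<in> \<A>" "d \<in> \<A>" "p \<in> cdom c" "p \<in> cdom d"
  show "(r *\<^sub>R v) d = transition_deriv c d p ((r *\<^sub>R v) c)"
    by (simp only: scaleR_fun_apply linear_scale[OF transition_deriv_linear[OF c]] tangent_change[OF v c, symmetric])
next
  fix c assume c: "\<not> (c \<in> \<A> \<and> p \<in> cdom c)"
  show "(r *\<^sub>R v) c = 0" by (simp only: scaleR_fun_apply tangent_outside[OF v c] scaleR_zero_right)
qed

lemma tangent_zero: "0 \<in> tangent_space \<A> p"
  by (rule tangentI) (simp_all add: linear_0[OF transition_deriv_linear])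

lemma tangent_sum: "(\<And>i. i \<in> I \<Longrightarrow> v i \<in> tangent_space \<A> p) \<Longrightarrow> (\<Sum>i\<in>I. v i) \<in> tangent_space \<A> p"
  by (induction I rule: infinite_finite_induct) (simp_all add: tangent_zero tangent_add)

text \<open>One component determines a tangent vector: the other charts around the point see its
  images, and all further components are normalised to zero.\<close>

lemma tangent_eqI:
  assumes "v \<in> tangent_space \<A> p" "w \<in> tangent_space \<A> p" "c \<in> \<A>" "p \<in> cdom c" "v c = w c"
  shows "v = w"
proof
  fix d show "v d = w d"
  proof (cases "d \<in> \<A> \<and> p \<in> cdom d")
    case True
    then show ?thesis using tangent_change[OF assms(1,3)] tangent_change[OF assms(2,3)] assms(4,5) by simp
  next
    case False
    then show ?thesis by (simp only: tangent_outside[OF assms(1) False] tangent_outside[OF assms(2) False])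
  qed
qed

lemma metric_at_chart:
  assumes v: "v \<in> tangent_space \<A> p" and w: "w \<in> tangent_space \<A> p" and c: "c \<in> \<A>" "p \<in> cdom c"
  shows "metric_at \<A> g p v w = v c \<bullet> (g c (coord c p) *v w c)"
proof -
  define d where "d = (SOME c. c \<in> \<A> \<and> p \<in> cdom c)"
  have d: "d \<in> \<A>" "p \<in> cdom d"
    using someI_ex[of "\<lambda>c. c \<in> \<A> \<and> p \<in> cdom c"] c unfolding d_def by blast+
  have "v d \<bullet> (g d (coord d p) *v w d) = v c \<bullet> (g c (coord c p) *v w c)"
    unfolding tangent_change[OF v c(1) d(1) c(2) d(2)] tangent_change[OF w c(1) d(1) c(2) d(2)]
    using tensor[unfolded metric_tensor_def, THEN conjunct2, THEN conjunct2, rule_format, of c d p "v c" "w c"] c d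
    by simp
  then show ?thesis by (simp add: metric_at_def Let_def d_def)
qed

lemma metric_at_simps:
  "metric_at \<A> g p (u + v) w = metric_at \<A> g p u w + metric_at \<A> g p v w"
  "metric_at \<A> g p w (u + v) = metric_at \<A> g p w u + metric_at \<A> g p w v"
  "metric_at \<A> g p (r *\<^sub>R v) w = r * metric_at \<A> g p v w"
  "metric_at \<A> g p w (r *\<^sub>R v) = r * metric_at \<A> g p w v"
  "metric_at \<A> g p 0 w = 0" "metric_at \<A> g p w 0 = 0"
  by (simp_all add: metric_at_def Let_def inner_simps matrix_vector_right_distrib matrix_vector_mult_scaleR)

lemma metric_at_sum:
  "metric_at \<A> g p (\<Sum>i\<in>I. v i) w = (\<Sum>i\<in>I. metric_at \<A> g p (v i) w)"
  "metric_at \<A> g p w (\<Sum>i\<in>I. v i) = (\<Sum>i\<in>I. metric_at \<A> g p w (v i))"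
  by (induction I rule: infinite_finite_induct) (simp_all add: metric_at_simps)

lemma metric_at_commute:
  assumes "v \<in> tangent_space \<A> p" "w \<in> tangent_space \<A> p" "p \<in> manifold \<A>"
  shows "metric_at \<A> g p v w = metric_at \<A> g p w v"
proof -
  obtain c where c: "c \<in> \<A>" "p \<in> cdom c" using assms(3) unfolding manifold_def by blast
  then show ?thesis using metric_at_chart[OF assms(1,2) c] metric_at_chart[OF assms(2,1) c]
      chart_metric.gm_commute[OF chart[OF c(1)]] by simp
qed

lemma curvature_at_chart:
  assumes "c \<in> \<A>" "p \<in> cdom c"
  shows "curvature_at \<A> g p u v w c = chart_metric.curv (g c) (coord c p) (u c) (v c) (w c)"
  using chart_metric.curvature_op_const[OF chart[OF assms(1)]] assms by (simp add: curvature_at_def)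

text \<open>The definition computes each component in its own chart; \<open>curv_change\<close>
  makes these components transform like a vector.\<close>

lemma curvature_at_tangent:
  assumes "u \<in> tangent_space \<A> p" "v \<in> tangent_space \<A> p" "w \<in> tangent_space \<A> p"
  shows "curvature_at \<A> g p u v w \<in> tangent_space \<A> p"
  unfolding tangent_space_def
proof (intro CollectI conjI allI ballI impI)
  fix c d assume c: "c \<in> \<A>" "d \<in> \<A>" "p \<in> cdom c" "p \<in> cdom d"
  have V: "coord c p \<in> coord c ` (cdom c \<inter> cdom d)" using c by blast
  note t = tangent_change[OF assms(1) c] tangent_change[OF assms(2) c] tangent_change[OF assms(3) c]
  show "curvature_at \<A> g p u v w d = transition_deriv c d p (curvature_at \<A> g p u v w c)"
    unfolding curvature_at_chart[OF c(1,3)] curvature_at_chart[OF c(2,4)] t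
    using chart_change.curv_change[OF change[OF c(1,2)] V] c by (simp add: transition_deriv_def transition_coord)
next
  fix c assume "\<not> (c \<in> \<A> \<and> p \<in> cdom c)"
  then show "curvature_at \<A> g p u v w c = 0" by (auto simp: curvature_at_def)
qed

text \<open>The multiple of u drops out by skewness of the curvature in its first two
  arguments.\<close>

lemma curvature_at_lincomb:
  assumes p: "p \<in> manifold \<A>"
  shows "curvature_at \<A> g p u ((\<Sum>i\<in>I. r i *\<^sub>R v i) + s *\<^sub>R u) u = (\<Sum>i\<in>I. r i *\<^sub>R curvature_at \<A> g p u (v i) u)"
proof
  fix c
  show "curvature_at \<A> g p u ((\<Sum>i\<in>I. r i *\<^sub>R v i) + s *\<^sub>R u) u c = (\<Sum>i\<in>I. r i *\<^sub>R curvature_at \<A> g p u (v i) u) c"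
  proof (cases "c \<in> \<A> \<and> p \<in> cdom c")
    case True
    then have x: "coord c p \<in> coord c ` cdom c" by blast
    interpret chart_metric "coord c ` cdom c" "g c" using chart True by blast
    have u: "curv (coord c p) (u c) (u c) (u c) = 0" by (simp add: curv_def)
    note b = curv_bilinear[OF x, of "u c"]
    have s: "curv (coord c p) (u c) (\<Sum>i\<in>I. r i *\<^sub>R v i c) (u c) = (\<Sum>i\<in>I. r i *\<^sub>R curv (coord c p) (u c) (v i c) (u c))"
      by (simp add: bounded_bilinear.sum_left[OF b] bounded_bilinear.scaleR_left[OF b])
    show ?thesis using True
      by (simp add: curvature_at_chart sum_fun_apply bounded_bilinear.add_left[OF b] bounded_bilinear.scaleR_left[OF b] u s)
  next
    case False
    then have F: "(c \<in> \<A> \<and> p \<in> cdom c) = False" by blast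
    show ?thesis
      by (simp only: curvature_at_def sum_fun_apply scaleR_fun_apply F if_False scaleR_zero_right sum.neutral_const)
  qed
qed

lemma curvature_at_symmetric:
  assumes u: "u \<in> tangent_space \<A> p" and v: "v \<in> tangent_space \<A> p" and w: "w \<in> tangent_space \<A> p" and p: "p \<in> manifold \<A>"
  shows "metric_at \<A> g p (curvature_at \<A> g p u v u) w = metric_at \<A> g p (curvature_at \<A> g p u w u) v"
proof -
  obtain c where c: "c \<in> \<A>" "p \<in> cdom c" using p unfolding manifold_def by blast
  then have x: "coord c p \<in> coord c ` cdom c" by blast
  show ?thesis
    unfolding metric_at_chart[OF curvature_at_tangent[OF u v u] w c] metric_at_chart[OF curvature_at_tangent[OF u w u] v c]
      curvature_at_chart[OF c]
    by (rule chart_metric.curv_symmetric[OF chart[OF c(1)] x])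
qed

end

section \<open>Fields along a curve\<close>

locale metric_curve = metric_manifold \<A> g
  for \<A> :: "('a::{t2_space, second_countable_topology}, 'm::finite) chart set" and g :: "('a, 'm) metric" +
  fixes T :: real and \<gamma> :: "real \<Rightarrow> 'a"
  assumes T: "0 < T" and curve: "smooth_curve \<A> T \<gamma>"
begin

abbreviation field where "field \<xi> \<equiv> smooth_field_along \<A> T \<gamma> \<xi>"
abbreviation V where "V \<equiv> velocity \<A> T \<gamma>"
abbreviation Dt where "Dt \<equiv> cov_deriv \<A> g T \<gamma>"
abbreviation gt where "gt t v w \<equiv> metric_at \<A> g (\<gamma> t) v w"

definition dom_of :: "('a, 'm) chart \<Rightarrow> real set" where
  "dom_of c = {t\<in>{0..T}. \<gamma> t \<in> cdom c}"

lemma dom_ofD: "t \<in> dom_of c \<Longrightarrow> t \<in> {0..T}" "t \<in> dom_of c \<Longrightarrow> \<gamma> t \<in> cdom c"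
  by (simp_all add: dom_of_def)

lemma in_manifold: "t \<in> {0..T} \<Longrightarrow> \<gamma> t \<in> manifold \<A>"
  using curve unfolding smooth_curve_def by blast

lemma ex_chart: assumes "t \<in> {0..T}" shows "\<exists>c. c \<in> \<A> \<and> t \<in> dom_of c"
  using in_manifold[OF assms] assms unfolding manifold_def dom_of_def by blast

lemma dom_of_open: assumes "c \<in> \<A>" shows "\<exists>W. open W \<and> dom_of c = {0..T} \<inter> W"
proof -
  have "open (cdom c)" using atlas assms unfolding smooth_atlas_def is_chart_def by blast
  moreover have "continuous_on {0..T} \<gamma>" using curve unfolding smooth_curve_def by blast
  ultimately obtain W where "open W" "W \<inter> {0..T} = \<gamma> -` cdom c \<inter> {0..T}"
    unfolding continuous_on_open_invariant by blast
  then show ?thesis unfolding dom_of_def by (intro exI[of _ W]) blast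
qed

lemma full_dom_of: "c \<in> \<A> \<Longrightarrow> full_dirs (dom_of c)"
  using dom_of_open[of c] full_dirs_interval[OF T] by auto

text \<open>The part of the curve lying in a chart is relatively open in [0,T], so derivatives
  within it are derivatives within [0,T], one-sided at the ends.\<close>

lemma at_dom_of: "c \<in> \<A> \<Longrightarrow> t \<in> dom_of c \<Longrightarrow> at t within dom_of c = at t within {0..T}"
  using dom_of_open[of c] at_within_open_Int[of _ t "{0..T}"] by auto

lemma at_dom_of2:
  assumes "c \<in> \<A>" "d \<in> \<A>" "t \<in> dom_of c" "t \<in> dom_of d"
  shows "at t within (dom_of c \<inter> dom_of d) = at t within {0..T}"
proof -
  obtain W where "open W" "dom_of d = {0..T} \<inter> W" using dom_of_open[OF assms(2)] by blast
  moreover have "dom_of c \<inter> ({0..T} \<inter> W) = dom_of c \<inter> W" using dom_ofD(1) by blast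
  ultimately show ?thesis using at_within_open_Int[of W t "dom_of c"] assms(4) at_dom_of[OF assms(1,3)] by simp
qed

lemma vector_derivative_eq:
  fixes f :: "real \<Rightarrow> 'b::real_normed_vector"
  assumes "t \<in> {0..T}" "(f has_vector_derivative f') (at t within {0..T})"
  shows "vector_derivative f (at t within {0..T}) = f'"
  using vector_derivative_within_cbox[of 0 T t f f'] assms T by simp

lemma smooth_vector_derivative:
  fixes f :: "real \<Rightarrow> 'b::real_normed_vector"
  assumes c: "c \<in> \<A>" and f: "smooth_on (dom_of c) f"
  shows "t \<in> dom_of c \<Longrightarrow> (f has_vector_derivative vector_derivative f (at t within {0..T})) (at t within {0..T})"
    and "smooth_on (dom_of c) (\<lambda>t. vector_derivative f (at t within {0..T}))"
proof -
  have d: "(f has_derivative frechet_derivative f (at t within dom_of c)) (at t within {0..T})" if "t \<in> dom_of c" for t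
  proof -
    have "tdo (Suc 0) (dom_of c) f" using f unfolding smooth_on_def by blast
    from tdo_has_derivative[OF this that] show ?thesis unfolding at_dom_of[OF c that] .
  qed
  have v: "(f has_vector_derivative vector_derivative f (at t within {0..T})) (at t within {0..T})" if "t \<in> dom_of c" for t
    using d[OF that] vector_derivative_works differentiableI by blast
  then show "t \<in> dom_of c \<Longrightarrow> (f has_vector_derivative vector_derivative f (at t within {0..T})) (at t within {0..T})" .
  have "frechet_derivative f (at t within dom_of c) 1 = vector_derivative f (at t within {0..T})" if t: "t \<in> dom_of c" for t
  proof -
    have "(f has_derivative (\<lambda>h. h *\<^sub>R vector_derivative f (at t within {0..T}))) (at t within dom_of c)"
      using v[OF t] unfolding has_vector_derivative_def at_dom_of[OF c t] .
    from frechet_derivative_eq[OF full_dom_of[OF c] t this] show ?thesis by simp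
  qed
  then show "smooth_on (dom_of c) (\<lambda>t. vector_derivative f (at t within {0..T}))"
    by (rule smooth_cong[OF _ smooth_deriv[OF f]])
qed

lemma coord_smooth: "c \<in> \<A> \<Longrightarrow> smooth_on (dom_of c) (\<lambda>t. coord c (\<gamma> t))"
  using curve unfolding smooth_curve_def dom_of_def o_def by blast

lemma field_smooth: "field \<xi> \<Longrightarrow> c \<in> \<A> \<Longrightarrow> smooth_on (dom_of c) (\<lambda>t. \<xi> t c)"
  unfolding smooth_field_along_def dom_of_def by blast

lemma field_tangent: "field \<xi> \<Longrightarrow> t \<in> {0..T} \<Longrightarrow> \<xi> t \<in> tangent_space \<A> (\<gamma> t)"
  unfolding smooth_field_along_def by blast

lemma fieldI:
  assumes "\<And>t. t \<in> {0..T} \<Longrightarrow> \<xi> t \<in> tangent_space \<A> (\<gamma> t)" "\<And>c. c \<in> \<A> \<Longrightarrow> smooth_on (dom_of c) (\<lambda>t. \<xi> t c)"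
  shows "field \<xi>"
  using assms unfolding smooth_field_along_def dom_of_def by blast

lemma field_deriv:
  assumes "field \<xi>" "c \<in> \<A>" "t \<in> dom_of c"
  shows "((\<lambda>s. \<xi> s c) has_vector_derivative vector_derivative (\<lambda>s. \<xi> s c) (at t within {0..T})) (at t within {0..T})"
  by (rule smooth_vector_derivative(1)[OF assms(2) field_smooth[OF assms(1,2)] assms(3)])

lemma V_chart: "c \<in> \<A> \<Longrightarrow> t \<in> dom_of c \<Longrightarrow> V t c = vector_derivative (\<lambda>t. coord c (\<gamma> t)) (at t within {0..T})"
  by (simp add: velocity_def dom_of_def o_def)

lemma V_deriv: "c \<in> \<A> \<Longrightarrow> t \<in> dom_of c \<Longrightarrow> ((\<lambda>t. coord c (\<gamma> t)) has_vector_derivative V t c) (at t within {0..T})"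
  using smooth_vector_derivative(1)[OF _ coord_smooth, where c = c and t = t] by (simp add: V_chart)

lemma in_overlap: "t \<in> dom_of c \<Longrightarrow> t \<in> dom_of d \<Longrightarrow> coord c (\<gamma> t) \<in> coord c ` (cdom c \<inter> cdom d)"
  by (auto simp: dom_of_def)

lemma field_V: "field V"
proof (rule fieldI)
  show "smooth_on (dom_of c) (\<lambda>t. V t c)" if "c \<in> \<A>" for c
    by (rule smooth_cong[OF _ smooth_vector_derivative(2)[OF that coord_smooth[OF that]]]) (simp add: V_chart that)
  fix t assume t: "t \<in> {0..T}"
  show "V t \<in> tangent_space \<A> (\<gamma> t)"
  proof (rule tangentI)
    fix c d assume c': "c \<in> \<A>" "d \<in> \<A>" "\<gamma> t \<in> cdom c" "\<gamma> t \<in> cdom d"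
    then have c: "c \<in> \<A>" "d \<in> \<A>" "t \<in> dom_of c" "t \<in> dom_of d" using t by (auto simp: dom_of_def)
    have "((\<lambda>t. transition c d (coord c (\<gamma> t))) has_vector_derivative transition_deriv c d (\<gamma> t) (V t c)) (at t within {0..T})"
      using vector_derivative_diff_chain_within[OF V_deriv[OF c(1,3)]
          has_derivative_at_withinI[OF chart_change.\<phi>_deriv[OF change[OF c(1,2)] in_overlap[OF c(3,4)]]]]
      by (simp add: o_def transition_deriv_def)
    then have "((\<lambda>t. coord d (\<gamma> t)) has_vector_derivative transition_deriv c d (\<gamma> t) (V t c)) (at t within (dom_of c \<inter> dom_of d))"
      unfolding at_dom_of2[OF c, symmetric]
      by (rule has_vector_derivative_transform[rotated 2]) (use c in \<open>auto simp: transition_coord dom_ofD\<close>)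
    then show "V t d = transition_deriv c d (\<gamma> t) (V t c)"
      unfolding at_dom_of2[OF c] V_chart[OF c(2,4)] by (rule vector_derivative_eq[OF t])
  qed (auto simp: velocity_def)
qed

lemma Dt_chart:
  "c \<in> \<A> \<Longrightarrow> t \<in> dom_of c \<Longrightarrow> Dt \<xi> t c = vector_derivative (\<lambda>s. \<xi> s c) (at t within {0..T}) +
       christoffel_form (g c) (coord c (\<gamma> t)) (V t c) (\<xi> t c)"
  by (simp add: cov_deriv_def dom_of_def)

lemma Dt_outside: "\<not> (c \<in> \<A> \<and> \<gamma> t \<in> cdom c) \<Longrightarrow> Dt \<xi> t c = 0"
  by (auto simp: cov_deriv_def)

lemma Dt_cong:
  assumes "\<And>s. s \<in> {0..T} \<Longrightarrow> \<xi> s = \<eta> s" "t \<in> {0..T}"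
  shows "Dt \<xi> t = Dt \<eta> t"
proof
  fix c
  have "vector_derivative (\<lambda>s. \<xi> s c) (at t within {0..T}) = vector_derivative (\<lambda>s. \<eta> s c) (at t within {0..T})"
    by (rule vector_derivative_cong_eq) (use assms in auto)
  then show "Dt \<xi> t c = Dt \<eta> t c" using assms by (simp add: cov_deriv_def)
qed

text \<open>Differentiating the transformation law of \<xi> produces a second derivative of the
  transition map. The Christoffel form produces the same term with the opposite sign, so the sum
  transforms like a vector.\<close>

lemma field_Dt: assumes \<xi>: "field \<xi>" shows "field (Dt \<xi>)"
proof (rule fieldI)
  fix c assume c: "c \<in> \<A>"
  interpret chart_metric "coord c ` cdom c" "g c" by (rule chart[OF c])
  have "smooth_on (dom_of c) (\<lambda>t. vector_derivative (\<lambda>s. \<xi> s c) (at t within {0..T}) +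
       christoffel_form (g c) (coord c (\<gamma> t)) (V t c) (\<xi> t c))"
    by (intro smooth_add full_dom_of c smooth_vector_derivative(2) \<Gamma>.smooth_along field_smooth \<xi> field_V coord_smooth)
      (auto simp: dom_of_def)
  then show "smooth_on (dom_of c) (\<lambda>t. Dt \<xi> t c)"
    by (rule smooth_cong[rotated]) (simp add: Dt_chart c)
next
  fix t assume t: "t \<in> {0..T}"
  show "Dt \<xi> t \<in> tangent_space \<A> (\<gamma> t)"
  proof (rule tangentI[OF _ Dt_outside])
    fix c d assume c': "c \<in> \<A>" "d \<in> \<A>" "\<gamma> t \<in> cdom c" "\<gamma> t \<in> cdom d"
    then have c: "c \<in> \<A>" "d \<in> \<A>" "t \<in> dom_of c" "t \<in> dom_of d" using t by (auto simp: dom_of_def)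
    interpret chart_change "coord c ` cdom c" "g c" "coord d ` cdom d" "g d" "coord c ` (cdom c \<inter> cdom d)" "transition c d"
      by (rule change[OF c(1,2)])
    let ?x = "\<lambda>t. coord c (\<gamma> t)" and ?S = "dom_of c \<inter> dom_of d"
    let ?v = "vector_derivative (\<lambda>s. \<xi> s c) (at t within {0..T})"
    note x = in_overlap[OF c(3,4)]
    have fd: "\<xi> s d = D (?x s) (\<xi> s c)" if "s \<in> ?S" for s
      using tangent_change[OF field_tangent[OF \<xi>] c(1,2), of s] dom_ofD[of s c] dom_ofD[of s d] that
      by (simp add: transition_deriv_def)
    have "((\<lambda>s. D (?x s) (\<xi> s c)) has_derivative (\<lambda>h. D2 (?x t) (h *\<^sub>R V t c) (\<xi> t c) + D (?x t) (h *\<^sub>R ?v))) (at t within ?S)"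
      using V_deriv[OF c(1,3)] field_deriv[OF \<xi> c(1,3)] c in_overlap unfolding at_dom_of2[OF c, symmetric] has_vector_derivative_def
      by (intro D_product_rule) blast+
    then have "((\<lambda>s. D (?x s) (\<xi> s c)) has_vector_derivative (D2 (?x t) (V t c) (\<xi> t c) + D (?x t) ?v)) (at t within ?S)"
      unfolding has_vector_derivative_def
      by (simp add: linear_scale[OF D_linear[OF x]] linear_scale[OF has_derivative_linear[OF D_deriv[OF x]]] scaleR_add_right)
    then have "((\<lambda>s. \<xi> s d) has_vector_derivative (D2 (?x t) (V t c) (\<xi> t c) + D (?x t) ?v)) (at t within ?S)"
      by (rule has_vector_derivative_transform[rotated 2]) (use c fd in auto)
    then have *: "vector_derivative (\<lambda>s. \<xi> s d) (at t within {0..T}) = D2 (?x t) (V t c) (\<xi> t c) + D (?x t) ?v"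
      unfolding at_dom_of2[OF c] by (rule vector_derivative_eq[OF t])
    have tc: "w d = D (?x t) (w c)" if "w \<in> tangent_space \<A> (\<gamma> t)" for w
      using tangent_change[OF that c(1,2)] c by (simp add: transition_deriv_def dom_ofD)
    show "Dt \<xi> t d = transition_deriv c d (\<gamma> t) (Dt \<xi> t c)"
      unfolding Dt_chart[OF c(1,3)] Dt_chart[OF c(2,4)] * tc[OF field_tangent[OF field_V t]] tc[OF field_tangent[OF \<xi> t]]
        transition_deriv_def linear_add[OF D_linear[OF x]] christoffel_change[OF x]
      using transition_coord[OF c(1) dom_ofD(2)[OF c(3)], of d] by simp
  qed
qed

lemma field_curvature:
  assumes \<xi>: "field \<xi>"
  shows "field (\<lambda>t. curvature_at \<A> g (\<gamma> t) (V t) (\<xi> t) (V t))"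
proof (rule fieldI)
  show "curvature_at \<A> g (\<gamma> t) (V t) (\<xi> t) (V t) \<in> tangent_space \<A> (\<gamma> t)" if "t \<in> {0..T}" for t
    by (intro curvature_at_tangent field_tangent field_V \<xi> that)
  fix c assume c: "c \<in> \<A>"
  interpret chart_metric "coord c ` cdom c" "g c" by (rule chart[OF c])
  have "smooth_on (dom_of c) (\<lambda>t. curv (coord c (\<gamma> t)) (V t c) (\<xi> t c) (V t c))"
    by (intro smooth_curv_along full_dom_of c field_smooth \<xi> field_V coord_smooth) (auto simp: dom_of_def)
  then show "smooth_on (dom_of c) (\<lambda>t. curvature_at \<A> g (\<gamma> t) (V t) (\<xi> t) (V t) c)"
    by (rule smooth_cong[rotated]) (simp add: curvature_at_chart c dom_ofD)
qed

lemma smooth_local: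
  assumes "\<And>c. c \<in> \<A> \<Longrightarrow> smooth_on (dom_of c) f"
  shows "smooth_on {0..T} f"
  unfolding smooth_on_def
proof
  fix k
  show "tdo k {0..T} f"
  proof (rule tdo_local)
    fix t assume "t \<in> {0..T}"
    then obtain c where c: "c \<in> \<A>" "t \<in> dom_of c" using ex_chart[of t] by auto
    obtain W where W: "open W" "dom_of c = {0..T} \<inter> W" using dom_of_open[OF c(1)] by blast
    have "tdo k (dom_of c) f" using assms[OF c(1)] unfolding smooth_on_def by blast
    then show "\<exists>W. open W \<and> t \<in> W \<and> tdo k ({0..T} \<inter> W) f" using W c(2) by auto
  qed
qed

lemma smooth_restrict: "smooth_on {0..T} f \<Longrightarrow> c \<in> \<A> \<Longrightarrow> smooth_on (dom_of c) f"
  using dom_of_open[of c] tdo_restrict[of _ _ "{0..T}" f] unfolding smooth_on_def by auto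

lemma gt_chart:
  assumes "field \<xi>" "field \<eta>" "c \<in> \<A>" "t \<in> dom_of c"
  shows "gt t (\<xi> t) (\<eta> t) = \<xi> t c \<bullet> (g c (coord c (\<gamma> t)) *v \<eta> t c)"
  by (intro metric_at_chart field_tangent assms(1-3) dom_ofD[OF assms(4)])

lemma gt_smooth:
  assumes "field \<xi>" "field \<eta>"
  shows "smooth_on {0..T} (\<lambda>t. gt t (\<xi> t) (\<eta> t))"
proof (rule smooth_local)
  fix c assume c: "c \<in> \<A>"
  interpret chart_metric "coord c ` cdom c" "g c" by (rule chart[OF c])
  have "smooth_on (dom_of c) (\<lambda>t. gm (coord c (\<gamma> t)) (\<xi> t c) (\<eta> t c))"
    by (intro gm.smooth_along full_dom_of c field_smooth assms coord_smooth) (auto simp: dom_of_def)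
  then show "smooth_on (dom_of c) (\<lambda>t. gt t (\<xi> t) (\<eta> t))"
    by (rule smooth_cong[rotated]) (simp add: gt_chart[OF assms c])
qed

text \<open>Metric compatibility along the curve, evaluated in a chart around the point.\<close>

lemma gt_deriv:
  assumes \<xi>: "field \<xi>" and \<eta>: "field \<eta>" and t: "t \<in> {0..T}"
  shows "((\<lambda>t. gt t (\<xi> t) (\<eta> t)) has_real_derivative gt t (Dt \<xi> t) (\<eta> t) + gt t (\<xi> t) (Dt \<eta> t)) (at t within {0..T})"
proof -
  obtain c where c: "c \<in> \<A>" "t \<in> dom_of c" using ex_chart[OF t] by auto
  interpret chart_metric "coord c ` cdom c" "g c" by (rule chart[OF c(1)])
  let ?x = "\<lambda>t. coord c (\<gamma> t)"
  have x: "?x t \<in> coord c ` cdom c" using c by (auto simp: dom_of_def)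
  let ?d\<xi> = "vector_derivative (\<lambda>s. \<xi> s c) (at t within {0..T})" and ?d\<eta> = "vector_derivative (\<lambda>s. \<eta> s c) (at t within {0..T})"
  have "((\<lambda>t. gm (?x t) (\<xi> t c) (\<eta> t c)) has_derivative
    (\<lambda>h. gm.DF (?x t) (\<xi> t c) (\<eta> t c) (h *\<^sub>R V t c) + gm (?x t) (h *\<^sub>R ?d\<xi>) (\<eta> t c) + gm (?x t) (\<xi> t c) (h *\<^sub>R ?d\<eta>))) (at t within dom_of c)"
    using V_deriv[OF c] field_deriv[OF \<xi> c] field_deriv[OF \<eta> c] unfolding at_dom_of[OF c, symmetric] has_vector_derivative_def
    by (intro gm.product_rule) (use c in \<open>auto simp: dom_of_def\<close>)
  also have "(\<lambda>h. gm.DF (?x t) (\<xi> t c) (\<eta> t c) (h *\<^sub>R V t c) + gm (?x t) (h *\<^sub>R ?d\<xi>) (\<eta> t c) + gm (?x t) (\<xi> t c) (h *\<^sub>R ?d\<eta>))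
     = (*) (gm (?x t) (Dt \<xi> t c) (\<eta> t c) + gm (?x t) (\<xi> t c) (Dt \<eta> t c))"
    unfolding linear_scale[OF has_derivative_linear[OF gm.dF[OF x]]] metric_compatible[OF x] Dt_chart[OF c]
    by (simp add: fun_eq_iff inner_simps matrix_vector_right_distrib matrix_vector_mult_scaleR bounded_bilinear.scaleR_left[OF christoffel_form_bilinear] algebra_simps)
  finally have "((\<lambda>t. gm (?x t) (\<xi> t c) (\<eta> t c)) has_real_derivative (gm (?x t) (Dt \<xi> t c) (\<eta> t c) + gm (?x t) (\<xi> t c) (Dt \<eta> t c))) (at t within dom_of c)"
    unfolding has_field_derivative_def .
  then have "((\<lambda>t. gt t (\<xi> t) (\<eta> t)) has_real_derivative (gm (?x t) (Dt \<xi> t c) (\<eta> t c) + gm (?x t) (\<xi> t c) (Dt \<eta> t c))) (at t within dom_of c)"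
    unfolding has_field_derivative_def by (rule has_derivative_transform[OF c(2), rotated]) (simp add: gt_chart[OF \<xi> \<eta> c(1)])
  then show ?thesis
    unfolding at_dom_of[OF c] gt_chart[OF field_Dt[OF \<xi>] \<eta> c] gt_chart[OF \<xi> field_Dt[OF \<eta>] c] .
qed

lemma field_lincomb:
  assumes "\<And>i. i \<in> I \<Longrightarrow> field (\<xi> i)" "\<And>i. i \<in> I \<Longrightarrow> smooth_on {0..T} (f i)"
  shows "field (\<lambda>t. \<Sum>i\<in>I. f i t *\<^sub>R \<xi> i t)"
proof (rule fieldI)
  show "(\<Sum>i\<in>I. f i t *\<^sub>R \<xi> i t) \<in> tangent_space \<A> (\<gamma> t)" if "t \<in> {0..T}" for t
    by (intro tangent_sum tangent_scaleR field_tangent assms that)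
  show "smooth_on (dom_of c) (\<lambda>t. (\<Sum>i\<in>I. f i t *\<^sub>R \<xi> i t) c)" if "c \<in> \<A>" for c
    unfolding sum_fun_apply scaleR_fun_apply
    by (intro smooth_sum smooth_scaleR full_dom_of smooth_restrict field_smooth assms that)
qed

lemma Dt_lincomb:
  assumes \<xi>: "\<And>i. i \<in> I \<Longrightarrow> field (\<xi> i)" and f: "\<And>i. i \<in> I \<Longrightarrow> (f i has_real_derivative f' i) (at t within {0..T})"
    and t: "t \<in> {0..T}"
  shows "Dt (\<lambda>t. \<Sum>i\<in>I. f i t *\<^sub>R \<xi> i t) t = (\<Sum>i\<in>I. f' i *\<^sub>R \<xi> i t + f i t *\<^sub>R Dt (\<xi> i) t)"
proof
  fix c
  show "Dt (\<lambda>t. \<Sum>i\<in>I. f i t *\<^sub>R \<xi> i t) t c = (\<Sum>i\<in>I. f' i *\<^sub>R \<xi> i t + f i t *\<^sub>R Dt (\<xi> i) t) c"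
  proof (cases "c \<in> \<A> \<and> \<gamma> t \<in> cdom c")
    case True
    then have c: "c \<in> \<A>" "t \<in> dom_of c" using t by (auto simp: dom_of_def)
    have "((\<lambda>s. \<Sum>i\<in>I. f i s *\<^sub>R \<xi> i s c) has_vector_derivative
      (\<Sum>i\<in>I. f i t *\<^sub>R vector_derivative (\<lambda>s. \<xi> i s c) (at t within {0..T}) + f' i *\<^sub>R \<xi> i t c)) (at t within {0..T})"
      by (intro has_vector_derivative_sum has_vector_derivative_scaleR f field_deriv \<xi> c)
    note d = vector_derivative_eq[OF t this]
    note \<Gamma> = bounded_bilinear.sum_right[OF christoffel_form_bilinear] bounded_bilinear.scaleR_right[OF christoffel_form_bilinear]
    show ?thesis
      unfolding Dt_chart[OF c] sum_fun_apply scaleR_fun_apply plus_fun_apply d \<Gamma>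
      by (simp add: sum.distrib scaleR_add_right)
  next
    case False
    then have "\<xi> i t c = 0" if "i \<in> I" for i using tangent_outside[OF field_tangent[OF \<xi>[OF that] t]] by blast
    then show ?thesis by (simp add: Dt_outside[OF False] sum_fun_apply)
  qed
qed

end

section \<open>Matrices of linearly stable maps\<close>

text \<open>Linearity is asked for on W only, because the Poincare map will be controlled on pairs
  of normal vectors.\<close>

locale map_matrix =
  fixes W :: "'v::real_vector set" and L :: "'v \<Rightarrow> 'v" and P :: "real mat" and k :: nat and b :: "nat \<Rightarrow> 'v"
  assumes P: "P \<in> carrier_mat k k" and inj: "inj_on b {..<k}" and ind: "independent (b ` {..<k})"
    and span: "span (b ` {..<k}) = W" and L: "\<And>j. j < k \<Longrightarrow> L (b j) = (\<Sum>i<k. P $$ (i, j) *\<^sub>R b i)"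
    and lin: "\<And>w w' r s. w \<in> W \<Longrightarrow> w' \<in> W \<Longrightarrow> L (r *\<^sub>R w + s *\<^sub>R w') = r *\<^sub>R L w + s *\<^sub>R L w'"
begin

definition comb :: "(nat \<Rightarrow> real) \<Rightarrow> 'v" where
  "comb y = (\<Sum>i<k. y i *\<^sub>R b i)"

definition cvec :: "(nat \<Rightarrow> real) \<Rightarrow> complex Matrix.vec" where
  "cvec y = Matrix.vec k (\<lambda>i. complex_of_real (y i))"

abbreviation PC where "PC \<equiv> map_mat complex_of_real P"

lemma ex_comb: assumes "w \<in> W" shows "\<exists>y. w = comb y"
proof -
  have "w \<in> range (\<lambda>u. \<Sum>v\<in>b ` {..<k}. u v *\<^sub>R v)" using assms span_finite[of "b ` {..<k}"] span by simp
  then obtain u where "w = (\<Sum>v\<in>b ` {..<k}. u v *\<^sub>R v)" by blast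
  then have "w = comb (\<lambda>i. u (b i))" unfolding comb_def by (simp add: sum.reindex[OF inj])
  then show ?thesis by blast
qed

lemma comb_inj: assumes "comb y = comb z" "i < k" shows "y i = z i"
proof -
  let ?u = "\<lambda>v. y (inv_into {..<k} b v) - z (inv_into {..<k} b v)"
  have "(\<Sum>v\<in>b ` {..<k}. ?u v *\<^sub>R v) = comb y - comb z"
    by (simp add: sum.reindex[OF inj] comb_def inv_into_f_f[OF inj] scaleR_diff_left sum_subtractf)
  then have "?u (b i) = 0" using independentD[OF ind, of "b ` {..<k}" ?u "b i"] assms by simp
  then show ?thesis using inv_into_f_f[OF inj] assms by simp
qed

lemma comb_in: "comb y \<in> W"
  unfolding comb_def span[symmetric] by (intro span_sum span_scale span_base) auto

lemma L_comb: "L (comb y) = comb (\<lambda>i. \<Sum>j<k. P $$ (i, j) * y j)"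
proof -
  have L0: "L 0 = 0" using lin[OF comb_in comb_in, of 0 _ 0] by simp
  have "L (\<Sum>j<m. y j *\<^sub>R b j) = (\<Sum>j<m. y j *\<^sub>R L (b j)) \<and> (\<Sum>j<m. y j *\<^sub>R b j) \<in> W" if "m \<le> k" for m
    using that
  proof (induction m)
    case 0
    then show ?case using L0 span span_zero by auto
  next
    case (Suc m)
    have "b m \<in> W" using Suc.prems unfolding span[symmetric] by (intro span_base) auto
    moreover have "(\<Sum>j<Suc m. y j *\<^sub>R b j) \<in> W"
      unfolding span[symmetric] by (intro span_sum span_scale span_base) (use Suc.prems in auto)
    ultimately show ?case using lin[of "\<Sum>j<m. y j *\<^sub>R b j" "b m" 1 "y m"] Suc by simp
  qed
  then have "L (comb y) = (\<Sum>j<k. y j *\<^sub>R L (b j))" unfolding comb_def by blast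
  also have "\<dots> = (\<Sum>j<k. \<Sum>i<k. (P $$ (i, j) * y j) *\<^sub>R b i)"
    by (intro sum.cong refl) (simp add: L scaleR_sum_right mult.commute)
  also have "\<dots> = comb (\<lambda>i. \<Sum>j<k. P $$ (i, j) * y j)"
    unfolding comb_def by (subst sum.swap) (simp add: scaleR_sum_left)
  finally show ?thesis .
qed

lemma PC: "PC \<in> carrier_mat k k" using P by simp

lemma PC_cvec: "PC *\<^sub>v cvec y = cvec (\<lambda>i. \<Sum>j<k. P $$ (i, j) * y j)"
  by (rule eq_vecI) (use P in \<open>auto simp: cvec_def scalar_prod_def lessThan_atLeast0\<close>)

lemma PC_cvec_eq:
  assumes "L (comb y) = comb z"
  shows "PC *\<^sub>v cvec y = cvec z"
  unfolding PC_cvec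
  by (rule eq_vecI) (use comb_inj[OF assms[unfolded L_comb]] in \<open>simp_all add: cvec_def del: of_real_sum of_real_mult\<close>)

lemma cvec_nonzero: assumes "comb y \<noteq> 0" shows "cvec y \<noteq> 0\<^sub>v k"
proof
  assume "cvec y = 0\<^sub>v k"
  then have "vec_index (cvec y) i = 0" if "i < k" for i using that by simp
  then have "y i = 0" if "i < k" for i using that by (simp add: cvec_def)
  then have "comb y = 0" by (simp add: comb_def)
  with assms show False by simp
qed

lemma eigenvector_unit_circle:
  assumes spec: "\<And>z. eigenvalue PC z \<Longrightarrow> norm z = 1"
    and w: "w \<in> W" "L w = x *\<^sub>R w" and x: "1 < x"
  shows "w = 0"
proof (rule ccontr)
  assume "w \<noteq> 0"
  obtain y where y: "w = comb y" using ex_comb[OF w(1)] by blast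
  have "L (comb y) = comb (\<lambda>i. x * y i)" using w(2) unfolding y by (simp add: comb_def scaleR_sum_right)
  then have "PC *\<^sub>v cvec y = cvec (\<lambda>i. x * y i)" by (rule PC_cvec_eq)
  also have "\<dots> = complex_of_real x \<cdot>\<^sub>v cvec y" by (rule eq_vecI) (auto simp: cvec_def)
  finally have "eigenvector PC (cvec y) (complex_of_real x)"
    unfolding eigenvector_def using cvec_nonzero \<open>w \<noteq> 0\<close> y P by (auto simp: cvec_def)
  then have "norm (complex_of_real x) = 1" using spec unfolding eigenvalue_def by blast
  then show False using x by simp
qed

text \<open>In diagonalising coordinates each component satisfies D q = q and D q' = q' + c q with a
  scalar D. A nonzero q forces D = 1, and then c q = 0.\<close>

lemma no_jordan_chain:
  assumes sim: "similar_mat PC D" and diag: "diagonal_mat D"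
    and w: "w \<in> W" "L w = w" "w' \<in> W" "L w' = w' + c *\<^sub>R w" and c: "c \<noteq> 0"
  shows "w = 0"
proof (rule ccontr)
  assume "w \<noteq> 0"
  obtain y where y: "w = comb y" using ex_comb[OF w(1)] by blast
  obtain y' where y': "w' = comb y'" using ex_comb[OF w(3)] by blast
  have e: "PC *\<^sub>v cvec y = cvec y" by (rule PC_cvec_eq) (use w(2) y in simp)
  have e': "PC *\<^sub>v cvec y' = cvec (\<lambda>i. y' i + c * y i)"
    by (rule PC_cvec_eq) (use w(4) y y' in \<open>simp add: comb_def scaleR_sum_right scaleR_add_left sum.distrib\<close>)
  obtain S Q where wit: "similar_mat_wit PC D S Q" using sim unfolding similar_mat_def by blast
  have dim: "D \<in> carrier_mat k k" "S \<in> carrier_mat k k" "Q \<in> carrier_mat k k"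
    and SQ: "S * Q = 1\<^sub>m k" "Q * S = 1\<^sub>m k" and PC_eq: "PC = S * D * Q"
    using wit P unfolding similar_mat_wit_def Let_def by auto
  have "Q * PC = (Q * S) * (D * Q)"
    unfolding PC_eq using dim by (simp add: assoc_mult_mat[of _ k k _ k _ k])
  then have QP: "Q * PC = D * Q" unfolding SQ using dim by simp
  have cv: "cvec y \<in> carrier_vec k" for y by (simp add: cvec_def)
  have DQ: "D *\<^sub>v (Q *\<^sub>v cvec y) = Q *\<^sub>v (PC *\<^sub>v cvec y)" for y
    using QP assoc_mult_mat_vec[OF dim(1,3) cv[of y]] assoc_mult_mat_vec[OF dim(3) PC cv[of y]] by simp
  have Dq: "vec_index (D *\<^sub>v q) i = D $$ (i, i) * vec_index q i" if "q \<in> carrier_vec k" "i < k" for q i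
  proof -
    have "vec_index (D *\<^sub>v q) i = (\<Sum>j<k. D $$ (i, j) * vec_index q j)"
      using dim that by (simp add: scalar_prod_def lessThan_atLeast0)
    also have "\<dots> = (\<Sum>j<k. if j = i then D $$ (i, i) * vec_index q i else 0)"
      by (intro sum.cong refl) (use diag dim that in \<open>auto simp: diagonal_mat_def\<close>)
    finally show ?thesis using that by simp
  qed
  have split: "cvec (\<lambda>i. y' i + c * y i) = cvec y' + complex_of_real c \<cdot>\<^sub>v cvec y"
    by (rule eq_vecI) (auto simp: cvec_def)
  have Qs: "Q *\<^sub>v cvec (\<lambda>i. y' i + c * y i) = Q *\<^sub>v cvec y' + complex_of_real c \<cdot>\<^sub>v (Q *\<^sub>v cvec y)"
    unfolding split using mult_add_distrib_mat_vec[OF dim(3) cv, of "complex_of_real c \<cdot>\<^sub>v cvec y" y']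
      mult_mat_vec[OF dim(3) cv, of "complex_of_real c" y] cv by simp
  have Qc: "Q *\<^sub>v cvec y \<in> carrier_vec k" for y using dim cv by simp
  have "vec_index (Q *\<^sub>v cvec y) i = 0" if i: "i < k" for i
  proof (rule ccontr)
    assume nz: "vec_index (Q *\<^sub>v cvec y) i \<noteq> 0"
    have "D $$ (i, i) * vec_index (Q *\<^sub>v cvec y) i = vec_index (Q *\<^sub>v cvec y) i"
      using Dq[OF Qc i, of y] unfolding DQ e by simp
    then have "D $$ (i, i) = 1" using nz by simp
    moreover have "D $$ (i, i) * vec_index (Q *\<^sub>v cvec y') i = vec_index (Q *\<^sub>v cvec y') i + complex_of_real c * vec_index (Q *\<^sub>v cvec y) i"
      using Dq[OF Qc i, of y'] i dim unfolding DQ e' Qs by simp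
    ultimately show False using nz c by simp
  qed
  then have "Q *\<^sub>v cvec y = 0\<^sub>v k" using dim by (intro eq_vecI) auto
  then have "S *\<^sub>v (Q *\<^sub>v cvec y) = 0\<^sub>v k"
    using dim by (intro eq_vecI) (simp_all add: scalar_prod_def)
  then have "cvec y = 0\<^sub>v k" using assoc_mult_mat_vec[OF dim(2,3) cv[of y]] SQ cv[of y] by simp
  with cvec_nonzero \<open>w \<noteq> 0\<close> y show False by blast
qed

end

section \<open>Closed geodesics with a parallel frame\<close>

text \<open>Zero velocity makes the coordinates locally constant, and [0,T] is connected. This will
  give a nonconstant Riemannian geodesic nonzero energy.\<close>

lemma (in metric_curve) constant_curveI:
  assumes V0: "\<And>t. t \<in> {0..T} \<Longrightarrow> V t = 0"
  shows "constant_curve T \<gamma>"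
proof -
  have loc: "eventually (\<lambda>s. \<gamma> t = \<gamma> s) (at t within {0..T})" if t: "t \<in> {0..T}" for t
  proof -
    obtain c where c: "c \<in> \<A>" "t \<in> dom_of c" using ex_chart[OF t] by auto
    obtain W where W: "open W" "dom_of c = {0..T} \<inter> W" using dom_of_open[OF c(1)] by auto
    have "t \<in> W" using W(2) c(2) by blast
    then obtain r where r: "0 < r" "ball t r \<subseteq> W" using W(1) unfolding open_contains_ball by blast
    let ?I = "{0..T} \<inter> ball t r"
    have I: "s \<in> dom_of c" if "s \<in> ?I" for s using that r W by auto
    have "((\<lambda>t. coord c (\<gamma> t)) has_derivative (\<lambda>h. 0)) (at s within ?I)" if "s \<in> ?I" for s
    proof -
      have "((\<lambda>t. coord c (\<gamma> t)) has_derivative (\<lambda>h. 0)) (at s within {0..T})"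
        using V_deriv[OF c(1) I[OF that]] V0[of s] that by (simp add: has_vector_derivative_def)
      then show ?thesis by (rule has_derivative_subset) blast
    qed
    moreover have "convex ?I" by (intro convex_Int convex_ball) simp
    ultimately have "\<exists>q. \<forall>s\<in>?I. coord c (\<gamma> s) = q"
      by (intro has_derivative_zero_constant)
    then obtain q where q: "\<And>s. s \<in> ?I \<Longrightarrow> coord c (\<gamma> s) = q" by blast
    have "\<gamma> t = \<gamma> s" if s: "s \<in> ?I" for s
    proof -
      have "t \<in> ?I" using t r by simp
      then have eq: "coord c (\<gamma> t) = coord c (\<gamma> s)" using q[OF s] q[of t] by blast
      show ?thesis
        using chart_inv[OF c(1) dom_ofD(2)[OF c(2)]] chart_inv[OF c(1) dom_ofD(2)[OF I[OF s]]] unfolding eq by (rule trans[OF sym])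
    qed
    then show ?thesis unfolding eventually_at using r by (intro exI[of _ r]) (auto simp: dist_commute)
  qed
  have "\<gamma> t = \<gamma> 0" if "t \<in> {0..T}" for t
    by (rule connected_local_const[of "{0..T}"]) (use that T loc in auto)
  then show ?thesis unfolding constant_curve_def by blast
qed

locale geodesic = metric_curve \<A> g T \<gamma>
  for \<A> :: "('a::{t2_space, second_countable_topology}, 'm::finite) chart set" and g :: "('a, 'm) metric"
    and T :: real and \<gamma> :: "real \<Rightarrow> 'a" +
  assumes geodesic: "\<And>t. t \<in> {0..T} \<Longrightarrow> Dt V t = 0"
begin

lemma energy_constant: assumes "t \<in> {0..T}" shows "gt t (V t) (V t) = gt 0 (V 0) (V 0)"
proof -
  have "((\<lambda>t. gt t (V t) (V t)) has_real_derivative 0) (at t within {0..T})" if "t \<in> {0..T}" for t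
    using gt_deriv[OF field_V field_V that] by (simp add: geodesic[OF that] metric_at_simps)
  then have "\<exists>c. \<forall>t\<in>{0..T}. gt t (V t) (V t) = c"
    by (intro has_field_derivative_zero_constant) auto
  then show ?thesis using assms T by auto
qed

end

section \<open>Jacobi fields in a parallel frame\<close>

locale geodesic_frame = geodesic \<A> g T \<gamma>
  for \<A> :: "('a::{t2_space, second_countable_topology}, 'm::finite) chart set" and g :: "('a, 'm) metric"
    and T :: real and \<gamma> :: "real \<Rightarrow> 'a" +
  fixes n :: nat and e :: "nat \<Rightarrow> real \<Rightarrow> ('a, 'm) tvec" and \<epsilon> :: real
  assumes card: "CARD('m) = n + 1" and frame: "parallel_orthonormal_frame \<A> g T \<gamma> n e"
    and energy: "\<And>t. t \<in> {0..T} \<Longrightarrow> gt t (V t) (V t) = \<epsilon>" and nonnull: "\<epsilon> \<noteq> 0"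
begin

abbreviation R where "R \<equiv> curvature_matrix \<A> g T \<gamma> e"

lemma field_e: "i < n \<Longrightarrow> field (e i)" and e_parallel: "i < n \<Longrightarrow> t \<in> {0..T} \<Longrightarrow> Dt (e i) t = 0"
  and e_V: "i < n \<Longrightarrow> t \<in> {0..T} \<Longrightarrow> gt t (e i t) (V t) = 0"
  and e_e: "i < n \<Longrightarrow> j < n \<Longrightarrow> t \<in> {0..T} \<Longrightarrow> gt t (e i t) (e j t) = (if i = j then 1 else 0)"
  using frame unfolding parallel_orthonormal_frame_def by blast+

lemma e_tangent: "i < n \<Longrightarrow> t \<in> {0..T} \<Longrightarrow> e i t \<in> tangent_space \<A> (\<gamma> t)"
  by (rule field_tangent[OF field_e])

lemma V_tangent: "t \<in> {0..T} \<Longrightarrow> V t \<in> tangent_space \<A> (\<gamma> t)"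
  by (rule field_tangent[OF field_V])

text \<open>The frame and the velocity are n + 1 orthogonal vectors of nonzero square in dimension n
  + 1, hence a basis. By nondegeneracy a vector is determined by its products with them.\<close>

lemma expansion:
  assumes t: "t \<in> {0..T}" and v: "v \<in> tangent_space \<A> (\<gamma> t)"
  shows "v = (\<Sum>i<n. gt t v (e i t) *\<^sub>R e i t) + (gt t v (V t) / \<epsilon>) *\<^sub>R V t"
proof -
  obtain c where c: "c \<in> \<A>" "t \<in> dom_of c" using ex_chart[OF t] by auto
  interpret chart_metric "coord c ` cdom c" "g c" by (rule chart[OF c(1)])
  define x where "x = coord c (\<gamma> t)"
  have x: "x \<in> coord c ` cdom c" using c(2) unfolding x_def by (auto simp: dom_of_def)
  define b where "b j = (if j < n then e j t else V t)" for j
  define \<nu> where "\<nu> j = (if j < n then 1 else \<epsilon>)" for j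
  have bt: "b j \<in> tangent_space \<A> (\<gamma> t)" for j using e_tangent[OF _ t] V_tangent[OF t] by (simp add: b_def)
  have gm: "gt t u w = gm x (u c) (w c)" if "u \<in> tangent_space \<A> (\<gamma> t)" "w \<in> tangent_space \<A> (\<gamma> t)" for u w
    unfolding x_def by (rule metric_at_chart[OF that c(1) dom_ofD(2)[OF c(2)]])
  have V_e: "gt t (V t) (e i t) = 0" if "i < n" for i
    using metric_at_commute[OF V_tangent[OF t] e_tangent[OF that t] in_manifold[OF t]] e_V[OF that t] by simp
  have orth: "gm x (b i c) (b j c) = (if i = j then \<nu> i else 0)" if "i < n + 1" "j < n + 1" for i j
  proof -
    have "gt t (b i) (b j) = (if i = j then \<nu> i else 0)"
      using that unfolding b_def \<nu>_def by (cases "i < n"; cases "j < n") (simp_all add: e_e[OF _ _ t] e_V[OF _ t] V_e energy[OF t])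
    then show ?thesis by (simp only: gm[OF bt bt])
  qed
  \<comment> \<open>A numbering of the coordinates turns \<open>L\<close> into a linear map of the
    coordinate space into itself, so that injectivity yields surjectivity.\<close>
  obtain h where h: "bij_betw h (UNIV :: 'm set) {0..<n + 1}"
    using ex_bij_betw_finite_nat[of "UNIV :: 'm set"] card by auto
  have hlt: "h k < n + 1" for k using h by (auto simp: bij_betw_def)
  have hinj: "h k = h l \<longleftrightarrow> k = l" for k l using h by (auto simp: bij_betw_def inj_eq)
  define L where "L u = (\<Sum>k\<in>UNIV. (u $ k) *\<^sub>R b (h k) c)" for u :: "real ^ 'm"
  have lin: "linear L" unfolding L_def
    by (rule linearI) (simp_all add: scaleR_add_left sum.distrib scaleR_sum_right)
  have sl: "gm x (\<Sum>i\<in>I. f i *\<^sub>R w i) z = (\<Sum>i\<in>I. f i * gm x (w i) z)" for f and w :: "'i \<Rightarrow> _" and I z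
    by (simp add: inner_sum_left)
  have sr: "gm x z (\<Sum>i\<in>I. f i *\<^sub>R w i) = (\<Sum>i\<in>I. f i * gm x z (w i))" for f and w :: "'i \<Rightarrow> _" and I z
    unfolding gm_commute[OF x, of z] by (rule sl)
  have Lb: "gm x (L u) (b (h l) c) = u $ l * \<nu> (h l)" for u l
    unfolding L_def sl by (simp add: orth[OF hlt hlt] hinj if_distrib cong: if_cong)
  have "inj L"
    unfolding linear_injective_0[OF lin]
  proof (intro allI impI)
    fix u assume "L u = 0"
    then have "u $ l * \<nu> (h l) = 0" for l using Lb[of u l] by simp
    moreover have "\<nu> j \<noteq> 0" for j using nonnull by (simp add: \<nu>_def)
    ultimately show "u = 0" by (simp add: Finite_Cartesian_Product.vec_eq_iff)
  qed
  then have surj: "surj L" by (rule linear_injective_imp_surjective[OF lin]) simp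
  define w where "w = (\<Sum>i<n. gt t v (e i t) *\<^sub>R e i t) + (gt t v (V t) / \<epsilon>) *\<^sub>R V t"
  have wt: "w \<in> tangent_space \<A> (\<gamma> t)" unfolding w_def
    by (intro tangent_add tangent_sum tangent_scaleR) (simp_all add: e_tangent[OF _ t] V_tangent[OF t])
  have "gt t w (e j t) = gt t v (e j t)" if "j < n" for j
    unfolding w_def using that by (simp add: metric_at_simps metric_at_sum e_e[OF _ _ t] V_e if_distrib cong: if_cong)
  moreover have "gt t w (V t) = gt t v (V t)"
    unfolding w_def using nonnull by (simp add: metric_at_simps metric_at_sum e_V[OF _ t] energy[OF t])
  ultimately have "gt t w (b j) = gt t v (b j)" for j by (simp add: b_def)
  then have wb: "gm x (v c - w c) (b j c) = 0" for j
    unfolding gm[OF wt bt] gm[OF v bt] by (simp add: inner_diff_left)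
  have "gm x (v c - w c) z = 0" for z
  proof -
    obtain u where "z = L u" using surj by blast
    then show ?thesis unfolding L_def by (simp only: sr wb mult_zero_right sum.neutral_const)
  qed
  then have "v c - w c = 0" by (rule gm_nondegenerate[OF x])
  then have "v = w" by (intro tangent_eqI[OF v wt c(1) dom_ofD(2)[OF c(2)]]) simp
  then show ?thesis unfolding w_def .
qed

lemma gt_comb:
  assumes "t \<in> {0..T}" "j < n"
  shows "gt t (\<Sum>i<n. a i *\<^sub>R e i t) (e j t) = a j"
  using assms by (simp add: metric_at_simps metric_at_sum e_e if_distrib cong: if_cong)

lemma gt_comb_V:
  assumes "t \<in> {0..T}"
  shows "gt t (\<Sum>i<n. a i *\<^sub>R e i t) (V t) = 0"
  using assms by (simp add: metric_at_simps metric_at_sum e_V)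

lemma R_symmetric: "t \<in> {0..T} \<Longrightarrow> i < n \<Longrightarrow> j < n \<Longrightarrow> R t i j = R t j i"
  unfolding curvature_matrix_def by (rule curvature_at_symmetric[OF V_tangent e_tangent e_tangent in_manifold])

lemma R_smooth: "i < n \<Longrightarrow> j < n \<Longrightarrow> smooth_on {0..T} (\<lambda>t. R t i j)"
  unfolding curvature_matrix_def by (rule gt_smooth[OF field_curvature[OF field_e] field_e])

lemma R_continuous: "i < n \<Longrightarrow> j < n \<Longrightarrow> continuous_on {0..T} (\<lambda>t. R t i j)"
  using R_smooth[of i j] tdo_continuous unfolding smooth_on_def by blast

lemma curvature_V: "t \<in> {0..T} \<Longrightarrow> curvature_at \<A> g (\<gamma> t) (V t) (V t) (V t) = 0"
  using curvature_at_lincomb[OF in_manifold, of t "V t" "\<lambda>_. 0" "\<lambda>_. 0" "{}" 1] by simp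

lemma curvature_gt_V:
  assumes t: "t \<in> {0..T}" and v: "v \<in> tangent_space \<A> (\<gamma> t)"
  shows "gt t (curvature_at \<A> g (\<gamma> t) (V t) v (V t)) (V t) = 0"
  using curvature_at_symmetric[OF V_tangent[OF t] v V_tangent[OF t] in_manifold[OF t]] curvature_V[OF t]
  by (simp add: metric_at_simps)

lemma curvature_e:
  assumes t: "t \<in> {0..T}" and i: "i < n"
  shows "curvature_at \<A> g (\<gamma> t) (V t) (e i t) (V t) = (\<Sum>j<n. R t i j *\<^sub>R e j t)"
  by (rule trans[OF expansion[OF t curvature_at_tangent[OF V_tangent[OF t] e_tangent[OF i t] V_tangent[OF t]]]])
    (simp add: curvature_matrix_def curvature_gt_V[OF t e_tangent[OF i t]])

lemma curvature_comb:
  assumes t: "t \<in> {0..T}"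
  shows "curvature_at \<A> g (\<gamma> t) (V t) ((\<Sum>i<n. u i *\<^sub>R e i t) + s *\<^sub>R V t) (V t) = (\<Sum>i<n. (\<Sum>j<n. R t i j * u j) *\<^sub>R e i t)"
proof -
  have "curvature_at \<A> g (\<gamma> t) (V t) ((\<Sum>i<n. u i *\<^sub>R e i t) + s *\<^sub>R V t) (V t) = (\<Sum>i<n. u i *\<^sub>R (\<Sum>j<n. R t i j *\<^sub>R e j t))"
    by (simp add: curvature_at_lincomb[OF in_manifold[OF t]] curvature_e[OF t])
  \<comment> \<open>The first index of \<open>R\<close> belongs to the argument of the curvature.
    Symmetry moves it to the column, where the matrix equation expects it.\<close>
  also have "\<dots> = (\<Sum>i<n. \<Sum>j<n. (R t j i * u i) *\<^sub>R e j t)"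
    by (simp add: scaleR_sum_right R_symmetric[OF t] mult.commute)
  also have "\<dots> = (\<Sum>j<n. (\<Sum>i<n. R t j i * u i) *\<^sub>R e j t)"
    by (subst sum.swap) (simp add: scaleR_sum_left)
  finally show ?thesis .
qed

text \<open>Bootstrapping: if u and v are of class k, the equation with smooth R makes their
  derivatives of class k. Jacobi fields are smooth by definition, whereas a solution comes only with
  first derivatives.\<close>

lemma sol_smooth:
  assumes sol: "jacobi_sol T n R u v" and i: "i < n"
  shows "smooth_on {0..T} (\<lambda>t. u t i)" "smooth_on {0..T} (\<lambda>t. v t i)"
proof -
  have S: "full_dirs {0..T}" using full_dirs_interval[OF T open_UNIV] by simp
  note d = sol[unfolded jacobi_sol_def has_field_derivative_def, rule_format]
  have "\<forall>i<n. tdo k {0..T} (\<lambda>t. u t i) \<and> tdo k {0..T} (\<lambda>t. v t i)" for k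
  proof (induction k)
    case 0
    show ?case
      unfolding times_differentiable_on.simps continuous_on_eq_continuous_within
      using has_derivative_continuous[OF conjunct1[OF d]] has_derivative_continuous[OF conjunct2[OF d]] by blast
  next
    case (Suc k)
    have r: "tdo k {0..T} (\<lambda>t. R t i j)" if "i < n" "j < n" for i j using R_smooth[OF that] unfolding smooth_on_def by blast
    show ?case
    proof (intro allI impI conjI)
      fix i assume i: "i < n"
      show "tdo (Suc k) {0..T} (\<lambda>t. u t i)"
        by (rule tdo_SucI[OF S conjunct1[OF d[OF i]]]) (use Suc i in \<open>auto intro!: tdo_mult S tdo_const\<close>)
      show "tdo (Suc k) {0..T} (\<lambda>t. v t i)"
        by (rule tdo_SucI[OF S conjunct2[OF d[OF i]]]) (use Suc i in \<open>auto intro!: tdo_mult tdo_sum r S tdo_const\<close>)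
    qed
  qed
  then show "smooth_on {0..T} (\<lambda>t. u t i)" "smooth_on {0..T} (\<lambda>t. v t i)"
    using i unfolding smooth_on_def by blast+
qed

lemma Dt_comb:
  assumes f: "\<And>i. i < n \<Longrightarrow> ((\<lambda>s. f s i) has_real_derivative f' i) (at t within {0..T})" and t: "t \<in> {0..T}"
  shows "Dt (\<lambda>t. \<Sum>i<n. f t i *\<^sub>R e i t) t = (\<Sum>i<n. f' i *\<^sub>R e i t)"
  using Dt_lincomb[of "{..<n}" e "\<lambda>i t. f t i" f' t] f t by (simp add: field_e e_parallel)

text \<open>The frame is parallel, so covariant differentiation acts on the coefficients
  only.\<close>

lemma jacobi_field_of_sol:
  assumes sol: "jacobi_sol T n R u v"
  shows "jacobi_field \<A> g T \<gamma> (\<lambda>t. \<Sum>i<n. u t i *\<^sub>R e i t)"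
    and "\<And>t. t \<in> {0..T} \<Longrightarrow> Dt (\<lambda>t. \<Sum>i<n. u t i *\<^sub>R e i t) t = (\<Sum>i<n. v t i *\<^sub>R e i t)"
proof -
  let ?\<xi> = "\<lambda>t. \<Sum>i<n. u t i *\<^sub>R e i t" and ?\<eta> = "\<lambda>t. \<Sum>i<n. v t i *\<^sub>R e i t"
  note d = sol[unfolded jacobi_sol_def, rule_format]
  have D: "Dt ?\<xi> t = ?\<eta> t" if "t \<in> {0..T}" for t
    by (rule Dt_comb[OF conjunct1[OF d] that]) (use that in auto)
  then show "\<And>t. t \<in> {0..T} \<Longrightarrow> Dt ?\<xi> t = ?\<eta> t" .
  show "jacobi_field \<A> g T \<gamma> ?\<xi>"
    unfolding jacobi_field_def
  proof (intro conjI ballI)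
    show "field ?\<xi>" by (rule field_lincomb) (use field_e sol_smooth[OF sol] in auto)
    fix t assume t: "t \<in> {0..T}"
    have "Dt (Dt ?\<xi>) t = Dt ?\<eta> t" by (rule Dt_cong[OF D t])
    also have "\<dots> = (\<Sum>i<n. (\<Sum>j<n. R t i j * u t j) *\<^sub>R e i t)"
      by (rule Dt_comb[OF conjunct2[OF d] t]) (use t in auto)
    also have "\<dots> = curvature_at \<A> g (\<gamma> t) (V t) (?\<xi> t) (V t)" using curvature_comb[OF t, of "u t" 0] by simp
    finally show "- Dt (Dt ?\<xi>) t + curvature_at \<A> g (\<gamma> t) (V t) (?\<xi> t) (V t) = 0" by simp
  qed
qed

text \<open>The curvature term is orthogonal to the velocity, so the product of
  \<open>Dt \<xi>\<close> with the velocity is constant, and it is the derivative of the product of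
  \<xi> with the velocity. Hence normal initial data stay normal, and the frame coefficients
  describe the field completely.\<close>

lemma sol_of_jacobi_field:
  assumes \<xi>: "jacobi_field \<A> g T \<gamma> \<xi>" and normal: "gt 0 (\<xi> 0) (V 0) = 0" "gt 0 (Dt \<xi> 0) (V 0) = 0"
  defines "u \<equiv> \<lambda>t i. gt t (\<xi> t) (e i t)" and "v \<equiv> \<lambda>t i. gt t (Dt \<xi> t) (e i t)"
  shows "jacobi_sol T n R u v"
    and "\<And>t. t \<in> {0..T} \<Longrightarrow> \<xi> t = (\<Sum>i<n. u t i *\<^sub>R e i t)"
    and "\<And>t. t \<in> {0..T} \<Longrightarrow> Dt \<xi> t = (\<Sum>i<n. v t i *\<^sub>R e i t)"
proof -
  have f: "field \<xi>" using \<xi> unfolding jacobi_field_def by blast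
  note f' = field_Dt[OF f]
  have J: "Dt (Dt \<xi>) t = curvature_at \<A> g (\<gamma> t) (V t) (\<xi> t) (V t)" if "t \<in> {0..T}" for t
    using \<xi> that unfolding jacobi_field_def by (simp add: add_eq_0_iff)
  have hV: "gt t (Dt \<xi> t) (V t) = 0" if "t \<in> {0..T}" for t
  proof -
    have "((\<lambda>t. gt t (Dt \<xi> t) (V t)) has_real_derivative 0) (at t within {0..T})" if "t \<in> {0..T}" for t
      using gt_deriv[OF f' field_V that] curvature_gt_V[OF that field_tangent[OF f that]]
      by (simp add: J[OF that] geodesic[OF that] metric_at_simps)
    then have "\<exists>c. \<forall>t\<in>{0..T}. gt t (Dt \<xi> t) (V t) = c" by (intro has_field_derivative_zero_constant) auto
    then show ?thesis using that T normal(2) by auto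
  qed
  have gV: "gt t (\<xi> t) (V t) = 0" if "t \<in> {0..T}" for t
  proof -
    have "((\<lambda>t. gt t (\<xi> t) (V t)) has_real_derivative 0) (at t within {0..T})" if "t \<in> {0..T}" for t
      using gt_deriv[OF f field_V that] by (simp add: hV[OF that] geodesic[OF that] metric_at_simps)
    then have "\<exists>c. \<forall>t\<in>{0..T}. gt t (\<xi> t) (V t) = c" by (intro has_field_derivative_zero_constant) auto
    then show ?thesis using that T normal(1) by auto
  qed
  show \<xi>_eq: "\<xi> t = (\<Sum>i<n. u t i *\<^sub>R e i t)" if "t \<in> {0..T}" for t
    unfolding u_def by (rule trans[OF expansion[OF that field_tangent[OF f that]]]) (simp add: gV[OF that])
  show "Dt \<xi> t = (\<Sum>i<n. v t i *\<^sub>R e i t)" if "t \<in> {0..T}" for t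
    unfolding v_def by (rule trans[OF expansion[OF that field_tangent[OF f' that]]]) (simp add: hV[OF that])
  show "jacobi_sol T n R u v"
    unfolding jacobi_sol_def
  proof (intro allI impI ballI conjI)
    fix i t assume i: "i < n" and t: "t \<in> {0..T}"
    show "((\<lambda>s. u s i) has_real_derivative v t i) (at t within {0..T})"
      unfolding u_def v_def using gt_deriv[OF f field_e[OF i] t] by (simp add: e_parallel[OF i t] metric_at_simps)
    have "Dt (Dt \<xi>) t = (\<Sum>i<n. (\<Sum>j<n. R t i j * u t j) *\<^sub>R e i t)"
      unfolding J[OF t] \<xi>_eq[OF t] using curvature_comb[OF t, of "u t" 0] by simp
    then have "gt t (Dt (Dt \<xi>) t) (e i t) = (\<Sum>j<n. R t i j * u t j)" using gt_comb[OF t i] by simp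
    then show "((\<lambda>s. v s i) has_real_derivative (\<Sum>j<n. R t i j * u t j)) (at t within {0..T})"
      unfolding v_def using gt_deriv[OF f' field_e[OF i] t] by (simp add: e_parallel[OF i t] metric_at_simps)
  qed
qed

text \<open>Frame coordinates for pairs of normal vectors at the base point.\<close>

definition \<Phi> :: "(nat \<Rightarrow> real) \<Rightarrow> (nat \<Rightarrow> real) \<Rightarrow> ('a, 'm) tvec \<times> ('a, 'm) tvec" where
  "\<Phi> a b = (\<Sum>i<n. a i *\<^sub>R e i 0, \<Sum>i<n. b i *\<^sub>R e i 0)"

abbreviation NN where "NN \<equiv> normal_space \<A> g T \<gamma> \<times> normal_space \<A> g T \<gamma>"
abbreviation PM where "PM \<equiv> poincare_map \<A> g T \<gamma>"

lemma zero_in: "0 \<in> {0..T}" using T by simp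

lemma \<Phi>_in: "\<Phi> a b \<in> NN"
  unfolding \<Phi>_def normal_space_def
  by (auto simp: gt_comb_V[OF zero_in] intro!: tangent_sum tangent_scaleR e_tangent[OF _ zero_in])

lemma ex_\<Phi>: assumes "w \<in> NN" shows "\<exists>a b. w = \<Phi> a b"
proof -
  have "x = (\<Sum>i<n. gt 0 x (e i 0) *\<^sub>R e i 0)" if "x \<in> normal_space \<A> g T \<gamma>" for x
    by (rule trans[OF expansion[OF zero_in]]) (use that in \<open>simp_all add: normal_space_def\<close>)
  then have "fst w = (\<Sum>i<n. gt 0 (fst w) (e i 0) *\<^sub>R e i 0)" "snd w = (\<Sum>i<n. gt 0 (snd w) (e i 0) *\<^sub>R e i 0)"
    using assms by (auto simp: mem_Times_iff)
  then have "w = \<Phi> (\<lambda>i. gt 0 (fst w) (e i 0)) (\<lambda>i. gt 0 (snd w) (e i 0))"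
    unfolding \<Phi>_def by (intro prod_eqI) (simp_all only: fst_conv snd_conv)
  then show ?thesis by blast
qed

lemma \<Phi>_inj: assumes "\<Phi> a b = \<Phi> a' b'" "i < n" shows "a i = a' i" "b i = b' i"
  using assms(1) gt_comb[OF zero_in assms(2), of a] gt_comb[OF zero_in assms(2), of a']
    gt_comb[OF zero_in assms(2), of b] gt_comb[OF zero_in assms(2), of b']
  unfolding \<Phi>_def by simp_all

lemma \<Phi>_lincomb: "\<Phi> (\<lambda>i. r * a i + s * a' i) (\<lambda>i. r * b i + s * b' i) = r *\<^sub>R \<Phi> a b + s *\<^sub>R \<Phi> a' b'"
  unfolding \<Phi>_def by (simp add: scaleR_add_left sum.distrib scaleR_sum_right)

lemma \<Phi>_cong: "(\<And>i. i < n \<Longrightarrow> a i = a' i) \<Longrightarrow> (\<And>i. i < n \<Longrightarrow> b i = b' i) \<Longrightarrow> \<Phi> a b = \<Phi> a' b'"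
  unfolding \<Phi>_def by (auto intro!: sum.cong)

lemma sol_unique:
  assumes sol: "jacobi_sol T n R u v" "jacobi_sol T n R u' v'"
    and init: "\<And>i. i < n \<Longrightarrow> u 0 i = u' 0 i" "\<And>i. i < n \<Longrightarrow> v 0 i = v' 0 i"
    and t: "t \<in> {0..T}" "i < n"
  shows "u t i = u' t i" "v t i = v' t i"
proof -
  have d: "jacobi_sol T n R (\<lambda>t i. 1 * u t i + (- 1) * u' t i) (\<lambda>t i. 1 * v t i + (- 1) * v' t i)"
    by (rule jacobi_sol_lincomb[OF sol])
  have "1 * u t i + (- 1) * u' t i = 0" "1 * v t i + (- 1) * v' t i = 0"
    using jacobi_sol_unique[OF less_imp_le[OF T] R_continuous d zero_in _ _ t] init by auto
  then show "u t i = u' t i" "v t i = v' t i" by simp_all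
qed

lemma ex_sol: "\<exists>u v. jacobi_sol T n R u v \<and> (\<forall>i<n. u 0 i = a i \<and> v 0 i = b i)"
proof (rule jacobi_sol_exists[OF less_imp_le[OF T] R_continuous, where a = a and b = b])
  fix u v assume "jacobi_sol T n R u v" "\<And>i. i < n \<Longrightarrow> u 0 i = a i" "\<And>i. i < n \<Longrightarrow> v 0 i = b i"
  then show ?thesis by blast
qed

text \<open>The Poincare map picks some Jacobi field with the given data. The frame coefficients of
  any such field solve the same initial value problem, so the values at T do not depend on the
  choice.\<close>

lemma poincare_sol:
  assumes sol: "jacobi_sol T n R u v"
  shows "PM (\<Phi> (u 0) (v 0)) = (\<Sum>i<n. u T i *\<^sub>R e i T, \<Sum>i<n. v T i *\<^sub>R e i T)"
proof -
  have T': "T \<in> {0..T}" using T by simp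
  let ?x = "\<Sum>i<n. u 0 i *\<^sub>R e i 0" and ?x' = "\<Sum>i<n. v 0 i *\<^sub>R e i 0"
  define \<xi> where "\<xi> = (SOME \<xi>. jacobi_field \<A> g T \<gamma> \<xi> \<and> \<xi> 0 = ?x \<and> Dt \<xi> 0 = ?x')"
  have "jacobi_field \<A> g T \<gamma> \<xi> \<and> \<xi> 0 = ?x \<and> Dt \<xi> 0 = ?x'"
    unfolding \<xi>_def
    by (rule someI[of _ "\<lambda>t. \<Sum>i<n. u t i *\<^sub>R e i t"])
      (use jacobi_field_of_sol[OF sol] zero_in in blast)
  then have \<xi>: "jacobi_field \<A> g T \<gamma> \<xi>" "\<xi> 0 = ?x" "Dt \<xi> 0 = ?x'" by blast+
  have N: "gt 0 (\<xi> 0) (V 0) = 0" "gt 0 (Dt \<xi> 0) (V 0) = 0" unfolding \<xi>(2,3) by (rule gt_comb_V[OF zero_in])+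
  note s = sol_of_jacobi_field[OF \<xi>(1) N]
  have "gt T (\<xi> T) (e i T) = u T i \<and> gt T (Dt \<xi> T) (e i T) = v T i" if i: "i < n" for i
    using sol_unique[OF s(1) sol _ _ T' i] unfolding \<xi>(2,3) by (simp add: gt_comb[OF zero_in])
  then have "\<xi> T = (\<Sum>i<n. u T i *\<^sub>R e i T)" "Dt \<xi> T = (\<Sum>i<n. v T i *\<^sub>R e i T)"
    by (rule_tac trans[OF s(2)[OF T']], simp, rule_tac trans[OF s(3)[OF T']], simp)
  then show ?thesis unfolding poincare_map_def \<Phi>_def prod.case \<xi>_def[symmetric] Let_def by simp
qed

text \<open>Every pair of normal vectors is the initial data of a solution, and solutions combine
  linearly.\<close>

lemma poincare_lincomb:
  assumes "w \<in> NN" "w' \<in> NN"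
  shows "PM (r *\<^sub>R w + s *\<^sub>R w') = r *\<^sub>R PM w + s *\<^sub>R PM w'"
proof -
  have "\<exists>u v. jacobi_sol T n R u v \<and> w = \<Phi> (u 0) (v 0)" if w: "w \<in> NN" for w
  proof -
    obtain a b where "w = \<Phi> a b" using ex_\<Phi>[OF w] by blast
    moreover obtain u v where "jacobi_sol T n R u v" "\<forall>i<n. u 0 i = a i \<and> v 0 i = b i" using ex_sol[of a b] by blast
    ultimately show ?thesis using \<Phi>_cong[of a "u 0" b "v 0"] by auto
  qed
  note ex = this
  obtain u v where w: "jacobi_sol T n R u v" "w = \<Phi> (u 0) (v 0)" using ex[OF assms(1)] by blast
  obtain u' v' where w': "jacobi_sol T n R u' v'" "w' = \<Phi> (u' 0) (v' 0)" using ex[OF assms(2)] by blast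
  have "PM (r *\<^sub>R w + s *\<^sub>R w') = (\<Sum>i<n. (r * u T i + s * u' T i) *\<^sub>R e i T, \<Sum>i<n. (r * v T i + s * v' T i) *\<^sub>R e i T)"
    using poincare_sol[OF jacobi_sol_lincomb[OF w(1) w'(1), of r s]] unfolding w(2) w'(2) \<Phi>_lincomb .
  also have "\<dots> = r *\<^sub>R PM w + s *\<^sub>R PM w'"
    unfolding w(2) w'(2) poincare_sol[OF w(1)] poincare_sol[OF w'(1)]
    by (simp add: scaleR_add_left sum.distrib scaleR_sum_right)
  finally show ?thesis .
qed

section \<open>The return map and the holonomy of a closed geodesic\<close>

context
  fixes A :: "real mat"
  assumes closed: "\<gamma> 0 = \<gamma> T" and hol: "holonomy_matrix T n e A"
begin

lemma comb_T: "(\<Sum>j<n. a j *\<^sub>R e j T) = (\<Sum>i<n. (\<Sum>j<n. A $$ (i, j) * a j) *\<^sub>R e i 0)"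
proof -
  have "e j T = (\<Sum>i<n. A $$ (i, j) *\<^sub>R e i 0)" if "j < n" for j using hol that unfolding holonomy_matrix_def by blast
  then have "(\<Sum>j<n. a j *\<^sub>R e j T) = (\<Sum>j<n. \<Sum>i<n. (A $$ (i, j) * a j) *\<^sub>R e i 0)"
    by (intro sum.cong refl) (simp add: scaleR_sum_right mult.commute)
  also have "\<dots> = (\<Sum>i<n. (\<Sum>j<n. A $$ (i, j) * a j) *\<^sub>R e i 0)"
    by (subst sum.swap) (simp add: scaleR_sum_left)
  finally show ?thesis .
qed

lemma poincare_\<Phi>:
  "jacobi_sol T n R u v \<Longrightarrow> PM (\<Phi> (u 0) (v 0)) = \<Phi> (\<lambda>i. \<Sum>j<n. A $$ (i, j) * u T j) (\<lambda>i. \<Sum>j<n. A $$ (i, j) * v T j)"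
  using poincare_sol[of u v] unfolding comb_T \<Phi>_def by simp

text \<open>The curve closes up, so the frames at 0 and at T are orthonormal for one and the same
  inner product.\<close>

lemma holonomy_orthogonal:
  assumes ij: "i < n" "j < n"
  shows "(\<Sum>k<n. A $$ (k, i) * A $$ (k, j)) = (if i = j then 1 else 0)"
proof -
  have T': "T \<in> {0..T}" using T by simp
  have h: "e j T = (\<Sum>i<n. A $$ (i, j) *\<^sub>R e i 0)" if "j < n" for j using hol that unfolding holonomy_matrix_def by blast
  have "(if i = j then 1 else 0) = gt 0 (e i T) (e j T)" using e_e[OF ij T'] unfolding closed by simp
  also have "\<dots> = (\<Sum>k<n. A $$ (k, j) * gt 0 (\<Sum>k<n. A $$ (k, i) *\<^sub>R e k 0) (e k 0))"
    unfolding h[OF ij(1)] h[OF ij(2)] by (simp add: metric_at_sum(2) metric_at_simps(4))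
  also have "\<dots> = (\<Sum>k<n. A $$ (k, i) * A $$ (k, j))"
    by (intro sum.cong refl) (simp add: gt_comb[OF zero_in] mult.commute)
  finally show ?thesis by simp
qed

text \<open>A solution excluded in \<open>morse_parity\<close> would give the Poincare map an
  eigenvector with real eigenvalue above 1, against the unit circle, or a Jordan chain at 1, against
  diagonalisability. Its initial data therefore vanish, and with them the solution.\<close>

lemma stable_parity:
  assumes stable: "linearly_stable \<A> g T \<gamma>"
  shows "(- 1) ^ morse_index \<A> g T \<gamma> n e A = (- 1) ^ n * sgn (Determinant.det A)"
proof -
  obtain P D where P: "matrix_of_map NN PM P" "diagonal_mat D" "similar_mat (map_mat complex_of_real P) D"
    and spec: "\<And>z. eigenvalue (map_mat complex_of_real P) z \<Longrightarrow> norm z = 1"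
    using stable unfolding linearly_stable_def by blast
  obtain k b where kb: "P \<in> carrier_mat k k" "inj_on b {..<k}" "independent (b ` {..<k})" "span (b ` {..<k}) = NN"
    "\<forall>j<k. PM (b j) = (\<Sum>i<k. P $$ (i, j) *\<^sub>R b i)"
    using P(1) unfolding matrix_of_map_def by blast
  interpret M: map_matrix NN PM P k b
    by (rule map_matrix.intro[OF kb(1-4) kb(5)[rule_format] poincare_lincomb])
  have zero: "\<forall>t\<in>{0..T}. \<forall>i<n. u t i = 0" if sol: "jacobi_sol T n R u v" and z: "\<Phi> (u 0) (v 0) = 0" for u v
  proof -
    have "\<Phi> (u 0) (v 0) = \<Phi> (\<lambda>i. 0) (\<lambda>i. 0)" unfolding z by (simp add: \<Phi>_def zero_prod_def)
    note i = \<Phi>_inj[OF this]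
    show ?thesis
    proof (intro ballI allI impI)
      fix t j assume t: "t \<in> {0..T}" "j < n"
      show "u t j = 0" using jacobi_sol_unique(1)[OF less_imp_le[OF T] R_continuous sol zero_in _ _ t] i by auto
    qed
  qed
  have scale: "\<Phi> (\<lambda>i. x * a i) (\<lambda>i. x * b i) = x *\<^sub>R \<Phi> a b" for x a b
    using \<Phi>_lincomb[of x a 0 a b b] by simp
  show ?thesis
    unfolding morse_index_def
  proof (rule morse_parity[OF T R_continuous R_symmetric])
    show "A \<in> carrier_mat n n" using hol unfolding holonomy_matrix_def by blast
    show "(\<Sum>k<n. A $$ (k, i) * A $$ (k, j)) = (if i = j then 1 else 0)" if "i < n" "j < n" for i j
      by (rule holonomy_orthogonal[OF that])
    fix u v x assume sol: "jacobi_sol T n R u v" and x: "1 < x"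
      and bc: "\<forall>i<n. (\<Sum>j<n. A $$ (i, j) * u T j) = x * u 0 i" "\<forall>i<n. (\<Sum>j<n. A $$ (i, j) * v T j) = x * v 0 i"
    have pm: "PM (\<Phi> (u 0) (v 0)) = x *\<^sub>R \<Phi> (u 0) (v 0)"
      unfolding poincare_\<Phi>[OF sol] scale[symmetric] by (rule \<Phi>_cong) (use bc in auto)
    have "\<Phi> (u 0) (v 0) = 0" by (rule M.eigenvector_unit_circle[OF spec \<Phi>_in pm x])
    then show "\<forall>t\<in>{0..T}. \<forall>i<n. u t i = 0" by (rule zero[OF sol])
  next
    fix u v u' v' c assume sol: "jacobi_sol T n R u v" "jacobi_sol T n R u' v'" and c: "c \<noteq> 0"
      and bc: "\<forall>i<n. (\<Sum>j<n. A $$ (i, j) * u T j) = u 0 i" "\<forall>i<n. (\<Sum>j<n. A $$ (i, j) * v T j) = v 0 i"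
        "\<forall>i<n. (\<Sum>j<n. A $$ (i, j) * u' T j) = u' 0 i + c * u 0 i" "\<forall>i<n. (\<Sum>j<n. A $$ (i, j) * v' T j) = v' 0 i + c * v 0 i"
    have "PM (\<Phi> (u 0) (v 0)) = \<Phi> (u 0) (v 0)"
      unfolding poincare_\<Phi>[OF sol(1)] by (rule \<Phi>_cong) (use bc in auto)
    moreover have "PM (\<Phi> (u' 0) (v' 0)) = \<Phi> (\<lambda>i. 1 * u' 0 i + c * u 0 i) (\<lambda>i. 1 * v' 0 i + c * v 0 i)"
      unfolding poincare_\<Phi>[OF sol(2)] by (rule \<Phi>_cong) (use bc in auto)
    then have "PM (\<Phi> (u' 0) (v' 0)) = \<Phi> (u' 0) (v' 0) + c *\<^sub>R \<Phi> (u 0) (v 0)"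
      unfolding \<Phi>_lincomb by simp
    ultimately have "\<Phi> (u 0) (v 0) = 0"
      using M.no_jordan_chain[OF P(3,2) \<Phi>_in _ \<Phi>_in _ c] by blast
    then show "\<forall>t\<in>{0..T}. \<forall>i<n. u t i = 0" by (rule zero[OF sol(1)])
  qed
qed

end

end

text \<open>The sign of the energy enters only through its being nonzero, which is why the Riemannian and the
  Lorentzian case are treated together.\<close>

theorem corollary2:
  fixes \<A> :: "('a::{t2_space, second_countable_topology}, 'm::finite) chart set"
    and g :: "('a, 'm) metric"
    and T :: real
    and \<gamma> :: "real \<Rightarrow> 'a"
    and n :: nat
    and e :: "nat \<Rightarrow> real \<Rightarrow> ('a, 'm) tvec"
    and A :: "real mat"
  assumes "CARD('m) = n + 1"
    and "riemannian_manifold \<A> g \<and> closed_geodesic \<A> g T \<gamma> \<and> \<not> constant_curve T \<gamma> \<or>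
         lorentzian_manifold \<A> g \<and> closed_geodesic \<A> g T \<gamma> \<and> timelike_curve \<A> g T \<gamma>"
    and "parallel_orthonormal_frame \<A> g T \<gamma> n e"
    and "holonomy_matrix T n e A"
    and "Determinant.det A = 1 \<and> odd (morse_index \<A> g T \<gamma> n e A + n) \<or>
         Determinant.det A = - 1 \<and> even (morse_index \<A> g T \<gamma> n e A + n)"
  shows "linearly_unstable \<A> g T \<gamma>"
proof -
  have atlas: "smooth_atlas \<A>" "metric_tensor \<A> g" and cg: "closed_geodesic \<A> g T \<gamma>"
    using assms(2) unfolding riemannian_manifold_def lorentzian_manifold_def by blast+
  interpret geodesic \<A> g T \<gamma>
    by unfold_locales (use atlas cg in \<open>auto simp: closed_geodesic_def\<close>)
  define \<epsilon> where "\<epsilon> = gt 0 (V 0) (V 0)"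
  have energy: "gt t (V t) (V t) = \<epsilon>" if "t \<in> {0..T}" for t
    unfolding \<epsilon>_def by (rule energy_constant[OF that])
  have z: "0 \<in> {0..T}" using T by simp
  have "\<epsilon> \<noteq> 0"
  proof (rule disjE[OF assms(2)])
    assume r: "riemannian_manifold \<A> g \<and> closed_geodesic \<A> g T \<gamma> \<and> \<not> constant_curve T \<gamma>"
    show "\<epsilon> \<noteq> 0"
    proof
      assume "\<epsilon> = 0"
      \<comment> \<open>Positive definiteness turns zero energy into zero velocity along the whole
        curve.\<close>
      have "V t = 0" if t: "t \<in> {0..T}" for t
      proof -
        obtain c where c: "c \<in> \<A>" "t \<in> dom_of c" using ex_chart[OF t] by auto
        have "V t c \<bullet> (g c (coord c (\<gamma> t)) *v V t c) = 0"
          using energy[OF t] unfolding \<open>\<epsilon> = 0\<close> gt_chart[OF field_V field_V c] .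
        moreover have "coord c (\<gamma> t) \<in> coord c ` cdom c" using dom_ofD(2)[OF c(2)] by blast
        ultimately have "V t c = 0" using r c(1) unfolding riemannian_manifold_def by (metis less_irrefl)
        then show ?thesis
          by (intro tangent_eqI[OF field_tangent[OF field_V t] tangent_zero c(1) dom_ofD(2)[OF c(2)]]) simp
      qed
      then show False using constant_curveI r by blast
    qed
  next
    assume "lorentzian_manifold \<A> g \<and> closed_geodesic \<A> g T \<gamma> \<and> timelike_curve \<A> g T \<gamma>"
    then have "\<epsilon> < 0" using z unfolding timelike_curve_def \<epsilon>_def by blast
    then show "\<epsilon> \<noteq> 0" by simp
  qed
  then interpret geodesic_frame \<A> g T \<gamma> n e \<epsilon>
    using assms(1,3) energy by unfold_locales auto
  show ?thesis
    unfolding linearly_unstable_def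
  proof
    assume stable: "linearly_stable \<A> g T \<gamma>"
    have "\<gamma> 0 = \<gamma> T" using cg unfolding closed_geodesic_def by blast
    \<comment> \<open>Stability makes det A equal to (-1) to the power of the index plus n. By the
      assumed parity that power is -1 when det A = 1, and 1 when det A = -1.\<close>
    from stable_parity[OF this assms(4) stable] assms(5) show False
      by (cases "even n"; cases "even (morse_index \<A> g T \<gamma> n e A)") auto
  qed
qed

end
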